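(* Let $c$ be a positive real number, $N$ a positive integer, and $w$ a weight satisfying the following two conditions. (1) $\lim_{d\to\infty} w(d)\log(d)/d=0$. (2) The function $d\mapsto w(d)/d$ is eventually non-increasing. Then there exists a field $L\subset\overline{\mathbb{Q}}$ such that $$\mathrm{Nor}(L^{(N)},h^w)=c.$$
   Context: Fix an algebraic closure $\overline{\mathbb{Q}}$ of $\mathbb{Q}$. Let $h\colon\overline{\mathbb{Q}}\to\mathbb{R}_{\ge 0}$ be the absolute logarithmic Weil height: for $a$ in a number field $K$, $h(a)=\sum_{v}\frac{[K_v:\mathbb{Q}_v]}{[K:\mathbb{Q}]}\log\max\{1,|a|_v\}$, the sum over all places $v$ of $K$, with $|\cdot|_v$ extending the usual absolute value on $\mathbb{Q}$ (archimedean or $p$-adic); this is independent of $K$. For $a\in\overline{\mathbb{Q}}$, $\deg(a)=[\mathbb{Q}(a):\mathbb{Q}]$. A weight is a function $w\colon\mathbb{Z}_{>0}\to\mathbb{R}_{>0}$ that is eventually non-increasing or eventually non-decreasing. The $w$-weighted Weil height is $h^w(a)=w(\deg(a))h(a)$ for $a\in\overline{\mathbb{Q}}$. For a set $S$ and a function $\mathfrak{h}\colon S\to\mathbb{R}_{\ge0}$, the $\mathfrak{h}$-Northcott number of $S$ is $\mathrm{Nor}(S,\mathfrak{h})=\inf\{C\in\mathbb{R}_{>0}\mid \#\{s\in S\mid\mathfrak{h}(s)<C\}=\infty\}$, with $\inf\emptyset=\infty$. For a field $L\subset\overline{\mathbb{Q}}$ and $N\in\mathbb{Z}_{>0}$,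 $L^{(N)}=\{a\in\overline{\mathbb{Q}}\mid [L(a):L]\le N\}$. *)

theory Defs
  imports
    "HOL-Analysis.Analysis"
    "HOL-Algebra.Algebraic_Closure_Type"
    "HOL-Algebra.Generated_Fields"
begin

section \<open>Fields of algebraic numbers\<close>

text \<open>
  The fixed algebraic closure of the rationals is the set of algebraic complex numbers.
  Subfields are subfields, in the sense of HOL-Algebra, of the complex numbers viewed as a ring
  record.
\<close>

abbreviation complex_ring :: "complex ring" where
  "complex_ring \<equiv> ring_of_type_algebra"

definition Qbar :: "complex set" where
  "Qbar = {a. algebraic a}"

definition adjoin :: "complex set \<Rightarrow> complex \<Rightarrow> complex set" where
  "adjoin L a = generate_field complex_ring (insert a L)"

text \<open>
  The degree of \<open>E\<close> as an extension of \<open>F\<close>. It is only used for finite extensions: the library's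
  dimension is a definite description and has no meaningful value for infinite ones.
\<close>

definition ext_degree :: "complex set \<Rightarrow> complex set \<Rightarrow> nat" where
  "ext_degree F E = ring.dim complex_ring F E"

definition alg_degree :: "complex \<Rightarrow> nat" where
  "alg_degree a = ext_degree \<rat> (adjoin \<rat> a)"

definition bounded_degree_over :: "complex set \<Rightarrow> nat \<Rightarrow> complex set" where
  "bounded_degree_over L N = {a \<in> Qbar. ext_degree L (adjoin L a) \<le> N}"


section \<open>Places and local degrees\<close>

definition padic_abs :: "nat \<Rightarrow> rat \<Rightarrow> real" where
  "padic_abs p q =
     (if q = 0 then 0
      else let (n, d) = quotient_of q
           in real p powi (int (multiplicity (int p) d) - int (multiplicity (int p) n)))"

definition absolute_value_on :: "complex set \<Rightarrow> (complex \<Rightarrow> real) \<Rightarrow> bool" where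
  "absolute_value_on K v \<longleftrightarrow>
     (\<forall>x\<in>K. 0 \<le> v x) \<and> (\<forall>x\<in>K. v x = 0 \<longleftrightarrow> x = 0) \<and>
     (\<forall>x\<in>K. \<forall>y\<in>K. v (x * y) = v x * v y) \<and>
     (\<forall>x\<in>K. \<forall>y\<in>K. v (x + y) \<le> v x + v y)"

text \<open>
  A place is represented by its normalised absolute value, that is, the unique one in its
  equivalence class that extends the usual or a \<open>p\<close>-adic absolute value of the rationals.
  Extensionality outside \<open>K\<close> makes distinct functions represent distinct places.
\<close>

definition places :: "complex set \<Rightarrow> (complex \<Rightarrow> real) set" where
  "places K = {v \<in> extensional K. absolute_value_on K v \<and>
     ((\<forall>q. v (of_rat q) = \<bar>of_rat q\<bar>) \<or>
      (\<exists>p. Factorial_Ring.prime p \<and> (\<forall>q. v (of_rat q) = padic_abs p q)))}"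

text \<open>
  The completion of \<open>K\<close> at \<open>v\<close> is the ring of Cauchy sequences modulo the ideal of null sequences.
\<close>

definition cauchy_seqs :: "complex set \<Rightarrow> (complex \<Rightarrow> real) \<Rightarrow> (nat \<Rightarrow> complex) set" where
  "cauchy_seqs K v = {s. (\<forall>n. s n \<in> K) \<and>
     (\<forall>e>0. \<exists>M. \<forall>m\<ge>M. \<forall>n\<ge>M. v (s m - s n) < e)}"

definition null_seqs :: "complex set \<Rightarrow> (complex \<Rightarrow> real) \<Rightarrow> (nat \<Rightarrow> complex) set" where
  "null_seqs K v = {s. (\<forall>n. s n \<in> K) \<and> (\<lambda>n. v (s n)) \<longlonglongrightarrow> 0}"

definition cauchy_ring :: "complex set \<Rightarrow> (complex \<Rightarrow> real) \<Rightarrow> (nat \<Rightarrow> complex) ring" where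
  "cauchy_ring K v = \<lparr>carrier = cauchy_seqs K v,
     monoid.mult = (\<lambda>s t n. s n * t n), one = (\<lambda>_. 1),
     ring.zero = (\<lambda>_. 0), add = (\<lambda>s t n. s n + t n)\<rparr>"

definition completion :: "complex set \<Rightarrow> (complex \<Rightarrow> real) \<Rightarrow> (nat \<Rightarrow> complex) set ring" where
  "completion K v = cauchy_ring K v Quot null_seqs K v"

text \<open>
  The completion of the rationals, embedded in that of \<open>K\<close>: the classes of rational Cauchy
  sequences.
\<close>

definition rat_completion_in :: "complex set \<Rightarrow> (complex \<Rightarrow> real) \<Rightarrow> (nat \<Rightarrow> complex) set set" where
  "rat_completion_in K v =
     (\<lambda>s. null_seqs K v +>\<^bsub>cauchy_ring K v\<^esub> s) ` cauchy_seqs \<rat> v"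

definition local_degree :: "complex set \<Rightarrow> (complex \<Rightarrow> real) \<Rightarrow> nat" where
  "local_degree K v =
     ring.dim (completion K v) (rat_completion_in K v) (carrier (completion K v))"


section \<open>Heights\<close>

text \<open>
  Only finitely many terms are nonzero when \<open>a\<close> lies in the number field \<open>K\<close>. The value does not
  depend on \<open>K\<close>, so the absolute height uses the field generated by \<open>a\<close>.
\<close>

definition weil_height_wrt :: "complex set \<Rightarrow> complex \<Rightarrow> real" where
  "weil_height_wrt K a =
     (\<Sum>\<^sub>\<infinity>v\<in>places K. real (local_degree K v) / real (ext_degree \<rat> K) * ln (max 1 (v a)))"

definition weil_height :: "complex \<Rightarrow> real" where
  "weil_height a = weil_height_wrt (adjoin \<rat> a) a"

text \<open>The value of a weight at 0 is irrelevant.\<close>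

definition weight :: "(nat \<Rightarrow> real) \<Rightarrow> bool" where
  "weight w \<longleftrightarrow> (\<forall>d>0. w d > 0) \<and>
     ((\<exists>d0. antimono_on {d0..} w) \<or> (\<exists>d0. mono_on {d0..} w))"

definition weighted_height :: "(nat \<Rightarrow> real) \<Rightarrow> complex \<Rightarrow> real" where
  "weighted_height w a = w (alg_degree a) * weil_height a"

definition northcott_number :: "'a set \<Rightarrow> ('a \<Rightarrow> real) \<Rightarrow> ereal" where
  "northcott_number S h = Inf {ereal C | C. C > 0 \<and> infinite {s \<in> S. h s < C}}"

end

theory Submission
  imports Defs "HOL-Algebra.Finite_Extensions" "Jordan_Normal_Form.Char_Poly" "Jordan_Normal_Form.Schur_Decomposition"
    "HOL-Number_Theory.Cong" "HOL-Real_Asymp.Real_Asymp"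
begin

hide_const (open) Polynomials.degree Polynomials.lead_coeff Divisibility.prime Coset.order up_ring.coeff up_ring.monom module.smult

text \<open>
  Fix \<open>c\<close>, \<open>N\<close> and \<open>w\<close>. The field is the union of a tower \<open>K\<^sub>0 \<subseteq> K\<^sub>1 \<subseteq> \<dots>\<close> of number fields, where
  \<open>K\<^sub>0\<close> is the field of rationals and \<open>K\<^sub>i\<^sub>+\<^sub>1 = K\<^sub>i(\<alpha>)\<close> with \<open>\<alpha> ^ d = p / q\<close> for primes \<open>d\<close>, \<open>p < q\<close> that
  are large in terms of \<open>K\<^sub>i\<close>. The idea is that a new radical imposes a lower bound on the height of every element
  that needs it, and that this bound can be prescribed, because \<open>p\<close> and \<open>q\<close> are free.

  The lower bound. Let \<open>K = K\<^sub>i\<close> be generated by \<open>\<gamma>\<close>, of degree \<open>E\<close>, and let \<open>a\<close> have degree at most \<open>N\<close> over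
  \<open>K(\<alpha>)\<close> but larger degree over \<open>K\<close>. As \<open>d\<close> is a prime larger than \<open>N\<close>, the degree of \<open>a\<close> over \<open>K\<close> is \<open>k * d\<close>
  with \<open>k \<le> N\<close>, and \<open>\<alpha>\<close> has degree at most \<open>N\<close> over \<open>K(a)\<close> (\<open>level_degrees\<close>). So \<open>K(a, \<alpha>)\<close> has a rational basis of
  monomials in \<open>\<gamma>\<close>, \<open>a\<close>, \<open>\<alpha>\<close> in which \<open>a\<close> has exponents below \<open>k * d\<close> and \<open>\<alpha>\<close> has exponents below \<open>N\<close>
  (\<open>monomial_basis\<close>). The determinant of the trace form on this basis is a nonzero rational. At most places its absolute
  value is bounded trivially in terms of the conjugates of \<open>a\<close> and \<open>\<gamma>\<close>. At \<open>p\<close> and \<open>q\<close>, where the order of \<open>\<alpha>\<close> is a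
  fraction with denominator \<open>d\<close>, one gains almost a factor \<open>p\<close> or \<open>q\<close> for each basis element, because traces are rational and their
  orders are integers (\<open>gram_local_bound\<close>, \<open>prime_bound\<close>). The product formula turns this into
  \<open>k * d * h(a) \<ge> ln p - \<dots>\<close> up to small errors (\<open>height_lower_bound\<close>, \<open>stage_lower_bound\<close>). The argument
  replaces the usual one through relative discriminants.

  The calibration. With \<open>ln p\<close> and \<open>ln q\<close> close to \<open>c * N * d / W\<close>, where \<open>W\<close> is about the weight of the relevant
  degrees, this gives weighted height at least nearly \<open>c\<close> for all elements that are new at this stage. The radical
  \<open>(p / q) ^ (1 / (N * d))\<close>, or its product with \<open>\<gamma>\<close>, has degree at most \<open>N\<close> over \<open>K(\<alpha>)\<close> and weighted height nearly \<open>c\<close>, so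
  the value is attained in the limit (\<open>weight_stage\<close>, \<open>stage_exists\<close>). The monotonicity of \<open>w d / d\<close>
  compares the degrees \<open>k * d\<close> and \<open>N * d\<close>, and the limit condition makes the error terms, of the order of \<open>ln d\<close>, negligible. Primes
  that are close enough to each other exist by a Chebyshev bound (\<open>prime_in_interval\<close>). Finitely many stages contribute only finitely many elements of
  bounded weighted height, by Northcott's theorem (\<open>northcott_finite\<close>).

  The foundation is \<open>weil_height_formula\<close>: the height, defined through places and local degrees, is a sum of
  \<open>ln (max 1 (vabs v z))\<close> over the conjugates \<open>z\<close> and over the places \<open>v\<close> of the rationals, for one fixed extension
  \<open>vabs v\<close> of \<open>v\<close> to the algebraic numbers. It rests on the existence of these extensions
  (\<open>exists_padic_extension\<close>) and on the equality of the global degree with the sum of the local ones (\<open>places_over_q\<close>).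
\<close>

section \<open>Conjugates and embeddings\<close>

interpretation of_rat_poly_hom: map_poly_comm_ring_hom "of_rat :: rat \<Rightarrow> complex" ..

abbreviation rpoly :: "rat poly \<Rightarrow> complex \<Rightarrow> complex" where
  "rpoly g x \<equiv> poly (map_poly of_rat g) x"

abbreviation cxp :: "rat poly \<Rightarrow> complex poly" where
  "cxp g \<equiv> map_poly of_rat g"

lemma rpoly_simps [simp]:
  "rpoly (p + q) x = rpoly p x + rpoly q x" "rpoly (p - q) x = rpoly p x - rpoly q x"
  "rpoly (p * q) x = rpoly p x * rpoly q x" "rpoly (- p) x = - rpoly p x"
  "rpoly (p ^ n) x = rpoly p x ^ n" "rpoly (smult c p) x = of_rat c * rpoly p x"
  by (simp_all add: hom_distribs)

lemma algebraic_iff_rpoly: "algebraic x \<longleftrightarrow> (\<exists>p. p \<noteq> 0 \<and> rpoly p x = 0)"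
proof
  assume "algebraic x"
  then obtain p where p: "p \<noteq> 0" "poly (map_poly of_int p) x = 0" by (rule algebraicE')
  have "map_poly of_int p = cxp (map_poly of_int p)"
    by (rule poly_eqI) (simp add: coeff_map_poly)
  with p show "\<exists>p. p \<noteq> 0 \<and> rpoly p x = 0"
    by (intro exI[of _ "map_poly of_int p"]) (auto simp: map_poly_eq_0_iff)
next
  assume "\<exists>p. p \<noteq> 0 \<and> rpoly p x = 0"
  then obtain p where "p \<noteq> 0" "rpoly p x = 0" by blast
  thus "algebraic x" by (intro algebraicI'[of "cxp p"]) (auto simp: coeff_map_poly)
qed

definition minpol :: "complex \<Rightarrow> rat poly" where
  "minpol x = (SOME p. rpoly p x = 0 \<and> lead_coeff p = 1 \<and>
     (\<forall>q. rpoly q x = 0 \<and> q \<noteq> 0 \<longrightarrow> degree p \<le> degree q))"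

lemma minpol_props:
  assumes "algebraic x"
  shows "rpoly (minpol x) x = 0" "lead_coeff (minpol x) = 1"
    "\<And>q. rpoly q x = 0 \<Longrightarrow> q \<noteq> 0 \<Longrightarrow> degree (minpol x) \<le> degree q"
proof -
  define P where "P = (\<lambda>p. p \<noteq> 0 \<and> rpoly p x = 0)"
  obtain p0 where "P p0" using assms unfolding P_def algebraic_iff_rpoly by blast
  define p where "p = arg_min degree P"
  have p: "P p" "\<And>q. P q \<Longrightarrow> degree p \<le> degree q"
    unfolding p_def using arg_min_nat_lemma[of P p0 degree] \<open>P p0\<close> by auto
  define r where "r = smult (inverse (lead_coeff p)) p"
  have "rpoly r x = 0 \<and> lead_coeff r = 1 \<and>
     (\<forall>q. rpoly q x = 0 \<and> q \<noteq> 0 \<longrightarrow> degree r \<le> degree q)"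
    using p unfolding r_def P_def by auto
  from someI[where P="\<lambda>p. rpoly p x = 0 \<and> lead_coeff p = 1 \<and>
     (\<forall>q. rpoly q x = 0 \<and> q \<noteq> 0 \<longrightarrow> degree p \<le> degree q)", OF this]
  show "rpoly (minpol x) x = 0" "lead_coeff (minpol x) = 1"
    "\<And>q. rpoly q x = 0 \<Longrightarrow> q \<noteq> 0 \<Longrightarrow> degree (minpol x) \<le> degree q"
    unfolding minpol_def by blast+
qed

lemma minpol_nz: "algebraic x \<Longrightarrow> minpol x \<noteq> 0"
  using minpol_props(2) by force

lemma minpol_dvd_iff:
  assumes "algebraic x" shows "rpoly g x = 0 \<longleftrightarrow> minpol x dvd g"
proof
  assume "minpol x dvd g"
  thus "rpoly g x = 0" using minpol_props(1)[OF assms] by (auto elim!: dvdE)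
next
  assume *: "rpoly g x = 0"
  have "g = (g div minpol x) * minpol x + g mod minpol x" by simp
  hence "rpoly g x = rpoly ((g div minpol x) * minpol x + g mod minpol x) x" by simp
  hence 0: "rpoly (g mod minpol x) x = 0" using minpol_props(1)[OF assms] * by (simp only: rpoly_simps) simp
  show "minpol x dvd g"
  proof (rule ccontr)
    assume "\<not> minpol x dvd g"
    hence "g mod minpol x \<noteq> 0" by (simp add: dvd_eq_mod_eq_0)
    thus False using minpol_props(3)[OF assms 0] degree_mod_less[OF minpol_nz[OF assms], of g]
      by simp
  qed
qed

lemma degree_minpol_pos: "algebraic x \<Longrightarrow> degree (minpol x) > 0"
proof (rule ccontr)
  assume a: "algebraic x" "\<not> degree (minpol x) > 0"
  then obtain c where "minpol x = [:c:]" by (auto elim: degree_eq_zeroE)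
  thus False using minpol_props(1,2)[OF a(1)] by simp
qed

lemma minpol_root_eq:
  assumes x: "algebraic x" and z: "rpoly (minpol x) z = 0"
  shows "algebraic z" "minpol z = minpol x"
proof -
  show az: "algebraic z" using z minpol_nz[OF x] algebraic_iff_rpoly by blast
  from z have "minpol z dvd minpol x" using minpol_dvd_iff[OF az] by simp
  then obtain h where h: "minpol x = minpol z * h" by (elim dvdE)
  have "rpoly (minpol z) x = 0 \<or> rpoly h x = 0"
    using minpol_props(1)[OF x] unfolding h by simp
  moreover have "rpoly h x \<noteq> 0"
  proof
    assume "rpoly h x = 0"
    moreover have "h \<noteq> 0" using h minpol_nz[OF x] by auto
    ultimately have "degree (minpol x) \<le> degree h" by (intro minpol_props(3)[OF x])
    moreover have "degree (minpol x) = degree (minpol z) + degree h"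
      unfolding h by (rule degree_mult_eq[OF minpol_nz[OF az] \<open>h \<noteq> 0\<close>])
    ultimately show False using degree_minpol_pos[OF az] by simp
  qed
  ultimately have "minpol x dvd minpol z" using minpol_dvd_iff[OF x] by blast
  with \<open>minpol z dvd minpol x\<close> show "minpol z = minpol x"
    using minpol_props(2)[OF x] minpol_props(2)[OF az] by (metis poly_dvd_antisym)
qed

definition conjs :: "complex \<Rightarrow> complex set" where
  "conjs x = {z. rpoly (minpol x) z = 0}"

definition qdeg :: "complex \<Rightarrow> nat" where "qdeg x = degree (minpol x)"

lemma qdeg_pos: "algebraic x \<Longrightarrow> qdeg x > 0"
  unfolding qdeg_def by (rule degree_minpol_pos)

lemma conjs_self [simp]: "algebraic x \<Longrightarrow> x \<in> conjs x"
  by (simp add: conjs_def minpol_props)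

lemma conjs_algebraic: "algebraic x \<Longrightarrow> z \<in> conjs x \<Longrightarrow> algebraic z"
  unfolding conjs_def using minpol_root_eq by blast

lemma conjs_minpol: "algebraic x \<Longrightarrow> z \<in> conjs x \<Longrightarrow> minpol z = minpol x"
  unfolding conjs_def using minpol_root_eq by blast

lemma conjs_rpoly_0: "algebraic x \<Longrightarrow> z \<in> conjs x \<Longrightarrow> rpoly g x = 0 \<longleftrightarrow> rpoly g z = 0"
  using minpol_dvd_iff conjs_algebraic conjs_minpol by metis

lemma cxp_eq_0_iff [simp]: "cxp p = 0 \<longleftrightarrow> p = 0"
  by (simp add: map_poly_eq_0_iff)

lemma finite_conjs [simp]: "algebraic x \<Longrightarrow> finite (conjs x)"
  unfolding conjs_def by (intro poly_roots_finite) (simp add: minpol_nz)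

text \<open>
  The minimal polynomial cannot divide its derivative, so its complex roots are simple.
\<close>

lemma minpol_decomp:
  assumes x: "algebraic x"
  shows "cxp (minpol x) = (\<Prod>z\<in>conjs x. [:-z, 1:])"
proof -
  have "rsquarefree (cxp (minpol x))"
    unfolding rsquarefree_roots
  proof (intro allI notI)
    fix z assume *: "rpoly (minpol x) z = 0 \<and> poly (pderiv (cxp (minpol x))) z = 0"
    have z: "algebraic z" "minpol z = minpol x" using minpol_root_eq[OF x] * by auto
    have "rpoly (pderiv (minpol x)) z = 0"
      using * by (simp add: of_rat_hom.map_poly_pderiv)
    moreover have "pderiv (minpol x) \<noteq> 0"
      using degree_minpol_pos[OF x] by (simp add: pderiv_eq_0_iff)
    ultimately have "degree (minpol z) \<le> degree (pderiv (minpol x))"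
      by (intro minpol_props(3)[OF z(1)])
    thus False using z degree_minpol_pos[OF x] by (simp add: degree_pderiv)
  qed
  from complex_poly_decompose_rsquarefree[OF this] show ?thesis
    unfolding conjs_def using minpol_props(2)[OF x] by simp
qed

lemma card_conjs: assumes "algebraic x" shows "card (conjs x) = qdeg x"
proof -
  have "qdeg x = degree (\<Prod>z\<in>conjs x. [:-z, 1:])"
    unfolding qdeg_def minpol_decomp[OF assms, symmetric] by simp
  also have "\<dots> = (\<Sum>z\<in>conjs x. degree [:-z, 1:])" by (rule degree_prod_eq_sum_degree) auto
  finally show ?thesis by simp
qed

definition Qgen :: "complex \<Rightarrow> complex set" where
  "Qgen x = range (\<lambda>g. rpoly g x)"

text \<open>
  The embedding of \<open>Qgen x\<close> that sends \<open>x\<close> to \<open>z\<close>. For a conjugate \<open>z\<close> of \<open>x\<close> the choice of \<open>g\<close> is immaterial: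
  two choices differ by a multiple of the minimal polynomial, which vanishes at \<open>z\<close>.
\<close>

definition emb :: "complex \<Rightarrow> complex \<Rightarrow> complex \<Rightarrow> complex" where
  "emb x z y = rpoly (SOME g. rpoly g x = y) z"

lemma emb_rpoly:
  assumes "algebraic x" "z \<in> conjs x" shows "emb x z (rpoly g x) = rpoly g z"
proof -
  define h where "h = (SOME h. rpoly h x = rpoly g x)"
  have "rpoly h x = rpoly g x" unfolding h_def by (rule someI[where x=g]) (rule refl)
  hence "rpoly (h - g) x = 0" by simp
  hence "rpoly (h - g) z = 0" using conjs_rpoly_0[OF assms] by blast
  thus ?thesis unfolding emb_def h_def[symmetric] by simp
qed

lemma QgenE: assumes "y \<in> Qgen x" obtains g where "y = rpoly g x"
  using assms unfolding Qgen_def by blast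

lemma Qgen_rpoly [simp, intro]: "rpoly g x \<in> Qgen x" unfolding Qgen_def by blast

lemma Qgen_self [simp, intro]: "x \<in> Qgen x"
  using Qgen_rpoly[of "[:0,1:]" x] by (simp add: hom_distribs)

lemma Qgen_of_rat [simp, intro]: "of_rat q \<in> Qgen x"
  using Qgen_rpoly[of "[:q:]" x] by (simp add: hom_distribs)

lemma Qgen_closed [intro]:
  assumes "y \<in> Qgen x" "z \<in> Qgen x"
  shows "y + z \<in> Qgen x" "y * z \<in> Qgen x" "y - z \<in> Qgen x"
proof -
  obtain g h where "y = rpoly g x" "z = rpoly h x" using assms by (meson QgenE)
  thus "y + z \<in> Qgen x" "y * z \<in> Qgen x" "y - z \<in> Qgen x"
    using Qgen_rpoly[of "g + h" x] Qgen_rpoly[of "g * h" x] Qgen_rpoly[of "g - h" x] by simp_all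
qed

lemma Qgen_uminus [intro]: "y \<in> Qgen x \<Longrightarrow> - y \<in> Qgen x"
  using Qgen_closed(3)[of 0 x y] Qgen_of_rat[of 0 x] by simp

lemma Qgen_power [intro]: "y \<in> Qgen x \<Longrightarrow> y ^ n \<in> Qgen x"
  using Qgen_of_rat[of 1 x] by (induction n) auto

lemma Qgen_inverse [intro]:
  assumes x: "algebraic x" and y: "y \<in> Qgen x"
  shows "inverse y \<in> Qgen x"
proof (cases "y = 0")
  case True thus ?thesis using Qgen_of_rat[of 0] by simp
next
  case False
  obtain g where g: "y = rpoly g x" using y by (rule QgenE)
  have "gcd (minpol x) g = 1"
  proof -
    define d where "d = gcd (minpol x) g"
    obtain h where h: "minpol x = d * h" unfolding d_def by (meson gcd_dvd1 dvdE)
    have nz: "d \<noteq> 0" "h \<noteq> 0" using h minpol_nz[OF x] by auto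
    have "rpoly d x \<noteq> 0"
    proof
      assume "rpoly d x = 0"
      moreover have "d dvd g" unfolding d_def by simp
      ultimately have "rpoly g x = 0" by (auto elim!: dvdE)
      with False g show False by simp
    qed
    hence "rpoly h x = 0" using minpol_props(1)[OF x] unfolding h by simp
    hence "degree (minpol x) \<le> degree h" by (intro minpol_props(3)[OF x] nz)
    hence "degree d = 0" using h nz by (simp add: degree_mult_eq)
    hence "is_unit d" using nz by (simp add: is_unit_iff_degree)
    thus ?thesis unfolding d_def by (metis is_unit_gcd coprime_iff_gcd_eq_1)
  qed
  hence bz: "fst (bezout_coefficients (minpol x) g) * minpol x + snd (bezout_coefficients (minpol x) g) * g = 1"
    using bezout_coefficients_fst_snd[of "minpol x" g] by metis
  hence "rpoly (fst (bezout_coefficients (minpol x) g) * minpol x + snd (bezout_coefficients (minpol x) g) * g) x = 1"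
    by simp
  hence "rpoly (snd (bezout_coefficients (minpol x) g)) x * y = 1"
    using minpol_props(1)[OF x] g by simp
  hence "inverse y = rpoly (snd (bezout_coefficients (minpol x) g)) x"
    by (metis inverse_unique mult.commute)
  thus ?thesis by simp
qed

lemma emb_simps:
  assumes x: "algebraic x" "z \<in> conjs x"
  shows "emb x z x = z" "emb x z (of_rat q) = of_rat q" "emb x z 0 = 0" "emb x z 1 = 1"
    and "\<And>y1 y2. y1 \<in> Qgen x \<Longrightarrow> y2 \<in> Qgen x \<Longrightarrow> emb x z (y1 + y2) = emb x z y1 + emb x z y2"
    and "\<And>y1 y2. y1 \<in> Qgen x \<Longrightarrow> y2 \<in> Qgen x \<Longrightarrow> emb x z (y1 - y2) = emb x z y1 - emb x z y2"
    and "\<And>y1 y2. y1 \<in> Qgen x \<Longrightarrow> y2 \<in> Qgen x \<Longrightarrow> emb x z (y1 * y2) = emb x z y1 * emb x z y2"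
    and "\<And>y n. y \<in> Qgen x \<Longrightarrow> emb x z (y ^ n) = emb x z y ^ n"
proof -
  show "emb x z x = z" using emb_rpoly[OF x, of "[:0,1:]"] by (simp add: hom_distribs)
  show *: "emb x z (of_rat q) = of_rat q" for q using emb_rpoly[OF x, of "[:q:]"] by (simp add: hom_distribs)
  show "emb x z 0 = 0" "emb x z 1 = 1" using *[of 0] *[of 1] by auto
  show "emb x z (y1 + y2) = emb x z y1 + emb x z y2"
    "emb x z (y1 - y2) = emb x z y1 - emb x z y2"
    "emb x z (y1 * y2) = emb x z y1 * emb x z y2" if yy: "y1 \<in> Qgen x" "y2 \<in> Qgen x" for y1 y2
  proof -
    obtain g1 g2 where g: "y1 = rpoly g1 x" "y2 = rpoly g2 x" using yy by (auto elim!: QgenE)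
    show "emb x z (y1 + y2) = emb x z y1 + emb x z y2"
      "emb x z (y1 - y2) = emb x z y1 - emb x z y2"
      "emb x z (y1 * y2) = emb x z y1 * emb x z y2"
      unfolding g using emb_rpoly[OF x, of "g1 + g2"] emb_rpoly[OF x, of "g1 - g2"]
        emb_rpoly[OF x, of "g1 * g2"] emb_rpoly[OF x, of g1] emb_rpoly[OF x, of g2] by simp_all
  qed
  show "emb x z (y ^ n) = emb x z y ^ n" if y: "y \<in> Qgen x" for y n
  proof -
    obtain g where g: "y = rpoly g x" using y by (rule QgenE)
    show ?thesis unfolding g using emb_rpoly[OF x, of "g ^ n"] emb_rpoly[OF x, of g] by simp
  qed
qed

lemma emb_eq_0_iff:
  assumes x: "algebraic x" "z \<in> conjs x" and y: "y \<in> Qgen x"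
  shows "emb x z y = 0 \<longleftrightarrow> y = 0"
  using y conjs_rpoly_0[OF x] emb_rpoly[OF x] by (metis QgenE)

lemma emb_inverse:
  assumes x: "algebraic x" "z \<in> conjs x" and y: "y \<in> Qgen x"
  shows "emb x z (inverse y) = inverse (emb x z y)"
proof (cases "y = 0")
  case False
  have "emb x z (inverse y * y) = 1" using False emb_simps[OF x] by simp
  hence "emb x z (inverse y) * emb x z y = 1"
    using emb_simps(7)[OF x Qgen_inverse[OF x(1) y] y] by simp
  thus ?thesis by (metis inverse_unique mult.commute)
qed (use emb_simps[OF x] in auto)

section \<open>Sums and products of algebraic numbers\<close>

text \<open>
  An element that maps a finitely generated nonzero group of complex numbers into itself is an eigenvalue of an integer
  matrix, hence a root of its monic characteristic polynomial.
\<close>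

lemma algebraic_int_module:
  fixes z :: complex and v :: "'i \<Rightarrow> complex"
  assumes I: "finite I" and k0: "k0 \<in> I" "v k0 \<noteq> 0"
    and rel: "\<And>k. k \<in> I \<Longrightarrow> \<exists>c :: 'i \<Rightarrow> int. z * v k = (\<Sum>l\<in>I. of_int (c l) * v l)"
  shows "algebraic_int z"
proof -
  define n where "n = card I"
  obtain h where h: "bij_betw h {0..<n} I"
    using ex_bij_betw_nat_finite[OF I] unfolding n_def by blast
  obtain c :: "'i \<Rightarrow> 'i \<Rightarrow> int" where c: "\<And>k. k \<in> I \<Longrightarrow> z * v k = (\<Sum>l\<in>I. of_int (c k l) * v l)"
    using rel by metis
  define M :: "int mat" where "M = mat n n (\<lambda>(i, j). c (h i) (h j))"
  define V where "V = vec n (\<lambda>i. v (h i))"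
  have M: "M \<in> carrier_mat n n" unfolding M_def by simp
  have MC: "map_mat of_int M \<in> carrier_mat n n" using M by simp
  have hI: "\<And>i. i < n \<Longrightarrow> h i \<in> I" using h by (auto simp: bij_betw_def)
  have "map_mat of_int M *\<^sub>v V = z \<cdot>\<^sub>v V"
  proof (rule eq_vecI)
    fix i assume "i < dim_vec (z \<cdot>\<^sub>v V)"
    hence i: "i < n" by (simp add: V_def)
    have "(map_mat of_int M *\<^sub>v V) $ i = (\<Sum>j\<in>{0..<n}. of_int (c (h i) (h j)) * v (h j))"
      using i by (simp add: M_def V_def scalar_prod_def)
    also have "\<dots> = (\<Sum>l\<in>I. of_int (c (h i) l) * v l)"
      by (rule sum.reindex_bij_betw[OF h])
    also have "\<dots> = z * v (h i)" using c[OF hI[OF i]] by simp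
    finally show "(map_mat of_int M *\<^sub>v V) $ i = (z \<cdot>\<^sub>v V) $ i" using i by (simp add: V_def)
  qed (simp add: M_def V_def)
  moreover have "V \<noteq> 0\<^sub>v n"
  proof
    assume V0: "V = 0\<^sub>v n"
    obtain i where i: "i < n" "h i = k0" using h k0(1) by (auto simp: bij_betw_def)
    have "V $ i = v k0" using i by (simp add: V_def)
    thus False using V0 i k0 by simp
  qed
  ultimately have "eigenvalue (map_mat of_int M) z"
    unfolding eigenvalue_def eigenvector_def using MC by (intro exI[of _ V]) (auto simp: V_def)
  hence "poly (char_poly (map_mat of_int M)) z = 0" using eigenvalue_root_char_poly[OF MC] by blast
  moreover have "char_poly (map_mat of_int M) = map_poly (of_int :: int \<Rightarrow> complex) (char_poly M)"
    using of_int_hom.char_poly_hom[OF M] by simp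
  moreover have "lead_coeff (char_poly M) = 1" using degree_monic_char_poly[OF M] by simp
  ultimately show ?thesis unfolding algebraic_int_altdef_ipoly by auto
qed

lemma algebraic_int_powers:
  fixes x :: complex
  assumes "algebraic_int x"
  shows "\<exists>m>0. \<forall>j. \<exists>c :: nat \<Rightarrow> int. x ^ j = (\<Sum>i<m. of_int (c i) * x ^ i)"
proof -
  obtain p where p: "poly (map_poly of_int p) x = 0" "lead_coeff p = (1::int)"
    using assms unfolding algebraic_int_altdef_ipoly by blast
  define m where "m = degree p"
  have "m > 0"
  proof (rule ccontr)
    assume "\<not> m > 0"
    then obtain c where c: "p = [:c:]" unfolding m_def by (auto elim: degree_eq_zeroE)
    thus False using p by simp
  qed
  have deg: "degree (map_poly of_int p :: complex poly) = m" unfolding m_def by simp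
  have "poly (map_poly of_int p) x = (\<Sum>i<m. of_int (coeff p i) * x ^ i) + x ^ m"
    unfolding poly_altdef deg using p(2) by (simp add: m_def lessThan_Suc_atMost[symmetric])
  hence xm: "x ^ m = - (\<Sum>i<m. of_int (coeff p i) * x ^ i)" using p(1) by (simp add: eq_neg_iff_add_eq_0 add.commute)
  have "\<exists>c :: nat \<Rightarrow> int. x ^ j = (\<Sum>i<m. of_int (c i) * x ^ i)" for j
  proof (induction j)
    case 0
    have "x ^ 0 = (\<Sum>i<m. of_int (if i = 0 then 1 else 0) * x ^ i)"
      using gr0_implies_Suc[OF \<open>m > 0\<close>] by (auto simp: sum.lessThan_Suc_shift simp del: sum.lessThan_Suc)
    thus ?case by (rule exI[of _ "\<lambda>i. if i = 0 then 1 else 0"])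
  next
    case (Suc j)
    then obtain c :: "nat \<Rightarrow> int" where c: "x ^ j = (\<Sum>i<m. of_int (c i) * x ^ i)" by blast
    obtain r where r: "m = Suc r" using \<open>m > 0\<close> gr0_implies_Suc by blast
    define d where "d = (\<lambda>i. (case i of 0 \<Rightarrow> 0 | Suc k \<Rightarrow> c k) - c r * coeff p i)"
    have "x ^ Suc j = (\<Sum>i<m. of_int (c i) * x ^ Suc i)"
      using c by (simp add: sum_distrib_left mult_ac)
    also have "\<dots> = (\<Sum>i<r. of_int (c i) * x ^ Suc i) + of_int (c r) * x ^ m" unfolding r by simp
    also have "(\<Sum>i<r. of_int (c i) * x ^ Suc i) = (\<Sum>i<m. of_int (case i of 0 \<Rightarrow> 0 | Suc k \<Rightarrow> c k) * x ^ i)"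
      unfolding r sum.lessThan_Suc_shift by simp
    also have "of_int (c r) * x ^ m = (\<Sum>i<m. of_int (- c r * coeff p i) * x ^ i)"
      unfolding xm by (simp add: sum_distrib_left sum_negf mult_ac)
    also have "(\<Sum>i<m. of_int (case i of 0 \<Rightarrow> 0 | Suc k \<Rightarrow> c k) * x ^ i) + (\<Sum>i<m. of_int (- c r * coeff p i) * x ^ i)
       = (\<Sum>i<m. of_int (d i) * x ^ i)"
      unfolding sum.distrib[symmetric] d_def by (intro sum.cong refl) (simp add: algebra_simps)
    finally show ?case by blast
  qed
  with \<open>m > 0\<close> show ?thesis by blast
qed

lemma algebraic_int_add_mult:
  fixes x y :: complex
  assumes x: "algebraic_int x" and y: "algebraic_int y"
  shows "algebraic_int (x + y)" "algebraic_int (x * y)"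
proof -
  obtain m where m: "m > 0" "\<And>j. \<exists>c :: nat \<Rightarrow> int. x ^ j = (\<Sum>i<m. of_int (c i) * x ^ i)"
    using algebraic_int_powers[OF x] by blast
  obtain n where n: "n > 0" "\<And>j. \<exists>c :: nat \<Rightarrow> int. y ^ j = (\<Sum>i<n. of_int (c i) * y ^ i)"
    using algebraic_int_powers[OF y] by blast
  define I where "I = {..<m} \<times> {..<n}"
  define v where "v = (\<lambda>(i, j). x ^ i * y ^ j)"
  have vp: "\<exists>c :: nat \<times> nat \<Rightarrow> int. x ^ a * y ^ b = (\<Sum>l\<in>I. of_int (c l) * v l)" for a b
  proof -
    obtain c d :: "nat \<Rightarrow> int" where c: "x ^ a = (\<Sum>i<m. of_int (c i) * x ^ i)"
      and d: "y ^ b = (\<Sum>i<n. of_int (d i) * y ^ i)" using m(2) n(2) by metis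
    have "x ^ a * y ^ b = (\<Sum>l\<in>I. of_int (c (fst l) * d (snd l)) * v l)"
      unfolding c d sum_product I_def sum.cartesian_product v_def
      by (intro sum.cong refl) auto
    thus ?thesis by (rule exI[where P="\<lambda>c. x ^ a * y ^ b = (\<Sum>l\<in>I. of_int (c l) * v l)"])
  qed
  have I: "finite I" "(0, 0) \<in> I" "v (0,0) \<noteq> 0" using m(1) n(1) by (auto simp: I_def v_def)
  show "algebraic_int (x + y)"
  proof (rule algebraic_int_module[where I = I and v = v and ?k0.0 = "(0, 0)", OF I(1) I(2) I(3)])
    fix k assume "k \<in> I"
    obtain a b where k: "k = (a, b)" by force
    obtain c d :: "nat \<times> nat \<Rightarrow> int" where "x ^ Suc a * y ^ b = (\<Sum>l\<in>I. of_int (c l) * v l)"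
      "x ^ a * y ^ Suc b = (\<Sum>l\<in>I. of_int (d l) * v l)" using vp by metis
    moreover have "(x + y) * v k = x ^ Suc a * y ^ b + x ^ a * y ^ Suc b" unfolding k v_def
      by (simp add: algebra_simps)
    ultimately have "(x + y) * v k = (\<Sum>l\<in>I. of_int (c l + d l) * v l)"
      by (simp add: sum.distrib distrib_right)
    thus "\<exists>c. (x + y) * v k = (\<Sum>l\<in>I. of_int (c l) * v l)"
      by (intro exI[of _ "\<lambda>l. c l + d l"])
  qed
  show "algebraic_int (x * y)"
  proof (rule algebraic_int_module[where I = I and v = v and ?k0.0 = "(0, 0)", OF I(1) I(2) I(3)])
    fix k assume "k \<in> I"
    obtain a b where k: "k = (a, b)" by force
    have "(x * y) * v k = x ^ Suc a * y ^ Suc b" unfolding k v_def by simp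
    thus "\<exists>c. (x * y) * v k = (\<Sum>l\<in>I. of_int (c l) * v l)" using vp[of "Suc a" "Suc b"] by (simp only:)
  qed
qed

text \<open>
  If \<open>c\<close> is the leading coefficient of an equation of degree \<open>n\<close> for \<open>x\<close>, then multiplication by \<open>c ^ (n - 1)\<close> turns it into
  a monic equation for \<open>c * x\<close>.
\<close>

lemma algebraic_imp_int_multiple:
  fixes x :: complex
  assumes "algebraic x"
  obtains c :: int where "c \<noteq> 0" "algebraic_int (of_int c * x)"
proof -
  obtain p where p: "p \<noteq> 0" "poly (map_poly of_int p) x = 0" using assms by (rule algebraicE')
  define n c where "n = degree p" and "c = lead_coeff p"
  have c0: "c \<noteq> 0" using p c_def by simp
  define q :: "int poly" where "q = monom 1 n + (\<Sum>i<n. monom (coeff p i * c ^ (n - 1 - i)) i)"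
  have cq: "coeff q i = (if i = n then 1 else if i < n then coeff p i * c ^ (n - 1 - i) else 0)" for i
    unfolding q_def by (simp add: coeff_sum)
  have dq: "degree q = n"
    by (rule antisym) (auto intro!: degree_le le_degree simp: cq)
  have "of_int c * poly (map_poly of_int q) (of_int c * x) = 0"
  proof -
    have "of_int c * poly (map_poly of_int q) (of_int c * x) =
      of_int c * (\<Sum>i\<le>n. of_int (coeff q i) * (of_int c * x) ^ i)"
      unfolding poly_altdef by (simp add: dq)
    also have "\<dots> = (\<Sum>i\<le>n. of_int c ^ n * (of_int (coeff p i) * x ^ i))"
      unfolding sum_distrib_left
    proof (intro sum.cong refl)
      fix i assume i: "i \<in> {..n}"
      show "of_int c * (of_int (coeff q i) * (of_int c * x) ^ i) = of_int c ^ n * (of_int (coeff p i) * x ^ i)"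
      proof (cases "i = n")
        case True thus ?thesis by (simp add: cq c_def n_def power_mult_distrib mult_ac)
      next
        case False
        hence i: "i < n" using i by simp
        hence e: "c ^ n = c * c ^ (n - 1 - i) * c ^ i"
          using power_add[of c "Suc (n - 1 - i)" i] by simp
        have "(of_int c :: complex) ^ n = of_int (c * c ^ (n - 1 - i) * c ^ i)"
          unfolding e[symmetric] by simp
        thus ?thesis using i by (simp add: cq power_mult_distrib mult_ac)
      qed
    qed
    also have "\<dots> = of_int c ^ n * poly (map_poly of_int p) x"
      unfolding sum_distrib_left[symmetric] poly_altdef by (simp add: n_def)
    finally show ?thesis using p by simp
  qed
  hence "poly (map_poly of_int q) (of_int c * x) = 0" using c0 by simp
  moreover have "lead_coeff q = 1" using cq[of n] dq by simp
  ultimately have "algebraic_int (of_int c * x)" unfolding algebraic_int_altdef_ipoly by blast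
  with c0 that show ?thesis by blast
qed

lemma algebraic_of_int_multiple:
  fixes x :: complex
  assumes "c \<noteq> 0" "algebraic (of_int c * x)"
  shows "algebraic x"
proof -
  obtain p where p: "p \<noteq> 0" "poly (map_poly of_int p) (of_int c * x) = 0" using assms(2) by (rule algebraicE')
  define q :: "complex poly" where "q = pcompose (map_poly of_int p) [:0, of_int c:]"
  have "q \<noteq> 0" unfolding q_def using p(1) assms(1)
    by (subst pcompose_eq_0_iff) auto
  moreover have "poly q x = 0" unfolding q_def poly_pcompose using p(2) by (simp add: mult.commute)
  moreover have "coeff q i \<in> \<int>" for i
  proof -
    have "q = map_poly of_int (pcompose p [:0, c:])" unfolding q_def
      by (simp add: of_int_hom.map_poly_pcompose hom_distribs)
    thus ?thesis by simp
  qed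
  ultimately show ?thesis by (intro algebraicI[of q])
qed

lemma algebraic_add_mult:
  fixes x y :: complex
  assumes x: "algebraic x" and y: "algebraic y"
  shows "algebraic (x + y)" "algebraic (x * y)"
proof -
  obtain c :: int where c: "c \<noteq> 0" "algebraic_int (of_int c * x)" using x by (rule algebraic_imp_int_multiple)
  obtain d :: int where d: "d \<noteq> 0" "algebraic_int (of_int d * y)" using y by (rule algebraic_imp_int_multiple)
  have "algebraic_int (of_int d * (of_int c * x) + of_int c * (of_int d * y))"
    by (rule algebraic_int_add_mult(1)[OF algebraic_int_add_mult(2)[OF algebraic_int_of_int c(2)]
          algebraic_int_add_mult(2)[OF algebraic_int_of_int d(2)]])
  moreover have "of_int (c * d) * (x + y) = of_int d * (of_int c * x) + of_int c * (of_int d * y)"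
    by (simp add: algebra_simps)
  ultimately have "algebraic (of_int (c * d) * (x + y))" using algebraic_int_imp_algebraic by metis
  thus "algebraic (x + y)" using c d by (metis algebraic_of_int_multiple mult_eq_0_iff)
  have "algebraic_int ((of_int c * x) * (of_int d * y))"
    by (rule algebraic_int_add_mult(2)[OF c(2) d(2)])
  moreover have "of_int (c * d) * (x * y) = (of_int c * x) * (of_int d * y)"
    by (simp add: algebra_simps)
  ultimately have "algebraic (of_int (c * d) * (x * y))" using algebraic_int_imp_algebraic by metis
  thus "algebraic (x * y)" using c d by (metis algebraic_of_int_multiple mult_eq_0_iff)
qed

section \<open>Minimal seminorms\<close>

lemma le_mult_limit:
  fixes a b z :: real
  assumes "\<And>s t. s > a \<Longrightarrow> t > b \<Longrightarrow> z \<le> s * t"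
  shows "z \<le> a * b"
proof -
  have "(\<lambda>n. (a + inverse (real (Suc n))) * (b + inverse (real (Suc n)))) \<longlonglongrightarrow> (a + 0) * (b + 0)"
    by (intro tendsto_intros LIMSEQ_inverse_real_of_nat)
  moreover have "z \<le> (a + inverse (real (Suc n))) * (b + inverse (real (Suc n)))" for n
    by (rule assms) auto
  ultimately have "z \<le> (a + 0) * (b + 0)" by (intro LIMSEQ_le_const) auto
  thus ?thesis by simp
qed

text \<open>
  The competitors in a minimality argument that produces multiplicative seminorms. The bounds are asked for outside \<open>K\<close>,
  too, so that the order is a pointwise order of functions; \<open>N0\<close> will vanish there.
\<close>

definition seminorms :: "complex set \<Rightarrow> (complex \<Rightarrow> real) \<Rightarrow> (complex \<Rightarrow> real) set" where
  "seminorms K N0 = {N. (\<forall>x. 0 \<le> N x \<and> N x \<le> N0 x) \<and> N 1 = 1 \<and>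
     (\<forall>x\<in>K. \<forall>y\<in>K. N (x + y) \<le> max (N x) (N y) \<and> N (x * y) \<le> N x * N y)}"

text \<open>
  Zorn's lemma: in a chain, any two strict upper bounds for the infimum are met by one member, so the infimum
  inherits the inequalities.
\<close>

lemma exists_minimal_seminorm:
  assumes "N0 \<in> seminorms K N0"
  obtains N where "N \<in> seminorms K N0" "\<And>M. M \<in> seminorms K N0 \<Longrightarrow> (\<And>x. M x \<le> N x) \<Longrightarrow> M = N"
proof -
  define S where "S = seminorms K N0"
  define P where "P = (\<lambda>N M :: complex \<Rightarrow> real. \<forall>x. M x \<le> N x)"
  have "\<exists>m\<in>S. \<forall>a\<in>S. P m a \<longrightarrow> a = m"
  proof (rule predicate_Zorn)
    show "partial_order_on S (relation_of P S)"
      by (auto simp: partial_order_on_def preorder_on_def refl_on_def trans_def antisym_def relation_of_def P_def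
          intro!: ext intro: order_trans antisym)
  next
    fix C assume C: "C \<in> Chains (relation_of P S)"
    hence CS: "C \<subseteq> S" and tot: "\<And>N M. N \<in> C \<Longrightarrow> M \<in> C \<Longrightarrow> P N M \<or> P M N"
      by (auto simp: Chains_def relation_of_def)
    show "\<exists>u\<in>S. \<forall>a\<in>C. P a u"
    proof (cases "C = {}")
      case True thus ?thesis using assms S_def by auto
    next
      case False
      define u where "u = (\<lambda>x. INF N\<in>C. N x)"
      have C0: "\<And>N x. N \<in> C \<Longrightarrow> 0 \<le> N x" using CS by (auto simp: S_def seminorms_def)
      have bb: "bdd_below ((\<lambda>N. N x) ` C)" for x using C0 by (intro bdd_belowI[of _ 0]) auto
      have ul: "u x \<le> N x" if "N \<in> C" for x N unfolding u_def by (rule cINF_lower[OF bb that])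
      have ug: "\<exists>N\<in>C. N x < t" if "u x < t" for x t
        using that cINF_less_iff[OF False bb] unfolding u_def by blast
      have both: "\<exists>N\<in>C. N x < s \<and> N y < t" if xy: "u x < s" "u y < t" for x y s t
      proof -
        obtain N M where NM: "N \<in> C" "N x < s" "M \<in> C" "M y < t" using ug[OF xy(1)] ug[OF xy(2)] by blast
        from tot[OF NM(1,3)] show ?thesis
        proof
          assume "P N M"
          hence "M x \<le> N x" by (simp add: P_def)
          thus ?thesis using NM by (intro bexI[of _ M]) auto
        next
          assume "P M N"
          hence "N y \<le> M y" by (simp add: P_def)
          thus ?thesis using NM by (intro bexI[of _ N]) auto
        qed
      qed
      have u0: "0 \<le> u x" for x unfolding u_def using False C0 by (intro cINF_greatest) auto
      have "u \<in> S" unfolding S_def seminorms_def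
      proof (intro CollectI conjI allI ballI)
        fix x show "0 \<le> u x" by (rule u0)
        obtain N where "N \<in> C" using False by blast
        moreover have "N x \<le> N0 x" using CS \<open>N \<in> C\<close> by (auto simp: S_def seminorms_def)
        ultimately show "u x \<le> N0 x" using ul[of N x] by linarith
      next
        have "\<And>N. N \<in> C \<Longrightarrow> N 1 = 1" using CS by (auto simp: S_def seminorms_def)
        hence "u 1 = (INF N\<in>C. 1)" unfolding u_def by (intro INF_cong) auto
        thus "u 1 = 1" using False by simp
      next
        fix x y assume xy: "x \<in> K" "y \<in> K"
        show "u (x + y) \<le> max (u x) (u y)"
        proof (rule dense_ge)
          fix t assume "max (u x) (u y) < t"
          then obtain N where N: "N \<in> C" "N x < t" "N y < t" using both[of x t y t] by auto
          have "u (x + y) \<le> N (x + y)" by (rule ul[OF N(1)])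
          also have "\<dots> \<le> max (N x) (N y)" using N(1) CS xy by (auto simp: S_def seminorms_def)
          finally show "u (x + y) \<le> t" using N by auto
        qed
        show "u (x * y) \<le> u x * u y"
        proof (rule le_mult_limit)
          fix s t assume "s > u x" "t > u y"
          then obtain N where N: "N \<in> C" "N x < s" "N y < t" using both[of x s y t] by auto
          have "u (x * y) \<le> N (x * y)" by (rule ul[OF N(1)])
          also have "\<dots> \<le> N x * N y" using N(1) CS xy by (auto simp: S_def seminorms_def)
          also have "\<dots> \<le> s * t" using N C0[OF N(1)] by (intro mult_mono) (auto intro: order_trans less_imp_le)
          finally show "u (x * y) \<le> s * t" .
        qed
      qed
      thus ?thesis using ul by (auto simp: P_def)
    qed
  qed
  thus ?thesis using that unfolding S_def P_def by blast
qed

text \<open>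
  A minimal \<open>N\<close> equals every competitor below it. The spectral seminorm, the limit of \<open>N (x ^ k) powr (1 / k)\<close>, is
  one, so \<open>N\<close> is multiplicative on powers. For fixed \<open>x\<close> with \<open>N x \<noteq> 0\<close>, the limit of the decreasing sequence
  \<open>N (x ^ n * y) / N x ^ n\<close> is, as a function of \<open>y\<close>, then another one, and equality with \<open>N y\<close> means that already the
  first step of the sequence does not decrease.
\<close>

lemma minimal_seminorm_multiplicative:
  assumes K: "1 \<in> K" "0 \<in> K" "\<And>x y. x \<in> K \<Longrightarrow> y \<in> K \<Longrightarrow> x + y \<in> K" "\<And>x y. x \<in> K \<Longrightarrow> y \<in> K \<Longrightarrow> x * y \<in> K"
    and N0: "\<And>x. x \<notin> K \<Longrightarrow> N0 x = 0" "N0 0 = 0"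
    and N: "N \<in> seminorms K N0"
    and min: "\<And>M. M \<in> seminorms K N0 \<Longrightarrow> (\<And>x. M x \<le> N x) \<Longrightarrow> M = N"
    and x: "x \<in> K" and y: "y \<in> K"
  shows "N (x * y) = N x * N y"
proof -
  have Nnn: "0 \<le> N x" "N x \<le> N0 x" for x using N by (auto simp: seminorms_def)
  have N1: "N 1 = 1" using N by (auto simp: seminorms_def)
  have Nadd: "N (x + y) \<le> max (N x) (N y)" and Nmult: "N (x * y) \<le> N x * N y" if "x \<in> K" "y \<in> K" for x y
    using N that by (auto simp: seminorms_def)
  have N00: "N 0 = 0" using Nnn[of 0] N0 by simp
  have Kpow: "x ^ n \<in> K" if "x \<in> K" for x n using that K by (induction n) auto
  have Ksum: "sum f I \<in> K" if "\<And>i. i \<in> I \<Longrightarrow> f i \<in> K" for f and I :: "nat set"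
    using that K(2,3) by (induction I rule: infinite_finite_induct) auto
  have Nsum: "N (sum f I) \<le> B" if "\<And>i. i \<in> I \<Longrightarrow> f i \<in> K \<and> N (f i) \<le> B" "0 \<le> B" for f B and I :: "nat set"
    using that(1)
  proof (induction I rule: infinite_finite_induct)
    case (insert i I)
    have "N (f i + sum f I) \<le> max (N (f i)) (N (sum f I))" using insert by (intro Nadd Ksum) auto
    thus ?case using insert by force
  qed (use N00 that(2) in auto)
  have Nnat: "of_nat n * z \<in> K \<and> N (of_nat n * z) \<le> N z" if "z \<in> K" for n z
  proof -
    have e: "of_nat n * z = (\<Sum>i<n. z)" by simp
    show ?thesis unfolding e using that Nnn by (intro conjI Nsum Ksum) auto
  qed
  have Npow: "N (x ^ k) \<le> N x ^ k" if "x \<in> K" for x k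
  proof (induction k)
    case (Suc k)
    have "N (x ^ Suc k) \<le> N x * N (x ^ k)" using Nmult[OF that Kpow[OF that], of k] by simp
    also have "\<dots> \<le> N x * N x ^ k" using Suc Nnn by (intro mult_left_mono) auto
    finally show ?case by simp
  qed (simp add: N1)
  \<comment> \<open>The spectral seminorm, written as an infimum of growth rates.\<close>
  define R where "R = (\<lambda>x. {a. a > 0 \<and> (\<exists>C. \<forall>k. N (x ^ k) \<le> C * a ^ k)})"
  define N' where "N' = (\<lambda>x. if x \<in> K then Inf (R x) else 0)"
  have Rin: "N x + e \<in> R x" if "x \<in> K" "e > 0" for x e
  proof -
    have "N (x ^ k) \<le> 1 * (N x + e) ^ k" for k
      using Npow[OF that(1), of k] power_mono[of "N x" "N x + e" k] that Nnn[of x] by simp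
    moreover have "N x + e > 0" using Nnn[of x] that by simp
    ultimately show ?thesis unfolding R_def by blast
  qed
  have Rbb: "bdd_below (R x)" for x unfolding R_def by (intro bdd_belowI[of _ 0]) auto
  have N'le: "N' x \<le> a" if "a \<in> R x" "x \<in> K" for a x
    unfolding N'_def using that cInf_lower[OF that(1) Rbb] by simp
  have N'nn: "0 \<le> N' x" for x
  proof (cases "x \<in> K")
    case True
    hence "R x \<noteq> {}" using Rin[of x 1] by auto
    thus ?thesis unfolding N'_def using True by (auto intro!: cInf_greatest simp: R_def)
  qed (simp add: N'_def)
  have N'N: "N' x \<le> N x" for x
  proof (cases "x \<in> K")
    case True
    show ?thesis by (rule field_le_epsilon) (rule N'le[OF Rin[OF True] True])
  qed (use Nnn in \<open>simp add: N'_def\<close>)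
  have key: "\<exists>C>0. \<forall>k. N (x ^ k) \<le> C * t ^ k" if t: "t > N' x" "x \<in> K" for x t
  proof -
    have "R x \<noteq> {}" using Rin[of x 1] t by auto
    hence "\<exists>a\<in>R x. a < t" using t cInf_less_iff[OF _ Rbb, of x t] by (auto simp: N'_def)
    then obtain a C where a: "a > 0" "a < t" "\<And>k. N (x ^ k) \<le> C * a ^ k" by (auto simp: R_def)
    have C: "C > 0" using a(3)[of 0] N1 by simp
    have "N (x ^ k) \<le> C * t ^ k" for k
      using a(3)[of k] power_mono[of a t k] a C by (smt (verit) mult_left_mono)
    thus ?thesis using C by blast
  qed
  have "N' \<in> seminorms K N0" unfolding seminorms_def
  proof (intro CollectI conjI allI ballI)
    fix x show "0 \<le> N' x" "N' x \<le> N0 x" using N'nn N'N Nnn(2) order_trans by blast+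
  next
    have "1 \<le> Inf (R 1)"
    proof (rule cInf_greatest)
      show "R 1 \<noteq> {}" using Rin[of 1 1] K(1) by auto
      fix a assume "a \<in> R 1"
      then obtain C where a: "a > 0" "\<And>k. 1 \<le> C * a ^ k" by (auto simp: R_def N1)
      show "1 \<le> a"
      proof (rule ccontr)
        assume "\<not> 1 \<le> a"
        hence "(\<lambda>k. C * a ^ k) \<longlonglongrightarrow> C * 0" using a by (intro tendsto_mult tendsto_const LIMSEQ_realpow_zero) auto
        hence "1 \<le> C * 0" by (rule LIMSEQ_le_const) (use a in auto)
        thus False by simp
      qed
    qed
    thus "N' 1 = 1" using N'N[of 1] K(1) N1 by (simp add: N'_def)
  next
    fix x y assume xy: "x \<in> K" "y \<in> K"
    show "N' (x + y) \<le> max (N' x) (N' y)"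
    proof (rule dense_ge)
      fix t assume t: "max (N' x) (N' y) < t"
      obtain C where C: "C > 0" "\<And>k. N (x ^ k) \<le> C * t ^ k" using key[of x t] t xy by auto
      obtain D where D: "D > 0" "\<And>k. N (y ^ k) \<le> D * t ^ k" using key[of y t] t xy by auto
      have t0: "t > 0" using t N'nn[of x] by auto
      have "N ((x + y) ^ k) \<le> (C * D) * t ^ k" for k
      proof -
        have "(x + y) ^ k = (\<Sum>i\<le>k. of_nat (k choose i) * (x ^ i * y ^ (k - i)))"
          unfolding binomial_ring by (simp add: mult_ac)
        also have "N \<dots> \<le> (C * D) * t ^ k"
        proof (intro Nsum conjI)
          fix i assume i: "i \<in> {..k}"
          have xi: "x ^ i * y ^ (k - i) \<in> K" using xy Kpow K by auto
          show "of_nat (k choose i) * (x ^ i * y ^ (k - i)) \<in> K" using Nnat[OF xi] by blast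
          have "N (of_nat (k choose i) * (x ^ i * y ^ (k - i))) \<le> N (x ^ i * y ^ (k - i))" using Nnat[OF xi] by blast
          also have "\<dots> \<le> N (x ^ i) * N (y ^ (k - i))" using Nmult xy Kpow by auto
          also have "\<dots> \<le> (C * t ^ i) * (D * t ^ (k - i))"
            using C D Nnn t0 by (intro mult_mono) auto
          also have "\<dots> = (C * D) * (t ^ i * t ^ (k - i))" by simp
          also have "t ^ i * t ^ (k - i) = t ^ k" using i by (simp flip: power_add)
          finally show "N (of_nat (k choose i) * (x ^ i * y ^ (k - i))) \<le> (C * D) * t ^ k" .
        qed (use C D t0 in auto)
        finally show ?thesis .
      qed
      hence "t \<in> R (x + y)" using t0 by (auto simp: R_def)
      thus "N' (x + y) \<le> t" using K xy by (intro N'le) auto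
    qed
    show "N' (x * y) \<le> N' x * N' y"
    proof (rule le_mult_limit)
      fix s t assume st: "s > N' x" "t > N' y"
      obtain C where C: "C > 0" "\<And>k. N (x ^ k) \<le> C * s ^ k" using key[of x s] st xy by auto
      obtain D where D: "D > 0" "\<And>k. N (y ^ k) \<le> D * t ^ k" using key[of y t] st xy by auto
      have st0: "s > 0" "t > 0" using st N'nn[of x] N'nn[of y] by auto
      have "N ((x * y) ^ k) \<le> (C * D) * (s * t) ^ k" for k
      proof -
        have "N ((x * y) ^ k) \<le> N (x ^ k) * N (y ^ k)" unfolding power_mult_distrib using Nmult xy Kpow by auto
        also have "\<dots> \<le> (C * s ^ k) * (D * t ^ k)" using C D Nnn st0 by (intro mult_mono) auto
        finally show ?thesis by (simp add: power_mult_distrib mult_ac)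
      qed
      hence "s * t \<in> R (x * y)" using st0 by (auto simp: R_def)
      thus "N' (x * y) \<le> s * t" using K xy by (intro N'le) auto
    qed
  qed
  hence NN': "N' = N" by (rule min[OF _ N'N])
  have Npow_eq: "N (x ^ n) = N x ^ n" if x: "x \<in> K" for x n
  proof (cases "n = 0")
    case False
    show ?thesis
    proof (rule ccontr)
      assume "N (x ^ n) \<noteq> N x ^ n"
      hence lt: "N (x ^ n) < N x ^ n" using Npow[OF x, of n] by simp
      then obtain c where c: "N (x ^ n) < c" "c < N x ^ n" using dense by blast
      have c0: "c > 0" using c Nnn[of "x ^ n"] by simp
      define b where "b = root n c"
      have b: "b > 0" "b ^ n = c" unfolding b_def using False c0 by auto
      have bN: "b < N x" using c(2) b Nnn[of x] by (metis power_less_imp_less_base)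
      define C where "C = (\<Sum>r<n. N (x ^ r) / b ^ r)"
      have "N (x ^ k) \<le> C * b ^ k" for k
      proof -
        define q r where "q = k div n" and "r = k mod n"
        have k: "k = n * q + r" "r < n" using False by (auto simp: q_def r_def)
        have "N (x ^ k) = N ((x ^ n) ^ q * x ^ r)" unfolding k by (simp add: power_add power_mult)
        also have "\<dots> \<le> N ((x ^ n) ^ q) * N (x ^ r)" using x Kpow by (intro Nmult) auto
        also have "\<dots> \<le> N (x ^ n) ^ q * N (x ^ r)" using Npow[of "x ^ n" q] Nnn x Kpow by (intro mult_right_mono) auto
        also have "\<dots> \<le> (b ^ n) ^ q * N (x ^ r)"
          using c b Nnn by (intro mult_right_mono power_mono) auto
        also have "\<dots> = b ^ k * (N (x ^ r) / b ^ r)" unfolding k using b by (simp add: power_add power_mult)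
        also have "\<dots> \<le> b ^ k * C" unfolding C_def using b Nnn k
          by (intro mult_left_mono member_le_sum[of r _ "\<lambda>r. N (x ^ r) / b ^ r"]) auto
        finally show ?thesis by (simp add: mult.commute)
      qed
      hence "b \<in> R x" using b by (auto simp: R_def)
      hence "N' x \<le> b" using x by (intro N'le)
      thus False using NN' bN by simp
    qed
  qed (simp add: N1)
  show ?thesis
  proof (cases "N x = 0")
    case True
    thus ?thesis using Nmult[OF x y] Nnn[of "x * y"] by simp
  next
    case False
    hence Nx: "N x > 0" using Nnn[of x] by simp
    define f where "f = (\<lambda>y n. N (x ^ n * y) / N x ^ n)"
    have fnn: "0 \<le> f y n" for y n unfolding f_def using Nnn by simp
    have fstep: "f y (Suc n) \<le> f y n" if "y \<in> K" for y n
    proof -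
      have "N (x ^ Suc n * y) \<le> N x * N (x ^ n * y)"
        using Nmult[of x "x ^ n * y"] x Kpow[OF x] K that by (simp add: mult.assoc)
      thus ?thesis unfolding f_def using Nx by (simp add: field_simps)
    qed
    have fmono: "f y n \<le> f y m" if "y \<in> K" "m \<le> n" for y m n
      using that(2) fstep[OF that(1)] by (rule lift_Suc_antimono_le[of "f y", rotated]) 
    define M where "M = (\<lambda>y. if y \<in> K then INF n. f y n else 0)"
    have fbb: "bdd_below (range (f y))" for y using fnn by (intro bdd_belowI[of _ 0]) auto
    have Mle: "M y \<le> f y n" if "y \<in> K" for y n unfolding M_def using that cINF_lower[OF fbb] by simp
    have Mnn: "0 \<le> M y" for y unfolding M_def using fnn by (auto intro!: cINF_greatest)
    have Mlt: "\<exists>n. f y n < t" if "y \<in> K" "M y < t" for y t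
      using that cINF_less_iff[OF _ fbb, of y t] by (auto simp: M_def)
    have MN: "M y \<le> N y" for y
    proof (cases "y \<in> K")
      case True
      have "f y 0 = N y" by (simp add: f_def)
      thus ?thesis using Mle[OF True, of 0] by simp
    qed (use Nnn in \<open>simp add: M_def\<close>)
    have "M \<in> seminorms K N0" unfolding seminorms_def
    proof (intro CollectI conjI allI ballI)
      fix y show "0 \<le> M y" "M y \<le> N0 y" using Mnn MN Nnn(2) order_trans by blast+
    next
      have "f 1 = (\<lambda>n. 1)" unfolding f_def using Npow_eq[OF x] Nx by auto
      thus "M 1 = 1" using K(1) by (simp add: M_def)
    next
      fix y z assume yz: "y \<in> K" "z \<in> K"
      show "M (y + z) \<le> max (M y) (M z)"
      proof (rule dense_ge)
        fix t assume t: "max (M y) (M z) < t"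
        obtain n1 n2 where n: "f y n1 < t" "f z n2 < t" using Mlt[of y t] Mlt[of z t] t yz by auto
        define n where "n = max n1 n2"
        have n': "f y n < t" "f z n < t"
          using n fmono[OF yz(1), of n1 n] fmono[OF yz(2), of n2 n] by (auto simp: n_def)
        have "N (x ^ n * (y + z)) \<le> max (N (x ^ n * y)) (N (x ^ n * z))"
          unfolding distrib_left using yz K Kpow[OF x] by (intro Nadd) auto
        hence "f (y + z) n \<le> f y n \<or> f (y + z) n \<le> f z n" unfolding f_def using Nx
          by (auto simp: le_max_iff_disj intro: divide_right_mono)
        moreover have "M (y + z) \<le> f (y + z) n" by (rule Mle) (rule K(3)[OF yz])
        ultimately show "M (y + z) \<le> t" using n' by linarith
      qed
      show "M (y * z) \<le> M y * M z"
      proof (rule le_mult_limit)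
        fix s t assume st: "M y < s" "M z < t"
        obtain n1 n2 where n: "f y n1 < s" "f z n2 < t" using Mlt[of y s] Mlt[of z t] st yz by auto
        have "N (x ^ (n1 + n2) * (y * z)) \<le> N (x ^ n1 * y) * N (x ^ n2 * z)"
          using Nmult[of "x ^ n1 * y" "x ^ n2 * z"] yz K Kpow[OF x] by (simp add: power_add mult_ac)
        hence "f (y * z) (n1 + n2) \<le> f y n1 * f z n2" unfolding f_def using Nx
          by (simp add: field_simps power_add)
        also have "\<dots> \<le> s * t" using n fnn[of y n1] fnn[of z n2] by (intro mult_mono) auto
        finally show "M (y * z) \<le> s * t" using Mle[OF K(4)[OF yz], of "n1 + n2"] by linarith
      qed
    qed
    hence "M = N" by (rule min[OF _ MN])
    hence "N y \<le> f y 1" using Mle[OF y, of 1] by simp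
    hence "N x * N y \<le> N (x * y)" unfolding f_def using Nx by (simp add: field_simps)
    thus ?thesis using Nmult[OF x y] by simp
  qed
qed

section \<open>Extension of p-adic absolute values\<close>

lemma padic_abs_fraction:
  assumes p: "prime p" and "a \<noteq> 0" "b \<noteq> 0"
  shows "padic_abs p (of_int a / of_int b) =
    real p powi (int (multiplicity (int p) b) - int (multiplicity (int p) a))"
proof -
  define q where "q = (of_int a / of_int b :: rat)"
  obtain n d where nd: "quotient_of q = (n, d)" by force
  have q0: "q \<noteq> 0" unfolding q_def using assms by simp
  have d: "d > 0" using quotient_of_denom_pos[OF nd] .
  have qe: "q = of_int n / of_int d" using quotient_of_div[OF nd] .
  hence n0: "n \<noteq> 0" using q0 by auto
  have "of_int (a * d) = (of_int (n * b) :: rat)" using qe d assms unfolding q_def by (simp add: field_simps)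
  hence e: "a * d = n * b" by (simp only: of_int_eq_iff)
  have pp: "prime_elem (int p)" using p by simp
  have "multiplicity (int p) (a * d) = multiplicity (int p) a + multiplicity (int p) d"
    using assms d by (intro prime_elem_multiplicity_mult_distrib pp) auto
  moreover have "multiplicity (int p) (n * b) = multiplicity (int p) n + multiplicity (int p) b"
    using assms n0 by (intro prime_elem_multiplicity_mult_distrib pp) auto
  ultimately have "int (multiplicity (int p) d) - int (multiplicity (int p) n) =
    int (multiplicity (int p) b) - int (multiplicity (int p) a)" using e by simp
  thus ?thesis unfolding padic_abs_def q_def[symmetric] using q0 nd by simp
qed

text \<open>
  Let \<open>A\<close> be the ring of algebraic numbers that are integral after multiplication by an integer prime to \<open>p\<close>, and let \<open>N0 x\<close> be
  the infimum of \<open>p powi (- k)\<close> over the \<open>k\<close> for which \<open>p powi k\<close> divides \<open>x\<close> in \<open>A\<close>. This is a submultiplicative seminorm; it is not trivial because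
  \<open>1 / p\<close> is not in \<open>A\<close>, a rational algebraic integer being an integer. A minimal seminorm below it is multiplicative, hence an absolute
  value, and its bounds on \<open>A\<close> and on the powers of \<open>p\<close> determine it on the rationals.
\<close>

lemma exists_padic_extension:
  assumes p: "prime p"
  shows "\<exists>v :: complex \<Rightarrow> real. (\<forall>x\<in>Qbar. 0 \<le> v x \<and> (v x = 0 \<longleftrightarrow> x = 0)) \<and>
    (\<forall>x\<in>Qbar. \<forall>y\<in>Qbar. v (x * y) = v x * v y \<and> v (x + y) \<le> max (v x) (v y)) \<and>
    (\<forall>q. v (of_rat q) = padic_abs p q)"
proof -
  define A where "A = {x :: complex. \<exists>m. \<not> int p dvd m \<and> algebraic_int (of_int m * x)}"
  have pp: "prime_elem (int p)" using p by simp
  have p1: "p > 1" using p prime_gt_1_nat by blast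
  have AI: "x \<in> A" if "\<not> int p dvd m" "algebraic_int (of_int m * x)" for x m
    using that unfolding A_def by blast
  have AE: "\<exists>m. \<not> int p dvd m \<and> algebraic_int (of_int m * x)" if "x \<in> A" for x
    using that unfolding A_def by blast
  have A_add: "x + y \<in> A" and A_mult: "x * y \<in> A" if xy: "x \<in> A" "y \<in> A" for x y
  proof -
    obtain m n where m: "\<not> int p dvd m" "algebraic_int (of_int m * x)"
      and n: "\<not> int p dvd n" "algebraic_int (of_int n * y)" using AE[OF xy(1)] AE[OF xy(2)] by blast
    have mn: "\<not> int p dvd m * n" using m n pp by (simp add: prime_elem_dvd_mult_iff)
    have "algebraic_int (of_int n * (of_int m * x) + of_int m * (of_int n * y))"
      by (rule algebraic_int_add_mult(1)[OF algebraic_int_add_mult(2)[OF algebraic_int_of_int m(2)]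
          algebraic_int_add_mult(2)[OF algebraic_int_of_int n(2)]])
    moreover have "of_int (m * n) * (x + y) = of_int n * (of_int m * x) + of_int m * (of_int n * y)"
      by (simp add: algebra_simps)
    ultimately show "x + y \<in> A" using AI[OF mn] by metis
    have "algebraic_int ((of_int m * x) * (of_int n * y))"
      by (rule algebraic_int_add_mult(2)[OF m(2) n(2)])
    moreover have "of_int (m * n) * (x * y) = (of_int m * x) * (of_int n * y)"
      by (simp add: algebra_simps)
    ultimately show "x * y \<in> A" using AI[OF mn] by metis
  qed
  have A_int: "of_int k \<in> A" for k
    by (rule AI[of 1]) (use p1 in auto)

  have p0: "of_nat p \<noteq> (0::complex)" using p1 by simp
  have A_pinv: "\<exists>k. of_nat p ^ k * x \<in> A" if "x \<in> Qbar" for x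
  proof -
    obtain c :: int where c: "c \<noteq> 0" "algebraic_int (of_int c * x)"
      using \<open>x \<in> Qbar\<close> unfolding Qbar_def using algebraic_imp_int_multiple by blast
    have "\<not> is_unit (int p)" using p1 by simp
    from multiplicity_decompose'[OF c(1) this]
    obtain m where m: "c = int p ^ multiplicity (int p) c * m" "\<not> int p dvd m" by blast
    have "of_int c = (of_nat p ^ multiplicity (int p) c * of_int m :: complex)"
      using arg_cong[OF m(1), of "of_int :: int \<Rightarrow> complex"] by simp
    hence "of_int m * (of_nat p ^ multiplicity (int p) c * x) = of_int c * x" by simp
    with c(2) have "algebraic_int (of_int m * (of_nat p ^ multiplicity (int p) c * x))" by (simp only:)
    thus ?thesis using AI[OF m(2)] by blast
  qed
  have A_Qbar: "x \<in> Qbar" if xA: "x \<in> A" for x :: complex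
  proof -
    obtain m where m: "\<not> int p dvd m" "algebraic_int (of_int m * x)" using AE[OF xA] by blast
    have "m \<noteq> 0" using m(1) by auto
    thus ?thesis using algebraic_of_int_multiple m(2) unfolding Qbar_def by blast
  qed
  define E where "E = (\<lambda>x (k::int). \<exists>y\<in>A. x = of_nat p powi k * y)"
  have E_mono: "E x l" if xk: "E x k" "l \<le> k" for x k l
  proof -
    obtain y where y: "y \<in> A" "x = of_nat p powi k * y" using xk(1) E_def by blast
    obtain n where n: "k = l + int n" using xk(2) zle_iff_zadd by blast
    have "x = of_nat p powi l * (of_int (int p ^ n) * y)"
      unfolding y(2) n using p0 by (simp add: power_int_add mult.assoc)
    thus ?thesis using A_mult[OF A_int y(1)] unfolding E_def by blast
  qed
  have E_add: "E (x + y) k" if xy: "E x k" "E y k" for x y k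
  proof -
    obtain x' y' where "x' \<in> A" "x = of_nat p powi k * x'" "y' \<in> A" "y = of_nat p powi k * y'"
      using xy E_def by blast
    thus ?thesis using A_add[of x' y'] unfolding E_def by (intro bexI[of _ "x' + y'"]) (auto simp: algebra_simps)
  qed
  have E_mult: "E (x * y) (k + l)" if xy: "E x k" "E y l" for x y k l
  proof -
    obtain x' y' where "x' \<in> A" "x = of_nat p powi k * x'" "y' \<in> A" "y = of_nat p powi l * y'"
      using xy E_def by blast
    thus ?thesis using A_mult[of x' y'] p0 unfolding E_def
      by (intro bexI[of _ "x' * y'"]) (auto simp: power_int_add)
  qed
  have E_A: "E x 0" if "x \<in> A" for x using that unfolding E_def by auto
  have E_ex: "\<exists>k. E x k" if "x \<in> Qbar" for x
  proof -
    obtain k where "of_nat p ^ k * x \<in> A" using A_pinv[OF \<open>x \<in> Qbar\<close>] by blast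
    hence "E x (- int k)" unfolding E_def using p0
      by (intro bexI[of _ "of_nat p ^ k * x"]) (auto simp: power_int_minus)
    thus ?thesis by blast
  qed
  have E_1: "k \<le> 0" if E1: "E 1 k" for k
  proof (rule ccontr)
    assume "\<not> k \<le> 0"
    hence "E 1 1" using E_mono[OF E1, of 1] by simp
    then obtain y where y: "y \<in> A" "1 = of_nat p * y" unfolding E_def by auto
    obtain m where m: "\<not> int p dvd m" "algebraic_int (of_int m * y)" using AE[OF y(1)] by blast
    have "y = 1 / of_nat p" using y(2) p0 by (simp add: field_simps)
    hence "of_int m * y = of_rat (of_int m / of_nat p)" by (simp add: of_rat_divide)
    hence "of_int m * y \<in> \<rat>" by simp
    hence "of_int m * y \<in> \<int>" using m(2) rational_algebraic_int_is_int by blast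
    then obtain z where z: "of_int m * y = of_int z" by (auto elim: Ints_cases)
    have "of_int m = of_nat p * (of_int m * y)" using y(2) by (metis mult.left_commute mult.right_neutral)
    also have "\<dots> = of_int (int p * z)" unfolding z by simp
    finally have "m = int p * z" by (simp only: of_int_eq_iff)
    thus False using m(1) by simp
  qed
  define V where "V = (\<lambda>x. {real p powi (- k) | k. E x k})"
  define N0 where "N0 = (\<lambda>x. if x \<in> Qbar then Inf (V x) else 0)"
  have rp: "real p > 1" using p1 by simp
  have Vpos: "a > 0" if "a \<in> V x" for a x using that rp unfolding V_def by (auto intro: zero_less_power_int)
  have Vbb: "bdd_below (V x)" for x using Vpos by (intro bdd_belowI[of _ 0]) (auto intro: less_imp_le)
  have Vne: "V x \<noteq> {}" if "x \<in> Qbar" for x using E_ex[OF that] unfolding V_def by blast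
  have N0le: "N0 x \<le> real p powi (- k)" if "x \<in> Qbar" "E x k" for x k
    unfolding N0_def using that cInf_lower[OF _ Vbb, of _ x] by (auto simp: V_def)
  have N0lt: "\<exists>k. E x k \<and> real p powi (- k) < t" if "x \<in> Qbar" "N0 x < t" for x t
    using that cInf_less_iff[OF Vne Vbb, of x t] by (auto simp: N0_def V_def)
  have N0nn: "0 \<le> N0 x" for x
    unfolding N0_def using Vne Vpos by (auto intro!: cInf_greatest intro: less_imp_le)
  have Q: "(1::complex) \<in> Qbar" "(0::complex) \<in> Qbar"
    "\<And>x y. x \<in> Qbar \<Longrightarrow> y \<in> Qbar \<Longrightarrow> x + y \<in> Qbar"
    "\<And>x y. x \<in> Qbar \<Longrightarrow> y \<in> Qbar \<Longrightarrow> x * y \<in> Qbar"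
    unfolding Qbar_def using algebraic_add_mult by (auto simp: rat_imp_algebraic)
  have N0S: "N0 \<in> seminorms Qbar N0" unfolding seminorms_def
  proof (intro CollectI conjI allI ballI)
    fix x show "0 \<le> N0 x" "N0 x \<le> N0 x" using N0nn by auto
  next
    have "E 1 0" using A_int[of 1] by (intro E_A) simp
    hence "N0 1 \<le> 1" using N0le[OF Q(1), of 0] by simp
    moreover have "1 \<le> N0 1"
    proof -
      have "1 \<le> a" if aV: "a \<in> V 1" for a
      proof -
        obtain k where k: "a = real p powi (- k)" "E 1 k" using aV unfolding V_def by blast
        have "k \<le> 0" using E_1 k by blast
        then obtain n where "k = - int n" by (metis nonpos_int_cases)
        thus ?thesis unfolding k using rp by simp
      qed
      thus ?thesis unfolding N0_def using Q(1) Vne[OF Q(1)] by (auto intro!: cInf_greatest)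
    qed
    ultimately show "N0 1 = 1" by simp
  next
    fix x y :: complex assume xy: "x \<in> Qbar" "y \<in> Qbar"
    show "N0 (x + y) \<le> max (N0 x) (N0 y)"
    proof (rule dense_ge)
      fix t assume t: "max (N0 x) (N0 y) < t"
      obtain k l where kl: "E x k" "real p powi (- k) < t" "E y l" "real p powi (- l) < t"
        using N0lt[of x t] N0lt[of y t] t xy by auto
      have "E (x + y) (min k l)" using kl by (intro E_add) (auto intro: E_mono)
      hence "N0 (x + y) \<le> real p powi (- min k l)" using Q(3)[OF xy] N0le by blast
      thus "N0 (x + y) \<le> t" using kl by (auto simp: min_def split: if_splits)
    qed
    show "N0 (x * y) \<le> N0 x * N0 y"
    proof (rule le_mult_limit)
      fix s t assume st: "N0 x < s" "N0 y < t"
      obtain k l where kl: "E x k" "real p powi (- k) < s" "E y l" "real p powi (- l) < t"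
        using N0lt[of x s] N0lt[of y t] st xy by auto
      have "N0 (x * y) \<le> real p powi (- (k + l))" by (intro N0le E_mult Q xy kl)
      also have "\<dots> = real p powi (- k) * real p powi (- l)" using rp power_int_add[of "real p" "- k" "- l"] by simp
      also have "\<dots> \<le> s * t"
      proof (intro mult_mono)
        have pos: "0 < real p powi n" for n using rp by (intro zero_less_power_int) simp
        show "0 \<le> real p powi (- l)" "0 \<le> s" using pos[of "- l"] pos[of "- k"] kl by linarith+
      qed (use kl in auto)
      finally show "N0 (x * y) \<le> s * t" .
    qed
  qed
  have N00: "N0 0 = 0"
  proof -
    have E0: "E 0 k" for k unfolding E_def using A_int[of 0] by auto
    have "N0 0 \<le> inverse (real p) ^ n" for n
      using N0le[OF Q(2) E0, of "int n"] by (simp add: power_int_minus power_inverse)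
    moreover have "(\<lambda>n. inverse (real p) ^ n) \<longlonglongrightarrow> 0" using rp by (intro LIMSEQ_realpow_zero) (auto simp: field_simps)
    ultimately have "N0 0 \<le> 0" by (intro LIMSEQ_le_const) auto
    thus ?thesis using N0nn[of 0] by simp
  qed
  obtain v where v: "v \<in> seminorms Qbar N0" "\<And>M. M \<in> seminorms Qbar N0 \<Longrightarrow> (\<And>x. M x \<le> v x) \<Longrightarrow> M = v"
    using exists_minimal_seminorm[OF N0S] by metis
  have vm: "v (x * y) = v x * v y" if "x \<in> Qbar" "y \<in> Qbar" for x y
    by (rule minimal_seminorm_multiplicative[OF Q _ N00 v that]) (auto simp: N0_def)
  have v0: "0 \<le> v x" "v x \<le> N0 x" and v1: "v 1 = 1" for x using v(1) by (auto simp: seminorms_def)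
  have vadd: "v (x + y) \<le> max (v x) (v y)" if "x \<in> Qbar" "y \<in> Qbar" for x y
    using v(1) that by (auto simp: seminorms_def)
  have vinv: "v x * v (inverse x) = 1" if "x \<in> Qbar" "x \<noteq> 0" for x
  proof -
    have "inverse x \<in> Qbar" using that by (auto simp: Qbar_def)
    hence "v x * v (inverse x) = v (x * inverse x)" using vm that by metis
    thus ?thesis using that v1 by simp
  qed
  have vz: "v x = 0 \<longleftrightarrow> x = 0" if "x \<in> Qbar" for x
    using vinv[OF that] v0[of 0] N00 by fastforce
  have vA: "v x \<le> 1" if "x \<in> A" for x
    using N0le[OF A_Qbar[OF that] E_A[OF that]] v0(2)[of x] by simp
  have Qrat: "of_rat q \<in> Qbar" for q unfolding Qbar_def by (simp add: rat_imp_algebraic)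
  have Qint: "of_int k \<in> Qbar" for k using Qrat[of "of_int k"] by simp
  have vunit: "v (of_int m) = 1" if "\<not> int p dvd m" for m
  proof -
    have m0: "m \<noteq> 0" using that by auto
    have "inverse (of_int m) \<in> A" using that m0 by (intro AI[of m]) auto
    hence "v (inverse (of_int m)) \<le> 1" by (rule vA)
    moreover have "v (of_int m) \<le> 1" by (rule vA[OF A_int])
    moreover have "v (of_int m) * v (inverse (of_int m)) = 1" by (rule vinv[OF Qint]) (use m0 in simp)
    ultimately show ?thesis using v0(1)[of "of_int m"] v0(1)[of "inverse (of_int m)"]
      by (smt (verit) mult_left_le mult_less_cancel_left2)
  qed
  have vp: "v (of_nat p) = inverse (real p)"
  proof -
    have Qp: "of_nat p \<in> Qbar" using Qint[of "int p"] by simp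
    have "E (of_nat p) 1" unfolding E_def using A_int[of 1] by (intro bexI[of _ 1]) auto
    hence 1: "v (of_nat p) \<le> inverse (real p)" using N0le[OF Qp, of 1] v0(2)[of "of_nat p"] by (simp add: power_int_minus)
    have Qip: "inverse (of_nat p) \<in> Qbar" using Qp by (auto simp: Qbar_def)
    have "E (inverse (of_nat p)) (-1)" unfolding E_def using A_int[of 1] by (intro bexI[of _ 1]) (auto simp: power_int_minus)
    hence 2: "v (inverse (of_nat p)) \<le> real p" using N0le[OF Qip, of "-1"] v0(2)[of "inverse (of_nat p)"] by simp
    have 3: "v (of_nat p) * v (inverse (of_nat p)) = 1" by (rule vinv[OF Qp p0])
    have "1 \<le> v (of_nat p) * real p" using 2 3 v0(1)[of "of_nat p"] by (metis mult_left_mono)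
    hence "inverse (real p) \<le> v (of_nat p)" using rp by (simp add: field_simps)
    with 1 show ?thesis by simp
  qed
  have vpow: "v (x ^ n) = v x ^ n" if "x \<in> Qbar" for x n
  proof -
    have "x ^ n \<in> Qbar \<and> v (x ^ n) = v x ^ n"
      by (induction n) (use Q that vm v1 in auto)
    thus ?thesis by blast
  qed
  have vint: "v (of_int a) = inverse (real p) ^ multiplicity (int p) a" if "a \<noteq> 0" for a
  proof -
    have "\<not> is_unit (int p)" using p1 by simp
    from multiplicity_decompose'[OF that this]
    obtain m where m: "a = int p ^ multiplicity (int p) a * m" "\<not> int p dvd m" by blast
    have e: "of_int a = (of_nat p ^ multiplicity (int p) a * of_int m :: complex)"
      using arg_cong[OF m(1), of "of_int :: int \<Rightarrow> complex"] by simp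
    have Qp: "of_nat p \<in> Qbar" using Qint[of "int p"] by simp
    have Qpn: "of_nat p ^ n \<in> Qbar" for n by (induction n) (use Q Qp in auto)
    show ?thesis unfolding e using vm[OF Qpn Qint] vpow[OF Qp] vp vunit[OF m(2)] by simp
  qed
  have "v (of_rat q) = padic_abs p q" for q
  proof (cases "q = 0")
    case True thus ?thesis using vz[OF Q(2)] by (simp add: padic_abs_def)
  next
    case False
    obtain a b where ab: "quotient_of q = (a, b)" by force
    have b: "b > 0" using quotient_of_denom_pos[OF ab] .
    have q: "q = of_int a / of_int b" using quotient_of_div[OF ab] .
    hence a: "a \<noteq> 0" using False by auto
    have "of_rat q * of_int b = (of_int a :: complex)" unfolding q using b by (simp add: of_rat_divide)
    hence "v (of_rat q) * v (of_int b) = v (of_int a)" using vm[OF Qrat Qint] by metis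
    hence "v (of_rat q) = v (of_int a) / v (of_int b)" using vz[OF Qint, of b] b by (simp add: field_simps)
    also have "\<dots> = inverse (real p) ^ multiplicity (int p) a / inverse (real p) ^ multiplicity (int p) b"
      using vint[OF a] vint[of b] b by simp
    also have "\<dots> = real p powi (int (multiplicity (int p) b) - int (multiplicity (int p) a))"
      using rp by (simp add: power_int_diff power_inverse divide_simps)
    also have "\<dots> = padic_abs p q" unfolding q using padic_abs_fraction[OF p a, of b] b by simp
    finally show ?thesis .
  qed
  thus ?thesis using v0 vz vm vadd by (intro exI[of _ v]) auto
qed

section \<open>Absolute values on the algebraic numbers\<close>

text \<open>
  The places of the rationals: 0 stands for the archimedean one.
\<close>

definition PL :: "nat set" where "PL = insert 0 {p. prime p}"

definition rabs :: "nat \<Rightarrow> rat \<Rightarrow> real" where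
  "rabs q r = (if q = 0 then \<bar>of_rat r\<bar> else padic_abs q r)"

text \<open>
  One extension of each place of the rationals to the algebraic numbers, fixed once and for all; all places of a number field
  arise from these by embeddings.
\<close>

definition vabs :: "nat \<Rightarrow> complex \<Rightarrow> real" where
  "vabs q = (if q = 0 then cmod else (SOME v. (\<forall>x\<in>Qbar. 0 \<le> v x \<and> (v x = 0 \<longleftrightarrow> x = 0)) \<and>
    (\<forall>x\<in>Qbar. \<forall>y\<in>Qbar. v (x * y) = v x * v y \<and> v (x + y) \<le> max (v x) (v y)) \<and>
    (\<forall>r. v (of_rat r) = padic_abs q r)))"

lemma Qbar_closed [intro, simp]:
  "x \<in> Qbar \<Longrightarrow> y \<in> Qbar \<Longrightarrow> x + y \<in> Qbar" "x \<in> Qbar \<Longrightarrow> y \<in> Qbar \<Longrightarrow> x * y \<in> Qbar"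
  "x \<in> Qbar \<Longrightarrow> y \<in> Qbar \<Longrightarrow> x - y \<in> Qbar" "x \<in> Qbar \<Longrightarrow> - x \<in> Qbar" "x \<in> Qbar \<Longrightarrow> inverse x \<in> Qbar"
  "of_rat r \<in> Qbar" "0 \<in> Qbar" "1 \<in> Qbar" "x \<in> Qbar \<Longrightarrow> x ^ n \<in> Qbar"
proof -
  show A: "x + y \<in> Qbar" if "x \<in> Qbar" "y \<in> Qbar" for x y using that algebraic_add_mult by (auto simp: Qbar_def)
  show M: "x * y \<in> Qbar" if "x \<in> Qbar" "y \<in> Qbar" for x y using that algebraic_add_mult by (auto simp: Qbar_def)
  show m: "- x \<in> Qbar" if "x \<in> Qbar" for x using that by (auto simp: Qbar_def)
  show "x - y \<in> Qbar" if "x \<in> Qbar" "y \<in> Qbar" for x y using A[OF that(1) m[OF that(2)]] by simp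
  show "inverse x \<in> Qbar" if "x \<in> Qbar" for x using that by (auto simp: Qbar_def)
  show "of_rat r \<in> Qbar" for r by (simp add: Qbar_def rat_imp_algebraic)
  show "0 \<in> Qbar" "1 \<in> Qbar" by (simp_all add: Qbar_def)
  thus "x ^ n \<in> Qbar" if "x \<in> Qbar" for x n using that M by (induction n) auto
qed

lemma vabs_prime:
  assumes "prime q"
  shows "x \<in> Qbar \<Longrightarrow> 0 \<le> vabs q x" "x \<in> Qbar \<Longrightarrow> vabs q x = 0 \<longleftrightarrow> x = 0"
    "x \<in> Qbar \<Longrightarrow> y \<in> Qbar \<Longrightarrow> vabs q (x * y) = vabs q x * vabs q y"
    "x \<in> Qbar \<Longrightarrow> y \<in> Qbar \<Longrightarrow> vabs q (x + y) \<le> max (vabs q x) (vabs q y)"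
    "vabs q (of_rat r) = padic_abs q r"
proof -
  have "q \<noteq> 0" using assms by auto
  hence e: "vabs q = (SOME v. (\<forall>x\<in>Qbar. 0 \<le> v x \<and> (v x = 0 \<longleftrightarrow> x = 0)) \<and>
    (\<forall>x\<in>Qbar. \<forall>y\<in>Qbar. v (x * y) = v x * v y \<and> v (x + y) \<le> max (v x) (v y)) \<and>
    (\<forall>r. v (of_rat r) = padic_abs q r))" by (simp add: vabs_def)
  have "(\<forall>x\<in>Qbar. 0 \<le> vabs q x \<and> (vabs q x = 0 \<longleftrightarrow> x = 0)) \<and>
    (\<forall>x\<in>Qbar. \<forall>y\<in>Qbar. vabs q (x * y) = vabs q x * vabs q y \<and> vabs q (x + y) \<le> max (vabs q x) (vabs q y)) \<and>
    (\<forall>r. vabs q (of_rat r) = padic_abs q r)"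
    unfolding e by (rule someI_ex[OF exists_padic_extension[OF assms]])
  thus "x \<in> Qbar \<Longrightarrow> 0 \<le> vabs q x" "x \<in> Qbar \<Longrightarrow> vabs q x = 0 \<longleftrightarrow> x = 0"
    "x \<in> Qbar \<Longrightarrow> y \<in> Qbar \<Longrightarrow> vabs q (x * y) = vabs q x * vabs q y"
    "x \<in> Qbar \<Longrightarrow> y \<in> Qbar \<Longrightarrow> vabs q (x + y) \<le> max (vabs q x) (vabs q y)"
    "vabs q (of_rat r) = padic_abs q r" by blast+
qed

lemma vabs_0 [simp]: "vabs 0 = cmod" by (simp add: vabs_def)

lemma vabs_nonneg [simp]: "q \<in> PL \<Longrightarrow> x \<in> Qbar \<Longrightarrow> 0 \<le> vabs q x"
  by (auto simp: PL_def vabs_prime)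

lemma vabs_eq_0 [simp]: "q \<in> PL \<Longrightarrow> x \<in> Qbar \<Longrightarrow> vabs q x = 0 \<longleftrightarrow> x = 0"
  by (auto simp: PL_def vabs_prime)

lemma vabs_mult: "q \<in> PL \<Longrightarrow> x \<in> Qbar \<Longrightarrow> y \<in> Qbar \<Longrightarrow> vabs q (x * y) = vabs q x * vabs q y"
  by (auto simp: PL_def vabs_prime norm_mult)

lemma vabs_triangle:
  assumes "q \<in> PL" "x \<in> Qbar" "y \<in> Qbar" shows "vabs q (x + y) \<le> vabs q x + vabs q y"
proof (cases "q = 0")
  case False
  hence "vabs q (x + y) \<le> max (vabs q x) (vabs q y)" using assms vabs_prime(4) by (auto simp: PL_def)
  thus ?thesis using vabs_nonneg[OF assms(1,2)] vabs_nonneg[OF assms(1,3)] by linarith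
qed (simp add: norm_triangle_ineq)

lemma vabs_of_rat: "q \<in> PL \<Longrightarrow> vabs q (of_rat r) = rabs q r"
proof -
  have "cmod (of_rat r) = \<bar>of_rat r\<bar>" by (cases r) (simp add: of_rat_rat norm_divide)
  thus "q \<in> PL \<Longrightarrow> vabs q (of_rat r) = rabs q r" by (auto simp: PL_def vabs_prime rabs_def)
qed

section \<open>Completions and local degrees\<close>

locale valued_field =
  fixes K :: "complex set" and v :: "complex \<Rightarrow> real"
  assumes K_rat: "\<And>r. of_rat r \<in> K"
    and K_closed: "x \<in> K \<Longrightarrow> y \<in> K \<Longrightarrow> x + y \<in> K" "x \<in> K \<Longrightarrow> y \<in> K \<Longrightarrow> x * y \<in> K"
      "x \<in> K \<Longrightarrow> - x \<in> K" "x \<in> K \<Longrightarrow> inverse x \<in> K"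
    and av: "absolute_value_on K v"
begin

lemma K01 [simp]: "0 \<in> K" "1 \<in> K" using K_rat[of 0] K_rat[of 1] by auto
lemma K_diff: "x \<in> K \<Longrightarrow> y \<in> K \<Longrightarrow> x - y \<in> K" using K_closed(1)[of x "- y"] K_closed(3)[of y] by simp
lemma K_sum: "(\<And>i. i \<in> I \<Longrightarrow> f i \<in> K) \<Longrightarrow> sum f I \<in> K"
  by (induction I rule: infinite_finite_induct) (auto intro: K_closed)
lemma K_pow: "x \<in> K \<Longrightarrow> x ^ n \<in> K" by (induction n) (auto intro: K_closed)

lemma v_nn: "x \<in> K \<Longrightarrow> 0 \<le> v x" and v_0iff: "x \<in> K \<Longrightarrow> v x = 0 \<longleftrightarrow> x = 0"
  and v_mult: "x \<in> K \<Longrightarrow> y \<in> K \<Longrightarrow> v (x * y) = v x * v y"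
  and v_tri: "x \<in> K \<Longrightarrow> y \<in> K \<Longrightarrow> v (x + y) \<le> v x + v y"
  using av unfolding absolute_value_on_def by blast+

lemma v0 [simp]: "v 0 = 0" using v_0iff[of 0] by simp

lemma v1 [simp]: "v 1 = 1"
proof -
  have "v 1 = v 1 * v 1" using v_mult[of 1 1] by simp
  thus ?thesis using v_0iff[of 1] by simp
qed

lemma v_minus: "x \<in> K \<Longrightarrow> v (- x) = v x"
proof -
  assume x: "x \<in> K"
  have m: "-1 \<in> K" using K_closed(3)[of 1] by simp
  have "v (-1) * v (-1) = 1" using v_mult[OF m m] by simp
  hence "v (-1) = 1" using v_nn[OF m] by (smt (verit) mult_less_cancel_left2 mult_le_cancel_left2)
  thus ?thesis using v_mult[OF m x] by simp
qed

lemma v_tri_diff: "x \<in> K \<Longrightarrow> y \<in> K \<Longrightarrow> v (x - y) \<le> v x + v y"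
  using v_tri[of x "- y"] v_minus[of y] K_closed(3)[of y] by simp

lemma v_pow: "x \<in> K \<Longrightarrow> v (x ^ n) = v x ^ n"
  by (induction n) (auto simp: v_mult K_pow)

lemma v_inverse: "x \<in> K \<Longrightarrow> v (inverse x) = inverse (v x)"
proof (cases "x = 0")
  case False
  assume x: "x \<in> K"
  have "v x * v (inverse x) = 1" using v_mult[OF x K_closed(4)[OF x]] False by simp
  thus ?thesis by (metis inverse_unique)
qed simp

lemma v_sum: "(\<And>i. i \<in> I \<Longrightarrow> f i \<in> K) \<Longrightarrow> v (sum f I) \<le> (\<Sum>i\<in>I. v (f i))"
proof (induction I rule: infinite_finite_induct)
  case (insert i I)
  have "v (f i + sum f I) \<le> v (f i) + v (sum f I)" using insert by (intro v_tri K_sum) auto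
  thus ?case using insert by force
qed auto

lemma cauchy_K: "s \<in> cauchy_seqs K v \<Longrightarrow> s n \<in> K" unfolding cauchy_seqs_def by blast
lemma cauchyD: "s \<in> cauchy_seqs K v \<Longrightarrow> e > 0 \<Longrightarrow> \<exists>M. \<forall>m\<ge>M. \<forall>n\<ge>M. v (s m - s n) < e"
  unfolding cauchy_seqs_def by blast
lemma null_K: "s \<in> null_seqs K v \<Longrightarrow> s n \<in> K" unfolding null_seqs_def by blast
lemma nullD: "s \<in> null_seqs K v \<Longrightarrow> (\<lambda>n. v (s n)) \<longlonglongrightarrow> 0" unfolding null_seqs_def by blast
lemma nullI: "(\<And>n. s n \<in> K) \<Longrightarrow> (\<lambda>n. v (s n)) \<longlonglongrightarrow> 0 \<Longrightarrow> s \<in> null_seqs K v"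
  unfolding null_seqs_def by blast
lemma cauchyI: "(\<And>n. s n \<in> K) \<Longrightarrow> (\<And>e. e > 0 \<Longrightarrow> \<exists>M. \<forall>m\<ge>M. \<forall>n\<ge>M. v (s m - s n) < e) \<Longrightarrow> s \<in> cauchy_seqs K v"
  unfolding cauchy_seqs_def by blast

lemma cauchy_const: "x \<in> K \<Longrightarrow> (\<lambda>_. x) \<in> cauchy_seqs K v"
  by (rule cauchyI) auto

lemma cauchy_bounded:
  assumes "s \<in> cauchy_seqs K v" obtains B where "B > 0" "\<And>n. v (s n) \<le> B"
proof -
  obtain M where M: "\<forall>m\<ge>M. \<forall>n\<ge>M. v (s m - s n) < 1" using cauchyD[OF assms, of 1] by auto
  define B where "B = 1 + v (s M) + (\<Sum>n<M. v (s n))"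
  have nn: "0 \<le> v (s n)" for n using v_nn cauchy_K[OF assms] by blast
  have "v (s n) \<le> B" for n
  proof (cases "n < M")
    case True
    have "v (s n) \<le> (\<Sum>n<M. v (s n))" using True nn by (intro member_le_sum) auto
    thus ?thesis using nn[of M] by (simp add: B_def)
  next
    case False
    have "v (s n) = v ((s n - s M) + s M)" by simp
    also have "\<dots> \<le> v (s n - s M) + v (s M)" by (intro v_tri K_diff cauchy_K[OF assms])
    also have "v (s n - s M) < 1" using M False by auto
    finally show ?thesis using sum_nonneg[of "{..<M}" "\<lambda>n. v (s n)"] nn by (simp add: B_def)
  qed
  moreover have "B > 0" using nn sum_nonneg[of "{..<M}" "\<lambda>n. v (s n)"] by (simp add: B_def add_pos_nonneg)
  ultimately show ?thesis using that by blast
qed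

lemma cauchy_add:
  assumes s: "s \<in> cauchy_seqs K v" and t: "t \<in> cauchy_seqs K v"
  shows "(\<lambda>n. s n + t n) \<in> cauchy_seqs K v"
proof (rule cauchyI)
  show "s n + t n \<in> K" for n by (intro K_closed(1) cauchy_K[OF s] cauchy_K[OF t])
  fix e :: real assume "e > 0"
  then obtain M N where MN: "\<forall>m\<ge>M. \<forall>n\<ge>M. v (s m - s n) < e/2" "\<forall>m\<ge>N. \<forall>n\<ge>N. v (t m - t n) < e/2"
    using cauchyD[OF s, of "e/2"] cauchyD[OF t, of "e/2"] by auto
  have "v (s m + t m - (s n + t n)) < e" if "m \<ge> max M N" "n \<ge> max M N" for m n
  proof -
    have "s m + t m - (s n + t n) = (s m - s n) + (t m - t n)" by simp
    hence "v (s m + t m - (s n + t n)) \<le> v (s m - s n) + v (t m - t n)"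
      by (metis v_tri K_diff cauchy_K s t)
    moreover have "v (s m - s n) < e/2" "v (t m - t n) < e/2" using MN that by auto
    ultimately show ?thesis by simp
  qed
  thus "\<exists>M. \<forall>m\<ge>M. \<forall>n\<ge>M. v (s m + t m - (s n + t n)) < e" by blast
qed

lemma cauchy_mult:
  assumes s: "s \<in> cauchy_seqs K v" and t: "t \<in> cauchy_seqs K v"
  shows "(\<lambda>n. s n * t n) \<in> cauchy_seqs K v"
proof (rule cauchyI)
  show "s n * t n \<in> K" for n by (intro K_closed(2) cauchy_K[OF s] cauchy_K[OF t])
  fix e :: real assume e: "e > 0"
  obtain B C where B: "B > 0" "\<And>n. v (s n) \<le> B" and C: "C > 0" "\<And>n. v (t n) \<le> C"
    using cauchy_bounded[OF s] cauchy_bounded[OF t] by metis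
  have "e / (2 * C) > 0" "e / (2 * B) > 0" using e B C by auto
  then obtain M N where MN: "\<forall>m\<ge>M. \<forall>n\<ge>M. v (s m - s n) < e / (2 * C)" "\<forall>m\<ge>N. \<forall>n\<ge>N. v (t m - t n) < e / (2 * B)"
    using cauchyD[OF s] cauchyD[OF t] by meson
  have "v (s m * t m - s n * t n) < e" if "m \<ge> max M N" "n \<ge> max M N" for m n
  proof -
    note Ks = cauchy_K[OF s] and Kt = cauchy_K[OF t]
    have "s m * t m - s n * t n = s m * (t m - t n) + t n * (s m - s n)" by (simp add: algebra_simps)
    also have "v \<dots> \<le> v (s m) * v (t m - t n) + v (t n) * v (s m - s n)"
      using v_tri[of "s m * (t m - t n)" "t n * (s m - s n)"] Ks Kt K_closed K_diff by (simp add: v_mult)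
    also have "\<dots> \<le> B * v (t m - t n) + C * v (s m - s n)"
      using B C v_nn Ks Kt K_diff by (intro add_mono mult_right_mono) auto
    also have "\<dots> < B * (e / (2 * B)) + C * (e / (2 * C))"
      using MN that B C by (intro add_strict_mono mult_strict_left_mono) auto
    also have "\<dots> = e" using B C by simp
    finally show ?thesis .
  qed
  thus "\<exists>M. \<forall>m\<ge>M. \<forall>n\<ge>M. v (s m * t m - s n * t n) < e" by blast
qed

lemma cauchy_uminus: "s \<in> cauchy_seqs K v \<Longrightarrow> (\<lambda>n. - s n) \<in> cauchy_seqs K v"
  using cauchy_mult[OF cauchy_const, of "-1" s] K_closed(3)[of 1] by simp

lemma null_cauchy: "s \<in> null_seqs K v \<Longrightarrow> s \<in> cauchy_seqs K v"
proof (rule cauchyI)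
  assume s: "s \<in> null_seqs K v"
  show "s n \<in> K" for n using s null_K by blast
  fix e :: real assume "e > 0"
  hence "eventually (\<lambda>n. v (s n) < e/2) sequentially"
    using order_tendstoD(2)[OF nullD[OF s], of "e/2"] by simp
  then obtain M where M: "\<forall>n\<ge>M. v (s n) < e/2" by (auto simp: eventually_sequentially)
  have "v (s m - s n) < e" if "m \<ge> M" "n \<ge> M" for m n
    using v_tri_diff[of "s m" "s n"] null_K[OF s] M that by (smt (verit) field_sum_of_halves)
  thus "\<exists>M. \<forall>m\<ge>M. \<forall>n\<ge>M. v (s m - s n) < e" by blast
qed

lemma null_add: "s \<in> null_seqs K v \<Longrightarrow> t \<in> null_seqs K v \<Longrightarrow> (\<lambda>n. s n + t n) \<in> null_seqs K v"
proof (rule nullI)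
  assume s: "s \<in> null_seqs K v" and t: "t \<in> null_seqs K v"
  show "s n + t n \<in> K" for n by (intro K_closed(1) null_K[OF s] null_K[OF t])
  have "(\<lambda>n. v (s n) + v (t n)) \<longlonglongrightarrow> 0 + 0" by (intro tendsto_add nullD s t)
  thus "(\<lambda>n. v (s n + t n)) \<longlonglongrightarrow> 0"
    using v_tri v_nn null_K[OF s] null_K[OF t] K_closed(1)
    by (intro tendsto_sandwich[OF _ _ tendsto_const, of 0 "\<lambda>n. v (s n + t n)" _ "\<lambda>n. v (s n) + v (t n)"]) auto
qed

lemma null_mult: "s \<in> cauchy_seqs K v \<Longrightarrow> t \<in> null_seqs K v \<Longrightarrow> (\<lambda>n. s n * t n) \<in> null_seqs K v"
proof (rule nullI)
  assume s: "s \<in> cauchy_seqs K v" and t: "t \<in> null_seqs K v"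
  note Ks = cauchy_K[OF s] and Kt = null_K[OF t]
  show "s n * t n \<in> K" for n by (intro K_closed(2) Ks Kt)
  obtain B where B: "B > 0" "\<And>n. v (s n) \<le> B" using cauchy_bounded[OF s] by metis
  have "(\<lambda>n. B * v (t n)) \<longlonglongrightarrow> B * 0" by (intro tendsto_mult tendsto_const nullD t)
  moreover have "v (s n * t n) \<le> B * v (t n)" "0 \<le> v (s n * t n)" for n
    using B Ks Kt v_nn by (auto simp: v_mult intro: mult_right_mono)
  ultimately show "(\<lambda>n. v (s n * t n)) \<longlonglongrightarrow> 0"
    by (intro tendsto_sandwich[OF _ _ tendsto_const, of 0 "\<lambda>n. v (s n * t n)" _ "\<lambda>n. B * v (t n)"]) auto
qed

lemma null_uminus: "s \<in> null_seqs K v \<Longrightarrow> (\<lambda>n. - s n) \<in> null_seqs K v"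
  using null_mult[OF cauchy_const, of "-1" s] K_closed(3)[of 1] by simp

lemma cauchy_ring_simps [simp]:
  "carrier (cauchy_ring K v) = cauchy_seqs K v"
  "s \<otimes>\<^bsub>cauchy_ring K v\<^esub> t = (\<lambda>n. s n * t n)"
  "s \<oplus>\<^bsub>cauchy_ring K v\<^esub> t = (\<lambda>n. s n + t n)"
  "\<one>\<^bsub>cauchy_ring K v\<^esub> = (\<lambda>n. 1)" "\<zero>\<^bsub>cauchy_ring K v\<^esub> = (\<lambda>n. 0)"
  by (simp_all add: cauchy_ring_def)

lemma cauchy_cring: "cring (cauchy_ring K v)"
proof (rule cringI)
  show "abelian_group (cauchy_ring K v)"
  proof (rule abelian_groupI)
    fix x assume "x \<in> carrier (cauchy_ring K v)"
    thus "\<exists>y\<in>carrier (cauchy_ring K v). y \<oplus>\<^bsub>cauchy_ring K v\<^esub> x = \<zero>\<^bsub>cauchy_ring K v\<^esub>"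
      by (intro bexI[of _ "\<lambda>n. - x n"]) (auto intro: cauchy_uminus)
  qed (auto intro: cauchy_add cauchy_const simp: add_ac)
  show "Group.comm_monoid (cauchy_ring K v)"
    by (rule comm_monoidI) (auto intro: cauchy_mult cauchy_const simp: mult_ac)
qed (auto simp: algebra_simps)

lemma null_ideal: "ideal (null_seqs K v) (cauchy_ring K v)"
proof -
  interpret R: cring "cauchy_ring K v" by (rule cauchy_cring)
  show ?thesis
  proof (rule idealI)
    show "Ring.ring (cauchy_ring K v)" by (rule R.ring_axioms)
    show "subgroup (null_seqs K v) (add_monoid (cauchy_ring K v))"
    proof (rule R.add.subgroupI)
      show "null_seqs K v \<subseteq> carrier (cauchy_ring K v)" using null_cauchy by auto
      have "(\<lambda>n. 0) \<in> null_seqs K v" by (rule nullI) auto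
      thus "null_seqs K v \<noteq> {}" by blast
      fix a assume a: "a \<in> null_seqs K v"
      have "\<ominus>\<^bsub>cauchy_ring K v\<^esub> a = (\<lambda>n. - a n)"
        using a by (intro R.minus_equality) (auto intro: null_cauchy cauchy_uminus)
      thus "\<ominus>\<^bsub>cauchy_ring K v\<^esub> a \<in> null_seqs K v" using null_uminus[OF a] by simp
      fix b assume "b \<in> null_seqs K v"
      thus "a \<oplus>\<^bsub>cauchy_ring K v\<^esub> b \<in> null_seqs K v" using null_add[OF a] by simp
    qed
  next
    fix a x assume ax: "a \<in> null_seqs K v" "x \<in> carrier (cauchy_ring K v)"
    thus "x \<otimes>\<^bsub>cauchy_ring K v\<^esub> a \<in> null_seqs K v" using null_mult by simp
    thus "a \<otimes>\<^bsub>cauchy_ring K v\<^esub> x \<in> null_seqs K v" by (simp add: mult.commute)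
  qed
qed

definition cls :: "(nat \<Rightarrow> complex) \<Rightarrow> (nat \<Rightarrow> complex) set" where
  "cls s = null_seqs K v +>\<^bsub>cauchy_ring K v\<^esub> s"

lemma completion_ring: "Ring.ring (completion K v)" "Ring.cring (completion K v)"
proof -
  show *: "Ring.cring (completion K v)" unfolding completion_def
    by (rule ideal.quotient_is_cring[OF null_ideal cauchy_cring])
  thus "Ring.ring (completion K v)" by (rule cring.axioms(1))
qed

lemma cls_hom: "ring_hom_ring (cauchy_ring K v) (completion K v) cls"
proof (rule ring_hom_ringI2)
  show "Ring.ring (cauchy_ring K v)" using cauchy_cring by (rule cring.axioms(1))
  show "Ring.ring (completion K v)" by (rule completion_ring)
  show "cls \<in> Ring.ring_hom (cauchy_ring K v) (completion K v)"
    unfolding completion_def cls_def using ideal.rcos_ring_hom[OF null_ideal] by simp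
qed

lemma carrier_completion: "carrier (completion K v) = cls ` cauchy_seqs K v"
  unfolding completion_def cls_def FactRing_def A_RCOSETS_def' by auto

lemma cls_zero_iff: "s \<in> cauchy_seqs K v \<Longrightarrow> cls s = \<zero>\<^bsub>completion K v\<^esub> \<longleftrightarrow> s \<in> null_seqs K v"
proof -
  assume s: "s \<in> cauchy_seqs K v"
  interpret I: ideal "null_seqs K v" "cauchy_ring K v" by (rule null_ideal)
  have z: "\<zero>\<^bsub>completion K v\<^esub> = null_seqs K v" unfolding completion_def FactRing_def by simp
  show ?thesis unfolding z cls_def
    using I.a_rcos_const I.a_rcos_self[of s] s by auto
qed

definition ratc :: "(nat \<Rightarrow> complex) set set" where "ratc = rat_completion_in K v"

lemma rat_cauchy: "s \<in> cauchy_seqs \<rat> v \<Longrightarrow> s \<in> cauchy_seqs K v"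
  using K_rat unfolding cauchy_seqs_def Rats_def by (auto simp: image_iff) (metis)

lemma ratc_eq: "ratc = cls ` cauchy_seqs \<rat> v"
  unfolding ratc_def rat_completion_in_def cls_def ..

lemma rat_cauchyI: "s \<in> cauchy_seqs K v \<Longrightarrow> (\<And>n. s n \<in> \<rat>) \<Longrightarrow> s \<in> cauchy_seqs \<rat> v"
  unfolding cauchy_seqs_def by blast

lemma rat_cauchy_rat: "s \<in> cauchy_seqs \<rat> v \<Longrightarrow> s n \<in> \<rat>"
  unfolding cauchy_seqs_def by blast

lemma cauchy_not_null_bounded_below:
  assumes s: "s \<in> cauchy_seqs K v" and nn: "s \<notin> null_seqs K v"
  obtains c M where "c > 0" "\<And>n. n \<ge> M \<Longrightarrow> v (s n) \<ge> c"
proof -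
  have "\<not> (\<lambda>n. v (s n)) \<longlonglongrightarrow> 0" using nn cauchy_K[OF s] nullI by blast
  then obtain e where e: "e > 0" "\<And>M. \<exists>n\<ge>M. \<not> norm (v (s n) - 0) < e"
    unfolding LIMSEQ_iff by blast
  obtain M where M: "\<forall>m\<ge>M. \<forall>n\<ge>M. v (s m - s n) < e / 2" using cauchyD[OF s, of "e/2"] e by auto
  obtain m where m: "m \<ge> M" "\<not> norm (v (s m) - 0) < e" using e(2) by blast
  have vm: "v (s m) \<ge> e" using m(2) v_nn[OF cauchy_K[OF s]] by simp
  have "v (s n) \<ge> e / 2" if "n \<ge> M" for n
  proof -
    have "v (s m) = v ((s m - s n) + s n)" by simp
    also have "\<dots> \<le> v (s m - s n) + v (s n)" by (intro v_tri K_diff cauchy_K[OF s])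
    also have "v (s m - s n) < e / 2" using M m that by blast
    finally show ?thesis using vm by simp
  qed
  thus ?thesis using that[of "e/2" M] e by simp
qed

text \<open>
  A rational Cauchy sequence that is not null is bounded away from 0 from some index on, so the inverses form a
  Cauchy sequence there.
\<close>

lemma ratc_subfield: "subfield ratc (completion K v)"
proof -
  interpret C: Ring.cring "completion K v" by (rule completion_ring)
  interpret R: Ring.cring "cauchy_ring K v" by (rule cauchy_cring)
  interpret H: ring_hom_ring "cauchy_ring K v" "completion K v" cls by (rule cls_hom)
  have sub: "subring (cauchy_seqs \<rat> v) (cauchy_ring K v)"
  proof (rule R.subringI)
    show "cauchy_seqs \<rat> v \<subseteq> carrier (cauchy_ring K v)" using rat_cauchy by auto
    show "\<one>\<^bsub>cauchy_ring K v\<^esub> \<in> cauchy_seqs \<rat> v" using cauchy_const[of 1] by (auto intro!: rat_cauchyI)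
    fix h assume h: "h \<in> cauchy_seqs \<rat> v"
    have "\<ominus>\<^bsub>cauchy_ring K v\<^esub> h = (\<lambda>n. - h n)"
      using rat_cauchy[OF h] by (intro R.minus_equality) (auto intro: cauchy_uminus)
    thus "\<ominus>\<^bsub>cauchy_ring K v\<^esub> h \<in> cauchy_seqs \<rat> v"
      using cauchy_uminus[OF rat_cauchy[OF h]] rat_cauchy_rat[OF h] by (auto intro!: rat_cauchyI)
    fix g assume g: "g \<in> cauchy_seqs \<rat> v"
    show "h \<otimes>\<^bsub>cauchy_ring K v\<^esub> g \<in> cauchy_seqs \<rat> v"
      using cauchy_mult[OF rat_cauchy[OF h] rat_cauchy[OF g]] rat_cauchy_rat[OF h] rat_cauchy_rat[OF g]
      by (auto intro!: rat_cauchyI)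
    show "h \<oplus>\<^bsub>cauchy_ring K v\<^esub> g \<in> cauchy_seqs \<rat> v"
      using cauchy_add[OF rat_cauchy[OF h] rat_cauchy[OF g]] rat_cauchy_rat[OF h] rat_cauchy_rat[OF g]
      by (auto intro!: rat_cauchyI)
  qed
  have subr: "subring ratc (completion K v)" unfolding ratc_eq by (rule H.img_is_subring[OF sub])
  have one: "\<one>\<^bsub>completion K v\<^esub> = cls (\<lambda>_. 1)" using H.hom_one by simp
  have one_nz: "\<one>\<^bsub>completion K v\<^esub> \<noteq> \<zero>\<^bsub>completion K v\<^esub>"
  proof
    assume "\<one>\<^bsub>completion K v\<^esub> = \<zero>\<^bsub>completion K v\<^esub>"
    hence "(\<lambda>_. 1) \<in> null_seqs K v" using cls_zero_iff[OF cauchy_const[of 1]] one by simp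
    hence "(\<lambda>_::nat. v 1) \<longlonglongrightarrow> 0" by (rule nullD)
    thus False by (simp add: LIMSEQ_const_iff)
  qed
  show ?thesis
  proof (rule C.subfieldI)
    show "subcring ratc (completion K v)" by (rule C.subcringI'[OF subr])
    show "Units (completion K v\<lparr>carrier := ratc\<rparr>) = ratc - {\<zero>\<^bsub>completion K v\<^esub>}"
    proof (intro equalityI subsetI)
      fix x assume "x \<in> Units (completion K v\<lparr>carrier := ratc\<rparr>)"
      then obtain y where x: "x \<in> ratc" "y \<in> ratc" "y \<otimes>\<^bsub>completion K v\<^esub> x = \<one>\<^bsub>completion K v\<^esub>"
        by (auto simp: Units_def)
      have "y \<in> carrier (completion K v)" using x(2) subringE(1)[OF subr] by blast
      hence "y \<otimes>\<^bsub>completion K v\<^esub> \<zero>\<^bsub>completion K v\<^esub> = \<zero>\<^bsub>completion K v\<^esub>" by (rule C.r_null)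
      hence "x \<noteq> \<zero>\<^bsub>completion K v\<^esub>" using x(3) one_nz by metis
      thus "x \<in> ratc - {\<zero>\<^bsub>completion K v\<^esub>}" using x by simp
    next
      fix x assume x: "x \<in> ratc - {\<zero>\<^bsub>completion K v\<^esub>}"
      then obtain s where s: "s \<in> cauchy_seqs \<rat> v" "x = cls s" unfolding ratc_eq by blast
      note sK = rat_cauchy[OF s(1)]
      have nn: "s \<notin> null_seqs K v" using x s cls_zero_iff[OF sK] by auto
      obtain c M where c: "c > 0" "\<And>n. n \<ge> M \<Longrightarrow> v (s n) \<ge> c" using cauchy_not_null_bounded_below[OF sK nn] by metis
      have snz: "s n \<noteq> 0" if "n \<ge> M" for n using c(2)[OF that] c(1) by auto
      define t where "t = (\<lambda>n. inverse (s n))"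
      have tK: "t n \<in> K" for n unfolding t_def by (intro K_closed(4) cauchy_K[OF sK])
      have tc: "t \<in> cauchy_seqs K v"
      proof (rule cauchyI[OF tK])
        fix e :: real assume e: "e > 0"
        hence "e * c * c > 0" using c by simp
        then obtain N where N: "\<forall>m\<ge>N. \<forall>n\<ge>N. v (s m - s n) < e * c * c" using cauchyD[OF sK] by blast
        have "v (t m - t n) < e" if mn: "m \<ge> max M N" "n \<ge> max M N" for m n
        proof -
          have nz: "s m \<noteq> 0" "s n \<noteq> 0" using snz mn by auto
          have "t m - t n = (s n - s m) * (t m * t n)" unfolding t_def using nz by (simp add: field_simps)
          hence "v (t m - t n) = v (s n - s m) * (v (t m) * v (t n))"
            using cauchy_K[OF sK] tK by (simp add: v_mult K_closed K_diff)
          also have "\<dots> = v (s n - s m) / (v (s m) * v (s n))"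
            unfolding t_def using v_inverse[OF cauchy_K[OF sK]] by (simp add: field_simps)
          also have "\<dots> \<le> v (s n - s m) / (c * c)"
            using c(1) c(2)[of m] c(2)[of n] mn v_nn[OF K_diff[OF cauchy_K[OF sK] cauchy_K[OF sK]]]
            by (intro divide_left_mono mult_mono mult_pos_pos) (auto intro: order.strict_trans2)
          also have "\<dots> < (e * c * c) / (c * c)" using N mn c(1) by (intro divide_strict_right_mono) auto
          finally show ?thesis using c(1) by simp
        qed
        thus "\<exists>M. \<forall>m\<ge>M. \<forall>n\<ge>M. v (t m - t n) < e" by blast
      qed
      have tr: "t \<in> cauchy_seqs \<rat> v"
        by (rule rat_cauchyI[OF tc]) (simp add: t_def rat_cauchy_rat[OF s(1)])
      define r where "r = (\<lambda>n. s n * t n - 1)"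
      have rn: "r \<in> null_seqs K v"
      proof (rule nullI)
        show "r n \<in> K" for n unfolding r_def by (intro K_diff K_closed(2) cauchy_K[OF sK] tK) simp
        have "eventually (\<lambda>n. v (r n) = 0) sequentially"
          unfolding eventually_sequentially r_def t_def using snz by (intro exI[of _ M]) auto
        thus "(\<lambda>n. v (r n)) \<longlonglongrightarrow> 0" by (rule tendsto_eventually)
      qed
      have st: "(\<lambda>n. s n * t n) = (\<lambda>n. 1) \<oplus>\<^bsub>cauchy_ring K v\<^esub> r" by (auto simp: r_def)
      have "cls s \<otimes>\<^bsub>completion K v\<^esub> cls t = cls (\<lambda>n. s n * t n)"
        using H.hom_mult[of s t] sK tc by simp
      also have "\<dots> = cls (\<lambda>n. 1) \<oplus>\<^bsub>completion K v\<^esub> cls r"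
        unfolding st using null_cauchy[OF rn] cauchy_const[of 1] by (intro H.hom_add) auto
      also have "cls r = \<zero>\<^bsub>completion K v\<^esub>" using cls_zero_iff[OF null_cauchy[OF rn]] rn by simp
      also have "cls (\<lambda>n. 1) \<oplus>\<^bsub>completion K v\<^esub> \<zero>\<^bsub>completion K v\<^esub> = \<one>\<^bsub>completion K v\<^esub>"
        unfolding one[symmetric] by simp
      finally have st1: "cls s \<otimes>\<^bsub>completion K v\<^esub> cls t = \<one>\<^bsub>completion K v\<^esub>" .
      have in_c: "cls s \<in> carrier (completion K v)" "cls t \<in> carrier (completion K v)"
        using sK tc by (auto simp: carrier_completion)
      have "cls t \<in> ratc" unfolding ratc_eq using tr by blast
      thus "x \<in> Units (completion K v\<lparr>carrier := ratc\<rparr>)"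
        unfolding Units_def using x s st1 C.m_comm[OF in_c] by auto
    qed
  qed
qed

text \<open>
  Linear independence over the completion of the rationals, read off representing sequences: this keeps
  the quotient ring out of the approximation arguments.
\<close>

definition indep :: "(nat \<Rightarrow> complex) list \<Rightarrow> bool" where
  "indep us \<longleftrightarrow> set us \<subseteq> cauchy_seqs K v \<and>
    (\<forall>cs. length cs = length us \<and> set cs \<subseteq> cauchy_seqs \<rat> v \<and>
      (\<lambda>n. v (\<Sum>i<length us. (cs ! i) n * (us ! i) n)) \<longlonglongrightarrow> 0 \<longrightarrow>
      (\<forall>i<length us. (\<lambda>n. v ((cs ! i) n)) \<longlonglongrightarrow> 0))"

lemma combine_cauchy:
  assumes "length cs = length us"
  shows "ring.combine (cauchy_ring K v) cs us = (\<lambda>n. \<Sum>i<length us. (cs ! i) n * (us ! i) n)"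
proof -
  interpret R: Ring.cring "cauchy_ring K v" by (rule cauchy_cring)
  show ?thesis using assms
  proof (induction cs us rule: list_induct2)
    case (Cons c cs u us)
    show ?case unfolding R.combine.simps Cons.IH length_Cons sum.lessThan_Suc_shift by simp
  qed simp
qed

lemma indep_iff:
  assumes us: "set us \<subseteq> cauchy_seqs K v"
  shows "ring.independent (completion K v) ratc (map cls us) \<longleftrightarrow> indep us"
proof -
  interpret C: Ring.cring "completion K v" by (rule completion_ring)
  interpret H: ring_hom_ring "cauchy_ring K v" "completion K v" cls by (rule cls_hom)
  note sf = ratc_subfield
  have comb: "ring.combine (completion K v) (map cls cs) (map cls us) = \<zero>\<^bsub>completion K v\<^esub> \<longleftrightarrow>
     (\<lambda>n. v (\<Sum>i<length us. (cs ! i) n * (us ! i) n)) \<longlonglongrightarrow> 0"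
    if cs: "length cs = length us" "set cs \<subseteq> cauchy_seqs \<rat> v" for cs
  proof -
    have csK: "set cs \<subseteq> cauchy_seqs K v" using cs rat_cauchy by blast
    have "ring.combine (completion K v) (map cls cs) (map cls us) = cls (ring.combine (cauchy_ring K v) cs us)"
      by (rule H.combine_hom) (use csK us in auto)
    also have "\<dots> = cls (\<lambda>n. \<Sum>i<length us. (cs ! i) n * (us ! i) n)" unfolding combine_cauchy[OF cs(1)] ..
    finally have e: "ring.combine (completion K v) (map cls cs) (map cls us) = \<dots>" .
    have c: "(\<lambda>n. \<Sum>i<length us. (cs ! i) n * (us ! i) n) \<in> cauchy_seqs K v"
      using H.R.combine_in_carrier[of cs us] csK us unfolding combine_cauchy[OF cs(1)] by simp
    show ?thesis unfolding e cls_zero_iff[OF c] using cauchy_K[OF c] by (simp add: null_seqs_def)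
  qed
  have z: "cls s = \<zero>\<^bsub>completion K v\<^esub> \<longleftrightarrow> (\<lambda>n. v (s n)) \<longlonglongrightarrow> 0" if s: "s \<in> cauchy_seqs \<rat> v" for s
    unfolding cls_zero_iff[OF rat_cauchy[OF s]] using cauchy_K[OF rat_cauchy[OF s]] by (simp add: null_seqs_def)
  have carr: "set (map cls us) \<subseteq> carrier (completion K v)" using us by (auto simp: carrier_completion)
  show ?thesis
  proof
    assume ind: "ring.independent (completion K v) ratc (map cls us)"
    show "indep us" unfolding indep_def
    proof (intro conjI allI impI us)
      fix cs i assume cs: "length cs = length us \<and> set cs \<subseteq> cauchy_seqs \<rat> v \<and>
        (\<lambda>n. v (\<Sum>i<length us. (cs ! i) n * (us ! i) n)) \<longlonglongrightarrow> 0" and i: "i < length us"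
      have "ring.combine (completion K v) (map cls cs) (map cls us) = \<zero>\<^bsub>completion K v\<^esub>" using comb cs by blast
      moreover have "set (map cls cs) \<subseteq> ratc" using cs ratc_eq by auto
      ultimately have "set (take (length (map cls us)) (map cls cs)) \<subseteq> {\<zero>\<^bsub>completion K v\<^esub>}"
        using C.independent_imp_trivial_combine[OF sf ind] by blast
      moreover have "cls (cs ! i) \<in> set (take (length (map cls us)) (map cls cs))" using cs i by simp
      ultimately have "cls (cs ! i) = \<zero>\<^bsub>completion K v\<^esub>" by blast
      moreover have "cs ! i \<in> cauchy_seqs \<rat> v" using cs i by auto
      ultimately show "(\<lambda>n. v ((cs ! i) n)) \<longlonglongrightarrow> 0" using z by blast
    qed
  next
    assume ind: "indep us"
    show "ring.independent (completion K v) ratc (map cls us)"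
    proof (rule ccontr)
      assume "\<not> ring.independent (completion K v) ratc (map cls us)"
      from C.dependent_imp_non_trivial_combine[OF sf carr this]
      obtain Ks where Ks: "length Ks = length (map cls us)"
        "ring.combine (completion K v) Ks (map cls us) = \<zero>\<^bsub>completion K v\<^esub>" "set Ks \<subseteq> ratc"
        "set Ks \<noteq> {\<zero>\<^bsub>completion K v\<^esub>}" by blast
      have "Ks \<in> lists (cls ` cauchy_seqs \<rat> v)" using Ks(3) unfolding ratc_eq by auto
      hence "Ks \<in> map cls ` lists (cauchy_seqs \<rat> v)" by (simp only: lists_image)
      then obtain cs where cs: "Ks = map cls cs" "set cs \<subseteq> cauchy_seqs \<rat> v" by auto
      have len: "length cs = length us" using Ks(1) cs by simp
      have "(\<lambda>n. v (\<Sum>i<length us. (cs ! i) n * (us ! i) n)) \<longlonglongrightarrow> 0"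
        using comb[OF len cs(2)] Ks(2) cs(1) by blast
      hence 0: "\<forall>i<length us. (\<lambda>n. v ((cs ! i) n)) \<longlonglongrightarrow> 0"
        using ind len cs(2) unfolding indep_def by blast
      have "set Ks \<subseteq> {\<zero>\<^bsub>completion K v\<^esub>}"
      proof
        fix x assume "x \<in> set Ks"
        then obtain i where i: "i < length us" "x = cls (cs ! i)" using cs len by (auto simp: in_set_conv_nth)
        have "cs ! i \<in> cauchy_seqs \<rat> v" using cs(2) i len by (metis nth_mem subsetD)
        hence "cls (cs ! i) = \<zero>\<^bsub>completion K v\<^esub>" using z 0 i(1) by blast
        thus "x \<in> {\<zero>\<^bsub>completion K v\<^esub>}" unfolding i(2) by blast
      qed
      hence "set Ks = {}" using Ks(4) by (metis subset_singletonD)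
      hence us0: "map cls us = []" using Ks(1) by (metis length_0_conv set_empty)
      have "ring.independent (completion K v) ratc (map cls us)" unfolding us0 by (rule C.li_Nil)
      with \<open>\<not> ring.independent (completion K v) ratc (map cls us)\<close> show False by (rule notE)
    qed
  qed
qed

text \<open>
  The dimension in the definition of the local degree is meaningful only when a finite basis exists. A bound on the
  length of independent lists gives one of maximal length, and this one spans.
\<close>

lemma local_degree_bounded:
  assumes bd: "\<And>us. indep us \<Longrightarrow> length us \<le> d"
  shows "\<exists>us. indep us \<and> length us = local_degree K v"
    and "\<And>us. indep us \<Longrightarrow> length us \<le> local_degree K v"
proof -
  interpret C: Ring.cring "completion K v" by (rule completion_ring)
  note sf = ratc_subfield
  define L where "L = Max {length us | us. indep us}"
  have fin: "finite {length us | us. indep us}" by (rule finite_subset[of _ "{..d}"]) (use bd in blast, simp)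
  have "indep []" unfolding indep_def by simp
  hence ne: "{length us | us. indep us} \<noteq> {}" by blast
  have "L \<in> {length us | us. indep us}" unfolding L_def by (rule Max_in[OF fin ne])
  then obtain us where us: "indep us" "length us = L" by blast
  have mx: "length ws \<le> L" if "indep ws" for ws unfolding L_def by (rule Max_ge[OF fin]) (use that in blast)
  have usc: "set us \<subseteq> cauchy_seqs K v" using us unfolding indep_def by blast
  have ind: "ring.independent (completion K v) ratc (map cls us)" using indep_iff[OF usc] us by blast
  have "ring.Span (completion K v) ratc (map cls us) = carrier (completion K v)"
  proof
    show "ring.Span (completion K v) ratc (map cls us) \<subseteq> carrier (completion K v)"
      using C.Span_subgroup_props(1)[OF sf] C.independent_in_carrier[OF ind] by blast
    show "carrier (completion K v) \<subseteq> ring.Span (completion K v) ratc (map cls us)"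
    proof
      fix x assume x: "x \<in> carrier (completion K v)"
      then obtain s where s: "s \<in> cauchy_seqs K v" "x = cls s" by (auto simp: carrier_completion)
      show "x \<in> ring.Span (completion K v) ratc (map cls us)"
      proof (rule ccontr)
        assume "x \<notin> ring.Span (completion K v) ratc (map cls us)"
        hence "ring.independent (completion K v) ratc (map cls (s # us))"
          unfolding list.map using C.li_Cons[OF _ _ ind] x s(2) by blast
        moreover have "set (s # us) \<subseteq> cauchy_seqs K v" using s usc by simp
        ultimately have "indep (s # us)" using indep_iff by blast
        thus False using mx[of "s # us"] us(2) by simp
      qed
    qed
  qed
  from C.dimensionI[OF sf ind this]
  have "ring.dimension (completion K v) L ratc (carrier (completion K v))" using us(2) by (simp only: length_map)
  from C.dimI[OF sf this] have ld: "local_degree K v = L"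
    unfolding local_degree_def ratc_def[symmetric] over_def .
  show "\<exists>us. indep us \<and> length us = local_degree K v" unfolding ld using us by blast
  show "\<And>us. indep us \<Longrightarrow> length us \<le> local_degree K v" unfolding ld by (rule mx)
qed


text \<open>
  The source of all approximation: \<open>x ^ n / (1 + x ^ n)\<close> tends to 0 where \<open>x\<close> is small and to 1 where \<open>x\<close> is large.
\<close>

lemma approx_tendsto:
  assumes x: "x \<in> K"
  shows "v x < 1 \<Longrightarrow> (\<lambda>n. v (x ^ n / (1 + x ^ n))) \<longlonglongrightarrow> 0"
    and "v x > 1 \<Longrightarrow> (\<lambda>n. v (x ^ n / (1 + x ^ n) - 1)) \<longlonglongrightarrow> 0"
proof -
  have xn: "x ^ n \<in> K" and x1: "1 + x ^ n \<in> K" for n using K_pow[OF x] K_closed(1) K01 by auto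
  have vd: "v (y / z) = v y / v z" if "y \<in> K" "z \<in> K" for y z
    using that by (simp add: divide_inverse v_mult K_closed v_inverse)
  have lo1: "v (1 + x ^ n) \<ge> 1 - v x ^ n" for n
  proof -
    have "v 1 = v ((1 + x ^ n) - x ^ n)" by simp
    also have "\<dots> \<le> v (1 + x ^ n) + v (x ^ n)" by (intro v_tri_diff x1 xn)
    finally show ?thesis using v_pow[OF x] by simp
  qed
  have lo2: "v (1 + x ^ n) \<ge> v x ^ n - 1" for n
  proof -
    have "v (x ^ n) = v ((1 + x ^ n) - 1)" by simp
    also have "\<dots> \<le> v (1 + x ^ n) + v 1" by (intro v_tri_diff x1 K01)
    finally show ?thesis using v_pow[OF x] by simp
  qed
  have vx0: "0 \<le> v x" by (rule v_nn[OF x])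
  show "(\<lambda>n. v (x ^ n / (1 + x ^ n))) \<longlonglongrightarrow> 0" if lt: "v x < 1"
  proof (rule tendsto_sandwich[of "\<lambda>_. 0" _ _ "\<lambda>n. v x ^ n / (1 - v x ^ n)"])
    show "\<forall>\<^sub>F n in sequentially. 0 \<le> v (x ^ n / (1 + x ^ n))"
      using vd[OF xn x1] v_nn[OF xn] v_nn[OF x1] by simp
    have "v (x ^ n / (1 + x ^ n)) \<le> v x ^ n / (1 - v x ^ n)" if "n > 0" for n
    proof -
      have p: "1 - v x ^ n > 0" using lt vx0 that by (simp add: power_less_one_iff)
      show ?thesis unfolding vd[OF xn x1] v_pow[OF x] using lo1[of n] p vx0
        by (intro divide_left_mono mult_pos_pos) auto
    qed
    thus "\<forall>\<^sub>F n in sequentially. v (x ^ n / (1 + x ^ n)) \<le> v x ^ n / (1 - v x ^ n)"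
      by (intro eventually_sequentiallyI[of 1]) auto
    have "(\<lambda>n. v x ^ n / (1 - v x ^ n)) \<longlonglongrightarrow> 0 / (1 - 0)"
      by (intro tendsto_intros LIMSEQ_realpow_zero vx0 lt) simp
    thus "(\<lambda>n. v x ^ n / (1 - v x ^ n)) \<longlonglongrightarrow> 0" by simp
  qed simp
  show "(\<lambda>n. v (x ^ n / (1 + x ^ n) - 1)) \<longlonglongrightarrow> 0" if gt: "v x > 1"
  proof (rule tendsto_sandwich[of "\<lambda>_. 0" _ _ "\<lambda>n. inverse (v x ^ n - 1)"])
    have dK: "x ^ n / (1 + x ^ n) - 1 \<in> K" for n
      unfolding divide_inverse by (intro K_diff K_closed(2) xn K_closed(4) x1 K01)
    show "\<forall>\<^sub>F n in sequentially. 0 \<le> v (x ^ n / (1 + x ^ n) - 1)" using v_nn[OF dK] by simp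
    have "v (x ^ n / (1 + x ^ n) - 1) \<le> inverse (v x ^ n - 1)" if "n > 0" for n
    proof -
      have p: "v x ^ n - 1 > 0" using gt that by (simp add: one_less_power)
      hence p': "v (1 + x ^ n) > 0" using lo2[of n] by simp
      hence "1 + x ^ n \<noteq> 0" using v_0iff[OF x1] by fastforce
      hence "x ^ n / (1 + x ^ n) - 1 = - inverse (1 + x ^ n)" by (simp add: field_simps)
      hence "v (x ^ n / (1 + x ^ n) - 1) = inverse (v (1 + x ^ n))"
        using v_minus[OF K_closed(4)[OF x1]] v_inverse[OF x1] by simp
      also have "\<dots> \<le> inverse (v x ^ n - 1)" using p lo2[of n] by (intro le_imp_inverse_le) auto
      finally show ?thesis .
    qed
    thus "\<forall>\<^sub>F n in sequentially. v (x ^ n / (1 + x ^ n) - 1) \<le> inverse (v x ^ n - 1)"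
      by (intro eventually_sequentiallyI[of 1]) auto
    have "filterlim (\<lambda>n. v x ^ n) at_top sequentially" using gt
      by (intro filterlim_at_infinity_imp_filterlim_at_top filterlim_realpow_sequentially_gt1) auto
    hence "filterlim (\<lambda>n. - 1 + v x ^ n) at_top sequentially" by (rule filterlim_tendsto_add_at_top[OF tendsto_const])
    hence "filterlim (\<lambda>n. v x ^ n - 1) at_top sequentially" by simp
    thus "(\<lambda>n. inverse (v x ^ n - 1)) \<longlonglongrightarrow> 0" by (rule tendsto_inverse_0_at_top)
  qed simp
qed

lemma v_powi: "x \<in> K \<Longrightarrow> x \<noteq> 0 \<Longrightarrow> v (x powi k) = v x powi k"
  by (auto simp: power_int_def v_pow v_inverse K_closed K_pow power_inverse)

lemma K_powi: "x \<in> K \<Longrightarrow> x powi k \<in> K"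
  by (auto simp: power_int_def K_pow K_closed)

end

lemma padic_abs_self: "prime p \<Longrightarrow> padic_abs p (of_nat p) = 1 / real p"
  using padic_abs_fraction[of p "int p" 1] by (simp add: power_int_minus field_simps prime_gt_0_nat)

section \<open>Weak approximation\<close>

definition over_place :: "complex set \<Rightarrow> nat \<Rightarrow> (complex \<Rightarrow> real) \<Rightarrow> bool" where
  "over_place K q v \<longleftrightarrow> valued_field K v \<and> (\<forall>r. v (of_rat r) = rabs q r)"

lemma rat_small: assumes "q \<in> PL" obtains t where "0 < rabs q t" "rabs q t < 1"
proof (cases "q = 0")
  case True
  have "0 < rabs q (1/2)" "rabs q (1/2) < 1" unfolding True rabs_def by (simp_all add: of_rat_divide)
  thus ?thesis using that by blast
next
  case False
  hence p: "prime q" using assms by (auto simp: PL_def)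
  have "0 < rabs q (of_nat q)" "rabs q (of_nat q) < 1" unfolding rabs_def
    using False padic_abs_self[OF p] prime_gt_1_nat[OF p] by simp_all
  thus ?thesis using that by blast
qed

text \<open>
  A high power of \<open>x\<close> makes the quotient of the two values as small as desired; a power of a rational, on which both agree, then moves 1
  between them.
\<close>

lemma separate_two_places:
  assumes q: "q \<in> PL" and v1: "over_place K q v1" and v2: "over_place K q v2"
    and ne: "x \<in> K" "v1 x < v2 x"
  shows "\<exists>y\<in>K. v1 y < 1 \<and> v2 y > 1"
proof -
  interpret V1: valued_field K v1 using v1 unfolding over_place_def by (rule conjunct1)
  interpret V2: valued_field K v2 using v2 unfolding over_place_def by (rule conjunct1)
  obtain t where t: "0 < rabs q t" "rabs q t < 1" using rat_small[OF q] .
  define c where "c = rabs q t"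
  have vt: "v1 (of_rat t) = c" "v2 (of_rat t) = c" using v1 v2 unfolding over_place_def c_def by auto
  have t0: "of_rat t \<noteq> (0::complex)" using vt t c_def by auto
  show ?thesis
  proof (cases "x = 0")
    case True thus ?thesis using ne by simp
  next
    case False
    have p1: "v1 x > 0" using V1.v_nn[OF ne(1)] V1.v_0iff[OF ne(1)] False by simp
    define r where "r = v1 x / v2 x"
    have r: "0 < r" "r < 1" unfolding r_def using p1 ne(2) by auto
    have "(\<lambda>n. r ^ n) \<longlonglongrightarrow> 0" using r by (intro LIMSEQ_realpow_zero) auto
    hence "\<forall>\<^sub>F n in sequentially. r ^ n < c" using t unfolding c_def by (intro order_tendstoD(2)) auto
    then obtain n where n: "r ^ n < c" by (auto simp: eventually_sequentially)
    define A where "A = v1 x ^ n"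
    have A: "A > 0" unfolding A_def using p1 by simp
    have AB: "A / c < v2 x ^ n" using n t p1 ne(2) unfolding A_def r_def c_def
      by (simp add: power_divide field_simps)
    define k where "k = \<lceil>log c A\<rceil> - 1"
    have c: "0 < c" "c < 1" using t c_def by auto
    have "real_of_int k < log c A" "log c A \<le> real_of_int k + 1" unfolding k_def by linarith+
    hence "c powr (log c A) < c powr real_of_int k" "c powr (real_of_int k + 1) \<le> c powr (log c A)"
      using c by (auto intro: powr_less_mono' powr_mono')
    hence k: "A < c powi k" "c powi k * c \<le> A"
      using c A by (simp_all add: powr_add powr_real_of_int' )
    define y where "y = x ^ n * inverse (of_rat t powi k)"
    have K1: "of_rat t \<in> K" by (rule V1.K_rat)
    have yK: "y \<in> K" unfolding y_def by (intro V1.K_closed V1.K_pow V1.K_powi ne K1)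
    have "v1 y = A / c powi k" unfolding y_def A_def
      using V1.v_mult[OF V1.K_pow[OF ne(1)] V1.K_closed(4)[OF V1.K_powi[OF K1]]] V1.v_inverse[OF V1.K_powi[OF K1]]
        V1.v_powi[OF K1 t0] vt V1.v_pow[OF ne(1)] by (simp add: field_simps)
    moreover have "v2 y = v2 x ^ n / c powi k" unfolding y_def A_def
      using V2.v_mult[OF V1.K_pow[OF ne(1)] V1.K_closed(4)[OF V1.K_powi[OF K1]]] V2.v_inverse[OF V1.K_powi[OF K1]]
        V2.v_powi[OF K1 t0] vt V2.v_pow[OF ne(1)] by (simp add: field_simps)
    moreover have "c powi k > 0" using c by simp
    moreover have "c powi k \<le> A / c" using k(2) c by (simp add: field_simps)
    ultimately have "v1 y < 1" "v2 y > 1" using k(1) AB by (simp_all add: field_simps)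
    thus ?thesis using yK by blast
  qed
qed

lemma separate_two_places':
  assumes q: "q \<in> PL" and v1: "over_place K q v1" and v2: "over_place K q v2"
    and ne: "x \<in> K" "v1 x \<noteq> v2 x"
  shows "\<exists>y\<in>K. v1 y > 1 \<and> v2 y < 1"
proof -
  interpret V1: valued_field K v1 using v1 unfolding over_place_def by (rule conjunct1)
  interpret V2: valued_field K v2 using v2 unfolding over_place_def by (rule conjunct1)
  show ?thesis
  proof (cases "v2 x < v1 x")
    case True
    thus ?thesis using separate_two_places[OF q v2 v1 ne(1)] by blast
  next
    case False
    then obtain y where y: "y \<in> K" "v1 y < 1" "v2 y > 1" using separate_two_places[OF q v1 v2 ne(1)] ne(2) by auto
    have "y \<noteq> 0" using y by auto
    hence "v1 y > 0" using V1.v_nn[OF y(1)] V1.v_0iff[OF y(1)] by simp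
    hence "v1 (inverse y) > 1" unfolding V1.v_inverse[OF y(1)] using y(2) by (rule one_less_inverse)
    moreover have "v2 (inverse y) < 1" unfolding V2.v_inverse[OF y(1)] using y(3) by (simp add: inverse_less_1_iff)
    ultimately have "v1 (inverse y) > 1" "v2 (inverse y) < 1" .
    thus ?thesis using V1.K_closed(4)[OF y(1)] by blast
  qed
qed

lemma less_1_mult': "1 < a \<Longrightarrow> 1 \<le> b \<Longrightarrow> 1 < a * (b::real)"
  using mult_left_mono[of 1 b a] by linarith

text \<open>
  Induction on \<open>S\<close>: if \<open>x\<close> separates \<open>v1\<close> from \<open>S\<close> and \<open>y\<close> separates it from \<open>v\<close>, then \<open>x ^ n * y\<close> serves if \<open>v x \<le> 1\<close>, and
  \<open>x ^ n / (1 + x ^ n) * y\<close> serves otherwise, for large \<open>n\<close>.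
\<close>

lemma separate_places:
  assumes q: "q \<in> PL" and v1: "over_place K q v1" and S: "finite S"
    and "\<And>v. v \<in> S \<Longrightarrow> over_place K q v \<and> (\<exists>x\<in>K. v1 x \<noteq> v x)"
  shows "\<exists>x\<in>K. v1 x > 1 \<and> (\<forall>v\<in>S. v x < 1)"
  using S assms(4)
proof (induction S rule: finite_induct)
  case empty
  interpret V1: valued_field K v1 using v1 unfolding over_place_def by (rule conjunct1)
  obtain t where t: "0 < rabs q t" "rabs q t < 1" using rat_small[OF q] .
  have "v1 (inverse (of_rat t)) = inverse (rabs q t)"
    using V1.v_inverse[OF V1.K_rat] v1 by (simp add: over_place_def)
  hence "v1 (inverse (of_rat t)) > 1" using t by (simp add: one_less_inverse)
  thus ?case using V1.K_closed(4)[OF V1.K_rat] by blast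
next
  case (insert v S)
  interpret V1: valued_field K v1 using v1 unfolding over_place_def by (rule conjunct1)
  have prem: "over_place K q u \<and> (\<exists>x\<in>K. v1 x \<noteq> u x)" if "u \<in> S" for u
    by (rule insert.prems) (simp add: that)
  have vp: "over_place K q v" "\<exists>x\<in>K. v1 x \<noteq> v x" using insert.prems[OF insertI1] by simp_all
  interpret V: valued_field K v using vp(1) unfolding over_place_def by (rule conjunct1)
  have "\<exists>x\<in>K. v1 x > 1 \<and> (\<forall>v\<in>S. v x < 1)" by (rule insert.IH[OF prem])
  then obtain x where x: "x \<in> K" "v1 x > 1" "\<And>u. u \<in> S \<Longrightarrow> u x < 1" by auto
  obtain w where w: "w \<in> K" "v1 w \<noteq> v w" using vp(2) by auto
  obtain y where y: "y \<in> K" "v1 y > 1" "v y < 1" using separate_two_places'[OF q v1 vp(1) w] by auto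
  have Sv: "valued_field K u" if "u \<in> S" for u using prem[OF that] unfolding over_place_def by simp
  show ?case
  proof (cases "v x \<le> 1")
    case True
    have "\<forall>\<^sub>F n in sequentially. u (x ^ n * y) < 1" if u: "u \<in> S" for u
    proof -
      interpret U: valued_field K u by (rule Sv[OF u])
      have "(\<lambda>n. u x ^ n * u y) \<longlonglongrightarrow> 0 * u y"
        by (intro tendsto_mult tendsto_const LIMSEQ_realpow_zero U.v_nn x(1) x(3)[OF u])
      hence "\<forall>\<^sub>F n in sequentially. u x ^ n * u y < 1" by (intro order_tendstoD(2)) auto
      thus ?thesis using U.v_mult[OF U.K_pow[OF x(1)] y(1)] U.v_pow[OF x(1)] by simp
    qed
    hence "\<forall>\<^sub>F n in sequentially. \<forall>u\<in>S. u (x ^ n * y) < 1" using insert.hyps by (simp add: eventually_ball_finite_distrib)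
    then obtain n where n: "\<forall>u\<in>S. u (x ^ n * y) < 1" by (auto simp: eventually_sequentially)
    have 1: "v1 (x ^ n * y) > 1"
      using V1.v_mult[OF V1.K_pow[OF x(1)] y(1), of n] V1.v_pow[OF x(1), of n] x(2) y(2)
      less_1_mult'[of "v1 y" "v1 x ^ n"] one_le_power[of "v1 x" n] by (simp add: mult.commute)
    have 2: "v (x ^ n * y) < 1"
      using V.v_mult[OF V.K_pow[OF x(1)] y(1), of n] V.v_pow[OF x(1), of n] y(3)
        mult_left_le_one_le[OF V.v_nn[OF y(1)] zero_le_power[OF V.v_nn[OF x(1)]] power_le_one[OF V.v_nn[OF x(1)] True]]
      by (metis order.strict_trans1)
    show ?thesis using n 1 2 V1.K_closed(2)[OF V1.K_pow[OF x(1)] y(1)] by (intro bexI[of _ "x ^ n * y"]) auto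
  next
    case False
    define z where "z = (\<lambda>n. x ^ n / (1 + x ^ n))"
    have zK: "z n \<in> K" for n
      unfolding z_def divide_inverse by (intro V.K_closed V.K_pow x(1) V.K01)
    have lim0: "(\<lambda>n. u (z n * y)) \<longlonglongrightarrow> 0" if "valued_field K u" "u x < 1" for u
    proof -
      interpret U: valued_field K u by (rule that)
      have "(\<lambda>n. u (z n) * u y) \<longlonglongrightarrow> 0 * u y" unfolding z_def
        by (intro tendsto_mult tendsto_const U.approx_tendsto(1) x(1) that)
      thus ?thesis using U.v_mult[OF zK y(1)] by simp
    qed
    have lim1: "(\<lambda>n. u (z n * y)) \<longlonglongrightarrow> u y" if "valued_field K u" "u x > 1" for u
    proof -
      interpret U: valued_field K u by (rule that)
      have l0: "(\<lambda>n. u (z n - 1)) \<longlonglongrightarrow> 0" unfolding z_def by (intro U.approx_tendsto(2) x(1) that)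
      have nb: "norm (u (z n) - 1) \<le> u (z n - 1)" for n
      proof -
        have "u (z n) \<le> u (z n - 1) + 1" using U.v_tri[OF U.K_diff[OF zK U.K01(2)] U.K01(2), of n] by simp
        moreover have "1 \<le> u (z n) + u (z n - 1)"
          using U.v_tri_diff[OF zK[of n] U.K_diff[OF zK U.K01(2), of n]] by simp
        ultimately show ?thesis by (simp add: abs_le_iff)
      qed
      have "(\<lambda>n. u (z n) - 1) \<longlonglongrightarrow> 0"
        by (rule Lim_null_comparison[OF always_eventually l0]) (rule allI, rule nb)
      hence "(\<lambda>n. u (z n)) \<longlonglongrightarrow> 1" by (simp add: LIM_zero_iff)
      hence "(\<lambda>n. u (z n) * u y) \<longlonglongrightarrow> 1 * u y" by (intro tendsto_mult tendsto_const)
      thus ?thesis using U.v_mult[OF zK y(1)] by simp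
    qed
    have "\<forall>\<^sub>F n in sequentially. u (z n * y) < 1" if u: "u \<in> S" for u
      using lim0[OF Sv[OF u] x(3)[OF u]] by (intro order_tendstoD(2)) auto
    hence e1: "\<forall>\<^sub>F n in sequentially. \<forall>u\<in>S. u (z n * y) < 1" using insert.hyps by (simp add: eventually_ball_finite_distrib)
    have e2: "\<forall>\<^sub>F n in sequentially. v1 (z n * y) > 1"
      by (rule order_tendstoD(1)[OF lim1[OF V1.valued_field_axioms x(2)] y(2)])
    have e3: "\<forall>\<^sub>F n in sequentially. v (z n * y) < 1"
      by (rule order_tendstoD(2)[OF lim1[OF V.valued_field_axioms] y(3)]) (use False in simp)
    from e1 e2 e3 have "\<forall>\<^sub>F n in sequentially. (\<forall>u\<in>S. u (z n * y) < 1) \<and> v1 (z n * y) > 1 \<and> v (z n * y) < 1"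
      by eventually_elim auto
    then obtain n where "(\<forall>u\<in>S. u (z n * y) < 1)" "v1 (z n * y) > 1" "v (z n * y) < 1"
      by (auto simp: eventually_sequentially)
    thus ?thesis using V1.K_closed(2)[OF zK y(1), of n] by (intro bexI[of _ "z n * y"]) auto
  qed
qed

lemma weak_approximation:
  assumes q: "q \<in> PL" and v1: "over_place K q v1" and S: "finite S"
    and S': "\<And>v. v \<in> S \<Longrightarrow> over_place K q v \<and> (\<exists>x\<in>K. v1 x \<noteq> v x)"
    and y: "y \<in> K" and e: "e > 0"
  shows "\<exists>x\<in>K. v1 (x - y) < e \<and> (\<forall>v\<in>S. v x < e)"
proof -
  interpret V1: valued_field K v1 using v1 unfolding over_place_def by (rule conjunct1)
  have "\<exists>x\<in>K. v1 x > 1 \<and> (\<forall>v\<in>S. v x < 1)" by (rule separate_places[OF q v1 S]) (rule S')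
  then obtain x where x: "x \<in> K" "v1 x > 1" "\<And>u. u \<in> S \<Longrightarrow> u x < 1" by auto
  define z where "z = (\<lambda>n. x ^ n / (1 + x ^ n))"
  have zK: "z n \<in> K" for n
    unfolding z_def divide_inverse by (intro V1.K_closed V1.K_pow x(1) V1.K01)
  have "\<forall>\<^sub>F n in sequentially. u (z n * y) < e" if u: "u \<in> S" for u
  proof -
    interpret U: valued_field K u using S'[OF u] unfolding over_place_def by simp
    have "(\<lambda>n. u (z n) * u y) \<longlonglongrightarrow> 0 * u y" unfolding z_def
      by (intro tendsto_mult tendsto_const U.approx_tendsto(1) x(1) x(3)[OF u])
    thus ?thesis using U.v_mult[OF zK y(1)] e by (intro order_tendstoD(2)) auto
  qed
  hence e1: "\<forall>\<^sub>F n in sequentially. \<forall>u\<in>S. u (z n * y) < e" using S by (simp add: eventually_ball_finite_distrib)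
  have "(\<lambda>n. v1 (z n - 1) * v1 y) \<longlonglongrightarrow> 0 * v1 y" unfolding z_def
    by (intro tendsto_mult tendsto_const V1.approx_tendsto(2) x(1) x(2))
  moreover have "v1 (z n * y - y) = v1 (z n - 1) * v1 y" for n
    using V1.v_mult[OF V1.K_diff[OF zK V1.K01(2)] y, of n] by (simp add: algebra_simps)
  ultimately have "\<forall>\<^sub>F n in sequentially. v1 (z n * y - y) < e" using e by (intro order_tendstoD(2)) auto
  with e1 have "\<forall>\<^sub>F n in sequentially. v1 (z n * y - y) < e \<and> (\<forall>u\<in>S. u (z n * y) < e)"
    by eventually_elim auto
  then obtain n where "v1 (z n * y - y) < e \<and> (\<forall>u\<in>S. u (z n * y) < e)" by (auto simp: eventually_sequentially)
  thus ?thesis using V1.K_closed(2)[OF zK y(1), of n] by (intro bexI[of _ "z n * y"]) auto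
qed

section \<open>Algebraic numbers as a rational vector space\<close>

interpretation Qvs: vector_space "\<lambda>(q::rat) (x::complex). of_rat q * x"
  by unfold_locales (simp_all add: algebra_simps of_rat_add of_rat_mult)

lemma Qvs_span_powers:
  assumes a: "algebraic a" and x: "x \<in> Qgen a"
  shows "x \<in> Qvs.span ((\<lambda>j. a ^ j) ` {..<qdeg a})"
proof -
  obtain g where g: "x = rpoly g a" using x by (rule QgenE)
  define h where "h = g mod minpol a"
  have "g = (g div minpol a) * minpol a + h" unfolding h_def by simp
  hence "rpoly g a = rpoly ((g div minpol a) * minpol a + h) a" by simp
  hence xh: "x = rpoly h a" using minpol_props(1)[OF a] g by (simp only: rpoly_simps) simp
  have "degree h < qdeg a" unfolding h_def qdeg_def
    using degree_mod_less[OF minpol_nz[OF a], of g] degree_minpol_pos[OF a] by auto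
  hence lt: "i \<in> {..degree h} \<Longrightarrow> i < qdeg a" for i by simp
  have e: "x = (\<Sum>i\<le>degree h. of_rat (coeff h i) * a ^ i)" unfolding xh poly_altdef by simp
  show ?thesis unfolding e
    by (rule Qvs.span_sum, rule Qvs.span_scale, rule Qvs.span_base) (use lt in blast)
qed

lemma Q_dependence:
  assumes a: "algebraic a" and I: "finite I" and x: "\<And>i. i \<in> I \<Longrightarrow> x i \<in> Qgen a" and card: "card I > qdeg a"
  shows "\<exists>c :: 'i \<Rightarrow> rat. (\<exists>i\<in>I. c i \<noteq> 0) \<and> (\<Sum>i\<in>I. of_rat (c i) * x i) = 0"
proof (cases "inj_on x I")
  case False
  then obtain i j where ij: "i \<in> I" "j \<in> I" "i \<noteq> j" "x i = x j" unfolding inj_on_def by blast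
  define c :: "'i \<Rightarrow> rat" where "c = (\<lambda>k. if k = i then 1 else if k = j then - 1 else 0)"
  have "(\<Sum>k\<in>I. of_rat (c k) * x k) = (\<Sum>k\<in>{i,j}. of_rat (c k) * x k)"
    by (rule sum.mono_neutral_right[OF I]) (use ij in \<open>auto simp: c_def\<close>)
  also have "\<dots> = 0" using ij by (simp add: c_def)
  finally show ?thesis using ij by (intro exI[of _ c]) (auto simp: c_def)
next
  case True
  have ci: "card (x ` I) = card I" by (rule card_image[OF True])
  have fx: "finite (x ` I)" using I by simp
  have sub: "x ` I \<subseteq> Qvs.span ((\<lambda>j. a ^ j) ` {..<qdeg a})" using Qvs_span_powers[OF a] x by blast
  have "Qvs.dependent (x ` I)"
  proof (rule ccontr)
    assume ind: "Qvs.independent (x ` I)"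
    have "card (x ` I) \<le> card ((\<lambda>j. a ^ j) ` {..<qdeg a})"
      using Qvs.independent_span_bound[OF _ ind sub] by simp
    also have "\<dots> \<le> qdeg a" using card_image_le[of "{..<qdeg a}" "\<lambda>j. a ^ j"] by simp
    finally show False using ci card by simp
  qed
  then obtain u where u: "\<exists>v\<in>x ` I. u v \<noteq> 0" "(\<Sum>v\<in>x ` I. of_rat (u v) * v) = 0"
    using Qvs.dependent_finite[OF fx] by blast
  have "(\<Sum>i\<in>I. of_rat (u (x i)) * x i) = 0" using u(2) by (simp add: sum.reindex[OF True])
  thus ?thesis using u(1) by (intro exI[of _ "\<lambda>i. u (x i)"]) auto
qed

section \<open>Compactness of bounded rationals at a place\<close>

lemma rabs_props:
  assumes q: "q \<in> PL"
  shows "0 \<le> rabs q r" "rabs q r = 0 \<longleftrightarrow> r = 0" "rabs q (r * s) = rabs q r * rabs q s"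
    "rabs q (r + s) \<le> rabs q r + rabs q s" "rabs q (- r) = rabs q r" "rabs q 1 = 1" "rabs q (inverse r) = inverse (rabs q r)"
    "rabs q (r - s) \<le> rabs q r + rabs q s"
proof -
  note v = vabs_of_rat[OF q, symmetric]
  show nn: "0 \<le> rabs q r" for r unfolding v using q by simp
  show 0: "rabs q r = 0 \<longleftrightarrow> r = 0" for r unfolding v using q by simp
  show m: "rabs q (r * s) = rabs q r * rabs q s" for r s unfolding v of_rat_mult by (rule vabs_mult[OF q]) simp_all
  show t: "rabs q (r + s) \<le> rabs q r + rabs q s" for r s unfolding v of_rat_add by (rule vabs_triangle[OF q]) simp_all
  have "rabs q 1 = rabs q 1 * rabs q 1" using m[of 1 1] by simp
  thus 1: "rabs q 1 = 1" using 0[of 1] by simp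
  have "rabs q (-1) * rabs q (-1) = 1" using m[of "-1" "-1"] 1 by simp
  hence "rabs q (-1) = 1" using nn[of "-1"] by (metis abs_of_nonneg abs_1 power2_eq_square power2_eq_1_iff abs_minus_cancel)
  thus u: "rabs q (- r) = rabs q r" for r using m[of "-1" r] by simp
  show "rabs q (r - s) \<le> rabs q r + rabs q s" using t[of r "- s"] u[of s] by simp
  show "rabs q (inverse r) = inverse (rabs q r)"
  proof (cases "r = 0")
    case False
    have "rabs q r * rabs q (inverse r) = 1" unfolding m[symmetric] using False 1 by simp
    thus ?thesis by (metis inverse_unique)
  qed (use 0[of 0] in simp)
qed

lemma rabs_int_le_1: "prime q \<Longrightarrow> rabs q (of_int k) \<le> 1"
proof -
  assume p: "prime q"
  have q0: "q > 1" using p prime_gt_1_nat by blast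
  show ?thesis
  proof (cases "k = 0")
    case True thus ?thesis using q0 by (simp add: rabs_def padic_abs_def)
  next
    case False
    have "rabs q (of_int k) = inverse (real q ^ multiplicity (int q) k)"
      using padic_abs_fraction[OF p False, of 1] q0 by (simp add: rabs_def power_int_minus)
    also have "\<dots> \<le> 1" using q0 one_le_power[of "real q"] by (simp add: inverse_le_1_iff)
    finally show ?thesis .
  qed
qed

lemma rabs_multiple: 
  assumes p: "prime q" shows "rabs q (of_int (int q ^ k * m)) \<le> 1 / real q ^ k"
proof -
  have q: "q \<in> PL" using p by (simp add: PL_def)
  have "rabs q (of_nat q) = 1 / real q" using padic_abs_self[OF p] prime_gt_0_nat[OF p] by (simp add: rabs_def)
  hence e: "rabs q (of_nat q ^ k) = 1 / real q ^ k"
    by (induction k) (simp_all add: rabs_props[OF q])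
  have "rabs q (of_int (int q ^ k * m)) = rabs q (of_nat q ^ k) * rabs q (of_int m)"
    using rabs_props(3)[OF q, of "of_nat q ^ k" "of_int m"] by simp
  also have "\<dots> \<le> (1 / real q ^ k) * 1" unfolding e using rabs_int_le_1[OF p] by (intro mult_left_mono) auto
  finally show ?thesis by simp
qed

text \<open>
  The natural numbers below \<open>q ^ k\<close> represent all residues of \<open>q\<close>-integral rationals; hence these are totally bounded.
\<close>

lemma padic_residue:
  assumes p: "prime q" and r: "rabs q r \<le> 1"
  shows "\<exists>s<q ^ k. rabs q (r - of_nat s) \<le> 1 / real q ^ k"
proof -
  have qP: "q \<in> PL" using p by (simp add: PL_def)
  have q1: "q > 1" using p prime_gt_1_nat by blast
  obtain a b where ab: "quotient_of r = (a, b)" by force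
  have b: "b > 0" using quotient_of_denom_pos[OF ab] .
  have cop: "coprime a b" using quotient_of_coprime[OF ab] .
  have re: "r = of_int a / of_int b" using quotient_of_div[OF ab] .
  have nb: "\<not> int q dvd b"
  proof
    assume qb: "int q dvd b"
    have na: "\<not> int q dvd a"
    proof
      assume "int q dvd a"
      hence "is_unit (int q)" by (rule coprime_common_divisor[OF cop _ qb])
      thus False using q1 by simp
    qed
    hence a0: "a \<noteq> 0" by auto
    have "multiplicity (int q) a = 0" using na by (rule not_dvd_imp_multiplicity_0)
    moreover have "multiplicity (int q) b > 0" using qb b q1 by (subst multiplicity_gt_zero_iff) auto
    ultimately have "rabs q r = real q ^ multiplicity (int q) b"
      unfolding re rabs_def using padic_abs_fraction[OF p a0, of b] b q1 by simp
    also have "\<dots> > 1" using q1 \<open>multiplicity (int q) b > 0\<close> by (intro one_less_power) auto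
    finally show False using r by simp
  qed
  have "prime (int q)" using p by simp
  hence "coprime (int q) b" using nb by (rule prime_imp_coprime)
  hence "coprime b (int q ^ k)" by (simp add: coprime_commute)
  then obtain c where c: "[b * c = 1] (mod int q ^ k)" using cong_solve_coprime_int by blast
  define s where "s = nat ((a * c) mod (int q ^ k))"
  have pos: "int q ^ k > 0" using q1 by simp
  have sI: "int s = (a * c) mod (int q ^ k)" unfolding s_def using pos by simp
  have s1: "s < q ^ k" using pos_mod_bound[OF pos, of "a * c"] sI by (metis of_nat_less_iff of_nat_power)
  have "[int s * b = a] (mod int q ^ k)"
  proof -
    have "[int s = a * c] (mod int q ^ k)" unfolding sI by (simp add: cong_def)
    hence "[int s * b = (a * c) * b] (mod int q ^ k)" by (rule cong_scalar_right)
    moreover have "[a * (b * c) = a * 1] (mod int q ^ k)" using c by (rule cong_scalar_left)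
    ultimately show ?thesis by (metis cong_trans mult.assoc mult.commute mult.right_neutral)
  qed
  then obtain m where m: "a - int s * b = int q ^ k * m" by (metis cong_iff_dvd_diff cong_sym dvdE)
  have "r - of_nat s = of_int (a - int s * b) * inverse (of_int b)" unfolding re using b by (simp add: field_simps)
  hence "rabs q (r - of_nat s) = rabs q (of_int (int q ^ k * m)) * inverse (rabs q (of_int b))"
    unfolding m using rabs_props(3,7)[OF qP] by metis
  also have "rabs q (of_int b) = 1"
    using padic_abs_fraction[OF p, of b 1] b q1 not_dvd_imp_multiplicity_0[OF nb] by (simp add: rabs_def)
  also have "rabs q (of_int (int q ^ k * m)) * inverse 1 \<le> 1 / real q ^ k" using rabs_multiple[OF p] by simp
  finally show ?thesis using s1 by blast
qed

definition qcauchy :: "nat \<Rightarrow> (nat \<Rightarrow> rat) \<Rightarrow> bool" where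
  "qcauchy q r \<longleftrightarrow> (\<forall>e>0. \<exists>M. \<forall>m\<ge>M. \<forall>n\<ge>M. rabs q (r m - r n) < e)"

lemma qcauchy_subseq: "qcauchy q r \<Longrightarrow> strict_mono f \<Longrightarrow> qcauchy q (\<lambda>n. r (f n))"
  unfolding qcauchy_def by (meson le_trans seq_suble)

text \<open>
  Compactness of the unit ball of the completion of the rationals, stated with Cauchy subsequences in place of limits.
\<close>

lemma rat_compact:
  fixes r :: "nat \<Rightarrow> rat"
  assumes q: "q \<in> PL" and r: "\<And>n. rabs q (r n) \<le> 1"
  shows "\<exists>f :: nat \<Rightarrow> nat. strict_mono f \<and> qcauchy q (\<lambda>n. r (f n))"
proof (cases "q = 0")
  case True
  have ab: "\<bar>real_of_rat (r n)\<bar> \<le> 1" for n using r[of n] unfolding rabs_def True by (simp only: if_True refl)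
  have "real_of_rat (r n) \<in> {-1..1}" for n using ab[of n] unfolding atLeastAtMost_iff by linarith
  from compact_Icc[of "-1::real" 1, unfolded compact_def, rule_format, of "\<lambda>n. real_of_rat (r n)", OF this]
  obtain l f where f: "strict_mono f" "((\<lambda>n. real_of_rat (r n)) \<circ> f) \<longlonglongrightarrow> l" by auto
  have "Cauchy ((\<lambda>n. real_of_rat (r n)) \<circ> f)" using f(2) LIMSEQ_imp_Cauchy by blast
  hence "qcauchy q (\<lambda>n. r (f n))" unfolding Cauchy_def qcauchy_def True rabs_def dist_real_def
    by (simp add: of_rat_diff)
  thus ?thesis using f by blast
next
  case False
  hence p: "prime q" using q by (auto simp: PL_def)
  have q1: "real q > 1" using p prime_gt_1_nat by auto
  interpret M: Metric_space "UNIV :: rat set" "\<lambda>x y. rabs q (x - y)"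
  proof
    fix x y z :: rat
    show "0 \<le> rabs q (x - y)" using rabs_props[OF q] by blast
    show "rabs q (x - y) = rabs q (y - x)" using rabs_props(5)[OF q, of "x - y"] by simp
    show "rabs q (x - y) = 0 \<longleftrightarrow> x = y" using rabs_props(2)[OF q, of "x - y"] by simp
    show "rabs q (x - z) \<le> rabs q (x - y) + rabs q (y - z)" using rabs_props(4)[OF q, of "x - y" "y - z"] by simp
  qed
  have tb: "M.mtotally_bounded {x. rabs q x \<le> 1}"
    unfolding M.mtotally_bounded_def
  proof (intro allI impI)
    fix e :: real assume e: "e > 0"
    obtain k where k: "1 / real q ^ k < e" using real_arch_pow_inv[of e "1 / real q"] e q1 by (auto simp: power_one_over)
    have "{x. rabs q x \<le> 1} \<subseteq> (\<Union>x\<in>of_nat ` {..<q ^ k}. M.mball x e)"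
    proof
      fix y assume "y \<in> {x. rabs q x \<le> 1}"
      then obtain s where s: "s < q ^ k" "rabs q (y - of_nat s) \<le> 1 / real q ^ k" using padic_residue[OF p] by blast
      hence "rabs q (of_nat s - y) < e" using k rabs_props(5)[OF q, of "y - of_nat s"] by simp
      hence "y \<in> M.mball (of_nat s) e" unfolding M.mball_def by simp
      thus "y \<in> (\<Union>x\<in>of_nat ` {..<q ^ k}. M.mball x e)" using s(1) by blast
    qed
    moreover have "(of_nat :: nat \<Rightarrow> rat) ` {..<q ^ k} \<subseteq> {x. rabs q x \<le> 1}"
    proof
      fix x :: rat assume "x \<in> of_nat ` {..<q ^ k}"
      then obtain s where "x = of_int (int s)" by auto
      thus "x \<in> {x. rabs q x \<le> 1}" using rabs_int_le_1[OF p, of "int s"] by simp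
    qed
    ultimately show "\<exists>Ka. finite Ka \<and> Ka \<subseteq> {x. rabs q x \<le> 1} \<and> {x. rabs q x \<le> 1} \<subseteq> (\<Union>x\<in>Ka. M.mball x e)"
      by (intro exI[of _ "of_nat ` {..<q ^ k}"]) simp
  qed
  have rr: "range r \<subseteq> {x. rabs q x \<le> 1}" using r by blast
  have "\<exists>f. strict_mono f \<and> M.MCauchy (r \<circ> f)"
    using tb[unfolded M.mtotally_bounded_sequentially] rr by simp
  then obtain f where f: "strict_mono f" "M.MCauchy (r \<circ> f)" by auto
  hence "qcauchy q (\<lambda>n. r (f n))" unfolding M.MCauchy_def qcauchy_def by (auto simp: o_def)
  thus ?thesis using f(1) by blast
qed

lemma rat_compact_family:
  fixes r :: "'i \<Rightarrow> nat \<Rightarrow> rat"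
  assumes q: "q \<in> PL" and I: "finite I" and r: "\<And>i n. i \<in> I \<Longrightarrow> rabs q (r i n) \<le> 1"
  shows "\<exists>f :: nat \<Rightarrow> nat. strict_mono f \<and> (\<forall>i\<in>I. qcauchy q (\<lambda>n. r i (f n)))"
  using I r
proof (induction I rule: finite_induct)
  case empty
  have "strict_mono (\<lambda>n::nat. n)" by (simp add: strict_mono_def)
  thus ?case by (intro exI[of _ "\<lambda>n. n"]) simp
next
  case (insert i I)
  obtain f where f: "strict_mono f" "\<forall>i\<in>I. qcauchy q (\<lambda>n. r i (f n))" using insert.IH insert.prems by (metis insertI2)
  have "\<And>n. rabs q (r i (f n)) \<le> 1" using insert.prems by simp
  from rat_compact[OF q, of "\<lambda>n. r i (f n)", OF this]
  obtain g where g: "strict_mono g" "qcauchy q (\<lambda>n. r i (f (g n)))" by auto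
  have "qcauchy q (\<lambda>n. r j (f (g n)))" if "j \<in> I" for j
    using f(2) that qcauchy_subseq[OF _ g(1), of q "\<lambda>n. r j (f n)"] by simp
  thus ?case using g f(1) by (intro exI[of _ "\<lambda>n. f (g n)"]) (simp add: strict_mono_def)
qed

section \<open>Subfields of the complex numbers\<close>

interpretation cx: Ring.domain complex_ring
  rewrites cx_carrier: "carrier complex_ring = (UNIV :: complex set)"
    and  "monoid.mult complex_ring = (\<lambda>x y :: complex. x * y)"
    and  "monoid.one complex_ring = (1 :: complex)"
    and  "ring.zero complex_ring = (0 :: complex)"
    and  "ring.add complex_ring = (\<lambda>x y :: complex. x + y)"
proof -
  have "Ring.field (ring_of_type_algebra :: complex ring)" by (rule field_from_type_algebra)
  thus "Ring.domain complex_ring" by (rule field.axioms(1))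
qed (simp_all add: ring_of_type_algebra_def)

lemma complex_field: "Ring.field complex_ring" by (rule field_from_type_algebra)

lemma complex_ring_simps [simp]:
  "carrier complex_ring = (UNIV :: complex set)"
  "monoid.mult complex_ring = (\<lambda>x y :: complex. x * y)"
  "monoid.one complex_ring = (1 :: complex)"
  "ring.zero complex_ring = (0 :: complex)"
  "ring.add complex_ring = (\<lambda>x y :: complex. x + y)"
  by (simp_all add: ring_of_type_algebra_def)

lemma complex_a_inv: "a_inv complex_ring x = - (x :: complex)"
proof -
  have "abelian_group complex_ring" using ring.is_abelian_group[OF cx.ring_axioms] .
  from abelian_group.minus_equality[OF this, of "- x" x] show ?thesis by simp
qed

lemma complex_m_inv: "x \<noteq> 0 \<Longrightarrow> m_inv complex_ring x = inverse (x :: complex)"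
proof -
  assume "x \<noteq> 0"
  have "Group.monoid complex_ring" by (rule ring.is_monoid[OF cx.ring_axioms])
  from monoid.inv_unique'[OF this, of x "inverse x"] \<open>x \<noteq> 0\<close> show ?thesis by simp
qed

lemma subfield_complexI:
  assumes "1 \<in> K" "\<And>x y. x \<in> K \<Longrightarrow> y \<in> K \<Longrightarrow> x + y \<in> K" "\<And>x y. x \<in> K \<Longrightarrow> y \<in> K \<Longrightarrow> x * y \<in> K"
    "\<And>x. x \<in> K \<Longrightarrow> - x \<in> K" "\<And>x. x \<in> K \<Longrightarrow> inverse x \<in> K"
  shows "subfield K complex_ring"
proof (rule field.subfieldI'[OF complex_field])
  show "subring K complex_ring"
    by (rule ring.subringI[OF cx.ring_axioms]) (use assms in \<open>simp_all add: complex_a_inv\<close>)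
  show "m_inv complex_ring k \<in> K" if "k \<in> K - {\<zero>\<^bsub>complex_ring\<^esub>}" for k
    using that assms(5) by (simp add: complex_m_inv)
qed

lemma subfield_complexD:
  assumes K: "subfield K complex_ring"
  shows "1 \<in> K" "0 \<in> K" "\<And>x y. x \<in> K \<Longrightarrow> y \<in> K \<Longrightarrow> x + y \<in> K" "\<And>x y. x \<in> K \<Longrightarrow> y \<in> K \<Longrightarrow> x * y \<in> K"
    "\<And>x. x \<in> K \<Longrightarrow> - x \<in> K" "\<And>x. x \<in> K \<Longrightarrow> inverse x \<in> K"
proof -
  note s = subringE[OF subfieldE(1)[OF K]]
  show 1: "1 \<in> K" "0 \<in> K" "\<And>x y. x \<in> K \<Longrightarrow> y \<in> K \<Longrightarrow> x + y \<in> K" "\<And>x y. x \<in> K \<Longrightarrow> y \<in> K \<Longrightarrow> x * y \<in> K"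
    "\<And>x. x \<in> K \<Longrightarrow> - x \<in> K" using s by (simp_all add: complex_a_inv)
  show "inverse x \<in> K" if "x \<in> K" for x
  proof (cases "x = 0")
    case False
    have "x \<in> K - {\<zero>\<^bsub>complex_ring\<^esub>}" using that False by simp
    hence "m_inv complex_ring x \<in> K" using ring.subfield_m_inv(1)[OF cx.ring_axioms K] by blast
    thus ?thesis using False by (simp add: complex_m_inv)
  qed (use 1 in simp)
qed

lemma Qgen_sum: "(\<And>i. i \<in> I \<Longrightarrow> f i \<in> Qgen a) \<Longrightarrow> sum f I \<in> Qgen a"
  using Qgen_of_rat[of 0 a] by (induction I rule: infinite_finite_induct) auto

lemma Qgen_subfield: "algebraic a \<Longrightarrow> subfield (Qgen a) complex_ring"
  using Qgen_of_rat[of 1 a] by (intro subfield_complexI) (auto intro: Qgen_closed Qgen_uminus Qgen_inverse)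

lemma Rats_subfield: "subfield \<rat> complex_ring"
  by (rule subfield_complexI) auto

lemma subfield_Rats: assumes K: "subfield K complex_ring" shows "\<rat> \<subseteq> K"
proof
  note c = subfield_complexD[OF K]
  have n: "of_nat n \<in> K" for n by (induction n) (use c in auto)
  have i: "of_int k \<in> K" for k using n[of "nat k"] c(5)[OF n[of "nat (- k)"]] by (cases "k \<ge> 0") auto
  fix x :: complex assume "x \<in> \<rat>"
  then obtain a b where "x = of_int a / of_int b" by (auto elim: Rats_cases')
  thus "x \<in> K" unfolding divide_inverse using c(4)[OF i c(6)[OF i]] by simp
qed

lemma adjoin_subfield: "subfield (adjoin L a) complex_ring"
  unfolding adjoin_def by (rule field.generate_field_is_subfield[OF complex_field]) simp

lemma adjoin_base: "L \<subseteq> adjoin L a" "a \<in> adjoin L a"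
  unfolding adjoin_def by (auto intro: generate_field.incl)

lemma adjoin_least: "subfield E complex_ring \<Longrightarrow> L \<subseteq> E \<Longrightarrow> a \<in> E \<Longrightarrow> adjoin L a \<subseteq> E"
  unfolding adjoin_def by (rule field.generate_field_min_subfield1[OF complex_field]) auto

lemma adjoin_Qgen:
  assumes "algebraic a" shows "adjoin \<rat> a = Qgen a"
proof
  show "adjoin \<rat> a \<subseteq> Qgen a"
    by (rule adjoin_least[OF Qgen_subfield[OF assms]]) (auto simp: Rats_def)
  note c = subfield_complexD[OF adjoin_subfield[of \<rat> a]]
  have "rpoly g a \<in> adjoin \<rat> a" for g
  proof (induction g)
    case 0 thus ?case using c(2) by simp
  next
    case (pCons r g)
    have "of_rat r \<in> adjoin \<rat> a" using adjoin_base(1)[of \<rat> a] by auto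
    thus ?case using pCons c(3,4) adjoin_base(2) by (simp add: hom_distribs)
  qed
  thus "Qgen a \<subseteq> adjoin \<rat> a" by (auto elim: QgenE)
qed

lemma combine_complex:
  "cx.combine cs us = (\<Sum>i<min (length cs) (length us). (cs ! i) * (us ! i))"
proof (induction cs us rule: cx.combine.induct)
  case (1 c cs u us)
  show ?case unfolding cx.combine.simps 1 by (simp add: sum.lessThan_Suc_shift del: sum.lessThan_Suc)
qed auto

lemma Qgen_reduced:
  assumes a: "algebraic a" and x: "x \<in> Qgen a"
  obtains h where "x = rpoly h a" "\<And>i. i \<ge> qdeg a \<Longrightarrow> coeff h i = 0" "x = (\<Sum>i<qdeg a. of_rat (coeff h i) * a ^ i)"
proof -
  obtain g where g: "x = rpoly g a" using x by (rule QgenE)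
  define h where "h = g mod minpol a"
  have "g = (g div minpol a) * minpol a + h" unfolding h_def by simp
  hence "rpoly g a = rpoly ((g div minpol a) * minpol a + h) a" by simp
  hence xh: "x = rpoly h a" using minpol_props(1)[OF a] g by (simp only: rpoly_simps) simp
  have d: "degree h < qdeg a" unfolding h_def qdeg_def
    using degree_mod_less[OF minpol_nz[OF a], of g] degree_minpol_pos[OF a] by auto
  have z: "coeff h i = 0" if "i \<ge> qdeg a" for i using d that by (intro coeff_eq_0) simp
  have "x = (\<Sum>i\<le>degree h. of_rat (coeff h i) * a ^ i)" unfolding xh poly_altdef by simp
  also have "\<dots> = (\<Sum>i<qdeg a. of_rat (coeff h i) * a ^ i)"
    by (rule sum.mono_neutral_left) (use d in \<open>auto intro: coeff_eq_0\<close>)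
  finally show ?thesis using that xh z by blast
qed

lemma Qgen_dimension:
  assumes a: "algebraic a" shows "cx.dimension (qdeg a) \<rat> (Qgen a)"
proof -
  define us where "us = map (\<lambda>i. a ^ i) [0..<qdeg a]"
  have len: "length us = qdeg a" unfolding us_def by simp
  have ind: "cx.independent \<rat> us"
  proof (rule cx.trivial_combine_imp_independent[OF Rats_subfield])
    fix Ks assume Ks: "set Ks \<subseteq> \<rat>" "cx.combine Ks us = 0"
    define m where "m = min (length Ks) (qdeg a)"
    have "\<exists>r. Ks ! i = of_rat r" if "i < m" for i
    proof -
      have "Ks ! i \<in> \<rat>" using that Ks(1) unfolding m_def by auto
      thus ?thesis unfolding Rats_def by blast
    qed
    then obtain f where f: "\<And>i. i < m \<Longrightarrow> Ks ! i = of_rat (f i)" by metis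
    define h where "h = (\<Sum>i<m. monom (f i) i)"
    have ch: "coeff h i = (if i < m then f i else 0)" for i unfolding h_def by (simp add: coeff_sum)
    have "rpoly h a = (\<Sum>i<m. of_rat (f i) * a ^ i)"
      unfolding h_def by (simp add: hom_distribs poly_sum poly_monom)
    also have "\<dots> = cx.combine Ks us" unfolding combine_complex len m_def[symmetric]
      by (rule sum.cong) (use f in \<open>auto simp: us_def m_def\<close>)
    finally have "rpoly h a = 0" using Ks(2) by simp
    moreover have "degree h < qdeg a"
    proof -
      have "degree h \<le> qdeg a - 1" by (rule degree_le) (use ch in \<open>auto simp: m_def\<close>)
      thus ?thesis using qdeg_pos[OF a] by simp
    qed
    ultimately have "h = 0" using minpol_props(3)[OF a] unfolding qdeg_def by fastforce
    hence "f i = 0" if "i < m" for i using ch[of i] that by simp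
    thus "set (take (length us) Ks) \<subseteq> {0}"
      using f unfolding len by (auto simp: in_set_conv_nth m_def)
  qed simp
  have "cx.Span \<rat> us = Qgen a"
  proof
    show "cx.Span \<rat> us \<subseteq> Qgen a"
    proof
      fix x assume "x \<in> cx.Span \<rat> us"
      then obtain Ks where Ks: "set Ks \<subseteq> \<rat>" "length Ks = length us" "x = cx.combine Ks us"
        using cx.Span_mem_iff_length_version[OF Rats_subfield, of us x] by auto
      have "(Ks ! i) * (us ! i) \<in> Qgen a" if "i < qdeg a" for i
      proof -
        have "Ks ! i \<in> \<rat>" using that Ks(1,2) len by auto
        thus ?thesis using that by (auto simp: us_def Rats_def intro!: Qgen_closed Qgen_power)
      qed
      thus "x \<in> Qgen a" unfolding Ks(3) combine_complex Ks(2) len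
        by (intro Qgen_sum) simp
    qed
    show "Qgen a \<subseteq> cx.Span \<rat> us"
    proof
      fix x assume "x \<in> Qgen a"
      then obtain h where h: "x = (\<Sum>i<qdeg a. of_rat (coeff h i) * a ^ i)" using Qgen_reduced[OF a] by metis
      define Ks where "Ks = map (\<lambda>i. of_rat (coeff h i) :: complex) [0..<qdeg a]"
      have "x = cx.combine Ks us" unfolding combine_complex h Ks_def us_def by simp
      moreover have "set Ks \<subseteq> \<rat>" "length Ks = length us" unfolding Ks_def us_def by auto
      ultimately show "x \<in> cx.Span \<rat> us"
        using cx.Span_mem_iff_length_version[OF Rats_subfield, of us x] by auto
    qed
  qed
  thus ?thesis using cx.dimensionI[OF Rats_subfield ind] len by simp
qed

lemma ext_degree_eq: "subfield F complex_ring \<Longrightarrow> cx.dimension n F E \<Longrightarrow> ext_degree F E = n"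
  unfolding ext_degree_def using cx.dimI by (simp add: over_def)

lemma ext_degree_Qgen: "algebraic a \<Longrightarrow> ext_degree \<rat> (Qgen a) = qdeg a"
  by (rule ext_degree_eq[OF Rats_subfield Qgen_dimension])

lemma alg_degree_eq: "algebraic a \<Longrightarrow> alg_degree a = qdeg a"
  unfolding alg_degree_def by (simp add: adjoin_Qgen ext_degree_Qgen)

section \<open>Lagrange interpolation and the sum of the local degrees\<close>

lemma prod_linear_coeff_Qbar:
  "finite T \<Longrightarrow> T \<subseteq> Qbar \<Longrightarrow> coeff (\<Prod>y\<in>T. [:- y, 1:]) i \<in> Qbar"
proof (induction T arbitrary: i rule: finite_induct)
  case (insert y T)
  have "coeff ([:- y, 1:] * (\<Prod>y\<in>T. [:- y, 1:])) i \<in> Qbar"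
    using insert by (cases i) (auto simp: coeff_pCons)
  thus ?case using insert by simp
qed (auto simp: coeff_1)

text \<open>
  The coefficients of a polynomial of small degree are fixed linear combinations of its values on \<open>T\<close>, hence small at every place
  where all values are small.
\<close>

lemma lagrange_coeff:
  fixes T :: "complex set"
  assumes T: "finite T" "T \<subseteq> Qbar"
  shows "\<exists>L. (\<forall>z\<in>T. L z \<in> Qbar) \<and>
     (\<forall>P :: complex poly. degree P < card T \<longrightarrow> coeff P i = (\<Sum>z\<in>T. L z * poly P z))"
proof -
  define B where "B = (\<lambda>z. \<Prod>y\<in>T - {z}. [:- y, 1:])"
  define D where "D = (\<lambda>z. \<Prod>y\<in>T - {z}. z - y)"
  have D0: "D z \<noteq> 0" for z unfolding D_def using T by simp
  have DQ: "D z \<in> Qbar" if "z \<in> T" for z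
  proof -
    have "(\<Prod>y\<in>S. z - y) \<in> Qbar" if "finite S" "S \<subseteq> T" for S
      using that by (induction S rule: finite_induct) (use T \<open>z \<in> T\<close> in auto)
    thus ?thesis unfolding D_def using T by simp
  qed
  have Bz: "poly (B z) x = (if x = z then D z else 0)" if "x \<in> T" for x z
    unfolding B_def D_def poly_prod using that T by (auto simp: prod_zero_iff)
  have Bd: "degree (B z) < card T" if "z \<in> T" for z
  proof -
    have "degree (B z) \<le> (\<Sum>y\<in>T - {z}. degree [:- y, 1:])" unfolding B_def
      using degree_prod_sum_le[of "T - {z}" "\<lambda>y. [:- y, 1:]"] T by (simp add: o_def)
    also have "\<dots> = card T - 1" using T that by simp
    finally show ?thesis using T that card_gt_0_iff[of T] by auto
  qed
  define L where "L = (\<lambda>z. coeff (B z) i * inverse (D z))"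
  have "L z \<in> Qbar" if "z \<in> T" for z unfolding L_def B_def
    using T DQ[OF that] by (intro Qbar_closed prod_linear_coeff_Qbar) auto
  moreover have "coeff P i = (\<Sum>z\<in>T. L z * poly P z)" if P: "degree P < card T" for P
  proof -
    define R where "R = (\<Sum>z\<in>T. smult (poly P z * inverse (D z)) (B z))"
    have "degree R \<le> card T - 1" unfolding R_def
    proof (rule degree_sum_le[OF T(1)])
      fix z assume "z \<in> T"
      from Bd[OF this] show "degree (smult (poly P z * inverse (D z)) (B z)) \<le> card T - 1"
        using degree_smult_le[of "poly P z * inverse (D z)" "B z"] by linarith
    qed
    hence Rd: "degree R < card T" using P by simp
    have "poly P x = poly R x" if x: "x \<in> T" for x
    proof -
      have "poly R x = (\<Sum>z\<in>T. if z = x then poly P x else 0)" unfolding R_def poly_sum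
        by (rule sum.cong) (use Bz[OF x] D0 in auto)
      thus ?thesis using x T by simp
    qed
    hence "P = R" using poly_eqI_degree[of T P R] P Rd by simp
    hence "coeff P i = coeff R i" by simp
    also have "\<dots> = (\<Sum>z\<in>T. L z * poly P z)" unfolding R_def L_def coeff_sum by (simp add: mult_ac)
    finally show ?thesis .
  qed
  ultimately show ?thesis by blast
qed

lemma ex_normalized_dependence:
  assumes q: "q \<in> PL" and a: "algebraic a" and I: "finite I" and x: "\<And>i. i \<in> I \<Longrightarrow> x i \<in> Qgen a"
    and card: "card I > qdeg a"
  shows "\<exists>c :: 'i \<Rightarrow> rat. (\<exists>i\<in>I. c i = 1) \<and> (\<forall>i\<in>I. rabs q (c i) \<le> 1) \<and> (\<Sum>i\<in>I. of_rat (c i) * x i) = 0"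
proof -
  obtain b :: "'i \<Rightarrow> rat" where b: "\<exists>i\<in>I. b i \<noteq> 0" "(\<Sum>i\<in>I. of_rat (b i) * x i) = 0"
    using Q_dependence[of a I x, OF a I x card] by metis
  have ne: "I \<noteq> {}" using b by auto
  define k where "k = arg_max_on (\<lambda>i. rabs q (b i)) I"
  have k: "k \<in> I" "\<And>i. i \<in> I \<Longrightarrow> rabs q (b i) \<le> rabs q (b k)"
  proof -
    have fin: "finite ((\<lambda>i. rabs q (b i)) ` I)" using I by simp
    have "Max ((\<lambda>i. rabs q (b i)) ` I) \<in> (\<lambda>i. rabs q (b i)) ` I" by (rule Max_in[OF fin]) (use ne in simp)
    then obtain j where j: "j \<in> I" "rabs q (b j) = Max ((\<lambda>i. rabs q (b i)) ` I)" by auto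
    have "is_arg_max (\<lambda>i. rabs q (b i)) (\<lambda>i. i \<in> I) j"
      unfolding is_arg_max_linorder using j Max_ge[OF fin] by auto
    hence "is_arg_max (\<lambda>i. rabs q (b i)) (\<lambda>i. i \<in> I) k"
      unfolding k_def arg_max_on_def arg_max_def by (rule someI)
    thus "k \<in> I" "\<And>i. i \<in> I \<Longrightarrow> rabs q (b i) \<le> rabs q (b k)" unfolding is_arg_max_linorder by auto
  qed
  have bk: "b k \<noteq> 0"
  proof
    assume "b k = 0"
    hence "rabs q (b i) \<le> 0" if "i \<in> I" for i using k(2)[OF that] rabs_props(2)[OF q, of 0] by simp
    hence "b i = 0" if "i \<in> I" for i using that rabs_props(1,2)[OF q, of "b i"] by (metis order.antisym)
    thus False using b(1) by auto
  qed
  define c where "c = (\<lambda>i. b i * inverse (b k))"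
  have rk: "rabs q (b k) > 0" using rabs_props(1,2)[OF q, of "b k"] bk by auto
  have "c k = 1" unfolding c_def using bk by simp
  moreover have "rabs q (c i) \<le> 1" if "i \<in> I" for i
    unfolding c_def rabs_props(3)[OF q] rabs_props(7)[OF q] using k(2)[OF that] rk by (simp add: field_simps)
  moreover have "(\<Sum>i\<in>I. of_rat (c i) * x i) = (\<Sum>i\<in>I. of_rat (b i) * x i) * of_rat (inverse (b k))"
    unfolding c_def sum_distrib_right by (rule sum.cong) (simp_all add: of_rat_mult)
  ultimately show ?thesis using k(1) b(2) by (intro exI[of _ c]) auto
qed

lemma over_placeD:
  assumes "over_place K q v" shows "valued_field K v" "v (of_rat r) = rabs q r"
  using assms unfolding over_place_def by simp_all

text \<open>
  The sum of the local degrees over one rational place does not exceed the global degree. Suppose that independent families \<open>us v\<close>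
  were too long in total. By weak approximation, each member \<open>i\<close> is approximated by elements \<open>Z n i\<close> of the field that are small at
  the other places of \<open>S\<close>. There are more than \<open>qdeg a\<close> of them, so for each \<open>n\<close> they satisfy a rational relation whose largest
  coefficient is 1. Along a subsequence the coefficients are Cauchy and the 1 stays at one index \<open>k\<close>; at the place of \<open>k\<close> the limit
  of the relations contradicts the independence of the family there.
\<close>

lemma sum_indep_le:
  assumes q: "q \<in> PL" and a: "algebraic a" and S: "finite S"
    and ov: "\<And>v. v \<in> S \<Longrightarrow> over_place (Qgen a) q v"
    and dis: "\<And>v w. v \<in> S \<Longrightarrow> w \<in> S \<Longrightarrow> v \<noteq> w \<Longrightarrow> \<exists>x\<in>Qgen a. v x \<noteq> w x"
    and us: "\<And>v. v \<in> S \<Longrightarrow> valued_field.indep (Qgen a) v (us v)"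
  shows "(\<Sum>v\<in>S. length (us v)) \<le> qdeg a"
proof (rule ccontr)
  assume "\<not> ?thesis"
  define K where "K = Qgen a"
  define I where "I = Sigma S (\<lambda>v. {..<length (us v)})"
  have I: "finite I" unfolding I_def using S by auto
  have "card I = (\<Sum>v\<in>S. length (us v))" unfolding I_def using S by (subst card_SigmaI) auto
  with \<open>\<not> ?thesis\<close> have card: "card I > qdeg a" by simp
  have usK: "(us v ! j) n \<in> K" if "(v, j) \<in> I" for v j n
  proof -
    have v: "v \<in> S" "j < length (us v)" using that by (auto simp: I_def)
    interpret V: valued_field K v unfolding K_def by (rule over_placeD(1)[OF ov[OF v(1)]])
    have "us v ! j \<in> cauchy_seqs K v" using us[OF v(1)] v(2) unfolding K_def[symmetric] V.indep_def by auto
    thus ?thesis by (rule V.cauchy_K)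
  qed
  have "\<exists>x\<in>K. fst i (x - (us (fst i) ! snd i) n) < inverse (real (Suc n)) \<and> (\<forall>w\<in>S - {fst i}. w x < inverse (real (Suc n)))"
    if i: "i \<in> I" for i n
    unfolding K_def
  proof (rule weak_approximation[OF q])
    have v: "fst i \<in> S" using i by (auto simp: I_def)
    show "over_place (Qgen a) q (fst i)" by (rule ov[OF v])
    show "finite (S - {fst i})" using S by simp
    show "over_place (Qgen a) q w \<and> (\<exists>x\<in>Qgen a. fst i x \<noteq> w x)" if "w \<in> S - {fst i}" for w
      using that ov[of w] dis[OF v, of w] by auto
    show "(us (fst i) ! snd i) n \<in> Qgen a" using usK[of "fst i" "snd i" n] i unfolding K_def by simp
    show "0 < inverse (real (Suc n))" by simp
  qed
  hence "\<forall>n. \<forall>i. \<exists>x. i \<in> I \<longrightarrow> x \<in> K \<and> fst i (x - (us (fst i) ! snd i) n) < inverse (real (Suc n)) \<and> (\<forall>w\<in>S - {fst i}. w x < inverse (real (Suc n)))"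
    by blast
  then obtain Z where Z: "\<forall>n i. i \<in> I \<longrightarrow> Z n i \<in> K \<and> fst i (Z n i - (us (fst i) ! snd i) n) < inverse (real (Suc n)) \<and> (\<forall>w\<in>S - {fst i}. w (Z n i) < inverse (real (Suc n)))"
    by metis
  have XK: "Z n i \<in> K" if "i \<in> I" for n i using Z that by blast
  have "\<forall>n. \<exists>c :: (complex \<Rightarrow> real) \<times> nat \<Rightarrow> rat. (\<exists>i\<in>I. c i = 1) \<and> (\<forall>i\<in>I. rabs q (c i) \<le> 1) \<and> (\<Sum>i\<in>I. of_rat (c i) * Z n i) = 0"
  proof
    fix n
    show "\<exists>c :: (complex \<Rightarrow> real) \<times> nat \<Rightarrow> rat. (\<exists>i\<in>I. c i = 1) \<and> (\<forall>i\<in>I. rabs q (c i) \<le> 1) \<and> (\<Sum>i\<in>I. of_rat (c i) * Z n i) = 0"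
      by (rule ex_normalized_dependence[OF q a I _ card]) (use XK K_def in auto)
  qed
  then obtain c where c: "\<forall>n. (\<exists>i\<in>I. c n i = (1::rat)) \<and> (\<forall>i\<in>I. rabs q (c n i) \<le> 1) \<and> (\<Sum>i\<in>I. of_rat (c n i) * Z n i) = 0"
    by metis
  hence "\<forall>n. \<exists>i. i \<in> I \<and> c n i = 1" by blast
  then obtain i0 where i0: "\<forall>n. i0 n \<in> I \<and> c n (i0 n) = 1" by metis
  have cb: "rabs q (c n i) \<le> 1" if "i \<in> I" for n i using c that by blast
  obtain f :: "nat \<Rightarrow> nat" where f: "strict_mono f" "\<forall>i\<in>I. qcauchy q (\<lambda>n. c (f n) i)"
    using rat_compact_family[OF q I, of "\<lambda>i n. c n i"] cb by auto
  have "\<exists>k\<in>I. infinite {n. i0 (f n) = k}"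
  proof (rule ccontr)
    assume "\<not> (\<exists>k\<in>I. infinite {n. i0 (f n) = k})"
    hence "finite (\<Union>k\<in>I. {n. i0 (f n) = k})" using I by blast
    moreover have "(\<Union>k\<in>I. {n. i0 (f n) = k}) = UNIV" using i0 by auto
    ultimately show False by simp
  qed
  then obtain k where k: "k \<in> I" "infinite {n. i0 (f n) = k}" by auto
  define g where "g = enumerate {n. i0 (f n) = k}"
  have g: "strict_mono g" unfolding g_def by (rule strict_mono_enumerate[OF k(2)])
  have gk: "i0 (f (g n)) = k" for n using enumerate_in_set[OF k(2), of n] unfolding g_def by simp
  define h where "h = (\<lambda>n. f (g n))"
  have h: "strict_mono h" unfolding h_def using f(1) g by (simp add: strict_mono_def)
  have hn: "n \<le> h n" for n by (rule seq_suble[OF h])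
  define C where "C = (\<lambda>i n. c (h n) i)"
  have Cc: "qcauchy q (C i)" if "i \<in> I" for i
    using qcauchy_subseq[OF bspec[OF f(2) that] g] unfolding C_def h_def .
  have Ck: "C k n = 1" for n using i0 gk[of n] unfolding C_def h_def by metis
  have Cb: "rabs q (C i n) \<le> 1" if "i \<in> I" for i n using cb that unfolding C_def by blast
  have Csum: "(\<Sum>i\<in>I. of_rat (C i n) * Z (h n) i) = 0" for n using c unfolding C_def by blast
  obtain v0 j0 where k0: "k = (v0, j0)" by force
  have v0: "v0 \<in> S" "j0 < length (us v0)" using k(1) k0 by (auto simp: I_def)
  interpret V: valued_field K v0 unfolding K_def by (rule over_placeD(1)[OF ov[OF v0(1)]])
  have vr: "v0 (of_rat r) = rabs q r" for r by (rule over_placeD(2)[OF ov[OF v0(1)]])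
  define L where "L = length (us v0)"
  have LI: "(v0, j) \<in> I" if "j < L" for j using v0 that by (auto simp: I_def L_def)
  have ind: "V.indep (us v0)" using us[OF v0(1)] unfolding K_def .
  have usc: "us v0 ! j \<in> cauchy_seqs K v0" if "j < L" for j using ind that unfolding V.indep_def L_def by auto
  define cs where "cs = map (\<lambda>j n. of_rat (C (v0, j) n) :: complex) [0..<L]"
  have csj: "cs ! j = (\<lambda>n. of_rat (C (v0, j) n))" if "j < L" for j unfolding cs_def using that by simp
  have cs: "length cs = length (us v0)" "set cs \<subseteq> cauchy_seqs \<rat> v0"
  proof -
    show "length cs = length (us v0)" unfolding cs_def L_def by simp
    show "set cs \<subseteq> cauchy_seqs \<rat> v0"
    proof
      fix s assume "s \<in> set cs"
      then obtain j where j: "j < L" "s = (\<lambda>n. of_rat (C (v0, j) n))" unfolding cs_def by auto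
      have "s \<in> cauchy_seqs K v0"
      proof (rule V.cauchyI)
        show "s n \<in> K" for n unfolding j by (rule V.K_rat)
        fix e :: real assume "e > 0"
        thus "\<exists>M. \<forall>m\<ge>M. \<forall>n\<ge>M. v0 (s m - s n) < e"
          using Cc[OF LI[OF j(1)]] unfolding qcauchy_def j by (simp add: vr flip: of_rat_diff)
      qed
      thus "s \<in> cauchy_seqs \<rat> v0" by (rule V.rat_cauchyI) (simp add: j)
    qed
  qed
  \<comment> \<open>A bound for the relation at \<open>v0\<close>: the first part comes from passing to the subsequence \<open>h\<close>, the second from approximation.\<close>
  define b where "b = (\<lambda>n. (\<Sum>j<L. v0 ((us v0 ! j) n - (us v0 ! j) (h n))) + real (card I) * inverse (real (Suc n)))"
  have bound: "v0 (\<Sum>i<length (us v0). (cs ! i) n * (us v0 ! i) n) \<le> b n" for n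
  proof -
    define t1 where "t1 = (\<lambda>j. of_rat (C (v0, j) n) * ((us v0 ! j) n - (us v0 ! j) (h n)))"
    define t2 where "t2 = (\<lambda>i. of_rat (C i n) * (if fst i = v0 then (us v0 ! snd i) (h n) - Z (h n) i else - Z (h n) i))"
    have I_split: "I = (\<lambda>j. (v0, j)) ` {..<L} \<union> {i \<in> I. fst i \<noteq> v0}"
      using v0 by (auto simp: I_def L_def)
    have uk: "(us v0 ! j) n \<in> K" if "j < L" for j n using usK[OF LI[OF that]] .
    have key: "(\<Sum>i<length (us v0). (cs ! i) n * (us v0 ! i) n) = (\<Sum>j<L. t1 j) + (\<Sum>i\<in>I. t2 i)"
    proof -
      have split: "(\<Sum>i\<in>I. F i) = (\<Sum>j<L. F (v0, j)) + (\<Sum>i\<in>{i \<in> I. fst i \<noteq> v0}. F i)" for F :: "_ \<Rightarrow> complex"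
      proof -
        have "(\<Sum>i\<in>I. F i) = (\<Sum>i\<in>(\<lambda>j. (v0, j)) ` {..<L}. F i) + (\<Sum>i\<in>{i \<in> I. fst i \<noteq> v0}. F i)"
          by (subst I_split, rule sum.union_disjoint) (use I in auto)
        also have "(\<Sum>i\<in>(\<lambda>j. (v0, j)) ` {..<L}. F i) = (\<Sum>j<L. F (v0, j))"
          by (subst sum.reindex) (auto simp: inj_on_def)
        finally show ?thesis .
      qed
      have "(\<Sum>i\<in>I. t2 i) = (\<Sum>i\<in>I. t2 i + of_rat (C i n) * Z (h n) i)"
        using Csum[of n] by (simp add: sum.distrib)
      also have "\<dots> = (\<Sum>j<L. of_rat (C (v0, j) n) * (us v0 ! j) (h n))"
        unfolding split t2_def by (simp add: algebra_simps)
      finally have "(\<Sum>j<L. t1 j) + (\<Sum>i\<in>I. t2 i) = (\<Sum>j<L. of_rat (C (v0, j) n) * (us v0 ! j) n)"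
        unfolding t1_def by (simp add: sum.distrib[symmetric] algebra_simps)
      thus ?thesis unfolding L_def[symmetric] by (simp add: csj)
    qed
    have t1K: "t1 j \<in> K" "v0 (t1 j) \<le> v0 ((us v0 ! j) n - (us v0 ! j) (h n))" if "j < L" for j
    proof -
      have d: "(us v0 ! j) n - (us v0 ! j) (h n) \<in> K" by (intro V.K_diff uk that)
      show "t1 j \<in> K" unfolding t1_def by (intro V.K_closed(2) V.K_rat d)
      show "v0 (t1 j) \<le> v0 ((us v0 ! j) n - (us v0 ! j) (h n))"
        unfolding t1_def V.v_mult[OF V.K_rat d] vr
        using mult_right_mono[OF Cb[OF LI[OF that], of n] V.v_nn[OF d]] by simp
    qed
    have t2K: "t2 i \<in> K \<and> v0 (t2 i) \<le> inverse (real (Suc n))" if i: "i \<in> I" for i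
    proof -
      define y where "y = (if fst i = v0 then (us v0 ! snd i) (h n) - Z (h n) i else - Z (h n) i)"
      have y: "y \<in> K" "v0 y < inverse (real (Suc (h n)))"
      proof (atomize(full), cases "fst i = v0")
        case True
        have s: "snd i < L" using i True by (auto simp: I_def L_def)
        have d: "Z (h n) i - (us v0 ! snd i) (h n) \<in> K" by (intro V.K_diff uk s XK i)
        have "y = - (Z (h n) i - (us v0 ! snd i) (h n))" unfolding y_def using True by simp
        hence "y \<in> K" "v0 y = v0 (Z (h n) i - (us v0 ! snd i) (h n))" using V.K_closed(3)[OF d] V.v_minus[OF d] by simp_all
        moreover have "v0 (Z (h n) i - (us v0 ! snd i) (h n)) < inverse (real (Suc (h n)))" using Z i True by metis
        ultimately show "y \<in> K \<and> v0 y < inverse (real (Suc (h n)))" by simp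
      next
        case False
        have "v0 \<in> S - {fst i}" using v0 False by simp
        hence "v0 (Z (h n) i) < inverse (real (Suc (h n)))" using Z i by blast
        thus "y \<in> K \<and> v0 y < inverse (real (Suc (h n)))"
          unfolding y_def using False V.K_closed(3)[OF XK[OF i]] V.v_minus[OF XK[OF i]] by simp
      qed
      have "inverse (real (Suc (h n))) \<le> inverse (real (Suc n))" using hn[of n] by (intro le_imp_inverse_le) auto
      moreover have "v0 (t2 i) \<le> v0 y"
        unfolding t2_def y_def[symmetric] V.v_mult[OF V.K_rat y(1)] vr
        using mult_right_mono[OF Cb[OF i, of n] V.v_nn[OF y(1)]] by simp
      moreover have "t2 i \<in> K" unfolding t2_def y_def[symmetric] by (intro V.K_closed(2) V.K_rat y)
      ultimately show ?thesis using y(2) by linarith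
    qed
    have "v0 ((\<Sum>j<L. t1 j) + (\<Sum>i\<in>I. t2 i)) \<le> v0 (\<Sum>j<L. t1 j) + v0 (\<Sum>i\<in>I. t2 i)"
      by (rule V.v_tri) (use t1K t2K in \<open>auto intro!: V.K_sum\<close>)
    also have "\<dots> \<le> (\<Sum>j<L. v0 (t1 j)) + (\<Sum>i\<in>I. v0 (t2 i))"
      by (intro add_mono V.v_sum) (use t1K t2K in auto)
    also have "\<dots> \<le> (\<Sum>j<L. v0 ((us v0 ! j) n - (us v0 ! j) (h n))) + (\<Sum>i\<in>I. inverse (real (Suc n)))"
      by (intro add_mono sum_mono) (use t1K t2K in auto)
    finally show ?thesis unfolding key b_def by simp
  qed
  have b0: "b \<longlonglongrightarrow> 0"
  proof -
    have "(\<lambda>n. v0 ((us v0 ! j) n - (us v0 ! j) (h n))) \<longlonglongrightarrow> 0" if j: "j < L" for j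
    proof (rule LIMSEQ_I)
      fix e :: real assume "e > 0"
      then obtain M where M: "\<forall>m\<ge>M. \<forall>n\<ge>M. v0 ((us v0 ! j) m - (us v0 ! j) n) < e" using V.cauchyD[OF usc[OF j]] by blast
      have "norm (v0 ((us v0 ! j) n - (us v0 ! j) (h n)) - 0) < e" if "n \<ge> M" for n
      proof -
        have "h n \<ge> M" using hn[of n] that by simp
        hence "v0 ((us v0 ! j) n - (us v0 ! j) (h n)) < e" using M that by blast
        thus ?thesis using V.v_nn[OF V.K_diff[OF usK[OF LI[OF j]] usK[OF LI[OF j]]]] by simp
      qed
      thus "\<exists>no. \<forall>n\<ge>no. norm (v0 ((us v0 ! j) n - (us v0 ! j) (h n)) - 0) < e" by blast
    qed
    hence "(\<lambda>n. \<Sum>j<L. v0 ((us v0 ! j) n - (us v0 ! j) (h n))) \<longlonglongrightarrow> (\<Sum>j<L. 0)"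
      by (intro tendsto_sum) simp
    moreover have "(\<lambda>n. real (card I) * inverse (real (Suc n))) \<longlonglongrightarrow> real (card I) * 0"
      by (intro tendsto_mult tendsto_const LIMSEQ_inverse_real_of_nat)
    ultimately have "b \<longlonglongrightarrow> (\<Sum>j<L. 0) + real (card I) * 0" unfolding b_def by (rule tendsto_add)
    thus ?thesis by simp
  qed
  have "(\<lambda>n. v0 (\<Sum>i<length (us v0). (cs ! i) n * (us v0 ! i) n)) \<longlonglongrightarrow> 0"
  proof (rule tendsto_sandwich[OF _ _ tendsto_const b0])
    have "(\<Sum>i<length (us v0). (cs ! i) n * (us v0 ! i) n) \<in> K" for n
      using usK[OF LI] csj V.K_rat unfolding L_def[symmetric] by (auto intro!: V.K_sum V.K_closed(2))
    thus "\<forall>\<^sub>F n in sequentially. 0 \<le> v0 (\<Sum>i<length (us v0). (cs ! i) n * (us v0 ! i) n)" using V.v_nn by simp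
    show "\<forall>\<^sub>F n in sequentially. v0 (\<Sum>i<length (us v0). (cs ! i) n * (us v0 ! i) n) \<le> b n" using bound by simp
  qed
  hence "\<forall>i<length (us v0). (\<lambda>n. v0 ((cs ! i) n)) \<longlonglongrightarrow> 0"
    using ind cs unfolding V.indep_def by blast
  hence "(\<lambda>n. v0 ((cs ! j0) n)) \<longlonglongrightarrow> 0" using v0(2) by blast
  moreover have "v0 ((cs ! j0) n) = 1" for n
    using csj[of j0] v0(2) Ck[of n] vr[of 1] rabs_props(6)[OF q] unfolding L_def k0 by simp
  ultimately show False by (simp add: LIMSEQ_const_iff)
qed

section \<open>The height as a sum over conjugates\<close>

lemma rpoly_Qbar [simp]: "x \<in> Qbar \<Longrightarrow> rpoly g x \<in> Qbar"
  by (induction g) (simp_all add: hom_distribs)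

lemma Qgen_Qbar: "algebraic a \<Longrightarrow> x \<in> Qgen a \<Longrightarrow> x \<in> Qbar"
  by (erule QgenE) (simp add: Qbar_def[symmetric] mem_Collect_eq[of a algebraic, symmetric] del: mem_Collect_eq)

lemma emb_Qbar: "algebraic a \<Longrightarrow> z \<in> conjs a \<Longrightarrow> x \<in> Qgen a \<Longrightarrow> emb a z x \<in> Qbar"
proof (erule QgenE)
  fix g assume a: "algebraic a" "z \<in> conjs a" "x = rpoly g a"
  have "z \<in> Qbar" using conjs_algebraic a by (simp add: Qbar_def)
  thus "emb a z x \<in> Qbar" unfolding a(3) emb_rpoly[OF a(1,2)] by simp
qed

definition cplace :: "complex \<Rightarrow> nat \<Rightarrow> complex \<Rightarrow> complex \<Rightarrow> real" where
  "cplace a q z = restrict (\<lambda>x. vabs q (emb a z x)) (Qgen a)"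

lemma Qgen_valuedI: "algebraic a \<Longrightarrow> absolute_value_on (Qgen a) v \<Longrightarrow> valued_field (Qgen a) v"
  by unfold_locales (auto intro: Qgen_closed Qgen_uminus Qgen_inverse)

lemma cplace_over:
  assumes a: "algebraic a" and z: "z \<in> conjs a" and q: "q \<in> PL"
  shows "over_place (Qgen a) q (cplace a q z)"
proof -
  note E = emb_simps[OF a z] and EQ = emb_Qbar[OF a z]
  have "absolute_value_on (Qgen a) (cplace a q z)"
    unfolding absolute_value_on_def
  proof (intro conjI ballI)
    fix x assume x: "x \<in> Qgen a"
    show "0 \<le> cplace a q z x" using x q EQ by (simp add: cplace_def)
    show "cplace a q z x = 0 \<longleftrightarrow> x = 0" using x q EQ emb_eq_0_iff[OF a z x] by (simp add: cplace_def)
    fix y assume y: "y \<in> Qgen a"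
    show "cplace a q z (x * y) = cplace a q z x * cplace a q z y"
      using x y Qgen_closed(2)[OF x y] E(7)[OF x y] vabs_mult[OF q EQ[OF x] EQ[OF y]] by (simp add: cplace_def)
    show "cplace a q z (x + y) \<le> cplace a q z x + cplace a q z y"
      using x y Qgen_closed(1)[OF x y] E(5)[OF x y] vabs_triangle[OF q EQ[OF x] EQ[OF y]] by (simp add: cplace_def)
  qed
  thus ?thesis unfolding over_place_def using Qgen_valuedI[OF a] E(2) vabs_of_rat[OF q]
    by (simp add: cplace_def)
qed

lemma places_Qgen:
  assumes a: "algebraic a"
  shows "v \<in> places (Qgen a) \<longleftrightarrow> v \<in> extensional (Qgen a) \<and> (\<exists>q\<in>PL. over_place (Qgen a) q v)"
proof
  assume v: "v \<in> places (Qgen a)"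
  hence vf: "v \<in> extensional (Qgen a)" "valued_field (Qgen a) v"
    using Qgen_valuedI[OF a] unfolding places_def by auto
  from v consider "\<forall>r. v (of_rat r) = \<bar>of_rat r\<bar>" | p where "prime p" "\<forall>r. v (of_rat r) = padic_abs p r"
    unfolding places_def by blast
  thus "v \<in> extensional (Qgen a) \<and> (\<exists>q\<in>PL. over_place (Qgen a) q v)"
  proof cases
    case 1 thus ?thesis using vf by (auto intro!: bexI[of _ 0] simp: PL_def over_place_def rabs_def)
  next
    case 2 
    have "p \<noteq> 0" using 2(1) by auto
    thus ?thesis using vf 2 by (auto intro!: bexI[of _ p] simp: PL_def over_place_def rabs_def)
  qed
next
  assume v: "v \<in> extensional (Qgen a) \<and> (\<exists>q\<in>PL. over_place (Qgen a) q v)"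
  then obtain q where q: "q \<in> PL" "over_place (Qgen a) q v" by blast
  interpret V: valued_field "Qgen a" v using q(2) by (rule over_placeD(1))
  have r: "v (of_rat r) = rabs q r" for r using q(2) by (rule over_placeD(2))
  have "(\<forall>r. v (of_rat r) = \<bar>of_rat r\<bar>) \<or> (\<exists>p. prime p \<and> (\<forall>r. v (of_rat r) = padic_abs p r))"
    using q(1) r by (auto simp: PL_def rabs_def)
  thus "v \<in> places (Qgen a)" unfolding places_def using v V.av by blast
qed

lemma extensional_distinct:
  assumes "v \<in> extensional K" "w \<in> extensional K" "v \<noteq> w" shows "\<exists>x\<in>K. v x \<noteq> w x"
  using assms extensionalityI by metis

lemma local_degree_sum_le:
  assumes q: "q \<in> PL" and a: "algebraic a" and S: "finite S"
    and ov: "\<And>v. v \<in> S \<Longrightarrow> v \<in> extensional (Qgen a) \<and> over_place (Qgen a) q v"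
  shows "(\<Sum>v\<in>S. local_degree (Qgen a) v) \<le> qdeg a"
proof -
  have bd: "length us \<le> qdeg a" if "v \<in> S" "valued_field.indep (Qgen a) v us" for v us
    using sum_indep_le[OF q a, of "{v}" "\<lambda>_. us"] ov that by auto
  have "\<forall>v\<in>S. \<exists>us. valued_field.indep (Qgen a) v us \<and> length us = local_degree (Qgen a) v"
  proof
    fix v assume v: "v \<in> S"
    show "\<exists>us. valued_field.indep (Qgen a) v us \<and> length us = local_degree (Qgen a) v"
      by (rule valued_field.local_degree_bounded(1)[OF over_placeD(1)[OF conjunct2[OF ov[OF v]]] bd[OF v]])
  qed
  then obtain us where us: "\<forall>v\<in>S. valued_field.indep (Qgen a) v (us v) \<and> length (us v) = local_degree (Qgen a) v"
    by metis
  have "(\<Sum>v\<in>S. length (us v)) \<le> qdeg a"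
  proof (rule sum_indep_le[OF q a S])
    show "over_place (Qgen a) q v" if "v \<in> S" for v using ov[OF that] by simp
    show "\<exists>x\<in>Qgen a. v x \<noteq> w x" if "v \<in> S" "w \<in> S" "v \<noteq> w" for v w
      using extensional_distinct[of v "Qgen a" w] ov[OF that(1)] ov[OF that(2)] that(3) by blast
    show "valued_field.indep (Qgen a) v (us v)" if "v \<in> S" for v using us that by blast
  qed
  thus ?thesis using us by simp
qed

lemma local_degree_ge:
  assumes q: "q \<in> PL" and a: "algebraic a" and ov: "v \<in> extensional (Qgen a)" "over_place (Qgen a) q v"
    and ind: "valued_field.indep (Qgen a) v us"
  shows "length us \<le> local_degree (Qgen a) v"
proof -
  have bd: "length us \<le> qdeg a" if "valued_field.indep (Qgen a) v us" for us
    using sum_indep_le[OF q a, of "{v}" "\<lambda>_. us"] ov that by auto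
  show ?thesis by (rule valued_field.local_degree_bounded(2)[OF over_placeD(1)[OF ov(2)] bd ind])
qed

lemma vabs_sum:
  assumes "q \<in> PL" "\<And>i. i \<in> I \<Longrightarrow> f i \<in> Qbar"
  shows "sum f I \<in> Qbar \<and> vabs q (sum f I) \<le> (\<Sum>i\<in>I. vabs q (f i))"
  using assms(2)
proof (induction I rule: infinite_finite_induct)
  case (insert i I)
  hence "vabs q (f i + sum f I) \<le> vabs q (f i) + vabs q (sum f I)" by (intro vabs_triangle assms(1)) auto
  thus ?case using insert by force
qed (use vabs_eq_0[OF assms(1), of 0] in auto)

text \<open>
  If \<open>k\<close> conjugates induce the same place, then \<open>1, a, \<dots>, a ^ (k - 1)\<close> are independent over the completion of the rationals:
  a combination that is small there is the value of a polynomial that is small at all \<open>k\<close> conjugates, so that its coefficients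
  are small by \<open>lagrange_coeff\<close>.
\<close>

lemma card_conjs_le_local_degree:
  assumes q: "q \<in> PL" and a: "algebraic a" and ov: "v \<in> extensional (Qgen a)" "over_place (Qgen a) q v"
  shows "card {z \<in> conjs a. cplace a q z = v} \<le> local_degree (Qgen a) v"
proof -
  define K where "K = Qgen a"
  define T where "T = {z \<in> conjs a. cplace a q z = v}"
  have T: "finite T" "T \<subseteq> conjs a" unfolding T_def using finite_conjs[OF a] by auto
  have TQ: "T \<subseteq> Qbar" using T(2) conjs_algebraic[OF a] by (auto simp: Qbar_def)
  interpret V: valued_field K v unfolding K_def using ov(2) by (rule over_placeD(1))
  have vr: "v (of_rat r) = rabs q r" for r using ov(2) by (rule over_placeD(2))
  define us where "us = map (\<lambda>j. (\<lambda>_::nat. a ^ j)) [0..<card T]"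
  have aK: "a ^ j \<in> K" for j unfolding K_def by (intro Qgen_power Qgen_self)
  have "V.indep us" unfolding V.indep_def
  proof (intro conjI allI impI)
    show "set us \<subseteq> cauchy_seqs K v" unfolding us_def using V.cauchy_const[OF aK] by auto
  next
    fix cs i
    assume cs: "length cs = length us \<and> set cs \<subseteq> cauchy_seqs \<rat> v \<and>
       (\<lambda>n. v (\<Sum>i<length us. (cs ! i) n * (us ! i) n)) \<longlonglongrightarrow> 0" and i: "i < length us"
    have lus: "length us = card T" unfolding us_def by simp
    have csr: "(cs ! j) n \<in> \<rat>" if "j < card T" for j n
      using cs that lus V.rat_cauchy_rat by (metis nth_mem subsetD)
    have "\<forall>j n. \<exists>r. j < card T \<longrightarrow> (cs ! j) n = of_rat r" using csr unfolding Rats_def by blast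
    then obtain r where r: "\<forall>j n. j < card T \<longrightarrow> (cs ! j) n = of_rat (r j n)" by metis
    define P where "P = (\<lambda>n. \<Sum>j<card T. monom (r j n) j)"
    have coP: "coeff (P n) j = (if j < card T then r j n else 0)" for n j unfolding P_def by (simp add: coeff_sum)
    have rP: "rpoly (P n) x = (\<Sum>j<card T. of_rat (r j n) * x ^ j)" for n x
      unfolding P_def by (simp add: hom_distribs poly_sum poly_monom)
    have "(\<Sum>i<length us. (cs ! i) n * (us ! i) n) = rpoly (P n) a" for n
      unfolding rP lus by (rule sum.cong) (use r in \<open>auto simp: us_def\<close>)
    hence lim: "(\<lambda>n. v (rpoly (P n) a)) \<longlonglongrightarrow> 0" using cs by simp
    have vz: "v (rpoly (P n) a) = vabs q (rpoly (P n) z)" if "z \<in> T" for n z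
    proof -
      have z: "z \<in> conjs a" "v = cplace a q z" using that by (auto simp: T_def)
      show ?thesis unfolding z(2) cplace_def using emb_rpoly[OF a z(1)] by simp
    qed
    obtain L where L: "\<forall>z\<in>T. L z \<in> Qbar"
      "\<forall>P :: complex poly. degree P < card T \<longrightarrow> coeff P i = (\<Sum>z\<in>T. L z * poly P z)"
      using lagrange_coeff[OF T(1) TQ, of i] by blast
    have bnd: "v ((cs ! i) n) \<le> (\<Sum>z\<in>T. vabs q (L z) * v (rpoly (P n) a))" for n
    proof -
      have "degree (P n) \<le> card T - 1" by (rule degree_le) (use coP in auto)
      hence "degree (cxp (P n)) < card T" using i lus by simp
      hence "coeff (cxp (P n)) i = (\<Sum>z\<in>T. L z * rpoly (P n) z)" using L(2) by blast
      hence e: "of_rat (r i n) = (\<Sum>z\<in>T. L z * rpoly (P n) z)" using coP i lus by (simp add: coeff_map_poly)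
      have LQ: "L z * rpoly (P n) z \<in> Qbar" if "z \<in> T" for z using L(1) TQ that by auto
      have "v ((cs ! i) n) = vabs q (of_rat (r i n))" using r i lus vr vabs_of_rat[OF q] by simp
      also have "\<dots> \<le> (\<Sum>z\<in>T. vabs q (L z * rpoly (P n) z))" unfolding e by (rule conjunct2[OF vabs_sum[OF q LQ]])
      also have "\<dots> = (\<Sum>z\<in>T. vabs q (L z) * v (rpoly (P n) a))"
      proof (rule sum.cong)
        fix z assume z: "z \<in> T"
        have "L z \<in> Qbar" "rpoly (P n) z \<in> Qbar" using L(1) TQ z by auto
        thus "vabs q (L z * rpoly (P n) z) = vabs q (L z) * v (rpoly (P n) a)"
          unfolding vz[OF z] by (rule vabs_mult[OF q])
      qed simp
      finally show ?thesis .
    qed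
    have "(\<lambda>n. \<Sum>z\<in>T. vabs q (L z) * v (rpoly (P n) a)) \<longlonglongrightarrow> (\<Sum>z\<in>T. vabs q (L z) * 0)"
      by (intro tendsto_sum tendsto_mult tendsto_const lim)
    hence lim2: "(\<lambda>n. \<Sum>z\<in>T. vabs q (L z) * v (rpoly (P n) a)) \<longlonglongrightarrow> 0" by simp
    have "v ((cs ! i) n) \<ge> 0" for n using r i lus vr rabs_props(1)[OF q] by simp
    thus "(\<lambda>n. v ((cs ! i) n)) \<longlonglongrightarrow> 0"
      using tendsto_sandwich[OF _ _ tendsto_const lim2, of "\<lambda>n. v ((cs ! i) n)"] bnd by simp
  qed
  from local_degree_ge[OF q a ov this[unfolded K_def]]
  show ?thesis unfolding us_def T_def by simp
qed

lemma local_degree_pos: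
  assumes q: "q \<in> PL" and a: "algebraic a" and ov: "v \<in> extensional (Qgen a)" "over_place (Qgen a) q v"
  shows "local_degree (Qgen a) v \<ge> 1"
proof -
  interpret V: valued_field "Qgen a" v using ov(2) by (rule over_placeD(1))
  have "V.indep [\<lambda>_. 1]" unfolding V.indep_def
  proof (intro conjI allI impI)
    show "set [\<lambda>_. 1] \<subseteq> cauchy_seqs (Qgen a) v" using V.cauchy_const[of 1] by simp
  next
    fix cs i
    assume cs: "length cs = length [\<lambda>_::nat. 1::complex] \<and> set cs \<subseteq> cauchy_seqs \<rat> v \<and>
       (\<lambda>n. v (\<Sum>i<length [\<lambda>_::nat. 1::complex]. (cs ! i) n * ([\<lambda>_. 1] ! i) n)) \<longlonglongrightarrow> 0" and i: "i < length [\<lambda>_::nat. 1::complex]"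
    thus "(\<lambda>n. v ((cs ! i) n)) \<longlonglongrightarrow> 0" by simp
  qed
  from local_degree_ge[OF q a ov this] show ?thesis by simp
qed

text \<open>
  By the two inequalities, the places induced by embeddings use up the whole degree. Hence each local degree counts the
  embeddings that induce the place, and there is no further place.
\<close>

lemma places_over_q:
  assumes q: "q \<in> PL" and a: "algebraic a"
  shows "{v \<in> places (Qgen a). over_place (Qgen a) q v} = cplace a q ` conjs a"
    and "(\<Sum>v\<in>cplace a q ` conjs a. real (local_degree (Qgen a) v) * F (v a)) = (\<Sum>z\<in>conjs a. F (vabs q z))"
proof -
  define W where "W = cplace a q ` conjs a"
  have fin: "finite W" unfolding W_def using finite_conjs[OF a] by simp
  have ext: "cplace a q z \<in> extensional (Qgen a)" for z unfolding cplace_def by simp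
  have Wov: "v \<in> extensional (Qgen a) \<and> over_place (Qgen a) q v" if "v \<in> W" for v
    using that cplace_over[OF a _ q] ext unfolding W_def by blast
  define n where "n = (\<lambda>v. card {z \<in> conjs a. cplace a q z = v})"
  have nd: "(\<Sum>v\<in>W. n v) = qdeg a"
  proof -
    have "(\<Sum>v\<in>W. n v) = (\<Sum>v\<in>W. \<Sum>z\<in>{z \<in> conjs a. cplace a q z = v}. 1)" unfolding n_def by simp
    also have "\<dots> = (\<Sum>z\<in>conjs a. 1)" unfolding W_def
      by (rule sum.image_gen[symmetric, OF finite_conjs[OF a]])
    finally show ?thesis using card_conjs[OF a] by simp
  qed
  have le: "n v \<le> local_degree (Qgen a) v" if "v \<in> W" for v
    unfolding n_def using card_conjs_le_local_degree[OF q a] Wov[OF that] by blast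
  have tot: "(\<Sum>v\<in>W. local_degree (Qgen a) v) \<le> qdeg a" by (rule local_degree_sum_le[OF q a fin Wov])
  have eq: "local_degree (Qgen a) v = n v" if "v \<in> W" for v
  proof (rule ccontr)
    assume "local_degree (Qgen a) v \<noteq> n v"
    hence "n v < local_degree (Qgen a) v" using le[OF that] by simp
    hence "(\<Sum>v\<in>W. n v) < (\<Sum>v\<in>W. local_degree (Qgen a) v)"
      by (intro sum_strict_mono_ex1[OF fin]) (use le that in auto)
    thus False using nd tot by simp
  qed
  show "{v \<in> places (Qgen a). over_place (Qgen a) q v} = W"
  proof (intro equalityI subsetI)
    fix v assume "v \<in> W"
    thus "v \<in> {v \<in> places (Qgen a). over_place (Qgen a) q v}" using Wov[of v] q places_Qgen[OF a, of v] by blast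
  next
    fix v assume "v \<in> {v \<in> places (Qgen a). over_place (Qgen a) q v}"
    hence v: "v \<in> extensional (Qgen a)" "over_place (Qgen a) q v" using places_Qgen[OF a, of v] by blast+
    show "v \<in> W"
    proof (rule ccontr)
      assume nW: "v \<notin> W"
      have "(\<Sum>v\<in>insert v W. local_degree (Qgen a) v) \<le> qdeg a"
      proof (rule local_degree_sum_le[OF q a])
        show "finite (insert v W)" using fin by simp
        show "w \<in> extensional (Qgen a) \<and> over_place (Qgen a) q w" if "w \<in> insert v W" for w using that Wov[of w] v by auto
      qed
      hence "local_degree (Qgen a) v + (\<Sum>v\<in>W. n v) \<le> qdeg a" using fin nW eq by simp
      thus False using nd local_degree_pos[OF q a v] by simp
    qed
  qed
  have "(\<Sum>v\<in>W. real (local_degree (Qgen a) v) * F (v a)) = (\<Sum>v\<in>W. \<Sum>z\<in>{z \<in> conjs a. cplace a q z = v}. F (vabs q z))"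
  proof (rule sum.cong)
    fix v assume v: "v \<in> W"
    have "(\<Sum>z\<in>{z \<in> conjs a. cplace a q z = v}. F (vabs q z)) = (\<Sum>z\<in>{z \<in> conjs a. cplace a q z = v}. F (v a))"
    proof (rule sum.cong)
      fix z assume "z \<in> {z \<in> conjs a. cplace a q z = v}"
      hence z: "z \<in> conjs a" "v = cplace a q z" by auto
      show "F (vabs q z) = F (v a)" unfolding z(2) cplace_def using emb_simps(1)[OF a z(1)] by simp
    qed simp
    thus "real (local_degree (Qgen a) v) * F (v a) = (\<Sum>z\<in>{z \<in> conjs a. cplace a q z = v}. F (vabs q z))"
      unfolding eq[OF v] n_def by simp
  qed simp
  also have "\<dots> = (\<Sum>z\<in>conjs a. F (vabs q z))" unfolding W_def
    by (rule sum.image_gen[symmetric, OF finite_conjs[OF a]])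
  finally show "(\<Sum>v\<in>W. real (local_degree (Qgen a) v) * F (v a)) = (\<Sum>z\<in>conjs a. F (vabs q z))" .
qed

lemma rabs_distinct:
  assumes "q \<in> PL" "q' \<in> PL" "\<And>r. rabs q r = rabs q' r" shows "q = q'"
proof -
  have key: "\<not> (\<forall>r. rabs p r = rabs s r)" if p: "prime p" and s: "s \<in> PL" "s \<noteq> p" for p s
  proof -
    have p1: "p > 1" using p prime_gt_1_nat by blast
    have 1: "rabs p (of_nat p) < 1" using padic_abs_self[OF p] p1 by (simp add: rabs_def)
    have "rabs s (of_nat p) \<ge> 1"
    proof (cases "s = 0")
      case True thus ?thesis using p1 by (simp add: rabs_def)
    next
      case False
      hence sp: "prime s" using s by (auto simp: PL_def)
      have "\<not> s dvd p" using p sp s(2) by (metis primes_dvd_imp_eq)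
      hence "multiplicity (int s) (int p) = 0" by (intro not_dvd_imp_multiplicity_0) simp
      thus ?thesis using padic_abs_fraction[OF sp, of "int p" 1] p1 False by (simp add: rabs_def)
    qed
    thus ?thesis using 1 by (metis not_le)
  qed
  show ?thesis
  proof (rule ccontr)
    assume "q \<noteq> q'"
    moreover from this have "q \<noteq> 0 \<or> q' \<noteq> 0" by auto
    ultimately show False using key[of q q'] key[of q' q] assms by (auto simp: PL_def)
  qed
qed

definition lmax :: "nat \<Rightarrow> complex \<Rightarrow> real" where "lmax q x = ln (max 1 (vabs q x))"

lemma lmax_nonneg [simp]: "0 \<le> lmax q x" unfolding lmax_def by simp

text \<open>
  The height as an average over embeddings, for any finite set \<open>P\<close> that contains all places at which some conjugate is large. From
  here on places of number fields and local degrees are replaced by conjugates.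
\<close>

theorem weil_height_formula:
  assumes a: "algebraic a" and P: "finite P" "P \<subseteq> PL"
    and out: "\<And>q z. q \<in> PL - P \<Longrightarrow> z \<in> conjs a \<Longrightarrow> vabs q z \<le> 1"
  shows "weil_height a * real (qdeg a) = (\<Sum>q\<in>P. \<Sum>z\<in>conjs a. lmax q z)"
proof -
  define K where "K = Qgen a"
  define G where "G = (\<lambda>v. real (local_degree K v) / real (qdeg a) * ln (max 1 (v a)))"
  define W where "W = (\<lambda>q. cplace a q ` conjs a)"
  have wh: "weil_height a = (\<Sum>\<^sub>\<infinity>v\<in>places K. G v)"
    unfolding weil_height_def weil_height_wrt_def adjoin_Qgen[OF a] ext_degree_Qgen[OF a] G_def K_def ..
  have finW: "finite (W q)" for q unfolding W_def using finite_conjs[OF a] by simp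
  have Wsub: "W q \<subseteq> places K" if "q \<in> PL" for q using places_over_q(1)[OF that a] unfolding W_def K_def by blast
  have zero: "G v = 0" if v: "v \<in> places K - (\<Union>q\<in>P. W q)" for v
  proof -
    obtain q where q: "q \<in> PL" "over_place K q v" using v places_Qgen[OF a, of v] unfolding K_def by blast
    hence vW: "v \<in> W q" using places_over_q(1)[OF q(1) a] v unfolding W_def K_def by blast
    hence "q \<in> PL - P" using v q(1) by blast
    moreover obtain z where z: "z \<in> conjs a" "v = cplace a q z" using vW unfolding W_def by blast
    moreover have "v a = vabs q z" unfolding z(2) cplace_def using emb_simps(1)[OF a z(1)] by simp
    ultimately have "v a \<le> 1" using out by simp
    thus ?thesis unfolding G_def by (simp add: max_def)
  qed
  have "weil_height a = (\<Sum>\<^sub>\<infinity>v\<in>(\<Union>q\<in>P. W q). G v)"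
    unfolding wh by (rule infsum_cong_neutral) (use zero Wsub P(2) in auto)
  also have "\<dots> = (\<Sum>v\<in>(\<Union>q\<in>P. W q). G v)"
    by (rule infsum_finite) (use P(1) finW in auto)
  also have "\<dots> = (\<Sum>q\<in>P. \<Sum>v\<in>W q. G v)"
  proof (rule sum.UNION_disjoint[OF P(1)])
    show "\<forall>q\<in>P. finite (W q)" using finW by simp
    show "\<forall>q\<in>P. \<forall>q'\<in>P. q \<noteq> q' \<longrightarrow> W q \<inter> W q' = {}"
    proof (intro ballI impI)
      fix q q' assume qq: "q \<in> P" "q' \<in> P" "q \<noteq> q'"
      show "W q \<inter> W q' = {}"
      proof (rule ccontr)
        assume "W q \<inter> W q' \<noteq> {}"
        then obtain v where v: "v \<in> W q" "v \<in> W q'" by blast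
        have "over_place K q v" "over_place K q' v"
          using v places_over_q(1)[of q a, OF _ a] places_over_q(1)[of q' a, OF _ a] qq P(2) unfolding W_def K_def by blast+
        hence "rabs q r = rabs q' r" for r using over_placeD(2) by metis
        thus False using rabs_distinct[of q q'] qq P(2) by blast
      qed
    qed
  qed
  also have "\<dots> = (\<Sum>q\<in>P. (\<Sum>z\<in>conjs a. lmax q z) / real (qdeg a))"
  proof (rule sum.cong)
    fix q assume "q \<in> P"
    hence q: "q \<in> PL" using P(2) by blast
    have "(\<Sum>v\<in>W q. G v) = (\<Sum>v\<in>W q. real (local_degree K v) * ln (max 1 (v a))) / real (qdeg a)"
      unfolding G_def sum_divide_distrib by simp
    also have "\<dots> = (\<Sum>z\<in>conjs a. lmax q z) / real (qdeg a)"
      unfolding W_def K_def lmax_def using places_over_q(2)[OF q a, of "\<lambda>t. ln (max 1 t)"] by simp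
    finally show "(\<Sum>v\<in>W q. G v) = (\<Sum>z\<in>conjs a. lmax q z) / real (qdeg a)" .
  qed simp
  finally show ?thesis using qdeg_pos[OF a] by (simp add: sum_divide_distrib[symmetric])
qed

section \<open>Characteristic polynomials and traces\<close>

definition vdm :: "complex list \<Rightarrow> complex mat" where
  "vdm zs = mat (length zs) (length zs) (\<lambda>(i, j). zs ! i ^ j)"

lemma det_vdm_nonzero:
  assumes "distinct zs" shows "det (vdm zs) \<noteq> 0"
proof
  define n where "n = length zs"
  have A: "vdm zs \<in> carrier_mat n n" unfolding vdm_def n_def by simp
  assume "det (vdm zs) = 0"
  then obtain w where w: "w \<in> carrier_vec n" "w \<noteq> 0\<^sub>v n" "vdm zs *\<^sub>v w = 0\<^sub>v n"
    using det_0_iff_vec_prod_zero_field[OF A] by blast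
  define P where "P = (\<Sum>j<n. monom (w $ j) j)"
  have cP: "coeff P j = (if j < n then w $ j else 0)" for j unfolding P_def by (simp add: coeff_sum)
  have root: "poly P z = 0" if zS: "z \<in> set zs" for z
  proof -
    obtain i where i: "i < n" "z = zs ! i" using zS unfolding n_def in_set_conv_nth by blast
    have "poly P z = (\<Sum>j<n. zs ! i ^ j * (w $ j))" unfolding P_def i(2) poly_sum poly_monom
      by (rule sum.cong[OF refl], rule mult.commute)
    also have "\<dots> = (vdm zs *\<^sub>v w) $ i" using i w(1) by (simp add: vdm_def scalar_prod_def n_def atLeast0LessThan)
    also have "\<dots> = 0" unfolding w(3) using i by simp
    finally show ?thesis .
  qed
  have "P = 0"
  proof (rule ccontr)
    assume P0: "P \<noteq> 0"
    hence "n > 0" unfolding P_def by (cases n) auto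
    have "degree P \<le> n - 1" by (rule degree_le) (use cP in auto)
    have "card (set zs) \<le> card {z. poly P z = 0}" by (rule card_mono) (use root poly_roots_finite[OF P0] in auto)
    also have "\<dots> \<le> degree P" by (rule card_poly_roots_bound) (rule P0)
    also have "\<dots> < n" using \<open>degree P \<le> n - 1\<close> \<open>n > 0\<close> by simp
    finally show False using distinct_card[OF assms] n_def by simp
  qed
  hence "w $ j = 0" if "j < n" for j using cP[of j] that by simp
  hence "w = 0\<^sub>v n" using w(1) by (intro eq_vecI) auto
  thus False using w(2) by simp
qed

lemma conjs_list:
  assumes "algebraic a" obtains zs where "set zs = conjs a" "distinct zs" "length zs = qdeg a"
  using finite_distinct_list[OF finite_conjs[OF assms]] card_conjs[OF assms] distinct_card by metis

text \<open>
  This is the characteristic polynomial of multiplication by \<open>g(a)\<close>: the Vandermonde matrix of the conjugates of \<open>a\<close>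
  diagonalises its matrix with respect to the powers of \<open>a\<close>.
\<close>

lemma char_poly_conj:
  assumes a: "algebraic a"
  shows "\<exists>ch :: rat poly. cxp ch = (\<Prod>z\<in>conjs a. [:- rpoly g z, 1:])"
proof -
  define n where "n = qdeg a"
  obtain zs where zs: "set zs = conjs a" "distinct zs" "length zs = n" using conjs_list[OF a] n_def by metis
  define H where "H = (\<lambda>i. (monom 1 i * g) mod minpol a)"
  define M where "M = mat n n (\<lambda>(i, j). coeff (H i) j)"
  define MC where "MC = map_mat (of_rat :: rat \<Rightarrow> complex) M"
  have M: "M \<in> carrier_mat n n" "MC \<in> carrier_mat n n" unfolding M_def MC_def by simp_all
  have Hz: "(\<Sum>j<n. of_rat (coeff (H i) j) * z ^ j) = z ^ i * rpoly g z" if "z \<in> conjs a" for z i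
  proof -
    have "rpoly (minpol a) z = 0" using that by (simp add: conjs_def)
    have "monom 1 i * g = ((monom 1 i * g) div minpol a) * minpol a + H i" unfolding H_def by simp
    hence "rpoly (monom 1 i * g) z = rpoly (((monom 1 i * g) div minpol a) * minpol a + H i) z" by simp
    also have "\<dots> = rpoly (H i) z" using \<open>rpoly (minpol a) z = 0\<close> by (simp only: rpoly_simps) simp
    also have "\<dots> = (\<Sum>j\<le>degree (H i). of_rat (coeff (H i) j) * z ^ j)" unfolding poly_altdef by simp
    also have "\<dots> = (\<Sum>j<n. of_rat (coeff (H i) j) * z ^ j)"
    proof (rule sum.mono_neutral_left)
      have "degree (H i) < n" unfolding H_def n_def qdeg_def
        using degree_mod_less[OF minpol_nz[OF a], of "monom 1 i * g"] degree_minpol_pos[OF a] by auto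
      thus "{..degree (H i)} \<subseteq> {..<n}" by auto
      show "\<forall>j\<in>{..<n} - {..degree (H i)}. of_rat (coeff (H i) j) * z ^ j = 0" by (auto intro: coeff_eq_0)
    qed simp
    finally show ?thesis by (simp add: poly_monom hom_distribs)
  qed
  define V where "V = transpose_mat (vdm zs)"
  have V: "V \<in> carrier_mat n n" unfolding V_def vdm_def using zs(3) by simp
  define D where "D = mat n n (\<lambda>(i, j). if i = j then rpoly g (zs ! i) else 0)"
  have D: "D \<in> carrier_mat n n" unfolding D_def by simp
  have MV: "MC * V = V * D"
  proof (rule eq_matI)
    fix i j assume "i < dim_row (V * D)" "j < dim_col (V * D)"
    hence ij: "i < n" "j < n" using V D by auto
    have zj: "zs ! j \<in> conjs a" using zs ij by (metis nth_mem)
    have "(MC * V) $$ (i, j) = (\<Sum>k<n. of_rat (coeff (H i) k) * (zs ! j) ^ k)"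
      using ij zs(3) by (simp add: MC_def M_def V_def vdm_def scalar_prod_def atLeast0LessThan)
    also have "\<dots> = (zs ! j) ^ i * rpoly g (zs ! j)" by (rule Hz[OF zj])
    also have "\<dots> = (\<Sum>k<n. (zs ! k) ^ i * (if k = j then rpoly g (zs ! k) else 0))"
      by (subst sum.remove[of _ j]) (use ij in auto)
    also have "\<dots> = (V * D) $$ (i, j)"
      using ij zs(3) by (simp add: D_def V_def vdm_def scalar_prod_def atLeast0LessThan)
    finally show "(MC * V) $$ (i, j) = (V * D) $$ (i, j)" .
  qed (use M V D in auto)
  have dV: "det V \<noteq> 0" unfolding V_def using det_vdm_nonzero[OF zs(2)] det_transpose[of "vdm zs" n] zs(3) by (simp add: vdm_def)
  from det_non_zero_imp_unit[OF V dV] obtain W where W: "W \<in> carrier_mat n n" "W * V = 1\<^sub>m n" "V * W = 1\<^sub>m n"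
    unfolding Units_def by (auto simp: ring_mat_simps)
  have "MC = V * D * W"
  proof -
    have "V * D * W = MC * V * W" unfolding MV ..
    also have "\<dots> = MC * (V * W)" by (rule assoc_mult_mat[OF M(2) V W(1)])
    also have "\<dots> = MC" unfolding W(3) using M(2) by simp
    finally show ?thesis ..
  qed
  hence "similar_mat MC D" using W V D M by (intro similar_matI[of _ _ V W n]) auto
  hence "char_poly MC = char_poly D" by (rule char_poly_similar)
  also have "\<dots> = (\<Prod>x\<leftarrow>diag_mat D. [:- x, 1:])"
    by (rule char_poly_upper_triangular[OF D]) (auto simp: D_def)
  also have "diag_mat D = map (rpoly g) zs"
    unfolding diag_mat_def using zs(3) by (intro nth_equalityI) (auto simp: D_def)
  also have "(\<Prod>x\<leftarrow>map (rpoly g) zs. [:- x, 1:]) = (\<Prod>z\<in>conjs a. [:- rpoly g z, 1:])"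
    unfolding zs(1)[symmetric] using prod.distinct_set_conv_list[OF zs(2), of "\<lambda>z. [:- rpoly g z, 1:]"] by (simp add: o_def)
  finally have "char_poly MC = (\<Prod>z\<in>conjs a. [:- rpoly g z, 1:])" .
  moreover have "char_poly MC = cxp (char_poly M)" unfolding MC_def by (rule of_rat_hom.char_poly_hom[OF M(1)])
  ultimately show ?thesis by metis
qed

lemma order_prod_linear:
  assumes "finite S" shows "order y (\<Prod>z\<in>S. [:- f z, 1:]) = card {z\<in>S. f z = (y::complex)}"
  using assms
proof (induction S rule: finite_induct)
  case (insert z S)
  have nz: "(\<Prod>z\<in>S. [:- f z, 1:]) \<noteq> 0" using insert by simp
  have "order y [:- f z, 1:] = (if f z = y then 1 else 0)"
    using order_linear[of "f z"] by (auto simp: order_0I)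
  moreover have "{w \<in> insert z S. f w = y} = (if f z = y then insert z {w \<in> S. f w = y} else {w \<in> S. f w = y})" by auto
  moreover have "order y (\<Prod>z\<in>insert z S. [:- f z, 1:]) = order y [:- f z, 1:] + order y (\<Prod>z\<in>S. [:- f z, 1:])"
    using insert nz by (simp add: order_mult del: mult_pCons_left)
  ultimately show ?case using insert by simp
qed (simp add: order_0I)

abbreviation emb_matrix :: "nat \<Rightarrow> complex \<Rightarrow> complex list \<Rightarrow> (nat \<Rightarrow> complex) \<Rightarrow> complex mat" where
  "emb_matrix n a zs x \<equiv> mat n n (\<lambda>(s, t). emb a (zs ! s) (x t))"

lemma emb_in_conjs:
  assumes a: "algebraic a" "z \<in> conjs a" and x: "x \<in> Qgen a"
  shows "emb a z x \<in> conjs x"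
proof -
  obtain g where g: "x = rpoly g a" using x by (rule QgenE)
  have xa: "algebraic x" unfolding g
    using a(1) by (induction g) (auto simp: hom_distribs rat_imp_algebraic intro!: algebraic_add_mult)
  have "rpoly (pcompose (minpol x) g) a = rpoly (minpol x) (rpoly g a)"
    by (simp add: of_rat_hom.map_poly_pcompose poly_pcompose)
  also have "\<dots> = 0" using minpol_props(1)[OF xa] g by simp
  finally have "rpoly (pcompose (minpol x) g) z = 0" using conjs_rpoly_0[OF a] by blast
  hence "rpoly (minpol x) (rpoly g z) = 0" by (simp add: of_rat_hom.map_poly_pcompose poly_pcompose)
  thus ?thesis unfolding conjs_def g emb_rpoly[OF a] using g by simp
qed

lemma Qgen_algebraic: "algebraic a \<Longrightarrow> x \<in> Qgen a \<Longrightarrow> algebraic x"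
proof (erule QgenE)
  fix g assume a: "algebraic a" "x = rpoly g a"
  show "algebraic x" unfolding a(2)
    using a(1) by (induction g) (auto simp: hom_distribs rat_imp_algebraic intro!: algebraic_add_mult)
qed

text \<open>
  The rational polynomial of \<open>char_poly_conj\<close> has no roots but the conjugates of \<open>x\<close>, so it is a constant multiple of a power of the minimal
  polynomial of \<open>x\<close>. Comparison of multiplicities shows that all conjugates of \<open>x\<close> are hit equally often.
\<close>

lemma conj_fibres:
  assumes a: "algebraic a" and x: "x \<in> Qgen a"
  shows "\<exists>k. qdeg a = k * qdeg x \<and>
    (\<forall>F :: complex \<Rightarrow> 'b :: comm_semiring_1. (\<Sum>z\<in>conjs a. F (emb a z x)) = of_nat k * (\<Sum>y\<in>conjs x. F y))"
proof -
  have xa: "algebraic x" by (rule Qgen_algebraic[OF a x])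
  obtain g where g: "x = rpoly g a" using x by (rule QgenE)
  have eg: "emb a z x = rpoly g z" if "z \<in> conjs a" for z unfolding g by (rule emb_rpoly[OF a that])
  obtain ch where ch: "cxp ch = (\<Prod>z\<in>conjs a. [:- rpoly g z, 1:])" using char_poly_conj[OF a] by blast
  have ch0: "ch \<noteq> 0" 
  proof
    assume "ch = 0"
    hence "(\<Prod>z\<in>conjs a. [:- rpoly g z, 1:]) = 0" using ch by simp
    thus False using finite_conjs[OF a] by simp
  qed
  define m where "m = minpol x"
  have m: "m \<noteq> 0" "degree m > 0" "\<not> is_unit m" unfolding m_def using minpol_nz[OF xa] degree_minpol_pos[OF xa]
    by (auto simp: is_unit_iff_degree)
  define k where "k = multiplicity m ch"
  obtain h where h: "ch = m ^ k * h" "\<not> m dvd h"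
    unfolding k_def using multiplicity_decompose'[OF ch0 m(3)] by metis
  have "degree h = 0"
  proof (rule ccontr)
    assume "degree h \<noteq> 0"
    hence "\<not> constant (poly (cxp h))" by (simp add: constant_degree)
    then obtain y where y: "rpoly h y = 0" using fundamental_theorem_of_algebra by blast
    have "rpoly ch y = 0" unfolding h(1) using y by simp
    then obtain z where z: "z \<in> conjs a" "y = rpoly g z" unfolding ch poly_prod using finite_conjs[OF a] by (auto simp: prod_zero_iff)
    hence yc: "y \<in> conjs x" using emb_in_conjs[OF a z(1) x] eg[OF z(1)] by simp
    have "minpol y dvd h" using minpol_dvd_iff[OF conjs_algebraic[OF xa yc]] y by blast
    thus False using h(2) conjs_minpol[OF xa yc] m_def by simp
  qed
  then obtain r where r: "h = [:r:]" by (auto elim: degree_eq_zeroE)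
  have r0: "r \<noteq> 0" using r h(1) ch0 by auto
  have ord: "card {z \<in> conjs a. emb a z x = y} = k" if y: "y \<in> conjs x" for y
  proof -
    have "{z \<in> conjs a. emb a z x = y} = {z \<in> conjs a. rpoly g z = y}" using eg by auto
    hence "card {z \<in> conjs a. emb a z x = y} = order y (cxp ch)"
      unfolding ch by (simp add: order_prod_linear[OF finite_conjs[OF a]])
    also have "cxp ch = cxp m ^ k * [:of_rat r:]" unfolding h(1) r by (simp add: hom_distribs)
    also have "order y (cxp m ^ k * [:of_rat r:]) = order y (cxp m ^ k)" using m r0 by (subst order_mult) (auto simp: order_0I)
    also have "\<dots> = k * order y (cxp m)"
      using m(1) by (induction k) (auto simp: order_mult order_0I)
    also have "order y (cxp m) = card {z \<in> conjs x. z = y}"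
      unfolding m_def minpol_decomp[OF xa] by (rule order_prod_linear[OF finite_conjs[OF xa]])
    also have "{z \<in> conjs x. z = y} = {y}" using y by auto
    finally show ?thesis by simp
  qed
  have F: "(\<Sum>z\<in>conjs a. F (emb a z x)) = of_nat k * (\<Sum>y\<in>conjs x. F y)" for F :: "complex \<Rightarrow> 'c :: comm_semiring_1"
  proof -
    have "(\<Sum>z\<in>conjs a. F (emb a z x)) = (\<Sum>y\<in>conjs x. \<Sum>z\<in>{z \<in> conjs a. emb a z x = y}. F (emb a z x))"
      by (rule sum.group[symmetric]) (use finite_conjs[OF a] finite_conjs[OF xa] emb_in_conjs[OF a _ x] in auto)
    also have "\<dots> = (\<Sum>y\<in>conjs x. of_nat k * F y)"
    proof (rule sum.cong)
      fix y assume y: "y \<in> conjs x"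
      have "(\<Sum>z\<in>{z \<in> conjs a. emb a z x = y}. F (emb a z x)) = (\<Sum>z\<in>{z \<in> conjs a. emb a z x = y}. F y)"
        by (rule sum.cong) auto
      thus "(\<Sum>z\<in>{z \<in> conjs a. emb a z x = y}. F (emb a z x)) = of_nat k * F y" using ord[OF y] by simp
    qed simp
    finally show ?thesis by (simp add: sum_distrib_left)
  qed
  have "qdeg a = k * qdeg x" using F[of "\<lambda>_. 1 :: nat"] card_conjs[OF a] card_conjs[OF xa] by simp
  thus ?thesis using F by blast
qed

lemma coeff_prod_linear_sum:
  assumes "finite S" "S \<noteq> {}"
  shows "coeff (\<Prod>y\<in>S. [:- y, 1:]) (card S - 1) = - (\<Sum>y\<in>S. y :: complex)"
proof -
  have "coeff (\<Prod>y\<in>S. [:- y, 1:]) (card S) = 1 \<and>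
    (S \<noteq> {} \<longrightarrow> coeff (\<Prod>y\<in>S. [:- y, 1:]) (card S - 1) = - (\<Sum>y\<in>S. y))" using assms(1)
  proof (induction S rule: finite_induct)
    case (insert y S)
    have d: "coeff (\<Prod>y\<in>S. [:- y, 1:]) (Suc (card S)) = 0"
      by (rule coeff_eq_0) (use insert(1) in \<open>simp add: degree_prod_eq_sum_degree\<close>)
    show ?case
    proof (cases "S = {}")
      case False
      then obtain c where c: "card S = Suc c" using insert(1) by (metis card_0_eq not0_implies_Suc)
      show ?thesis using insert d False c by (simp add: coeff_pCons)
    qed simp
  qed simp
  thus ?thesis using assms(2) by blast
qed

definition trace :: "complex \<Rightarrow> complex \<Rightarrow> complex" where
  "trace a x = (\<Sum>z\<in>conjs a. emb a z x)"

lemma trace_rational: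
  assumes a: "algebraic a" and x: "x \<in> Qgen a"
  shows "\<exists>r. trace a x = of_rat r"
proof -
  have xa: "algebraic x" by (rule Qgen_algebraic[OF a x])
  obtain k where k: "\<And>F :: complex \<Rightarrow> complex. (\<Sum>z\<in>conjs a. F (emb a z x)) = of_nat k * (\<Sum>y\<in>conjs x. F y)"
    using conj_fibres[OF a x] by blast
  have "conjs x \<noteq> {}" using conjs_self[OF xa] by blast
  hence "(\<Sum>y\<in>conjs x. y) = - coeff (cxp (minpol x)) (card (conjs x) - 1)"
    unfolding minpol_decomp[OF xa] using coeff_prod_linear_sum[OF finite_conjs[OF xa]] by simp
  also have "\<dots> = of_rat (- coeff (minpol x) (card (conjs x) - 1))" by (simp add: of_rat_minus coeff_map_poly)
  finally have "(\<Sum>y\<in>conjs x. y) = of_rat (- coeff (minpol x) (card (conjs x) - 1))" .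
  hence "trace a x = of_rat (of_nat k * (- coeff (minpol x) (card (conjs x) - 1)))"
    unfolding trace_def using k[of "\<lambda>y. y"] by (simp only: of_rat_mult of_rat_of_nat_eq)
  thus ?thesis by blast
qed

text \<open>
  The matrix is the product of the Vandermonde matrix of the conjugates and the rational matrix of coordinates in the powers
  of \<open>a\<close>; both are invertible.
\<close>

lemma emb_det_nonzero:
  assumes a: "algebraic a" and zs: "set zs = conjs a" "distinct zs" "length zs = n"
    and x: "\<And>t. t < n \<Longrightarrow> x t \<in> Qgen a"
    and ind: "\<And>c :: nat \<Rightarrow> rat. (\<Sum>t<n. of_rat (c t) * x t) = 0 \<Longrightarrow> \<forall>t<n. c t = 0"
  shows "det (emb_matrix n a zs x) \<noteq> 0"
proof -
  have n: "n = qdeg a" using zs card_conjs[OF a] distinct_card by metis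
  have "\<exists>h. x t = rpoly h a \<and> (\<forall>i\<ge>n. coeff h i = 0)" if "t < n" for t
    using Qgen_reduced[OF a x[OF that]] n by metis
  then obtain h where h: "\<And>t. t < n \<Longrightarrow> x t = rpoly (h t) a \<and> (\<forall>i\<ge>n. coeff (h t) i = 0)" by metis
  have ev: "rpoly (h t) z = (\<Sum>j<n. z ^ j * of_rat (coeff (h t) j))" if "t < n" for t z
  proof -
    have n0: "n > 0" using that by simp
    have "degree (h t) \<le> n - 1" by (rule degree_le) (use h[OF that] in auto)
    have "rpoly (h t) z = (\<Sum>j\<le>degree (h t). z ^ j * of_rat (coeff (h t) j))" unfolding poly_altdef by (simp add: mult.commute)
    also have "\<dots> = (\<Sum>j<n. z ^ j * of_rat (coeff (h t) j))"
      by (rule sum.mono_neutral_left) (use \<open>degree (h t) \<le> n - 1\<close> n0 in \<open>auto intro: coeff_eq_0\<close>)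
    finally show ?thesis .
  qed
  define H where "H = mat n n (\<lambda>(j, t). coeff (h t) j)"
  define HC where "HC = map_mat (of_rat :: rat \<Rightarrow> complex) H"
  have HM: "H \<in> carrier_mat n n" "HC \<in> carrier_mat n n" unfolding H_def HC_def by simp_all
  have V: "vdm zs \<in> carrier_mat n n" unfolding vdm_def using zs(3) by simp
  have "emb_matrix n a zs x = vdm zs * HC"
  proof (rule eq_matI)
    fix s t assume "s < dim_row (vdm zs * HC)" "t < dim_col (vdm zs * HC)"
    hence st: "s < n" "t < n" using V HM by auto
    have z: "zs ! s \<in> conjs a" using zs st by (metis nth_mem)
    have "emb a (zs ! s) (x t) = rpoly (h t) (zs ! s)" using h[OF st(2)] emb_rpoly[OF a z] by simp
    also have "\<dots> = (vdm zs * HC) $$ (s, t)" unfolding ev[OF st(2)]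
      using st zs(3) by (simp add: vdm_def HC_def H_def scalar_prod_def atLeast0LessThan)
    finally show "emb_matrix n a zs x $$ (s, t) = (vdm zs * HC) $$ (s, t)" using st by simp
  qed (use V HM in auto)
  hence "det (emb_matrix n a zs x) = det (vdm zs) * det HC" using det_mult[OF V HM(2)] by simp
  moreover have "det HC = of_rat (det H)" unfolding HC_def by (rule of_rat_hom.hom_det)
  moreover have "det H \<noteq> 0"
  proof
    assume "det H = 0"
    then obtain w where w: "w \<in> carrier_vec n" "w \<noteq> 0\<^sub>v n" "H *\<^sub>v w = 0\<^sub>v n"
      using det_0_iff_vec_prod_zero_field[OF HM(1)] by blast
    have Hw: "(\<Sum>t<n. coeff (h t) j * w $ t) = 0" if "j < n" for j
    proof -
      have "(H *\<^sub>v w) $ j = (\<Sum>t<n. coeff (h t) j * w $ t)"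
        using that w(1) by (simp add: H_def scalar_prod_def atLeast0LessThan)
      thus ?thesis unfolding w(3) using that by simp
    qed
    have "(\<Sum>t<n. of_rat (w $ t) * x t) = (\<Sum>t<n. \<Sum>j<n. of_rat (w $ t) * (a ^ j * of_rat (coeff (h t) j)))"
      by (rule sum.cong) (use h ev in \<open>auto simp: sum_distrib_left\<close>)
    also have "\<dots> = (\<Sum>j<n. \<Sum>t<n. of_rat (w $ t) * (a ^ j * of_rat (coeff (h t) j)))" by (rule sum.swap)
    also have "\<dots> = (\<Sum>j<n. a ^ j * of_rat (\<Sum>t<n. coeff (h t) j * w $ t))"
      by (simp add: of_rat_sum of_rat_mult sum_distrib_left mult_ac)
    also have "\<dots> = 0" using Hw by simp
    finally have "\<forall>t<n. w $ t = 0" by (rule ind)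
    hence "w = 0\<^sub>v n" using w(1) by (intro eq_vecI) auto
    thus False using w(2) by simp
  qed
  ultimately show ?thesis using det_vdm_nonzero[OF zs(2)] by simp
qed

section \<open>Polynomials over subfields\<close>

definition cin :: "complex set \<Rightarrow> complex poly \<Rightarrow> bool" where "cin K p \<longleftrightarrow> (\<forall>i. coeff p i \<in> K)"

lemma subfield_sum: "subfield K complex_ring \<Longrightarrow> (\<And>i. i \<in> I \<Longrightarrow> f i \<in> K) \<Longrightarrow> sum f I \<in> K"
  by (induction I rule: infinite_finite_induct) (auto simp: subfield_complexD)

lemma subfield_diff: "subfield K complex_ring \<Longrightarrow> x \<in> K \<Longrightarrow> y \<in> K \<Longrightarrow> x - y \<in> K"
  using subfield_complexD(3)[of K x "- y"] subfield_complexD(5)[of K y] by simp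

lemma cin_add: "subfield K complex_ring \<Longrightarrow> cin K p \<Longrightarrow> cin K q \<Longrightarrow> cin K (p + q)"
  unfolding cin_def by (simp add: subfield_complexD)
lemma cin_diff: "subfield K complex_ring \<Longrightarrow> cin K p \<Longrightarrow> cin K q \<Longrightarrow> cin K (p - q)"
  unfolding cin_def by (simp add: subfield_diff)
lemma cin_mult: "subfield K complex_ring \<Longrightarrow> cin K p \<Longrightarrow> cin K q \<Longrightarrow> cin K (p * q)"
  unfolding cin_def coeff_mult by (auto intro!: subfield_sum subfield_complexD(4))
lemma cin_monom: "subfield K complex_ring \<Longrightarrow> c \<in> K \<Longrightarrow> cin K (monom c n)"
  unfolding cin_def by (simp add: subfield_complexD)
lemma cin_smult: "subfield K complex_ring \<Longrightarrow> c \<in> K \<Longrightarrow> cin K p \<Longrightarrow> cin K (smult c p)"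
  unfolding cin_def by (simp add: subfield_complexD)
lemma cin_const: "subfield K complex_ring \<Longrightarrow> c \<in> K \<Longrightarrow> cin K [:c:]"
  unfolding cin_def by (auto simp: coeff_pCons subfield_complexD split: nat.splits)
lemma cin_cxp: "subfield K complex_ring \<Longrightarrow> cin K (cxp g)"
  unfolding cin_def using subfield_Rats[of K] by (auto simp: coeff_map_poly)
lemma cin_mono: "cin K p \<Longrightarrow> K \<subseteq> L \<Longrightarrow> cin L p" unfolding cin_def by blast

lemma cin_pcompose: 
  assumes K: "subfield K complex_ring" "cin K q" shows "cin K p \<Longrightarrow> cin K (pcompose p q)"
proof (induction p)
  case 0 thus ?case by (simp add: cin_def)
next
  case (pCons a p)
  have "cin K p" unfolding cin_def
  proof
    fix i show "coeff p i \<in> K" using pCons.prems[unfolded cin_def, rule_format, of "Suc i"] by simp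
  qed
  moreover have "a \<in> K" using pCons.prems[unfolded cin_def, rule_format, of 0] by simp
  ultimately show ?case unfolding pcompose_pCons
    by (intro cin_add cin_mult cin_const K pCons.IH)
qed

lemma cin_division:
  assumes K: "subfield K complex_ring" and m: "cin K m" "lead_coeff m = 1" and p: "cin K p"
  shows "\<exists>q r. p = q * m + r \<and> cin K r \<and> (r = 0 \<or> degree r < degree m)"
  using p
proof (induction "degree p" arbitrary: p rule: less_induct)
  case less
  show ?case
  proof (cases "p = 0 \<or> degree p < degree m")
    case True thus ?thesis using less.prems by (intro exI[of _ 0] exI[of _ p]) auto
  next
    case False
    define t where "t = monom (lead_coeff p) (degree p - degree m)"
    define p' where "p' = p - t * m"
    have cp': "cin K p'" unfolding p'_def t_def
      using less.prems m K by (intro cin_diff cin_mult cin_monom) (auto simp: cin_def)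
    show ?thesis
    proof (cases "p' = 0")
      case True
      hence "p = t * m + 0" unfolding p'_def by simp
      thus ?thesis using subfield_complexD(2)[OF K] by (intro exI[of _ t] exI[of _ 0]) (simp add: cin_def)
    next
      case nz: False
      have dt: "degree (t * m) \<le> degree p"
        using False degree_mult_le[of t m] degree_monom_le[of "lead_coeff p" "degree p - degree m"] unfolding t_def by linarith
      have "coeff (t * m) (degree p) = lead_coeff p"
        using False m(2) coeff_monom_mult[of "lead_coeff p" "degree p - degree m" m "degree p"] unfolding t_def by simp
      hence "coeff p' (degree p) = 0" unfolding p'_def by simp
      moreover have "degree p' \<le> degree p" unfolding p'_def using dt by (intro degree_diff_le) auto
      ultimately have "degree p' < degree p" using nz by (metis leading_coeff_0_iff order.not_eq_order_implies_strict)
      from less.hyps[OF this cp'] obtain q r where qr: "p' = q * m + r" "cin K r" "r = 0 \<or> degree r < degree m" by blast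
      have "p = (q + t) * m + r" using qr(1) unfolding p'_def by (simp add: algebra_simps)
      thus ?thesis using qr by blast
    qed
  qed
qed

lemma minimal_over:
  assumes K: "subfield K complex_ring" and a: "algebraic a"
  obtains m where "cin K m" "lead_coeff m = 1" "poly m a = 0" "\<And>p. cin K p \<Longrightarrow> poly p a = 0 \<Longrightarrow> m dvd p"
proof -
  define P where "P = (\<lambda>p. cin K p \<and> p \<noteq> 0 \<and> poly p a = 0)"
  have P0: "P (cxp (minpol a))" unfolding P_def using minpol_props(1)[OF a] minpol_nz[OF a] cin_cxp[OF K] by simp
  define p where "p = arg_min degree P"
  have p: "P p" "\<And>q. P q \<Longrightarrow> degree p \<le> degree q"
    unfolding p_def using arg_min_nat_lemma[of P _ degree, OF P0] by auto
  define m where "m = smult (inverse (lead_coeff p)) p"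
  have lp: "inverse (lead_coeff p) \<in> K" using p(1) K unfolding P_def cin_def by (simp add: subfield_complexD)
  have nz: "lead_coeff p \<noteq> 0" using p(1) unfolding P_def by simp
  have m: "cin K m" "lead_coeff m = 1" "poly m a = 0" "degree m = degree p"
    unfolding m_def using p(1) lp nz cin_smult[OF K] unfolding P_def by auto
  have "m dvd f" if f: "cin K f" "poly f a = 0" for f
  proof -
    obtain q r where qr: "f = q * m + r" "cin K r" "r = 0 \<or> degree r < degree m" using cin_division[OF K m(1,2) f(1)] by blast
    have "poly r a = 0" using f(2) m(3) unfolding qr(1) by simp
    hence "r = 0" using p(2)[of r] qr m(4) unfolding P_def by (metis not_le)
    thus ?thesis using qr by simp
  qed
  thus ?thesis using that m by blast
qed

text \<open>
  For all but finitely many \<open>t\<close>, the polynomials \<open>minpol c\<close> and \<open>minpol b\<close> composed with \<open>th - t * X\<close>, where \<open>th = b + t * c\<close>, have only the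
  root \<open>c\<close> in common. So the minimal polynomial of \<open>c\<close> over the field of \<open>th\<close> is linear.
\<close>

lemma primitive_element:
  assumes b: "algebraic b" and c: "algebraic c"
  shows "\<exists>t :: rat. b \<in> Qgen (b + of_rat t * c) \<and> c \<in> Qgen (b + of_rat t * c)"
proof -
  define bad where "bad = (\<lambda>(b', c'). (b' - b) / (c - c')) ` (conjs b \<times> conjs c)"
  have "finite bad" unfolding bad_def using finite_conjs[OF b] finite_conjs[OF c] by simp
  hence "finite {n :: nat. of_nat n \<in> bad}"
    by (rule finite_vimageI[of bad "of_nat :: nat \<Rightarrow> complex", unfolded vimage_def]) (simp add: inj_on_def)
  then obtain n :: nat where n: "of_nat n \<notin> bad" using infinite_UNIV_nat by (metis (mono_tags, lifting) UNIV_I finite_subset mem_Collect_eq subsetI)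
  define t :: complex where "t = of_nat n"
  define th where "th = b + t * c"
  have th: "algebraic th" unfolding th_def t_def using b c by (intro algebraic_add_mult) (auto simp: rat_imp_algebraic)
  define K where "K = Qgen th"
  have K: "subfield K complex_ring" unfolding K_def by (rule Qgen_subfield[OF th])
  have tK: "t \<in> K" unfolding K_def t_def using Qgen_of_rat[of "of_nat n" th] by simp
  have thK: "th \<in> K" unfolding K_def by simp
  obtain m where m: "cin K m" "lead_coeff m = 1" "poly m c = 0" "\<And>p. cin K p \<Longrightarrow> poly p c = 0 \<Longrightarrow> m dvd p"
    using minimal_over[OF K c] by blast
  define F where "F = pcompose (cxp (minpol b)) [:th, - t:]"
  have "cin K [:th, - t:]" unfolding cin_def using tK thK K by (auto simp: coeff_pCons subfield_complexD split: nat.splits)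
  hence "cin K F" unfolding F_def by (intro cin_pcompose K cin_cxp)
  moreover have "poly F c = 0" unfolding F_def poly_pcompose using minpol_props(1)[OF b] by (simp add: th_def mult.commute)
  ultimately have mF: "m dvd F" by (rule m(4))
  have mg: "m dvd cxp (minpol c)" by (rule m(4)[OF cin_cxp[OF K]]) (rule minpol_props(1)[OF c])
  have root: "y = c" if y: "poly m y = 0" for y
  proof (rule ccontr)
    assume ne: "y \<noteq> c"
    have "poly F y = 0" using mF y by (auto elim!: dvdE)
    hence "th - t * y \<in> conjs b" unfolding F_def poly_pcompose conjs_def by (simp add: mult.commute)
    moreover have "y \<in> conjs c" using mg y unfolding conjs_def by (auto elim!: dvdE)
    ultimately have "((th - t * y) - b) / (c - y) \<in> bad" unfolding bad_def by (intro image_eqI[of _ _ "(th - t * y, y)"]) auto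
    moreover have "((th - t * y) - b) / (c - y) = t" unfolding th_def using ne by (simp add: field_simps)
    ultimately show False using n unfolding t_def by simp
  qed
  obtain m' where m': "m = [:- c, 1:] * m'" using m(3) poly_eq_0_iff_dvd by (metis dvdE)
  have "degree m' = 0"
  proof (rule ccontr)
    assume "degree m' \<noteq> 0"
    hence "\<not> constant (poly m')" by (simp add: constant_degree)
    then obtain y where y: "poly m' y = 0" using fundamental_theorem_of_algebra by blast
    hence "y = c" using root[of y] unfolding m' by simp
    then obtain m'' where m'': "m' = [:- c, 1:] * m''" using y poly_eq_0_iff_dvd by (metis dvdE)
    have "[:- c, 1:] ^ 2 dvd cxp (minpol c)" using mg unfolding m' m'' power2_eq_square by (metis dvd_mult_left mult.assoc)
    hence "2 \<le> order c (cxp (minpol c))" using minpol_nz[OF c] by (simp add: order_divides)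
    also have "\<dots> = card {z \<in> conjs c. z = c}"
      unfolding minpol_decomp[OF c] by (rule order_prod_linear[OF finite_conjs[OF c]])
    also have "\<dots> \<le> card {c}" by (rule card_mono) auto
    finally show False by simp
  qed
  then obtain r where r: "m' = [:r:]" by (auto elim: degree_eq_zeroE)
  have "r = 1" using m(2) unfolding m' r by (simp split: if_splits)
  hence "coeff m 0 = - c" unfolding m' r by simp
  hence "- c \<in> K" using m(1) unfolding cin_def by metis
  hence cK: "c \<in> K" using subfield_complexD(5)[OF K, of "- c"] by simp
  have "b = th - t * c" unfolding th_def by simp
  hence bK: "b \<in> K" using subfield_diff[OF K thK subfield_complexD(4)[OF K tK cK]] by simp
  show ?thesis using bK cK unfolding K_def th_def t_def by (intro exI[of _ "of_nat n"]) simp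
qed

section \<open>Extension degrees\<close>

lemma list_eval_complex: "cx.eval p x = poly (Poly (rev p)) x"
proof (induction p)
  case (Cons c p)
  have pw: "x [^]\<^bsub>complex_ring\<^esub> n = x ^ n" for n :: nat
    by (induction n) (simp_all add: nat_pow_def)
  show ?case using Cons by (simp add: pw Poly_append poly_monom)
qed simp

lemma cin_list:
  assumes "cin K p" "p \<noteq> 0"
  shows "rev (coeffs p) \<in> carrier (univ_poly complex_ring K)" "rev (coeffs p) \<noteq> []"
    "cx.eval (rev (coeffs p)) x = poly p x"
proof -
  have "set (coeffs p) \<subseteq> K" using assms(1) unfolding cin_def coeffs_def by auto
  moreover have "hd (rev (coeffs p)) \<noteq> 0" using assms(2) by (simp add: hd_rev last_coeffs_eq_coeff_degree)
  ultimately show "rev (coeffs p) \<in> carrier (univ_poly complex_ring K)"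
    unfolding univ_poly_def polynomial_def by simp
  show "rev (coeffs p) \<noteq> []" using assms(2) by simp
  show "cx.eval (rev (coeffs p)) x = poly p x" unfolding list_eval_complex by simp
qed

lemma algebraic_over:
  assumes K: "subfield K complex_ring" and a: "algebraic a"
  shows "(cx.algebraic over K) a"
  using cx.algebraicI[OF cin_list(1,2)[OF cin_cxp[OF K], of "minpol a"]] cin_list(3)[OF cin_cxp[OF K], of "minpol a" a]
    minpol_props(1)[OF a] minpol_nz[OF a] by (simp add: over_def)

lemma adjoin_simple:
  assumes K: "subfield K complex_ring" and a: "algebraic a"
  shows "adjoin K a = cx.simple_extension K a"
proof
  have sf: "subfield (cx.simple_extension K a) complex_ring"
    using cx.simple_extension_is_subfield[OF K, of a] algebraic_over[OF assms] by simp
  show "adjoin K a \<subseteq> cx.simple_extension K a"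
    by (rule adjoin_least[OF sf]) (use cx.simple_extension_incl[of K a] cx.simple_extension_mem[OF subfieldE(1)[OF K], of a] in auto)
  show "cx.simple_extension K a \<subseteq> adjoin K a"
    by (rule cx.simple_extension_subring_incl[OF subfieldE(1)[OF adjoin_subfield] adjoin_base])
qed

lemma adjoin_dim:
  assumes K: "subfield K complex_ring" and a: "algebraic a"
  shows "cx.dimension (ext_degree K (adjoin K a)) K (adjoin K a)"
    and "ext_degree K (adjoin K a) = length (cx.Irr K a) - 1"
proof -
  have "cx.dimension (length (cx.Irr K a) - 1) K (adjoin K a)"
    unfolding adjoin_simple[OF assms] using cx.dimension_simple_extension[OF K _ algebraic_over[OF assms]] by simp
  thus "ext_degree K (adjoin K a) = length (cx.Irr K a) - 1" "cx.dimension (ext_degree K (adjoin K a)) K (adjoin K a)"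
    using ext_degree_eq[OF K] by simp_all
qed

lemma ext_degree_le:
  assumes K: "subfield K complex_ring" and a: "algebraic a" and p: "cin K p" "p \<noteq> 0" "poly p a = 0"
  shows "ext_degree K (adjoin K a) \<le> degree p"
proof -
  note alg = algebraic_over[OF K a]
  have "cx.eval (rev (coeffs p)) a = 0" using cin_list(3)[OF p(1,2)] p(3) by simp
  hence "length (cx.Irr K a) - 1 \<le> length (rev (coeffs p)) - 1"
    using cx.pdivides_imp_degree_le[OF subfieldE(1)[OF K] cx.IrrE(1)[OF K _ alg] cin_list(1)[OF p(1,2)] cin_list(2)[OF p(1,2)],
        OF _ cx.Irr_minimal[OF K _ alg cin_list(1)[OF p(1,2)]]] by simp
  thus ?thesis unfolding adjoin_dim(2)[OF K a] using p(2) by (simp add: length_coeffs_degree)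
qed

lemma ext_degree_poly:
  assumes K: "subfield K complex_ring" and a: "algebraic a"
  obtains p where "cin K p" "p \<noteq> 0" "poly p a = 0" "degree p = ext_degree K (adjoin K a)" "degree p > 0"
proof -
  note alg = algebraic_over[OF K a]
  define l where "l = cx.Irr K a"
  have l: "l \<in> carrier (univ_poly complex_ring K)" "cx.eval l a = 0" "hd l = 1"
    unfolding l_def using cx.IrrE(1,3,4)[OF K _ alg] by simp_all
  have ne: "l \<noteq> []" 
  proof
    assume "l = []"
    hence "cx.dimension 0 K (adjoin K a)" using adjoin_dim[OF K a] l_def by simp
    hence "adjoin K a = {0}" by (rule cx.dimension_zero[OF K])
    thus False using subfield_complexD(1)[OF adjoin_subfield[of K a]] by simp
  qed
  hence lK: "set l \<subseteq> K" using l(1) unfolding univ_poly_def polynomial_def by auto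
  define p where "p = Poly (rev l)"
  have "dropWhile ((=) 0) l = l" using ne l(3) by (cases l) auto
  hence cp: "coeffs p = rev l" unfolding p_def coeffs_Poly by (simp add: strip_while_rev)
  have p0: "p \<noteq> 0" using cp ne by (metis coeffs_eq_Nil rev_is_Nil_conv)
  have dp: "degree p = length l - 1" using cp by (simp add: degree_eq_length_coeffs)
  have pa: "poly p a = 0" unfolding p_def list_eval_complex[symmetric] by (rule l(2))
  have "cin K p" unfolding cin_def
  proof
    fix i show "coeff p i \<in> K"
    proof (cases "i < length (rev l)")
      case True
      hence "coeff p i = rev l ! i" using cp by (metis nth_coeffs_coeff coeffs_nth degree_eq_length_coeffs length_coeffs_degree less_Suc_eq_le p0)
      thus ?thesis using True lK by (metis nth_mem set_rev subsetD)
    next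
      case False
      hence "coeff p i = 0" using dp ne by (intro coeff_eq_0) (cases l, auto)
      thus ?thesis using subfield_complexD(2)[OF K] by simp
    qed
  qed
  moreover have "degree p > 0"
  proof (rule ccontr)
    assume "\<not> degree p > 0"
    then obtain c where "p = [:c:]" by (auto elim: degree_eq_zeroE)
    thus False using pa p0 by simp
  qed
  ultimately show ?thesis using that[of p] p0 pa dp adjoin_dim(2)[OF K a] l_def by simp
qed

lemma ext_degree_pos: "subfield K complex_ring \<Longrightarrow> algebraic a \<Longrightarrow> ext_degree K (adjoin K a) > 0"
  using ext_degree_poly by metis

lemma adjoin_reduced:
  assumes K: "subfield K complex_ring" and a: "algebraic a" and x: "x \<in> adjoin K a"
  shows "\<exists>k. (\<forall>j<ext_degree K (adjoin K a). k j \<in> K) \<and> x = (\<Sum>j<ext_degree K (adjoin K a). k j * a ^ j)"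
proof -
  note alg = algebraic_over[OF K a]
  define n where "n = ext_degree K (adjoin K a)"
  obtain p where p: "cin K p" "p \<noteq> 0" "poly p a = 0" "degree p = n" "degree p > 0"
    unfolding n_def using ext_degree_poly[OF K a] by metis
  define m where "m = smult (inverse (lead_coeff p)) p"
  have lp: "inverse (lead_coeff p) \<in> K" using p(1) K unfolding cin_def by (simp add: subfield_complexD)
  have m: "cin K m" "lead_coeff m = 1" "poly m a = 0" "degree m = n"
    unfolding m_def using p lp cin_smult[OF K] by auto
  obtain l where l: "l \<in> carrier (univ_poly complex_ring K)" "x = cx.eval l a"
    using x cx.simple_extension_as_eval_img[of K a] unfolding adjoin_simple[OF K a] by auto
  define f where "f = Poly (rev l)"
  have fa: "poly f a = x" unfolding f_def list_eval_complex[symmetric] l(2) ..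
  have lK: "set l \<subseteq> K" using l(1) unfolding univ_poly_def polynomial_def by auto
  have "cin K f" unfolding cin_def f_def coeff_Poly_eq nth_default_def
    using lK subfield_complexD(2)[OF K] by (auto simp: rev_nth)
  from cin_division[OF K m(1,2) this] obtain q r where qr: "f = q * m + r" "cin K r" "r = 0 \<or> degree r < n"
    unfolding m(4) by blast
  have xr: "x = poly r a" using fa m(3) unfolding qr(1) by simp
  have "poly r a = (\<Sum>j<n. coeff r j * a ^ j)"
  proof (cases "r = 0")
    case False
    hence "degree r < n" using qr by simp
    thus ?thesis unfolding poly_altdef by (intro sum.mono_neutral_left) (auto intro: coeff_eq_0)
  qed simp
  thus ?thesis unfolding xr n_def[symmetric] using qr(2) unfolding cin_def by (intro exI[of _ "coeff r"]) simp
qed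

text \<open>
  Membership without dimensions, which passes to larger fields and to unions of chains.
\<close>

lemma bounded_degree_over_iff:
  assumes L: "subfield L complex_ring"
  shows "a \<in> bounded_degree_over L N \<longleftrightarrow> algebraic a \<and> (\<exists>p. cin L p \<and> p \<noteq> 0 \<and> poly p a = 0 \<and> degree p \<le> N)"
proof
  assume "a \<in> bounded_degree_over L N"
  hence a: "algebraic a" "ext_degree L (adjoin L a) \<le> N" by (auto simp: bounded_degree_over_def Qbar_def)
  obtain p where "cin L p" "p \<noteq> 0" "poly p a = 0" "degree p = ext_degree L (adjoin L a)" using ext_degree_poly[OF L a(1)] by metis
  with a show "algebraic a \<and> (\<exists>p. cin L p \<and> p \<noteq> 0 \<and> poly p a = 0 \<and> degree p \<le> N)" by auto
next
  assume "algebraic a \<and> (\<exists>p. cin L p \<and> p \<noteq> 0 \<and> poly p a = 0 \<and> degree p \<le> N)"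
  then obtain p where a: "algebraic a" "cin L p" "p \<noteq> 0" "poly p a = 0" "degree p \<le> N" by blast
  thus "a \<in> bounded_degree_over L N" using ext_degree_le[OF L a(1-4)] by (simp add: bounded_degree_over_def Qbar_def)
qed

lemma adjoin_adjoin_commute: "adjoin (adjoin K a) b = adjoin (adjoin K b) a"
proof -
  have "adjoin (adjoin K a) b \<subseteq> adjoin (adjoin K b) a" for a b
    by (rule adjoin_least[OF adjoin_subfield], rule adjoin_least[OF adjoin_subfield])
      (use adjoin_base in blast)+
  thus ?thesis by blast
qed

text \<open>
  Both ways from \<open>K\<close> to \<open>K(a, \<alpha>)\<close> give \<open>m * e = d * n\<close>. If the prime \<open>d\<close> divided \<open>e\<close>, then \<open>e = d\<close> because \<open>e\<close> cannot exceed the degree of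
  \<open>\<alpha>\<close> over \<open>K\<close>; but then \<open>m = n \<le> N\<close>. So \<open>d\<close> divides \<open>m\<close>.
\<close>

lemma level_degrees:
  assumes K: "subfield K complex_ring" and al: "algebraic \<alpha>" and a: "algebraic a"
    and d: "ext_degree K (adjoin K \<alpha>) = d" "prime d" "d > N"
    and n: "ext_degree (adjoin K \<alpha>) (adjoin (adjoin K \<alpha>) a) = n" "n \<le> N"
    and m: "ext_degree K (adjoin K a) = m" "m > N"
    and e: "ext_degree (adjoin K a) (adjoin (adjoin K a) \<alpha>) = e"
  shows "\<exists>k. m = k * d \<and> k \<le> N \<and> k > 0" "e \<le> N" "e > 0"
    and "cx.dimension (d * n) K (adjoin (adjoin K a) \<alpha>)"
proof -
  have d1: "cx.dimension d K (adjoin K \<alpha>)" using adjoin_dim(1)[OF K al] d(1) by simp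
  have d2: "cx.dimension n (adjoin K \<alpha>) (adjoin (adjoin K \<alpha>) a)" using adjoin_dim(1)[OF adjoin_subfield[of K \<alpha>] a] unfolding n(1) .
  have d3: "cx.dimension m K (adjoin K a)" using adjoin_dim(1)[OF K a] m(1) by simp
  have d4: "cx.dimension e (adjoin K a) (adjoin (adjoin K a) \<alpha>)" using adjoin_dim(1)[OF adjoin_subfield[of K a] al] unfolding e .
  have t1: "cx.dimension (d * n) K (adjoin (adjoin K a) \<alpha>)"
    using cx.telescopic_base[OF K adjoin_subfield d1 d2] unfolding adjoin_adjoin_commute[of K \<alpha> a] .
  thus "cx.dimension (d * n) K (adjoin (adjoin K a) \<alpha>)" .
  have t2: "cx.dimension (m * e) K (adjoin (adjoin K a) \<alpha>)"
    by (rule cx.telescopic_base[OF K adjoin_subfield d3 d4])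
  have eq: "m * e = d * n" by (rule cx.dimension_is_inj[OF K t2 t1])
  show e0: "e > 0" using ext_degree_pos[OF adjoin_subfield[of K a] al] unfolding e .
  have n0: "n > 0" using ext_degree_pos[OF adjoin_subfield[of K \<alpha>] a] unfolding n(1) .
  obtain p where p: "cin K p" "p \<noteq> 0" "poly p \<alpha> = 0" "degree p = d" using ext_degree_poly[OF K al] d(1) by metis
  have ed: "e \<le> d" using ext_degree_le[OF adjoin_subfield[of K a] al cin_mono[OF p(1) adjoin_base(1)] p(2,3)] unfolding p(4) e .
  have "\<not> d dvd e"
  proof
    assume "d dvd e"
    hence "e = d" using ed e0 by (simp add: dvd_imp_le le_antisym)
    hence "m = n" using eq d(3) by simp
    thus False using m(2) n(2) by simp
  qed
  moreover have "d dvd m * e" using eq by simp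
  ultimately have "d dvd m" using d(2) prime_dvd_mult_iff by blast
  then obtain k where k: "m = d * k" by (elim dvdE)
  have "k * e = n" using eq d(3) unfolding k by (simp add: mult.assoc)
  hence "k \<le> N" "e \<le> N" "k > 0" using n(2) n0 e0 by (auto intro: order_trans[rotated] simp: Suc_leI intro!: gr0I)
  thus "\<exists>k. m = k * d \<and> k \<le> N \<and> k > 0" "e \<le> N" using k by (auto simp: mult.commute)
qed

section \<open>Product formula\<close>

lemma product_formula_int:
  assumes n: "(n::int) \<noteq> 0" and P: "finite P" "P \<subseteq> PL" "0 \<in> P" and out: "\<And>q. prime q \<Longrightarrow> int q dvd n \<Longrightarrow> q \<in> P"
  shows "(\<Prod>q\<in>P. rabs q (of_int n)) = 1"
proof -
  define N where "N = nat \<bar>n\<bar>"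
  have N0: "N > 0" unfolding N_def using n by simp
  have mult: "multiplicity (int q) n = multiplicity q N" for q
  proof -
    have "int q ^ k dvd n \<longleftrightarrow> q ^ k dvd N" for k
      unfolding N_def dvd_nat_abs_iff by simp
    thus ?thesis unfolding multiplicity_def by simp
  qed
  have pr: "rabs q (of_int n) = inverse (real q ^ multiplicity q N)" if "prime q" for q
  proof -
    have "q \<noteq> 0" using that by auto
    thus ?thesis using padic_abs_fraction[OF that n, of 1] mult[of q] by (simp add: rabs_def power_int_minus)
  qed
  define Q where "Q = P - {0}"
  have Qp: "prime q" if "q \<in> Q" for q using that P(2) by (auto simp: Q_def PL_def)
  have sub: "prime_factors N \<subseteq> Q"
  proof
    fix q assume q: "q \<in> prime_factors N"
    hence qp: "prime q" "q dvd N" by auto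
    hence "int q dvd n" unfolding N_def by simp
    hence "q \<in> P" using out qp by blast
    thus "q \<in> Q" using qp(1) unfolding Q_def by auto
  qed
  have "real N = real (\<Prod>q\<in>prime_factors N. q ^ multiplicity q N)" using prime_factorization_nat[OF N0] by simp
  also have "\<dots> = (\<Prod>q\<in>prime_factors N. real q ^ multiplicity q N)" by simp
  also have "\<dots> = (\<Prod>q\<in>Q. real q ^ multiplicity q N)"
  proof (rule prod.mono_neutral_left[OF _ sub])
    show "finite Q" using P(1) Q_def by simp
    show "\<forall>q\<in>Q - prime_factors N. real q ^ multiplicity q N = 1"
    proof
      fix q assume q: "q \<in> Q - prime_factors N"
      hence "\<not> q dvd N" using Qp[of q] N0 by (auto simp: prime_factors_dvd)
      thus "real q ^ multiplicity q N = 1" by (simp add: not_dvd_imp_multiplicity_0)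
    qed
  qed
  finally have N: "real N = (\<Prod>q\<in>Q. real q ^ multiplicity q N)" .
  have "(\<Prod>q\<in>P. rabs q (of_int n)) = rabs 0 (of_int n) * (\<Prod>q\<in>Q. rabs q (of_int n))"
    unfolding Q_def by (rule prod.remove[OF P(1,3)])
  also have "rabs 0 (of_int n) = real N" unfolding rabs_def N_def by simp
  also have "(\<Prod>q\<in>Q. rabs q (of_int n)) = inverse (\<Prod>q\<in>Q. real q ^ multiplicity q N)"
    unfolding prod_inversef[symmetric] by (rule prod.cong) (use pr Qp in auto)
  also have "real N * inverse (\<Prod>q\<in>Q. real q ^ multiplicity q N) = 1" unfolding N[symmetric] using N0 by simp
  finally show ?thesis .
qed

text \<open>
  The formula for sufficiently large finite sets of places: estimates can then be summed place by place without
  questions of convergence.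
\<close>

lemma product_formula:
  assumes r: "r \<noteq> 0"
  shows "\<exists>P0. finite P0 \<and> P0 \<subseteq> PL \<and> (\<forall>P. finite P \<and> P \<subseteq> PL \<and> P0 \<subseteq> P \<longrightarrow> (\<Sum>q\<in>P. ln (rabs q r)) = 0)"
proof -
  obtain a b where ab: "quotient_of r = (a, b)" by force
  have b: "b > 0" using quotient_of_denom_pos[OF ab] .
  have re: "r = of_int a / of_int b" using quotient_of_div[OF ab] .
  hence a: "a \<noteq> 0" using r by auto
  define P0 where "P0 = insert 0 {q. prime q \<and> (int q dvd a \<or> int q dvd b)}"
  have "finite {q. int q dvd c}" if "c \<noteq> 0" for c
  proof (rule finite_subset[of _ "{..nat \<bar>c\<bar>}"])
    show "{q. int q dvd c} \<subseteq> {..nat \<bar>c\<bar>}"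
    proof
      fix q assume "q \<in> {q. int q dvd c}"
      hence "int q \<le> \<bar>c\<bar>" using dvd_imp_le_int[OF that, of "int q"] by simp
      thus "q \<in> {..nat \<bar>c\<bar>}" by simp
    qed
  qed simp
  hence "finite ({q. int q dvd a} \<union> {q. int q dvd b})" using a b by simp
  hence "finite P0" unfolding P0_def by (auto elim: finite_subset[rotated])
  moreover have "P0 \<subseteq> PL" unfolding P0_def PL_def by auto
  moreover have "(\<Sum>q\<in>P. ln (rabs q r)) = 0" if P: "finite P" "P \<subseteq> PL" "P0 \<subseteq> P" for P
  proof -
    have pos: "rabs q (of_int a) > 0" "rabs q (of_int b) > 0" if "q \<in> P" for q
      using rabs_props(1,2)[of q "of_int a"] rabs_props(1,2)[of q "of_int b"] that P(2) a b by (auto simp: less_le)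
    have 1: "(\<Prod>q\<in>P. rabs q (of_int a)) = 1" "(\<Prod>q\<in>P. rabs q (of_int b)) = 1"
      by (rule product_formula_int; use P a b in \<open>auto simp: P0_def\<close>)+
    have "(\<Sum>q\<in>P. ln (rabs q r)) = (\<Sum>q\<in>P. ln (rabs q (of_int a)) - ln (rabs q (of_int b)))"
    proof (rule sum.cong)
      fix q assume q: "q \<in> P"
      have qP: "q \<in> PL" using q P(2) by blast
      have "rabs q r = rabs q (of_int a) / rabs q (of_int b)"
        unfolding re divide_inverse rabs_props(3)[OF qP] rabs_props(7)[OF qP] ..
      thus "ln (rabs q r) = ln (rabs q (of_int a)) - ln (rabs q (of_int b))" using pos[OF q] by (simp add: ln_div)
    qed simp
    also have "\<dots> = ln (\<Prod>q\<in>P. rabs q (of_int a)) - ln (\<Prod>q\<in>P. rabs q (of_int b))"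
      using pos by (subst (1 2) ln_prod) (auto simp: sum_subtractf P(1) less_imp_neq[THEN not_sym])
    finally show ?thesis unfolding 1 by simp
  qed
  ultimately show ?thesis by blast
qed

text \<open>
  Some integer multiple \<open>c * x\<close> is integral, and an integral element has absolute value at most 1 at every prime by its monic
  equation. So only the primes that divide \<open>c\<close> and the archimedean place can occur.
\<close>

lemma vabs_finite_support:
  assumes x: "x \<in> Qbar"
  shows "finite {q \<in> PL. vabs q x > 1}"
proof -
  obtain c :: int where c: "c \<noteq> 0" "algebraic_int (of_int c * x)"
    using x algebraic_imp_int_multiple unfolding Qbar_def by blast
  define y where "y = of_int c * x"
  have yQ: "y \<in> Qbar" using c(2) unfolding y_def Qbar_def by auto
  obtain p where p: "poly (map_poly of_int p) y = 0" "lead_coeff p = (1::int)"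
    using c(2) unfolding algebraic_int_altdef_ipoly y_def by blast
  have int: "vabs q y \<le> 1" if q: "prime q" for q
  proof (rule ccontr)
    assume gt: "\<not> vabs q y \<le> 1"
    have qP: "q \<in> PL" using q by (simp add: PL_def)
    define n where "n = degree p"
    have deg: "degree (map_poly of_int p :: complex poly) = n" unfolding n_def by simp
    have "poly (map_poly of_int p) y = (\<Sum>i<n. of_int (coeff p i) * y ^ i) + y ^ n"
      unfolding poly_altdef deg using p(2) by (simp add: n_def lessThan_Suc_atMost[symmetric])
    hence yn: "y ^ n = (\<Sum>i<n. - of_int (coeff p i) * y ^ i)" using p(1) by (simp add: eq_neg_iff_add_eq_0 add.commute sum_negf)
    have pw: "vabs q (y ^ i) = vabs q y ^ i" for i
      by (induction i) (use vabs_mult[OF qP yQ] vabs_of_rat[OF qP, of 1] rabs_props(6)[OF qP] yQ in auto)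
    have le: "of_int k * y ^ i \<in> Qbar \<and> vabs q (of_int k * y ^ i) \<le> vabs q y ^ i" for k i
    proof -
      have kQ: "of_int k \<in> Qbar" using Qbar_closed(6)[of "of_int k"] by simp
      have "vabs q (of_int k) \<le> 1" using vabs_of_rat[OF qP, of "of_int k"] rabs_int_le_1[OF q, of k] by simp
      hence "vabs q (of_int k) * vabs q y ^ i \<le> 1 * vabs q y ^ i" using vabs_nonneg[OF qP yQ] by (intro mult_right_mono) auto
      thus ?thesis using vabs_mult[OF qP kQ, of "y ^ i"] pw[of i] kQ yQ by simp
    qed
    have "n > 0"
    proof (rule ccontr)
      assume "\<not> n > 0"
      hence "y ^ n = 0" unfolding yn by simp
      thus False using \<open>\<not> n > 0\<close> by simp
    qed
    have "(\<Sum>i<k. - of_int (coeff p i) * y ^ i) \<in> Qbar \<and> vabs q (\<Sum>i<k. - of_int (coeff p i) * y ^ i) \<le> vabs q y ^ (n - 1)" if "k \<le> n" for k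
      using that
    proof (induction k)
      case 0 thus ?case using vabs_eq_0[OF qP, of 0] vabs_nonneg[OF qP yQ] by simp
    next
      case (Suc k)
      have l: "- of_int (coeff p k) * y ^ k \<in> Qbar" "vabs q (- of_int (coeff p k) * y ^ k) \<le> vabs q y ^ k"
        using le[of "- coeff p k" k] by simp_all
      have "vabs q y ^ k \<le> vabs q y ^ (n - 1)" using Suc.prems gt by (intro power_increasing) auto
      hence l2: "vabs q (- of_int (coeff p k) * y ^ k) \<le> vabs q y ^ (n - 1)" using l(2) by simp
      have ih: "(\<Sum>i<k. - of_int (coeff p i) * y ^ i) \<in> Qbar" "vabs q (\<Sum>i<k. - of_int (coeff p i) * y ^ i) \<le> vabs q y ^ (n - 1)"
        using Suc by auto
      show ?case unfolding sum.lessThan_Suc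
        using vabs_prime(4)[OF q ih(1) l(1)] l2 ih l(1) Qbar_closed(1)[OF ih(1) l(1)] by linarith
    qed
    from this[of n] have "vabs q y ^ n \<le> vabs q y ^ (n - 1)" unfolding yn[symmetric] pw by simp
    moreover have "vabs q y ^ (n - 1) < vabs q y ^ n" using gt \<open>n > 0\<close> by (intro power_strict_increasing) auto
    ultimately show False by simp
  qed
  have "q = 0 \<or> int q dvd c" if q: "q \<in> PL" "vabs q x > 1" for q
  proof (rule ccontr)
    assume n: "\<not> (q = 0 \<or> int q dvd c)"
    hence qp: "prime q" using q by (auto simp: PL_def)
    have "multiplicity (int q) c = 0" using n by (simp add: not_dvd_imp_multiplicity_0)
    hence "rabs q (of_int c) = 1" using padic_abs_fraction[OF qp c(1), of 1] n by (simp add: rabs_def)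
    hence "vabs q (of_int c) = 1" using vabs_of_rat[OF q(1), of "of_int c"] by simp
    moreover have "of_int c \<in> Qbar" using Qbar_closed(6)[of "of_int c"] by simp
    ultimately have "vabs q y = vabs q x" unfolding y_def using vabs_mult[OF q(1) _ x] by simp
    thus False using int[OF qp] q(2) by simp
  qed
  hence "{q \<in> PL. vabs q x > 1} \<subseteq> {..nat \<bar>c\<bar>}" using dvd_imp_le_int[OF c(1)] by fastforce
  thus ?thesis by (rule finite_subset) simp
qed

section \<open>Local bounds for determinants\<close>

lemma vabs_prod: "q \<in> PL \<Longrightarrow> (\<And>i. i \<in> I \<Longrightarrow> f i \<in> Qbar) \<Longrightarrow> prod f I \<in> Qbar \<and> vabs q (prod f I) = (\<Prod>i\<in>I. vabs q (f i))"
proof (induction I rule: infinite_finite_induct)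
  case (insert i I)
  thus ?case using vabs_mult[of q "f i" "prod f I"] by simp
qed (use vabs_of_rat[of q 1] rabs_props(6)[of q] in auto)

lemma vabs_uminus: "q \<in> PL \<Longrightarrow> x \<in> Qbar \<Longrightarrow> vabs q (- x) = vabs q x"
proof -
  assume q: "q \<in> PL" "x \<in> Qbar"
  have m: "- 1 = (of_rat (-1) :: complex)" by simp
  have "vabs q (-1) = 1" unfolding m vabs_of_rat[OF q(1)] using rabs_props(5,6)[OF q(1)] by simp
  thus ?thesis using vabs_mult[OF q(1) _ q(2), of "-1"] Qbar_closed(6)[of "-1"] by simp
qed

lemma vabs_sum_bound:
  assumes q: "q \<in> PL" and I: "finite I" and f: "\<And>i. i \<in> I \<Longrightarrow> f i \<in> Qbar \<and> vabs q (f i) \<le> B" and B: "0 \<le> B"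
  shows "sum f I \<in> Qbar \<and> vabs q (sum f I) \<le> (if q = 0 then real (card I) else 1) * B"
proof (cases "q = 0")
  case True
  have fq: "\<And>i. i \<in> I \<Longrightarrow> f i \<in> Qbar" using f by blast
  have "(\<Sum>i\<in>I. vabs q (f i)) \<le> (\<Sum>i\<in>I. B)" by (rule sum_mono) (use f in auto)
  with vabs_sum[of q I f, OF q fq] show ?thesis using True by simp
next
  case False
  hence qp: "prime q" using q by (auto simp: PL_def)
  have "sum f I \<in> Qbar \<and> vabs q (sum f I) \<le> B" using I f
  proof (induction I rule: finite_induct)
    case empty thus ?case using vabs_eq_0[OF q, of 0] B by simp
  next
    case (insert i I)
    thus ?case using vabs_prime(4)[OF qp, of "f i" "sum f I"] by force
  qed
  thus ?thesis using False by simp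
qed

lemma vabs_det_bound:
  assumes q: "q \<in> PL" and A: "A \<in> carrier_mat n n"
    and en: "\<And>s t. s < n \<Longrightarrow> t < n \<Longrightarrow> A $$ (s, t) \<in> Qbar \<and> vabs q (A $$ (s, t)) \<le> \<tau> s"
    and pos: "\<And>s. s < n \<Longrightarrow> 0 \<le> \<tau> s"
  shows "det A \<in> Qbar \<and> vabs q (det A) \<le> (if q = 0 then fact n else 1) * (\<Prod>s<n. \<tau> s)"
proof -
  define S where "S = {p. p permutes {0..<n}}"
  have S: "finite S" "card S = fact n" unfolding S_def by (simp_all add: finite_permutations card_permutations)
  have perm: "signof p * (\<Prod>i = 0..<n. A $$ (i, p i)) \<in> Qbar \<and> vabs q (signof p * (\<Prod>i = 0..<n. A $$ (i, p i))) \<le> (\<Prod>s<n. \<tau> s)" if p: "p \<in> S" for p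
  proof -
    have pi: "p i < n" if "i < n" for i using p that unfolding S_def by (metis atLeastLessThan_iff mem_Collect_eq permutes_in_image zero_le)
    have P: "(\<Prod>i = 0..<n. A $$ (i, p i)) \<in> Qbar \<and> vabs q (\<Prod>i = 0..<n. A $$ (i, p i)) = (\<Prod>i = 0..<n. vabs q (A $$ (i, p i)))"
      by (rule vabs_prod[OF q]) (use en pi in auto)
    have "(\<Prod>i = 0..<n. vabs q (A $$ (i, p i))) \<le> (\<Prod>i = 0..<n. \<tau> i)"
      by (rule prod_mono) (use en pi q in auto)
    hence b: "vabs q (\<Prod>i = 0..<n. A $$ (i, p i)) \<le> (\<Prod>s<n. \<tau> s)" using P by (simp add: atLeast0LessThan)
    have "signof p = (1::complex) \<or> signof p = (- 1 :: complex)" by (auto simp: sign_def)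
    thus ?thesis
    proof
      assume "signof p = (1::complex)" thus ?thesis using P b by simp
    next
      assume s: "signof p = (- 1 :: complex)"
      show ?thesis unfolding s using P b vabs_uminus[OF q] by simp
    qed
  qed
  have "(\<Sum>p\<in>S. signof p * (\<Prod>i = 0..<n. A $$ (i, p i))) \<in> Qbar \<and>
     vabs q (\<Sum>p\<in>S. signof p * (\<Prod>i = 0..<n. A $$ (i, p i))) \<le> (if q = 0 then real (card S) else 1) * (\<Prod>s<n. \<tau> s)"
    by (rule vabs_sum_bound[OF q S(1) perm]) (use pos in \<open>auto intro!: prod_nonneg\<close>)
  from this[unfolded S(2)] show ?thesis unfolding det_def'[OF A] S_def by (cases "q = 0") simp_all
qed

section \<open>Gram determinants\<close>

text \<open>
  The nonzero values are powers of \<open>q\<close>.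
\<close>

lemma rabs_less_prime:
  assumes q: "prime q" and r: "rabs q r < real q"
  shows "rabs q r \<le> 1"
proof (cases "r = 0")
  case True thus ?thesis using q by (auto simp: rabs_def padic_abs_def)
next
  case False
  have q1: "q > 1" using q prime_gt_1_nat by blast
  obtain a b where ab: "quotient_of r = (a, b)" by force
  define k where "k = int (multiplicity (int q) b) - int (multiplicity (int q) a)"
  have k: "rabs q r = real q powi k"
    using False q1 unfolding rabs_def padic_abs_def k_def by (simp add: ab)
  have "k \<le> 0"
  proof (rule ccontr)
    assume "\<not> k \<le> 0"
    hence "real q powi 1 \<le> real q powi k" using q1 by (intro power_int_increasing) auto
    thus False using r k by simp
  qed
  hence "real q powi k \<le> real q powi 0" using q1 by (intro power_int_increasing) auto
  thus ?thesis using k by simp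
qed

text \<open>
  The Gram matrix of the trace form twisted by \<open>y\<close> is \<open>transpose G * D * G\<close>, where \<open>G\<close> is the matrix of all embeddings of the family
  and \<open>D\<close> is the diagonal matrix of those of \<open>y\<close>.
\<close>

lemma trace_gram:
  assumes th: "algebraic th" and zs: "set zs = conjs th" "distinct zs" "length zs = n"
    and x: "\<And>t. t < n \<Longrightarrow> x t \<in> Qgen th" and y: "y \<in> Qgen th"
  shows "det (mat n n (\<lambda>(u, t). trace th (y * (x u * x t)))) =
    (\<Prod>s<n. emb th (zs ! s) y) * (det (emb_matrix n th zs x))\<^sup>2"
proof -
  define G where "G = emb_matrix n th zs x"
  define D where "D = mat n n (\<lambda>(s, t). if s = t then emb th (zs ! s) y else 0)"
  have c: "G \<in> carrier_mat n n" "D \<in> carrier_mat n n" "transpose_mat G \<in> carrier_mat n n" unfolding G_def D_def by simp_all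
  have "det D = prod_list (diag_mat D)" by (rule det_upper_triangular[OF _ c(2)]) (auto simp: D_def)
  also have "\<dots> = (\<Prod>s<n. emb th (zs ! s) y)" unfolding prod_list_diag_prod using c(2)
    by (simp add: D_def atLeast0LessThan)
  finally have D: "det D = (\<Prod>s<n. emb th (zs ! s) y)" .
  have DG: "(D * G) $$ (s, t) = emb th (zs ! s) y * emb th (zs ! s) (x t)" if st: "s < n" "t < n" for s t
  proof -
    have "(D * G) $$ (s, t) = (\<Sum>i<n. D $$ (s, i) * G $$ (i, t))"
      using st c by (simp add: scalar_prod_def atLeast0LessThan)
    also have "\<dots> = (\<Sum>i<n. if i = s then emb th (zs ! s) y * emb th (zs ! s) (x t) else 0)"
      by (rule sum.cong) (use st in \<open>auto simp: D_def G_def\<close>)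
    finally show ?thesis using st by simp
  qed
  define H where "H = D * G"
  have H: "H \<in> carrier_mat n n" unfolding H_def using c by simp
  have bij: "bij_betw ((!) zs) {..<n} (conjs th)" by (rule bij_betw_nth) (use zs in auto)
  have mem: "zs ! s \<in> conjs th" if "s < n" for s using that zs by force
  have "mat n n (\<lambda>(u, t). trace th (y * (x u * x t))) = transpose_mat G * (D * G)"
  proof (rule eq_matI)
    fix u t assume "u < dim_row (transpose_mat G * (D * G))" "t < dim_col (transpose_mat G * (D * G))"
    hence ut: "u < n" "t < n" using c by auto
    have "(transpose_mat G * (D * G)) $$ (u, t) = (\<Sum>s<n. G $$ (s, u) * (D * G) $$ (s, t))"
      using ut c(1,3) H unfolding H_def[symmetric] by (simp add: scalar_prod_def atLeast0LessThan)
    also have "\<dots> = (\<Sum>s<n. emb th (zs ! s) (y * (x u * x t)))"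
    proof (rule sum.cong)
      fix s assume "s \<in> {..<n}" hence s: "s < n" by simp
      have "emb th (zs ! s) (y * (x u * x t)) = emb th (zs ! s) y * (emb th (zs ! s) (x u) * emb th (zs ! s) (x t))"
        using emb_simps(7)[OF th mem[OF s]] y x[OF ut(1)] x[OF ut(2)] Qgen_closed(2) by simp
      thus "G $$ (s, u) * (D * G) $$ (s, t) = emb th (zs ! s) (y * (x u * x t))"
        unfolding DG[OF s ut(2)] using s ut by (simp add: G_def)
    qed simp
    also have "\<dots> = (\<Sum>z\<in>conjs th. emb th z (y * (x u * x t)))"
      by (rule sum.reindex_bij_betw[OF bij])
    finally show "mat n n (\<lambda>(u, t). trace th (y * (x u * x t))) $$ (u, t) = (transpose_mat G * (D * G)) $$ (u, t)"
      unfolding trace_def using ut by simp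
  qed (use c in auto)
  hence "det (mat n n (\<lambda>(u, t). trace th (y * (x u * x t)))) = det (transpose_mat G) * (det D * det G)"
    using det_mult[OF c(3), of "D * G"] det_mult[OF c(2,1)] c by simp
  thus ?thesis unfolding D det_transpose[OF c(1)] G_def[symmetric] by (simp add: power2_eq_square)
qed

lemma det_rational:
  assumes "\<And>i j. i < n \<Longrightarrow> j < n \<Longrightarrow> \<exists>r. f i j = (of_rat r :: complex)"
  shows "\<exists>r. det (mat n n (\<lambda>(i, j). f i j)) = of_rat r"
proof -
  obtain r where r: "\<And>i j. i < n \<Longrightarrow> j < n \<Longrightarrow> f i j = of_rat (r i j)" using assms by metis
  have "mat n n (\<lambda>(i, j). f i j) = map_mat of_rat (mat n n (\<lambda>(i, j). r i j))"
    by (rule eq_matI) (auto simp: r)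
  thus ?thesis using of_rat_hom.hom_det[of "mat n n (\<lambda>(i, j). r i j)"] by metis
qed

lemma vabs_power: "q \<in> PL \<Longrightarrow> x \<in> Qbar \<Longrightarrow> vabs q (x ^ n) = vabs q x ^ n"
  using vabs_of_rat[of q 1] rabs_props(6)[of q] by (induction n) (simp_all add: vabs_mult)

lemma vabs_inverse: "q \<in> PL \<Longrightarrow> x \<in> Qbar \<Longrightarrow> vabs q (inverse x) = inverse (vabs q x)"
proof (cases "x = 0")
  case False
  assume q: "q \<in> PL" "x \<in> Qbar"
  have "vabs q x * vabs q (inverse x) = 1"
    using vabs_mult[OF q Qbar_closed(5)[OF q(2)]] False vabs_of_rat[OF q(1), of 1] rabs_props(6)[OF q(1)] by simp
  thus ?thesis by (metis inverse_unique)
qed (use vabs_of_rat[of q 0] rabs_props(2)[of q 0] in \<open>simp del: vabs_eq_0\<close>)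

text \<open>
  Each \<open>s\<close> rules out at most one \<open>u\<close>: two such numbers would be congruent modulo \<open>q\<close>, but both are at most \<open>n < q\<close>. As there
  are \<open>n + 1\<close> candidates, one is left.
\<close>

lemma exists_shift:
  assumes q: "prime q" "q > n" and S: "finite S" "card S \<le> n" and f: "\<And>s. s \<in> S \<Longrightarrow> f s \<in> Qbar"
  shows "\<exists>u\<le>n. \<forall>s\<in>S. vabs q (f s + of_nat u) = max 1 (vabs q (f s))"
proof (rule ccontr)
  assume neg: "\<not> (\<exists>u\<le>n. \<forall>s\<in>S. vabs q (f s + of_nat u) = max 1 (vabs q (f s)))"
  have qP: "q \<in> PL" using q by (simp add: PL_def)
  have nQ: "of_nat u \<in> Qbar" for u using Qbar_closed(6)[of "of_nat u"] by simp
  have n1: "vabs q (of_nat u) \<le> 1" for u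
    using rabs_int_le_1[OF q(1), of "int u"] vabs_of_rat[OF qP, of "of_nat u"] by simp
  have bad: "vabs q (f s) \<le> 1 \<and> vabs q (f s + of_nat u) < 1"
    if s: "s \<in> S" and ne: "vabs q (f s + of_nat u) \<noteq> max 1 (vabs q (f s))" for s u
  proof -
    have le: "vabs q (f s + of_nat u) \<le> max (vabs q (f s)) (vabs q (of_nat u))"
      by (rule vabs_prime(4)[OF q(1) f[OF s] nQ])
    have eq: "f s + of_nat u + - of_nat u = f s" by simp
    have ge: "vabs q (f s) \<le> max (vabs q (f s + of_nat u)) (vabs q (of_nat u))"
      using vabs_prime(4)[OF q(1), of "f s + of_nat u" "- of_nat u"] f[OF s] nQ[of u] vabs_uminus[OF qP nQ[of u]]
      unfolding eq by simp
    show ?thesis using le ge n1[of u] ne by linarith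
  qed
  have "\<forall>u. \<exists>s. u \<le> n \<longrightarrow> s \<in> S \<and> vabs q (f s) \<le> 1 \<and> vabs q (f s + of_nat u) < 1" using neg bad by blast
  then obtain g where g: "\<And>u. u \<le> n \<Longrightarrow> g u \<in> S \<and> vabs q (f (g u)) \<le> 1 \<and> vabs q (f (g u) + of_nat u) < 1" by metis
  have inj: "inj_on g {..n}"
  proof (rule inj_onI)
    have key: "u \<le> u'" if u: "u \<le> n" "u' \<le> n" "g u = g u'" for u u'
    proof (rule ccontr)
      assume lt: "\<not> u \<le> u'"
      have A: "f (g u) + of_nat u \<in> Qbar" "- (f (g u) + of_nat u') \<in> Qbar" using f[of "g u"] g[OF u(1)] nQ by auto
      have "vabs q (f (g u) + of_nat u + - (f (g u) + of_nat u')) < 1"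
        using vabs_prime(4)[OF q(1) A] g[OF u(1)] g[OF u(2)] vabs_uminus[OF qP, of "f (g u) + of_nat u'"] f[of "g u"] nQ u(3) by auto
      moreover have "f (g u) + of_nat u + - (f (g u) + of_nat u') = of_rat (of_nat (u - u'))"
        using lt by (simp add: of_nat_diff of_rat_diff)
      ultimately have "vabs q (of_rat (of_nat (u - u'))) < 1" by metis
      hence "rabs q (of_int (int (u - u'))) < 1" unfolding vabs_of_rat[OF qP] by simp
      moreover have "\<not> q dvd u - u'" using lt u q(2) by (auto dest: dvd_imp_le)
      hence "\<not> int q dvd int (u - u')" unfolding int_dvd_int_iff .
      hence "multiplicity (int q) (int (u - u')) = 0" by (rule not_dvd_imp_multiplicity_0)
      hence "rabs q (of_int (int (u - u'))) = 1"
        using padic_abs_fraction[OF q(1), of "int (u - u')" 1] lt q(2) by (simp add: rabs_def)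
      ultimately show False by simp
    qed
    fix u u' assume "u \<in> {..n}" "u' \<in> {..n}" "g u = g u'"
    thus "u = u'" using key[of u u'] key[of u' u] by simp
  qed
  have "card (g ` {..n}) = Suc n" using card_image[OF inj] by simp
  moreover have "card (g ` {..n}) \<le> card S" by (rule card_mono[OF S(1)]) (use g in auto)
  ultimately show False using S(2) by simp
qed

section \<open>The lower bound for heights\<close>

text \<open>
  The twisted traces are rational, so that an absolute value below \<open>q\<close> is in fact at most 1, and the twisted Gram determinant is
  \<open>q\<close>-integral. The gain from below \<open>q\<close> to 1 is what makes a radical of fractional order expensive.
\<close>

lemma gram_local_bound:
  assumes th: "algebraic th" and zs: "set zs = conjs th" "distinct zs" "length zs = n" and q: "prime q"
    and x: "\<And>t. t < n \<Longrightarrow> x t \<in> Qgen th" and y: "y \<in> Qgen th"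
    and small: "\<And>z t u. z \<in> conjs th \<Longrightarrow> t < n \<Longrightarrow> u < n \<Longrightarrow> vabs q (emb th z (y * (x u * x t))) < real q"
  shows "(\<Prod>z\<in>conjs th. vabs q (emb th z y)) * (vabs q (det (emb_matrix n th zs x)))\<^sup>2 \<le> 1"
proof -
  have qP: "q \<in> PL" using q by (simp add: PL_def)
  have mem: "zs ! s \<in> conjs th" if "s < n" for s using that zs by force
  define G where "G = emb_matrix n th zs x"
  define M where "M = mat n n (\<lambda>(u, t). trace th (y * (x u * x t)))"
  have bij: "bij_betw ((!) zs) {..<n} (conjs th)" by (rule bij_betw_nth) (use zs in auto)
  have Gc: "G \<in> carrier_mat n n" unfolding G_def by simp
  have GQ: "det G \<in> Qbar"
  proof -
    have e: "G $$ (s, t) \<in> Qbar" if "s < n" "t < n" for s t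
      using that emb_Qbar[OF th mem x] unfolding G_def by simp
    show ?thesis
      by (rule conjunct1[OF vabs_det_bound[OF qP, of G n "\<lambda>s. \<Sum>t<n. vabs q (G $$ (s, t))"]])
        (use e qP Gc in \<open>auto intro!: member_le_sum sum_nonneg\<close>)
  qed
  have prod: "(\<Prod>s<n. emb th (zs ! s) y) \<in> Qbar \<and> vabs q (\<Prod>s<n. emb th (zs ! s) y) = (\<Prod>s<n. vabs q (emb th (zs ! s) y))"
    by (rule vabs_prod[OF qP]) (use emb_Qbar[OF th mem y] in auto)
  have ent: "M $$ (u, t) \<in> Qbar \<and> vabs q (M $$ (u, t)) \<le> 1" if ut: "u < n" "t < n" for u t
  proof -
    have yx: "y * (x u * x t) \<in> Qgen th" using y x ut Qgen_closed(2) by simp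
    have e: "M $$ (u, t) = trace th (y * (x u * x t))" using ut unfolding M_def by simp
    obtain r where r: "M $$ (u, t) = of_rat r" using trace_rational[OF th yx] e by metis
    define B where "B = Max ((\<lambda>z. vabs q (emb th z (y * (x u * x t)))) ` conjs th)"
    have ne: "conjs th \<noteq> {}" using conjs_self[OF th] by blast
    have Bm: "B \<in> (\<lambda>z. vabs q (emb th z (y * (x u * x t)))) ` conjs th"
      unfolding B_def using ne finite_conjs[OF th] by (intro Max_in) auto
    have B: "B < real q" "0 \<le> B" using Bm small ut emb_Qbar[OF th _ yx] qP by auto
    have "M $$ (u, t) \<in> Qbar \<and> vabs q (M $$ (u, t)) \<le> (if q = 0 then real (card (conjs th)) else 1) * B"
      unfolding e trace_def by (rule vabs_sum_bound[OF qP finite_conjs[OF th] _ B(2)])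
        (use emb_Qbar[OF th _ yx] finite_conjs[OF th] in \<open>auto simp: B_def\<close>)
    moreover have "q \<noteq> 0" using q by auto
    ultimately have "M $$ (u, t) \<in> Qbar" "vabs q (M $$ (u, t)) < real q" using B by auto
    thus ?thesis using rabs_less_prime[OF q, of r] unfolding r vabs_of_rat[OF qP] by simp
  qed
  have "vabs q (det M) \<le> (if q = 0 then fact n else 1) * (\<Prod>s<n. 1)"
    by (rule conjunct2[OF vabs_det_bound[OF qP]]) (use ent in \<open>auto simp: M_def\<close>)
  moreover have "q \<noteq> 0" using q by auto
  ultimately have "vabs q (det M) \<le> 1" by simp
  moreover have "det M = (\<Prod>s<n. emb th (zs ! s) y) * (det G)\<^sup>2"
    unfolding M_def G_def by (rule trace_gram[OF th zs x y])
  ultimately have "(\<Prod>s<n. vabs q (emb th (zs ! s) y)) * (vabs q (det G))\<^sup>2 \<le> 1"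
    using prod GQ vabs_mult[OF qP, of "\<Prod>s<n. emb th (zs ! s) y" "(det G)\<^sup>2"] vabs_power[OF qP GQ, of 2] by simp
  moreover have "(\<Prod>s<n. vabs q (emb th (zs ! s) y)) = (\<Prod>z\<in>conjs th. vabs q (emb th z y))"
    by (rule prod.reindex_bij_betw[OF bij])
  ultimately show ?thesis unfolding G_def by simp
qed

text \<open>
  The embeddings of a larger field serve equally well, since they hit every conjugate of \<open>a\<close> equally often.
\<close>

lemma weil_height_over:
  assumes th: "algebraic th" and a: "a \<in> Qgen th"
  shows "\<exists>P0. finite P0 \<and> P0 \<subseteq> PL \<and> (\<forall>P. finite P \<and> P \<subseteq> PL \<and> P0 \<subseteq> P \<longrightarrow>
    (\<Sum>q\<in>P. \<Sum>z\<in>conjs th. lmax q (emb th z a)) = real (qdeg th) * weil_height a)"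
proof -
  have aa: "algebraic a" by (rule Qgen_algebraic[OF th a])
  define P0 where "P0 = (\<Union>z\<in>conjs a. {q \<in> PL. vabs q z > 1})"
  have "finite P0" unfolding P0_def using finite_conjs[OF aa] vabs_finite_support conjs_algebraic[OF aa] by (simp add: Qbar_def)
  moreover have "P0 \<subseteq> PL" unfolding P0_def by auto
  moreover have "(\<Sum>q\<in>P. \<Sum>z\<in>conjs th. lmax q (emb th z a)) = real (qdeg th) * weil_height a"
    if P: "finite P" "P \<subseteq> PL" "P0 \<subseteq> P" for P
  proof -
    obtain k where k: "qdeg th = k * qdeg a" "\<And>F :: complex \<Rightarrow> real. (\<Sum>z\<in>conjs th. F (emb th z a)) = of_nat k * (\<Sum>y\<in>conjs a. F y)"
      using conj_fibres[OF th a] by blast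
    have "weil_height a * real (qdeg a) = (\<Sum>q\<in>P. \<Sum>z\<in>conjs a. lmax q z)"
      by (rule weil_height_formula[OF aa P(1,2)]) (use P(3) in \<open>force simp: P0_def\<close>)
    thus ?thesis unfolding k(2) sum_distrib_left[symmetric] k(1) by (simp add: mult.commute)
  qed
  ultimately show ?thesis by blast
qed

lemma vabs_radical:
  assumes q: "q \<in> PL" and x: "x \<in> Qbar" "x ^ d = of_rat r" "d > 0" "r \<noteq> 0"
  shows "vabs q x = rabs q r powr (1 / real d)"
proof -
  have v: "vabs q x ^ d = rabs q r" using vabs_power[OF q x(1), of d] x(2) vabs_of_rat[OF q] by simp
  have pos: "vabs q x > 0"
  proof -
    have "x \<noteq> 0" using x(2,3,4) by (auto simp: power_0_left)
    thus ?thesis using vabs_nonneg[OF q x(1)] vabs_eq_0[OF q x(1)] by linarith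
  qed
  show ?thesis unfolding v[symmetric] using pos x(3) by (simp add: powr_realpow[symmetric] powr_powr)
qed

lemma vabs_emb:
  assumes th: "algebraic th" and q: "q \<in> PL"
  shows "\<And>z x y. z \<in> conjs th \<Longrightarrow> x \<in> Qgen th \<Longrightarrow> y \<in> Qgen th \<Longrightarrow>
      vabs q (emb th z (x * y)) = vabs q (emb th z x) * vabs q (emb th z y)"
    and "\<And>z x k. z \<in> conjs th \<Longrightarrow> x \<in> Qgen th \<Longrightarrow> vabs q (emb th z (x ^ k)) = vabs q (emb th z x) ^ k"
    and "\<And>z x. z \<in> conjs th \<Longrightarrow> x \<in> Qgen th \<Longrightarrow> 0 \<le> vabs q (emb th z x)"
  using q emb_Qbar[OF th] by (simp_all add: emb_simps[OF th] vabs_mult vabs_power)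

text \<open>
  By \<open>exists_shift\<close> there are elements whose conjugates have exactly the values \<open>1 / max 1 \<bar>a\<bar>\<close> and \<open>1 / max 1 \<bar>\<gamma>\<bar>\<close>. Twisting by their
  powers removes \<open>a\<close> and \<open>\<gamma>\<close> from the condition of \<open>gram_local_bound\<close> and only costs the right-hand side; what remains is a condition
  on \<open>\<beta>\<close> and \<open>\<alpha>\<close>.
\<close>

lemma prime_bound:
  assumes th: "algebraic th" and zs: "set zs = conjs th" "distinct zs" "length zs = n" and q: "prime q" "n < q"
    and mem: "a \<in> Qgen th" "\<gamma> \<in> Qgen th" "\<alpha> \<in> Qgen th" "\<beta> \<in> Qgen th"
    and x: "\<And>t. t < n \<Longrightarrow> \<exists>b\<le>B. \<exists>j\<le>m. \<exists>l\<le>e. x t = \<gamma> ^ b * a ^ j * \<alpha> ^ l"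
    and small: "\<And>z l. z \<in> conjs th \<Longrightarrow> l \<le> 2 * e \<Longrightarrow> vabs q (emb th z \<beta>) * vabs q (emb th z \<alpha>) ^ l < real q"
  shows "(\<Prod>z\<in>conjs th. vabs q (emb th z \<beta>)) * (vabs q (det (emb_matrix n th zs x)))\<^sup>2
    \<le> (\<Prod>z\<in>conjs th. max 1 (vabs q (emb th z a)) ^ (2 * m) * max 1 (vabs q (emb th z \<gamma>)) ^ (2 * B))"
proof -
  have qP: "q \<in> PL" using q by (simp add: PL_def)
  have card: "card (conjs th) \<le> n" using zs distinct_card by fastforce
  have sh: "\<exists>c\<in>Qgen th. c \<noteq> 0 \<and> (\<forall>z\<in>conjs th. vabs q (emb th z c) = inverse (max 1 (vabs q (emb th z b))))" if b: "b \<in> Qgen th" for b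
  proof -
    obtain u where u: "\<forall>z\<in>conjs th. vabs q (emb th z b + of_nat u) = max 1 (vabs q (emb th z b))"
      using exists_shift[OF q finite_conjs[OF th] card, of "\<lambda>z. emb th z b"] emb_Qbar[OF th _ b] by blast
    have nG: "of_nat u \<in> Qgen th" using Qgen_of_rat[of "of_nat u" th] by simp
    have bu: "b + of_nat u \<in> Qgen th" by (rule Qgen_closed(1)[OF b nG])
    have e: "vabs q (emb th z (b + of_nat u)) = max 1 (vabs q (emb th z b))" if z: "z \<in> conjs th" for z
      using u z emb_simps(5)[OF th z b nG] emb_simps(2)[OF th z, of "of_nat u"] by simp
    have "b + of_nat u \<noteq> 0"
    proof
      assume "b + of_nat u = 0"
      with e[OF conjs_self[OF th]] show False using emb_simps(3)[OF th conjs_self[OF th]] vabs_of_rat[OF qP, of 0] rabs_props(2)[OF qP, of 0] by simp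
    qed
    moreover have "vabs q (emb th z (inverse (b + of_nat u))) = inverse (max 1 (vabs q (emb th z b)))" if z: "z \<in> conjs th" for z
      unfolding emb_inverse[OF th z bu] vabs_inverse[OF qP emb_Qbar[OF th z bu]] e[OF z] ..
    ultimately show ?thesis using Qgen_inverse[OF th bu] by (intro bexI[of _ "inverse (b + of_nat u)"]) auto
  qed
  obtain ca where ca: "ca \<in> Qgen th" "\<And>z. z \<in> conjs th \<Longrightarrow> vabs q (emb th z ca) = inverse (max 1 (vabs q (emb th z a)))"
    using sh[OF mem(1)] by blast
  obtain cg where cg: "cg \<in> Qgen th" "\<And>z. z \<in> conjs th \<Longrightarrow> vabs q (emb th z cg) = inverse (max 1 (vabs q (emb th z \<gamma>)))"
    using sh[OF mem(2)] by blast
  define v where "v = (\<lambda>z y. vabs q (emb th z y))"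
  have va: "vabs q (emb th z y) = v z y" for z y unfolding v_def ..
  note vm = vabs_emb(1)[OF th qP, unfolded va] and vp = vabs_emb(2)[OF th qP, unfolded va] and vn = vabs_emb(3)[OF th qP, unfolded va]
  define y where "y = ca ^ (2 * m) * cg ^ (2 * B) * \<beta>"
  have yG: "y \<in> Qgen th" unfolding y_def using ca(1) cg(1) mem by (auto intro!: Qgen_closed(2) Qgen_power)
  have xG: "x t \<in> Qgen th" if "t < n" for t using x[OF that] mem by (auto intro!: Qgen_closed(2) Qgen_power)
  have vc: "v z ca = inverse (max 1 (v z a))" "v z cg = inverse (max 1 (v z \<gamma>))" if z: "z \<in> conjs th" for z
    unfolding v_def using ca(2)[OF z] cg(2)[OF z] by simp_all
  have vy: "v z y = inverse (max 1 (v z a)) ^ (2 * m) * inverse (max 1 (v z \<gamma>)) ^ (2 * B) * v z \<beta>" if z: "z \<in> conjs th" for z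
    unfolding y_def using z ca(1) cg(1) vc[OF z] mem by (simp add: vm vp Qgen_closed(2) Qgen_power)
  have le1: "inverse (max 1 t) ^ (2 * k) * (t ^ i * t ^ j) \<le> 1" if "i \<le> k" "j \<le> k" "0 \<le> t" for i j k :: nat and t :: real
  proof -
    have "t ^ i * t ^ j \<le> max 1 t ^ (i + j)" unfolding power_add[symmetric] using that(3) by (intro power_mono) auto
    also have "\<dots> \<le> max 1 t ^ (2 * k)" using that by (intro power_increasing) auto
    finally have "inverse (max 1 t) ^ (2 * k) * (t ^ i * t ^ j) \<le> inverse (max 1 t) ^ (2 * k) * max 1 t ^ (2 * k)"
      by (intro mult_left_mono) auto
    thus ?thesis by (simp add: power_inverse[symmetric] power_mult_distrib[symmetric] del: power_mult)
  qed
  have "(\<Prod>z\<in>conjs th. vabs q (emb th z y)) * (vabs q (det (emb_matrix n th zs x)))\<^sup>2 \<le> 1"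
  proof (rule gram_local_bound[OF th zs q(1) xG yG])
    fix z t u assume h: "z \<in> conjs th" "t < n" "u < n"
    obtain b j l where t: "b \<le> B" "j \<le> m" "l \<le> e" "x t = \<gamma> ^ b * a ^ j * \<alpha> ^ l" using x[OF h(2)] by blast
    obtain b' j' l' where u: "b' \<le> B" "j' \<le> m" "l' \<le> e" "x u = \<gamma> ^ b' * a ^ j' * \<alpha> ^ l'" using x[OF h(3)] by blast
    define p1 where "p1 = inverse (max 1 (v z \<gamma>)) ^ (2 * B) * (v z \<gamma> ^ b' * v z \<gamma> ^ b)"
    define p2 where "p2 = inverse (max 1 (v z a)) ^ (2 * m) * (v z a ^ j' * v z a ^ j)"
    define p3 where "p3 = v z \<beta> * v z \<alpha> ^ (l' + l)"
    have e: "v z (y * (x u * x t)) = p1 * p2 * p3"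
      using h mem xG[OF h(2)] xG[OF h(3)] yG unfolding p1_def p2_def p3_def
      by (simp add: vm vp vy t(4) u(4) Qgen_closed(2) Qgen_power power_add del: power_mult)
    have p1: "0 \<le> p1" "p1 \<le> 1" unfolding p1_def using le1[OF u(1) t(1) vn[OF h(1) mem(2)]] vn[OF h(1) mem(2)] by auto
    have p2: "0 \<le> p2" "p2 \<le> 1" unfolding p2_def using le1[OF u(2) t(2) vn[OF h(1) mem(1)]] vn[OF h(1) mem(1)] by auto
    have p3: "0 \<le> p3" "p3 < real q" unfolding p3_def using small[OF h(1), of "l' + l"] t(3) u(3) vn[OF h(1)] mem(3,4) by (auto simp: v_def)
    have "p1 * p2 \<le> 1" using p1 p2 by (simp add: mult_le_one)
    hence "p1 * p2 * p3 \<le> p3" using p3 p1 p2 by (simp add: mult_left_le_one_le)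
    thus "vabs q (emb th z (y * (x u * x t))) < real q" using e p3 unfolding v_def by simp
  qed
  moreover define W where "W = (\<Prod>z\<in>conjs th. max 1 (v z a) ^ (2 * m) * max 1 (v z \<gamma>) ^ (2 * B))"
  moreover have "(\<Prod>z\<in>conjs th. vabs q (emb th z y)) * W = (\<Prod>z\<in>conjs th. v z \<beta>)"
    unfolding W_def prod.distrib[symmetric]
  proof (rule prod.cong)
    fix z assume z: "z \<in> conjs th"
    have nz: "max 1 (v z a) \<noteq> 0" "max 1 (v z \<gamma>) \<noteq> 0" by linarith+
    show "vabs q (emb th z y) * (max 1 (v z a) ^ (2 * m) * max 1 (v z \<gamma>) ^ (2 * B)) = v z \<beta>"
      unfolding va vy[OF z] using nz by (simp add: field_simps del: power_mult)
  qed simp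
  moreover have "W > 0" unfolding W_def by (intro prod_pos mult_pos_pos zero_less_power) auto
  moreover have "V * D \<le> W" if "P * D \<le> 1" "P * W = V" "W > 0" for P D W V :: real
  proof -
    have "P * D * W \<le> 1 * W" using that by (intro mult_right_mono) auto
    thus ?thesis unfolding that(2)[symmetric] by (simp add: mult_ac)
  qed
  ultimately have "(\<Prod>z\<in>conjs th. v z \<beta>) * (vabs q (det (emb_matrix n th zs x)))\<^sup>2 \<le> W"
    by blast
  thus ?thesis unfolding va W_def .
qed

text \<open>
  The expansion of the determinant, estimated row by row.
\<close>

lemma generic_bound:
  assumes th: "algebraic th" and zs: "set zs = conjs th" "distinct zs" "length zs = n" and q: "q \<in> PL"
    and mem: "a \<in> Qgen th" "\<gamma> \<in> Qgen th" "\<alpha> \<in> Qgen th"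
    and x: "\<And>t. t < n \<Longrightarrow> \<exists>b\<le>B. \<exists>j\<le>m. \<exists>l\<le>e. x t = \<gamma> ^ b * a ^ j * \<alpha> ^ l"
    and small: "\<And>z. z \<in> conjs th \<Longrightarrow> vabs q (emb th z \<alpha>) \<le> 1"
  shows "vabs q (det (emb_matrix n th zs x))
    \<le> (if q = 0 then fact n else 1) * (\<Prod>z\<in>conjs th. max 1 (vabs q (emb th z a)) ^ m * max 1 (vabs q (emb th z \<gamma>)) ^ B)"
proof -
  have bij: "bij_betw ((!) zs) {..<n} (conjs th)" by (rule bij_betw_nth) (use zs in auto)
  have mm: "zs ! s \<in> conjs th" if "s < n" for s using that zs by force
  define v where "v = (\<lambda>z y. vabs q (emb th z y))"
  have va: "vabs q (emb th z y) = v z y" for z y unfolding v_def ..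
  note vm = vabs_emb(1)[OF th q, unfolded va] and vp = vabs_emb(2)[OF th q, unfolded va] and vn = vabs_emb(3)[OF th q, unfolded va]
  define \<tau> where "\<tau> = (\<lambda>z. max 1 (v z a) ^ m * max 1 (v z \<gamma>) ^ B)"
  define G where "G = emb_matrix n th zs x"
  have xG: "x t \<in> Qgen th" if "t < n" for t using x[OF that] mem by (auto intro!: Qgen_closed(2) Qgen_power)
  have "vabs q (det G) \<le> (if q = 0 then fact n else 1) * (\<Prod>s<n. \<tau> (zs ! s))"
  proof (rule conjunct2[OF vabs_det_bound[OF q]])
    show "G \<in> carrier_mat n n" unfolding G_def by simp
    fix s t assume st: "s < n" "t < n"
    obtain b j l where t: "b \<le> B" "j \<le> m" "l \<le> e" "x t = \<gamma> ^ b * a ^ j * \<alpha> ^ l" using x[OF st(2)] by blast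
    note z = mm[OF st(1)]
    have "v (zs ! s) (x t) = v (zs ! s) \<gamma> ^ b * v (zs ! s) a ^ j * v (zs ! s) \<alpha> ^ l"
      unfolding t(4) using z mem by (simp add: vm vp Qgen_closed(2) Qgen_power)
    also have "\<dots> \<le> max 1 (v (zs ! s) \<gamma>) ^ B * max 1 (v (zs ! s) a) ^ m * 1"
    proof (intro mult_mono)
      have p: "y ^ i \<le> max 1 y ^ k" if "i \<le> k" "0 \<le> y" for y :: real and i k
      proof -
        have "y ^ i \<le> max 1 y ^ i" using that by (intro power_mono) auto
        also have "\<dots> \<le> max 1 y ^ k" using that by (intro power_increasing) auto
        finally show ?thesis .
      qed
      show "v (zs ! s) \<gamma> ^ b \<le> max 1 (v (zs ! s) \<gamma>) ^ B" by (rule p[OF t(1) vn[OF z mem(2)]])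
      show "v (zs ! s) a ^ j \<le> max 1 (v (zs ! s) a) ^ m" by (rule p[OF t(2) vn[OF z mem(1)]])
      show "v (zs ! s) \<alpha> ^ l \<le> 1" using small[OF z] vn[OF z mem(3)] unfolding va by (simp add: power_le_one)
    qed (use vn[OF z] mem in auto)
    finally have "v (zs ! s) (x t) \<le> \<tau> (zs ! s)" unfolding \<tau>_def by (simp add: mult.commute)
    moreover have "G $$ (s, t) = emb th (zs ! s) (x t)" unfolding G_def using st by simp
    ultimately show "G $$ (s, t) \<in> Qbar \<and> vabs q (G $$ (s, t)) \<le> \<tau> (zs ! s)"
      unfolding va[symmetric] using emb_Qbar[OF th z xG[OF st(2)]] by simp
  next
    show "0 \<le> \<tau> (zs ! s)" for s unfolding \<tau>_def by auto
  qed
  also have "(\<Prod>s<n. \<tau> (zs ! s)) = (\<Prod>z\<in>conjs th. \<tau> z)" by (rule prod.reindex_bij_betw[OF bij])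
  finally show ?thesis unfolding G_def \<tau>_def va .
qed

lemma rabs_ratio:
  assumes p: "prime p" and q: "prime q" and pq: "p \<noteq> q"
  shows "rabs p (of_nat p / of_nat q) = 1 / real p" "rabs q (of_nat p / of_nat q) = real q"
    "\<And>l. prime l \<Longrightarrow> l \<noteq> p \<Longrightarrow> l \<noteq> q \<Longrightarrow> rabs l (of_nat p / of_nat q) = 1"
    "rabs 0 (of_nat p / of_nat q) = real p / real q"
proof -
  have s: "rabs l (of_nat l) = 1 / real l" if l: "prime l" for l
  proof -
    have "l \<noteq> 0" using l by auto
    thus ?thesis using padic_abs_self[OF l] unfolding rabs_def by simp
  qed
  have o: "rabs l (of_nat r) = 1" if "prime l" "prime r" "l \<noteq> r" for l r
  proof -
    have "\<not> l dvd r" using that primes_dvd_imp_eq by blast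
    hence "\<not> int l dvd int r" by simp
    hence "multiplicity (int l) (int r) = 0" by (rule not_dvd_imp_multiplicity_0)
    moreover have "r > 0" "l \<noteq> 0" using that prime_gt_0_nat by auto
    ultimately show ?thesis using padic_abs_fraction[OF that(1), of "int r" 1] by (simp add: rabs_def)
  qed
  have PL: "l \<in> PL" if "prime l" for l using that by (simp add: PL_def)
  have d: "rabs l (of_nat p / of_nat q) = rabs l (of_nat p) / rabs l (of_nat q)" if l: "prime l" for l
    unfolding divide_inverse rabs_props(3,7)[OF PL[OF l]] ..
  show "rabs p (of_nat p / of_nat q) = 1 / real p" unfolding d[OF p] s[OF p] o[OF p q pq] by simp
  show "rabs q (of_nat p / of_nat q) = real q" unfolding d[OF q] s[OF q] o[OF q p pq[symmetric]] by simp
  show "rabs l (of_nat p / of_nat q) = 1" if "prime l" "l \<noteq> p" "l \<noteq> q" for l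
    unfolding d[OF that(1)] o[OF that(1) p that(2)] o[OF that(1) q that(3)] by simp
  show "rabs 0 (of_nat p / of_nat q) = real p / real q" unfolding rabs_def by (simp add: of_rat_divide)
qed

lemma ln_prod_max:
  assumes "finite S"
  shows "(\<Prod>z\<in>S. max 1 (f z) ^ i * max 1 (g z) ^ j) > (0::real)"
    "ln (\<Prod>z\<in>S. max 1 (f z) ^ i * max 1 (g z) ^ j) = real i * (\<Sum>z\<in>S. ln (max 1 (f z))) + real j * (\<Sum>z\<in>S. ln (max 1 (g z)))"
proof -
  have pos: "max 1 (f z) > 0" "max 1 (g z) > 0" for z by linarith+
  show "(\<Prod>z\<in>S. max 1 (f z) ^ i * max 1 (g z) ^ j) > 0" using pos by (intro prod_pos mult_pos_pos zero_less_power) auto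
  have "ln (\<Prod>z\<in>S. max 1 (f z) ^ i * max 1 (g z) ^ j) = (\<Sum>z\<in>S. ln (max 1 (f z) ^ i * max 1 (g z) ^ j))"
    by (rule ln_prod) (use pos assms in \<open>auto intro!: mult_pos_pos zero_less_power\<close>)
  also have "\<dots> = (\<Sum>z\<in>S. real i * ln (max 1 (f z)) + real j * ln (max 1 (g z)))"
  proof (rule sum.cong)
    fix z
    have "max 1 (f z) ^ i > 0" "max 1 (g z) ^ j > 0" using pos[of z] by (simp_all only: zero_less_power)
    thus "ln (max 1 (f z) ^ i * max 1 (g z) ^ j) = real i * ln (max 1 (f z)) + real j * ln (max 1 (g z))"
      using pos[of z] by (simp only: ln_mult_pos ln_realpow)
  qed simp
  finally show "ln (\<Prod>z\<in>S. max 1 (f z) ^ i * max 1 (g z) ^ j) = real i * (\<Sum>z\<in>S. ln (max 1 (f z))) + real j * (\<Sum>z\<in>S. ln (max 1 (g z)))"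
    by (simp add: sum.distrib sum_distrib_left)
qed

text \<open>
  The square of the determinant of all embeddings of the basis \<open>x\<close> is a nonzero rational \<open>s\<close>, and the product formula for \<open>s\<close> is summed
  from local bounds. Since \<open>\<alpha>\<close> has value \<open>p powr (- 1 / d)\<close> at \<open>p\<close> and \<open>q powr (1 / d)\<close> at \<open>q\<close>, the twist can be \<open>\<alpha>\<close> to the power
  \<open>-(d - 1)\<close> at \<open>p\<close>, and \<open>d - 1 - 2 * e\<close> at \<open>q\<close>, where the powers of \<open>\<alpha>\<close> in two basis elements are lost. All other finite places
  contribute only through \<open>a\<close> and \<open>\<gamma>\<close>, and the archimedean one also through \<open>n!\<close>, which gives the term \<open>ln n\<close>.
\<close>

theorem height_lower_bound:
  assumes th: "algebraic th" and n: "n = qdeg th" and mem: "a \<in> Qgen th" "\<gamma> \<in> Qgen th" "\<alpha> \<in> Qgen th"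
    and p: "prime p" and q: "prime q" and pq: "n < p" "p < q"
    and \<alpha>: "\<alpha> ^ d = of_rat (of_nat p / of_nat q)" and e: "2 * e + 1 \<le> d"
    and x: "\<And>t. t < n \<Longrightarrow> \<exists>b\<le>B. \<exists>j\<le>m. \<exists>l\<le>e. x t = \<gamma> ^ b * a ^ j * \<alpha> ^ l"
    and ind: "\<And>c :: nat \<Rightarrow> rat. (\<Sum>t<n. of_rat (c t) * x t) = 0 \<Longrightarrow> \<forall>t<n. c t = 0"
  shows "(real (d - 1) * ln (real p) + real (d - 1 - 2 * e) * ln (real q)) / (2 * real d)
    \<le> real m * weil_height a + real B * weil_height \<gamma> + ln (real n)"
proof -
  define r :: rat where "r = of_nat p / of_nat q"
  have npos: "n > 0" unfolding n by (rule qdeg_pos[OF th])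
  have d: "d > 0" using e by simp
  have p1: "p > 1" "q > 1" using p q prime_gt_1_nat by blast+
  have r0: "r \<noteq> 0" unfolding r_def using p1 by simp
  have pne: "p \<noteq> q" using pq by simp
  note rr = rabs_ratio[OF p q pne, folded r_def]
  obtain zs where zs: "set zs = conjs th" "distinct zs" "length zs = n" using conjs_list[OF th] n by metis
  define S where "S = conjs th"
  have S: "finite S" "card S = n" unfolding S_def n using finite_conjs[OF th] card_conjs[OF th] by simp_all
  have xG: "x t \<in> Qgen th" if "t < n" for t using x[OF that] mem by (auto intro!: Qgen_closed(2) Qgen_power)
  define G where "G = emb_matrix n th zs x"
  have G0: "det G \<noteq> 0" unfolding G_def by (rule emb_det_nonzero[OF th zs xG ind])
  have "\<exists>s. det (mat n n (\<lambda>(u, t). trace th (1 * (x u * x t)))) = of_rat s"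
    by (rule det_rational) (use xG in \<open>auto intro!: trace_rational[OF th] Qgen_closed(2)\<close>)
  moreover have one: "1 \<in> Qgen th" using Qgen_of_rat[of 1 th] by simp
  have "det (mat n n (\<lambda>(u, t). trace th (1 * (x u * x t)))) = (det G)\<^sup>2"
  proof -
    have m: "zs ! s \<in> conjs th" if "s < n" for s using that zs by force
    have "(\<Prod>s<n. emb th (zs ! s) 1) = 1" by (rule prod.neutral) (use emb_simps(4)[OF th m] in auto)
    thus ?thesis using trace_gram[OF th zs xG one] unfolding G_def by simp
  qed
  ultimately obtain s where s: "(det G)\<^sup>2 = of_rat s" by metis
  have s0: "s \<noteq> 0" using s G0 by auto
  have GQ: "det G \<in> Qbar"
  proof -
    have "algebraic ((det G)\<^sup>2)" unfolding s by (simp add: rat_imp_algebraic)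
    then obtain f where f: "f \<noteq> 0" "rpoly f ((det G)\<^sup>2) = 0" unfolding algebraic_iff_rpoly by blast
    have "rpoly (pcompose f (monom 1 2)) (det G) = 0"
      using f(2) by (simp add: of_rat_hom.map_poly_pcompose poly_pcompose poly_monom)
    moreover have "pcompose f (monom 1 2) \<noteq> 0" using f(1) by (simp add: pcompose_eq_0_iff degree_monom_eq)
    ultimately show ?thesis unfolding Qbar_def mem_Collect_eq algebraic_iff_rpoly by blast
  qed
  have vG: "rabs l s = (vabs l (det G))\<^sup>2" if "l \<in> PL" for l
    using vabs_of_rat[OF that, of s] vabs_power[OF that GQ, of 2] unfolding s by simp
  have vG0: "vabs l (det G) > 0" if "l \<in> PL" for l using that GQ G0 vabs_nonneg[OF that GQ] vabs_eq_0[OF that GQ] by linarith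
  have \<alpha>Q: "emb th z \<alpha> \<in> Qbar" "emb th z \<alpha> ^ d = of_rat r" if "z \<in> conjs th" for z
    using emb_Qbar[OF th that mem(3)] emb_simps(8)[OF th that mem(3), of d] emb_simps(2)[OF th that, of r] \<alpha>
    unfolding r_def by metis+
  have v\<alpha>: "vabs l (emb th z \<alpha>) = rabs l r powr (1 / real d)" if "l \<in> PL" "z \<in> conjs th" for l z
    by (rule vabs_radical[OF that(1) \<alpha>Q[OF that(2)] d r0])
  define Ha where "Ha = (\<lambda>l. \<Sum>z\<in>S. lmax l (emb th z a))"
  define Hg where "Hg = (\<lambda>l. \<Sum>z\<in>S. lmax l (emb th z \<gamma>))"
  have generic: "ln (rabs l s) \<le> 2 * (real m * Ha l + real B * Hg l) + (if l = 0 then 2 * ln (fact n) else 0)"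
    if l: "l \<in> PL" "l \<noteq> p" "l \<noteq> q" for l
  proof -
    have "rabs l r \<le> 1"
    proof (cases "l = 0")
      case True thus ?thesis using rr(4) pq p1 by simp
    next
      case False
      hence "prime l" using l by (auto simp: PL_def)
      thus ?thesis using rr(3) l by simp
    qed
    hence "rabs l r powr (1 / real d) \<le> 1" using rabs_props(1)[OF l(1)] by (intro powr_le1) auto
    hence "vabs l (det G) \<le> (if l = 0 then fact n else 1) *
      (\<Prod>z\<in>S. max 1 (vabs l (emb th z a)) ^ m * max 1 (vabs l (emb th z \<gamma>)) ^ B)"
      unfolding G_def S_def by (intro generic_bound[OF th zs l(1) mem x]) (simp_all add: v\<alpha>[OF l(1)])
    hence "ln (vabs l (det G)) \<le> ln ((if l = 0 then fact n else 1) *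
      (\<Prod>z\<in>S. max 1 (vabs l (emb th z a)) ^ m * max 1 (vabs l (emb th z \<gamma>)) ^ B))"
      using vG0[OF l(1)] by (subst ln_le_cancel_iff) (auto intro: less_le_trans)
    also have "\<dots> = (if l = 0 then ln (fact n) else 0) + (real m * Ha l + real B * Hg l)"
    proof -
      define W where "W = (\<Prod>z\<in>S. max 1 (vabs l (emb th z a)) ^ m * max 1 (vabs l (emb th z \<gamma>)) ^ B)"
      have "W > 0" "ln W = real m * Ha l + real B * Hg l"
        unfolding W_def Ha_def Hg_def lmax_def by (rule ln_prod_max[OF S(1)])+
      thus ?thesis unfolding W_def[symmetric] by (simp add: ln_mult_pos)
    qed
    finally show ?thesis unfolding vG[OF l(1)] using vG0[OF l(1)] by (cases "l = 0") (simp_all add: ln_realpow)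
  qed
  have local: "ln (rabs l s) \<le> 2 * (real m * Ha l + real B * Hg l) - real n * t"
    if l: "prime l" "n < l" and \<beta>: "\<beta> \<in> Qgen th" "\<And>z. z \<in> conjs th \<Longrightarrow> vabs l (emb th z \<beta>) = exp t"
      and small: "\<And>i. i \<le> 2 * e \<Longrightarrow> exp t * (rabs l r powr (1 / real d)) ^ i < real l" for l \<beta> t
  proof -
    have lP: "l \<in> PL" using l by (simp add: PL_def)
    have "(\<Prod>z\<in>conjs th. vabs l (emb th z \<beta>)) * (vabs l (det G))\<^sup>2
    \<le> (\<Prod>z\<in>conjs th. max 1 (vabs l (emb th z a)) ^ (2 * m) * max 1 (vabs l (emb th z \<gamma>)) ^ (2 * B))"
      unfolding G_def
      by (rule prime_bound[OF th zs l mem \<beta>(1) x]) (use small in \<open>simp_all add: v\<alpha>[OF lP] \<beta>(2)\<close>)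
    also have "(\<Prod>z\<in>conjs th. vabs l (emb th z \<beta>)) = exp (real n * t)"
      using \<beta>(2) S unfolding S_def[symmetric] by (simp add: exp_of_nat_mult)
    finally have "ln (exp (real n * t) * rabs l s) \<le> 
      ln (\<Prod>z\<in>conjs th. max 1 (vabs l (emb th z a)) ^ (2 * m) * max 1 (vabs l (emb th z \<gamma>)) ^ (2 * B))"
      unfolding vG[OF lP] using vG0[OF lP] ln_prod_max(1)[OF S(1), unfolded S_def] by (subst ln_le_cancel_iff) auto
    moreover have "ln (exp (real n * t) * rabs l s) = real n * t + ln (rabs l s)"
      unfolding vG[OF lP] using vG0[OF lP] by (subst ln_mult_pos) auto
    ultimately show ?thesis unfolding ln_prod_max(2)[OF S(1), unfolded S_def] Ha_def Hg_def lmax_def S_def by simp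
  qed
  define k where "k = d - 1 - 2 * e"
  \<comment> \<open>The logarithms of the twists at \<open>p\<close> and at \<open>q\<close>.\<close>
  define tp where "tp = real (d - 1) / real d * ln (real p)"
  define tq where "tq = real k / real d * ln (real q)"
  have ap: "rabs p r powr (1 / real d) = exp (- (ln (real p) / real d))"
    unfolding rr(1) powr_def using p1 by (simp add: ln_div)
  have aq: "rabs q r powr (1 / real d) = exp (ln (real q) / real d)"
    unfolding rr(2) powr_def using p1 by simp
  have PLpq: "p \<in> PL" "q \<in> PL" "0 \<in> PL" using p q by (simp_all add: PL_def)
  have lp: "ln (rabs p s) \<le> 2 * (real m * Ha p + real B * Hg p) - real n * tp"
  proof (rule local[OF p pq(1), of "inverse \<alpha> ^ (d - 1)"])
    show "inverse \<alpha> ^ (d - 1) \<in> Qgen th" by (intro Qgen_power Qgen_inverse[OF th] mem)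
  next
    fix z assume z: "z \<in> conjs th"
    have "vabs p (emb th z (inverse \<alpha> ^ (d - 1))) = inverse (vabs p (emb th z \<alpha>)) ^ (d - 1)"
      using emb_simps(8)[OF th z Qgen_inverse[OF th mem(3)]] emb_inverse[OF th z mem(3)] \<alpha>Q(1)[OF z]
        vabs_power[OF PLpq(1)] vabs_inverse[OF PLpq(1)] by simp
    also have "\<dots> = exp tp" unfolding v\<alpha>[OF PLpq(1) z] ap tp_def
      by (simp add: exp_minus[symmetric] exp_of_nat_mult[symmetric])
    finally show "vabs p (emb th z (inverse \<alpha> ^ (d - 1))) = exp tp" .
  next
    fix i
    have "exp tp * (rabs p r powr (1 / real d)) ^ i \<le> exp tp * 1"
      unfolding ap using p1 by (intro mult_left_mono power_le_one) auto
    also have "\<dots> < exp (ln (real p))"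
    proof -
      have "real (d - 1) / real d < 1" using d by simp
      hence "real (d - 1) / real d * ln (real p) < 1 * ln (real p)" using p1 by (intro mult_strict_right_mono) auto
      thus ?thesis unfolding tp_def by simp
    qed
    finally show "exp tp * (rabs p r powr (1 / real d)) ^ i < real p" using p1 by simp
  qed
  have lq: "ln (rabs q s) \<le> 2 * (real m * Ha q + real B * Hg q) - real n * tq"
  proof (rule local[OF q _, of "\<alpha> ^ k"])
    show "n < q" using pq by simp
    show "\<alpha> ^ k \<in> Qgen th" by (intro Qgen_power mem)
  next
    fix z assume z: "z \<in> conjs th"
    have "vabs q (emb th z (\<alpha> ^ k)) = vabs q (emb th z \<alpha>) ^ k"
      using emb_simps(8)[OF th z mem(3)] \<alpha>Q(1)[OF z] vabs_power[OF PLpq(2)] by simp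
    also have "\<dots> = exp tq" unfolding v\<alpha>[OF PLpq(2) z] aq tq_def by (simp add: exp_of_nat_mult[symmetric])
    finally show "vabs q (emb th z (\<alpha> ^ k)) = exp tq" .
  next
    fix i assume i: "i \<le> 2 * e"
    have "exp tq * (rabs q r powr (1 / real d)) ^ i = exp (real (k + i) / real d * ln (real q))"
      unfolding aq tq_def exp_of_nat_mult[symmetric] exp_add[symmetric] by (simp add: add_divide_distrib distrib_right)
    also have "\<dots> < exp (ln (real q))"
    proof -
      have "k + i < d" unfolding k_def using i e by simp
      hence "real (k + i) / real d < 1" by simp
      hence "real (k + i) / real d * ln (real q) < 1 * ln (real q)" using p1 by (intro mult_strict_right_mono) auto
      thus ?thesis by simp
    qed
    finally show "exp tq * (rabs q r powr (1 / real d)) ^ i < real q" using p1 by simp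
  qed
  obtain P1 where P1: "finite P1" "P1 \<subseteq> PL" "\<And>P. finite P \<and> P \<subseteq> PL \<and> P1 \<subseteq> P \<Longrightarrow> (\<Sum>l\<in>P. ln (rabs l s)) = 0"
    using product_formula[OF s0] by blast
  obtain P2 where P2: "finite P2" "P2 \<subseteq> PL" "\<And>P. finite P \<and> P \<subseteq> PL \<and> P2 \<subseteq> P \<Longrightarrow> (\<Sum>l\<in>P. Ha l) = real n * weil_height a"
    using weil_height_over[OF th mem(1)] unfolding Ha_def S_def n by blast
  obtain P3 where P3: "finite P3" "P3 \<subseteq> PL" "\<And>P. finite P \<and> P \<subseteq> PL \<and> P3 \<subseteq> P \<Longrightarrow> (\<Sum>l\<in>P. Hg l) = real n * weil_height \<gamma>"
    using weil_height_over[OF th mem(2)] unfolding Hg_def S_def n by blast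
  define P where "P = P1 \<union> P2 \<union> P3 \<union> {0, p, q}"
  have P: "finite P" "P \<subseteq> PL" "P1 \<subseteq> P" "P2 \<subseteq> P" "P3 \<subseteq> P" unfolding P_def using P1 P2 P3 PLpq by auto
  define U where "U = (\<lambda>l. 2 * (real m * Ha l + real B * Hg l))"
  define \<delta> where "\<delta> = (\<lambda>l. if l = 0 then 2 * ln (fact n) else if l = p then - (real n * tp) else if l = q then - (real n * tq) else (0::real))"
  have "(\<Sum>l\<in>P. ln (rabs l s)) \<le> (\<Sum>l\<in>P. U l + \<delta> l)"
  proof (rule sum_mono)
    fix l assume "l \<in> P"
    hence "l \<in> PL" using P by blast
    thus "ln (rabs l s) \<le> U l + \<delta> l"
      using generic[of l] lp lq p1 unfolding U_def \<delta>_def by auto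
  qed
  also have "\<dots> = 2 * (real m * (\<Sum>l\<in>P. Ha l) + real B * (\<Sum>l\<in>P. Hg l)) + (\<Sum>l\<in>P. \<delta> l)"
    unfolding U_def by (simp add: sum.distrib sum_distrib_left)
  also have "(\<Sum>l\<in>P. \<delta> l) = (\<Sum>l\<in>{0, p, q}. \<delta> l)"
    by (rule sum.mono_neutral_right[OF P(1)]) (auto simp: P_def \<delta>_def)
  also have "\<dots> = 2 * ln (fact n) - real n * tp - real n * tq" using p1 pne by (simp add: \<delta>_def)
  finally have "real n * (tp + tq) \<le> real n * (2 * (real m * weil_height a + real B * weil_height \<gamma>)) + 2 * ln (fact n)"
    using P1(3)[of P] P2(3)[of P] P3(3)[of P] P by (simp add: algebra_simps)
  moreover have "ln (fact n :: real) \<le> real n * ln (real n)"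
  proof -
    have "(fact n :: real) \<le> real n ^ n" using fact_le_power[of n, where 'a = real] by simp
    hence "ln (fact n :: real) \<le> ln (real n ^ n)" using npos by (subst ln_le_cancel_iff) auto
    thus ?thesis using npos by (simp add: ln_realpow)
  qed
  ultimately have "real n * (tp + tq) \<le> real n * (2 * (real m * weil_height a + real B * weil_height \<gamma> + ln (real n)))"
    by (simp add: algebra_simps)
  hence "tp + tq \<le> 2 * (real m * weil_height a + real B * weil_height \<gamma> + ln (real n))"
    using npos by (simp only: mult_le_cancel_left_pos of_nat_0_less_iff)
  hence fin: "(tp + tq) / 2 \<le> real m * weil_height a + real B * weil_height \<gamma> + ln (real n)" by simp
  have eq: "(real (d - 1) * ln (real p) + real (d - 1 - 2 * e) * ln (real q)) / (2 * real d) = (tp + tq) / 2"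
    unfolding tp_def tq_def k_def by (simp add: add_divide_distrib)
  show ?thesis unfolding eq by (rule fin)
qed

section \<open>Bases of monomials\<close>

lemma powers_independent:
  assumes th: "algebraic th" and z: "(\<Sum>i<qdeg th. of_rat (c i) * th ^ i) = 0"
  shows "\<forall>i<qdeg th. c i = 0"
proof -
  define g where "g = (\<Sum>i<qdeg th. monom (c i) i)"
  have cg: "coeff g i = (if i < qdeg th then c i else 0)" for i unfolding g_def by (simp add: coeff_sum)
  have "rpoly g th = (\<Sum>i<qdeg th. of_rat (c i) * th ^ i)" unfolding g_def
    by (simp add: hom_distribs poly_sum poly_monom)
  hence g0: "rpoly g th = 0" using z by simp
  have "g = 0"
  proof (rule ccontr)
    assume ne: "g \<noteq> 0"
    have "degree g < qdeg th" using cg[of "degree g"] ne by (metis leading_coeff_0_iff)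
    thus False using minpol_props(3)[OF th g0 ne] unfolding qdeg_def by simp
  qed
  thus ?thesis using cg by (metis coeff_0)
qed

lemma powers_independent_set:
  assumes th: "algebraic th"
  shows "\<not> Qvs.dependent ((\<lambda>i. th ^ i) ` {..<qdeg th})" "card ((\<lambda>i. th ^ i) ` {..<qdeg th}) = qdeg th"
proof -
  have inj: "inj_on (\<lambda>i. th ^ i) {..<qdeg th}"
  proof (rule inj_onI, rule ccontr)
    fix i j assume ij: "i \<in> {..<qdeg th}" "j \<in> {..<qdeg th}" "th ^ i = th ^ j" "i \<noteq> j"
    define c :: "nat \<Rightarrow> rat" where "c = (\<lambda>k. if k = i then 1 else if k = j then - 1 else 0)"
    have "(\<Sum>k<qdeg th. of_rat (c k) * th ^ k) = (\<Sum>k\<in>{i, j}. of_rat (c k) * th ^ k)"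
      by (rule sum.mono_neutral_right) (use ij in \<open>auto simp: c_def\<close>)
    also have "\<dots> = 0" using ij by (simp add: c_def)
    finally have "c i = 0" using powers_independent[OF th] ij(1) by blast
    thus False by (simp add: c_def)
  qed
  thus "card ((\<lambda>i. th ^ i) ` {..<qdeg th}) = qdeg th" by (simp add: card_image)
  show "\<not> Qvs.dependent ((\<lambda>i. th ^ i) ` {..<qdeg th})"
  proof (rule Qvs.independent_if_scalars_zero)
    fix f x assume s: "(\<Sum>x\<in>(\<lambda>i. th ^ i) ` {..<qdeg th}. of_rat (f x) * x) = 0" "x \<in> (\<lambda>i. th ^ i) ` {..<qdeg th}"
    have "(\<Sum>i<qdeg th. of_rat (f (th ^ i)) * th ^ i) = 0" using s(1) unfolding sum.reindex[OF inj] by simp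
    from powers_independent[OF th this] show "f x = 0" using s(2) by auto
  qed simp
qed

text \<open>
  Each step of the tower from the rationals over \<open>Qgen \<gamma>\<close> and \<open>Qgen \<gamma> (a)\<close> to the top is spanned by the powers of one element, so the
  monomials span, and some of them form a basis.
\<close>

lemma monomial_basis:
  assumes al: "algebraic \<gamma>" "algebraic \<alpha>" "algebraic a"
    and m: "ext_degree (Qgen \<gamma>) (adjoin (Qgen \<gamma>) a) = m"
    and e: "ext_degree (adjoin (Qgen \<gamma>) a) (adjoin (adjoin (Qgen \<gamma>) a) \<alpha>) = e"
    and k: "cx.dimension k (Qgen \<gamma>) (adjoin (adjoin (Qgen \<gamma>) a) \<alpha>)"
  shows "\<exists>th x. algebraic th \<and> qdeg th = qdeg \<gamma> * k \<and> a \<in> Qgen th \<and> \<gamma> \<in> Qgen th \<and> \<alpha> \<in> Qgen th \<and>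
    (\<forall>t<qdeg th. \<exists>b<qdeg \<gamma>. \<exists>j<m. \<exists>l<e. x t = \<gamma> ^ b * a ^ j * \<alpha> ^ l) \<and>
    (\<forall>c :: nat \<Rightarrow> rat. (\<Sum>t<qdeg th. of_rat (c t) * x t) = 0 \<longrightarrow> (\<forall>t<qdeg th. c t = 0))"
proof -
  define K where "K = Qgen \<gamma>"
  define F where "F = adjoin (adjoin K a) \<alpha>"
  have K: "subfield K complex_ring" unfolding K_def by (rule Qgen_subfield[OF al(1)])
  have F: "subfield F complex_ring" unfolding F_def by (rule adjoin_subfield)
  have inF: "\<gamma> \<in> F" "a \<in> F" "\<alpha> \<in> F" unfolding F_def K_def using adjoin_base Qgen_self by blast+
  obtain t1 where t1: "\<gamma> \<in> Qgen (\<gamma> + of_rat t1 * a)" "a \<in> Qgen (\<gamma> + of_rat t1 * a)"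
    using primitive_element[OF al(1,3)] by blast
  define th1 where "th1 = \<gamma> + of_rat t1 * a"
  have th1: "algebraic th1" unfolding th1_def using al by (intro algebraic_add_mult) (auto simp: rat_imp_algebraic)
  obtain t2 where t2: "th1 \<in> Qgen (th1 + of_rat t2 * \<alpha>)" "\<alpha> \<in> Qgen (th1 + of_rat t2 * \<alpha>)"
    using primitive_element[OF th1 al(2)] by blast
  define th where "th = th1 + of_rat t2 * \<alpha>"
  have th: "algebraic th" unfolding th_def using al th1 by (intro algebraic_add_mult) (auto simp: rat_imp_algebraic)
  have sub: "Qgen th1 \<subseteq> Qgen th"
    unfolding adjoin_Qgen[OF th1, symmetric]
    by (rule adjoin_least[OF Qgen_subfield[OF th]]) (use t2 in \<open>auto simp: th_def Rats_def\<close>)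
  have inth: "\<gamma> \<in> Qgen th" "a \<in> Qgen th" "\<alpha> \<in> Qgen th" using t1 t2 sub unfolding th1_def[symmetric] th_def[symmetric] by auto
  have rF: "of_rat r \<in> F" for r using subfield_Rats[OF F] by (auto simp: Rats_def)
  have FQ: "F = Qgen th"
  proof
    have "K \<subseteq> Qgen th" unfolding K_def adjoin_Qgen[OF al(1), symmetric]
      by (rule adjoin_least[OF Qgen_subfield[OF th]]) (use inth in \<open>auto simp: Rats_def\<close>)
    thus "F \<subseteq> Qgen th" unfolding F_def using inth by (intro adjoin_least[OF Qgen_subfield[OF th]]) auto
    have "th \<in> F" unfolding th_def th1_def using inF rF subfield_complexD[OF F] by metis
    thus "Qgen th \<subseteq> F" unfolding adjoin_Qgen[OF th, symmetric] by (intro adjoin_least[OF F] subfield_Rats[OF F])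
  qed
  have deg: "qdeg th = qdeg \<gamma> * k"
  proof (rule cx.dimension_is_inj[OF Rats_subfield])
    show "cx.dimension (qdeg th) \<rat> F" unfolding FQ by (rule Qgen_dimension[OF th])
    show "cx.dimension (qdeg \<gamma> * k) \<rat> F"
      by (rule cx.telescopic_base[OF Rats_subfield K]) (use Qgen_dimension[OF al(1)] k in \<open>simp_all add: K_def F_def\<close>)
  qed
  define M where "M = (\<lambda>(b, j, l). \<gamma> ^ b * a ^ j * \<alpha> ^ l) ` ({..<qdeg \<gamma>} \<times> {..<m} \<times> {..<e})"
  have finM: "finite M" unfolding M_def by simp
  have span: "x \<in> Qvs.span M" if x: "x \<in> F" for x
  proof -
    obtain u where u: "\<And>l. l < e \<Longrightarrow> u l \<in> adjoin K a" "x = (\<Sum>l<e. u l * \<alpha> ^ l)"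
      using adjoin_reduced[OF adjoin_subfield[of K a] al(2) x[unfolded F_def]] e unfolding K_def[symmetric] by metis
    have "\<exists>v. (\<forall>j<m. v j \<in> K) \<and> u l = (\<Sum>j<m. v j * a ^ j)" if "l < e" for l
      using adjoin_reduced[OF K al(3) u(1)[OF that]] m unfolding K_def[symmetric] by metis
    then obtain v where v: "\<And>l. l < e \<Longrightarrow> (\<forall>j<m. v l j \<in> K) \<and> u l = (\<Sum>j<m. v l j * a ^ j)" by metis
    have "y * a ^ j * \<alpha> ^ l \<in> Qvs.span M" if y: "y \<in> K" "j < m" "l < e" for y j l
    proof -
      obtain h where h: "y = (\<Sum>i<qdeg \<gamma>. of_rat (coeff h i) * \<gamma> ^ i)" using Qgen_reduced[OF al(1) y(1)[unfolded K_def]] by metis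
      have "y * a ^ j * \<alpha> ^ l = (\<Sum>i<qdeg \<gamma>. of_rat (coeff h i) * (\<gamma> ^ i * a ^ j * \<alpha> ^ l))"
        unfolding h by (simp add: sum_distrib_right mult.assoc)
      also have "\<dots> \<in> Qvs.span M"
        by (intro Qvs.span_sum Qvs.span_scale Qvs.span_base) (use y in \<open>force simp: M_def\<close>)
      finally show ?thesis .
    qed
    hence "(\<Sum>l<e. \<Sum>j<m. v l j * a ^ j * \<alpha> ^ l) \<in> Qvs.span M" by (intro Qvs.span_sum) (use v in auto)
    also have "(\<Sum>l<e. \<Sum>j<m. v l j * a ^ j * \<alpha> ^ l) = x" unfolding u(2) using v by (auto simp: sum_distrib_right intro!: sum.cong)
    finally show ?thesis .
  qed
  obtain S where S: "S \<subseteq> M" "\<not> Qvs.dependent S" "M \<subseteq> Qvs.span S"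
    using Qvs.maximal_independent_subset[of M] by metis
  have finS: "finite S" using finM S(1) finite_subset by blast
  have spanS: "x \<in> Qvs.span S" if "x \<in> F" for x
    using span[OF that] S(3) Qvs.span_minimal[OF _ Qvs.subspace_span] by blast
  have "qdeg th \<le> card S"
  proof -
    have "(\<lambda>i. th ^ i) ` {..<qdeg th} \<subseteq> Qvs.span S" using spanS unfolding FQ by auto
    from Qvs.independent_span_bound[OF finS powers_independent_set(1)[OF th] this]
    show ?thesis unfolding powers_independent_set(2)[OF th] by simp
  qed
  moreover have "card S \<le> qdeg th"
  proof -
    have "S \<subseteq> Qvs.span ((\<lambda>i. th ^ i) ` {..<qdeg th})"
    proof
      fix x assume "x \<in> S"
      hence "x \<in> M" using S(1) by blast
      hence "x \<in> Qgen th" unfolding M_def using inth by (auto intro!: Qgen_closed(2) Qgen_power)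
      thus "x \<in> Qvs.span ((\<lambda>i. th ^ i) ` {..<qdeg th})" by (rule Qvs_span_powers[OF th])
    qed
    from Qvs.independent_span_bound[OF _ S(2) this] show ?thesis using powers_independent_set(2)[OF th] by simp
  qed
  ultimately have card: "card S = qdeg th" by simp
  obtain x where x: "bij_betw x {..<qdeg th} S"
    using ex_bij_betw_nat_finite[OF finS] unfolding card atLeast0LessThan by blast
  have "\<exists>b<qdeg \<gamma>. \<exists>j<m. \<exists>l<e. x t = \<gamma> ^ b * a ^ j * \<alpha> ^ l" if "t < qdeg th" for t
  proof -
    have "x t \<in> M" using x that S(1) unfolding bij_betw_def by blast
    thus ?thesis unfolding M_def by auto
  qed
  moreover have "\<forall>t<qdeg th. c t = 0" if z: "(\<Sum>t<qdeg th. of_rat (c t) * x t) = 0" for c :: "nat \<Rightarrow> rat"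
  proof (intro allI impI)
    fix t assume t: "t < qdeg th"
    define u where "u = (\<lambda>v. c (inv_into {..<qdeg th} x v))"
    have ux: "u (x i) = c i" if "i < qdeg th" for i
      unfolding u_def using inv_into_f_f[OF bij_betw_imp_inj_on[OF x], of i] that by simp
    have "(\<Sum>v\<in>S. of_rat (u v) * v) = (\<Sum>i<qdeg th. of_rat (u (x i)) * x i)"
      by (rule sum.reindex_bij_betw[OF x, symmetric])
    also have "\<dots> = 0" using z by (simp add: ux)
    finally have "u (x t) = 0" using Qvs.independentD[OF S(2) finS subset_refl] x t unfolding bij_betw_def by blast
    thus "c t = 0" using ux[OF t] by simp
  qed
  ultimately show ?thesis using th deg inth by blast
qed

section \<open>The Northcott property\<close>

text \<open>
  One factor \<open>X - z\<close> multiplies the bound by \<open>max 1 \<bar>z\<bar>\<close>, and by 2 at the archimedean place.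
\<close>

lemma coeff_prod_linear_bound:
  assumes q: "q \<in> PL" and S: "finite S" "S \<subseteq> Qbar"
  shows "coeff (\<Prod>z\<in>S. [:- z, 1:]) i \<in> Qbar \<and>
    vabs q (coeff (\<Prod>z\<in>S. [:- z, 1:]) i) \<le> (if q = 0 then 2 ^ card S else 1) * (\<Prod>z\<in>S. max 1 (vabs q z))"
  using S
proof (induction S arbitrary: i rule: finite_induct)
  case empty
  have "vabs q (coeff 1 i) \<le> 1" 
    using vabs_of_rat[OF q, of 0] vabs_of_rat[OF q, of 1] rabs_props(6)[OF q] rabs_props(2)[OF q, of 0]
    by (cases i) (simp_all del: vabs_eq_0)
  thus ?case by (cases i) (auto simp: coeff_1)
next
  case (insert z S)
  define P where "P = (\<Prod>z\<in>S. [:- z, 1:])"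
  define t where "t = max 1 (vabs q z)"
  define W where "W = (if q = 0 then 2 ^ card S else 1) * (\<Prod>z\<in>S. max 1 (vabs q z))"
  have zQ: "z \<in> Qbar" using insert by simp
  have IH: "coeff P i \<in> Qbar" "vabs q (coeff P i) \<le> W" for i using insert unfolding P_def W_def by simp_all
  have W: "W \<ge> 0" unfolding W_def by (intro mult_nonneg_nonneg prod_nonneg) auto
  have t: "t \<ge> 1" "vabs q z \<le> t" unfolding t_def by auto
  define u where "u = - z * coeff P i"
  define v where "v = (case i of 0 \<Rightarrow> 0 | Suc j \<Rightarrow> coeff P j)"
  have c: "coeff (\<Prod>z\<in>insert z S. [:- z, 1:]) i = u + v"
    using insert(1,2) unfolding u_def v_def P_def by (cases i) (simp_all add: coeff_pCons)
  have uQ: "u \<in> Qbar" unfolding u_def using zQ IH by simp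
  have vQ: "v \<in> Qbar" unfolding v_def using IH by (cases i) simp_all
  have "vabs q u = vabs q z * vabs q (coeff P i)" unfolding u_def
    using vabs_mult[OF q, of "- z"] vabs_uminus[OF q zQ] zQ IH by simp
  also have "\<dots> \<le> t * W" by (intro mult_mono) (use t IH W q in auto)
  finally have u: "vabs q u \<le> t * W" .
  have "vabs q v \<le> W" unfolding v_def using IH(2) W vabs_of_rat[OF q, of 0] rabs_props(2)[OF q, of 0]
    by (cases i) (simp_all del: vabs_eq_0)
  also have "W \<le> t * W" using t W by (simp add: mult_le_cancel_right1)
  finally have v: "vabs q v \<le> t * W" .
  have "vabs q (u + v) \<le> (if q = 0 then 2 else 1) * (t * W)"
  proof (cases "q = 0")
    case True
    thus ?thesis using vabs_triangle[OF q uQ vQ] u v by simp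
  next
    case False
    hence "prime q" using q by (auto simp: PL_def)
    from vabs_prime(4)[OF this uQ vQ] show ?thesis using u v False by auto
  qed
  also have "(if q = 0 then 2 else 1) * (t * W) = (if q = 0 then 2 ^ card (insert z S) else 1) * (\<Prod>z\<in>insert z S. max 1 (vabs q z))"
    unfolding t_def W_def using insert(1,2) by simp
  finally show ?case unfolding c using uQ vQ by simp
qed

text \<open>
  The product formula expresses the denominator by the finite places, and the archimedean place bounds the quotient.
\<close>

lemma finite_rat_bounded_height:
  "finite {c :: rat. \<forall>P. finite P \<and> P \<subseteq> PL \<longrightarrow> (\<Sum>q\<in>P. ln (max 1 (rabs q c))) \<le> H}"
proof -
  define n where "n = nat \<lceil>exp H * exp H\<rceil> + nat \<lceil>exp H\<rceil>"
  have "{c :: rat. \<forall>P. finite P \<and> P \<subseteq> PL \<longrightarrow> (\<Sum>q\<in>P. ln (max 1 (rabs q c))) \<le> H}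
    \<subseteq> (\<lambda>(a, b). of_int a / of_int b) ` ({- int n..int n} \<times> {- int n..int n})"
  proof
    fix c :: rat assume "c \<in> {c :: rat. \<forall>P. finite P \<and> P \<subseteq> PL \<longrightarrow> (\<Sum>q\<in>P. ln (max 1 (rabs q c))) \<le> H}"
    hence c: "\<And>P. finite P \<Longrightarrow> P \<subseteq> PL \<Longrightarrow> (\<Sum>q\<in>P. ln (max 1 (rabs q c))) \<le> H" by blast
    obtain a b where ab: "quotient_of c = (a, b)" by force
    have b: "b > 0" using quotient_of_denom_pos[OF ab] .
    have cop: "coprime a b" using quotient_of_coprime[OF ab] .
    have ce: "c = of_int a / of_int b" using quotient_of_div[OF ab] .
    have b0: "(of_int b :: rat) \<noteq> 0" using b by simp
    obtain P0 where P0: "finite P0" "P0 \<subseteq> PL" "\<And>P. finite P \<and> P \<subseteq> PL \<and> P0 \<subseteq> P \<Longrightarrow> (\<Sum>q\<in>P. ln (rabs q (of_int b))) = 0"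
      using product_formula[OF b0] by blast
    define P where "P = insert 0 P0"
    have P: "finite P" "P \<subseteq> PL" "0 \<in> P" "P0 \<subseteq> P" unfolding P_def using P0 by (auto simp: PL_def)
    have loc: "- ln (rabs q (of_int b)) \<le> ln (max 1 (rabs q c))" if q: "q \<in> P - {0}" for q
    proof -
      have qP: "q \<in> PL" using q P by blast
      have qp: "prime q" using qP q by (auto simp: PL_def)
      have pos: "rabs q (of_int b) > 0" using rabs_props(1,2)[OF qP, of "of_int b"] b0 by linarith
      show ?thesis
      proof (cases "int q dvd b")
        case True
        hence nd: "\<not> int q dvd a" using cop qp by (meson coprime_common_divisor not_prime_unit prime_int_nat_transfer prime_nat_int_transfer)
        have a0: "a \<noteq> 0" using nd by auto
        have "multiplicity (int q) a = 0" using nd by (rule not_dvd_imp_multiplicity_0)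
        moreover have "q \<noteq> 0" using q by simp
        ultimately have "rabs q (of_int a) = 1" using padic_abs_fraction[OF qp a0, of 1] by (simp add: rabs_def)
        hence "rabs q c = inverse (rabs q (of_int b))"
          unfolding ce divide_inverse rabs_props(3,7)[OF qP] by simp
        hence "- ln (rabs q (of_int b)) = ln (rabs q c)" using pos by (simp add: ln_inverse)
        also have "\<dots> \<le> ln (max 1 (rabs q c))"
        proof -
          have "rabs q c > 0" using \<open>rabs q c = inverse (rabs q (of_int b))\<close> pos by simp
          thus ?thesis by (subst ln_le_cancel_iff) auto
        qed
        finally show ?thesis .
      next
        case False
        have "multiplicity (int q) b = 0" using False by (rule not_dvd_imp_multiplicity_0)
        moreover have "q \<noteq> 0" using q by simp
        ultimately have "rabs q (of_int b) = 1" using padic_abs_fraction[OF qp, of b 1] b by (simp add: rabs_def)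
        thus ?thesis by simp
      qed
    qed
    have "ln (real_of_int b) = ln (rabs 0 (of_int b))" unfolding rabs_def using b by simp
    also have "\<dots> = (\<Sum>q\<in>P - {0}. - ln (rabs q (of_int b)))"
      using P0(3)[of P] P sum.remove[OF P(1,3), of "\<lambda>q. ln (rabs q (of_int b))"] by (simp add: sum_negf)
    also have "\<dots> \<le> (\<Sum>q\<in>P - {0}. ln (max 1 (rabs q c)))" by (rule sum_mono) (rule loc)
    also have "\<dots> \<le> H" by (rule c) (use P in auto)
    finally have "real_of_int b \<le> exp H" using b by (metis exp_le_cancel_iff exp_ln of_int_0_less_iff)
    moreover have "\<bar>of_rat c\<bar> \<le> exp H"
    proof -
      have "ln (max 1 \<bar>of_rat c\<bar>) \<le> H" using c[of "{0}"] by (simp add: rabs_def PL_def)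
      moreover have "max 1 \<bar>of_rat c\<bar> > (0::real)" by linarith
      ultimately have "max 1 \<bar>of_rat c :: real\<bar> \<le> exp H" by (metis exp_le_cancel_iff exp_ln)
      thus ?thesis by simp
    qed
    ultimately have "\<bar>of_rat c\<bar> * real_of_int b \<le> exp H * exp H" using b by (intro mult_mono) auto
    moreover have "(of_rat c :: real) = of_int a / of_int b" unfolding ce by (simp add: of_rat_divide)
    ultimately have ab2: "\<bar>real_of_int a\<bar> \<le> exp H * exp H" using b by (simp add: abs_mult abs_divide)
    have "a \<in> {- int n..int n}" using ab2 unfolding n_def by (simp, linarith)
    moreover have "b \<in> {- int n..int n}" using \<open>real_of_int b \<le> exp H\<close> b unfolding n_def by (simp, linarith)
    ultimately show "c \<in> (\<lambda>(a, b). of_int a / of_int b) ` ({- int n..int n} \<times> {- int n..int n})" using ce by force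
  qed
  thus ?thesis by (rule finite_subset) simp
qed

lemma minpol_coeff_height:
  assumes a: "algebraic a" and P: "finite P" "P \<subseteq> PL"
  shows "(\<Sum>q\<in>P. ln (max 1 (rabs q (coeff (minpol a) i)))) \<le> real (qdeg a) * (ln 2 + weil_height a)"
proof -
  define P1 where "P1 = P \<union> {0} \<union> (\<Union>z\<in>conjs a. {q \<in> PL. vabs q z > 1})"
  have zQ: "z \<in> Qbar" if "z \<in> conjs a" for z using conjs_algebraic[OF a that] by (simp add: Qbar_def)
  have P1: "finite P1" "P1 \<subseteq> PL" "P \<subseteq> P1" "0 \<in> P1"
    unfolding P1_def using P finite_conjs[OF a] vabs_finite_support zQ by (auto simp: PL_def)
  have sub: "conjs a \<subseteq> Qbar" using zQ by blast
  define T where "T = (\<lambda>q. \<Prod>z\<in>conjs a. max 1 (vabs q z))"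
  have T: "T q \<ge> 1" for q unfolding T_def by (rule prod_ge_1) simp
  have lT: "ln (T q) = (\<Sum>z\<in>conjs a. lmax q z)" for q
    unfolding T_def lmax_def by (rule ln_prod) (use finite_conjs[OF a] in \<open>auto simp: max_def\<close>)
  have "(\<Sum>q\<in>P. ln (max 1 (rabs q (coeff (minpol a) i)))) \<le> (\<Sum>q\<in>P1. ln (max 1 (rabs q (coeff (minpol a) i))))"
    by (rule sum_mono2) (use P1 in auto)
  also have "\<dots> \<le> (\<Sum>q\<in>P1. (\<Sum>z\<in>conjs a. lmax q z) + (if q = 0 then real (qdeg a) * ln 2 else 0))"
  proof (rule sum_mono)
    fix q assume "q \<in> P1"
    hence q: "q \<in> PL" using P1 by blast
    have "rabs q (coeff (minpol a) i) \<le> (if q = 0 then 2 ^ qdeg a else 1) * T q"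
      using coeff_prod_linear_bound[OF q finite_conjs[OF a] sub, of i] vabs_of_rat[OF q, of "coeff (minpol a) i"]
      unfolding minpol_decomp[OF a, symmetric] T_def card_conjs[OF a] by auto
    moreover have "1 \<le> (if q = 0 then 2 ^ qdeg a else 1) * T q"
      using T[of q] mult_mono[of 1 "2 ^ qdeg a" 1 "T q"] by (auto simp: one_le_power)
    ultimately have le: "max 1 (rabs q (coeff (minpol a) i)) \<le> (if q = 0 then 2 ^ qdeg a else 1) * T q" by simp
    have mpos: "0 < max 1 (rabs q (coeff (minpol a) i))" by linarith
    have "ln (max 1 (rabs q (coeff (minpol a) i))) \<le> ln ((if q = 0 then 2 ^ qdeg a else 1) * T q)"
      by (rule iffD2[OF ln_le_cancel_iff[OF mpos less_le_trans[OF mpos le]] le])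
    also have "\<dots> = ln (T q) + (if q = 0 then real (qdeg a) * ln 2 else 0)"
      using T[of q] by (auto simp: ln_mult_pos ln_realpow)
    finally show "ln (max 1 (rabs q (coeff (minpol a) i))) \<le> (\<Sum>z\<in>conjs a. lmax q z) + (if q = 0 then real (qdeg a) * ln 2 else 0)"
      unfolding lT .
  qed
  also have "\<dots> = (\<Sum>q\<in>P1. \<Sum>z\<in>conjs a. lmax q z) + real (qdeg a) * ln 2"
    using P1 by (simp add: sum.distrib)
  also have "(\<Sum>q\<in>P1. \<Sum>z\<in>conjs a. lmax q z) = weil_height a * real (qdeg a)"
    by (rule weil_height_formula[OF a P1(1,2), symmetric]) (force simp: P1_def)
  finally show ?thesis by (simp add: algebra_simps)
qed

lemma weil_height_nonneg: "algebraic a \<Longrightarrow> weil_height a \<ge> 0"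
proof -
  assume a: "algebraic a"
  obtain P0 where P0: "finite P0" "P0 \<subseteq> PL" "\<And>P. finite P \<and> P \<subseteq> PL \<and> P0 \<subseteq> P \<Longrightarrow>
    (\<Sum>q\<in>P. \<Sum>z\<in>conjs a. lmax q (emb a z a)) = real (qdeg a) * weil_height a"
    using weil_height_over[OF a Qgen_self] by blast
  have "0 \<le> (\<Sum>q\<in>P0. \<Sum>z\<in>conjs a. lmax q (emb a z a))" by (intro sum_nonneg lmax_nonneg)
  thus ?thesis using P0(3)[of P0] P0(1,2) qdeg_pos[OF a] by (simp add: zero_le_mult_iff)
qed

text \<open>
  Northcott's theorem: degree and height bound the heights of the coefficients of the minimal polynomial.
\<close>

theorem northcott_finite: "finite {a. algebraic a \<and> qdeg a \<le> D \<and> weil_height a \<le> H}"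
proof -
  define T where "T = real D * (ln 2 + max 0 H)"
  define C where "C = {c :: rat. \<forall>P. finite P \<and> P \<subseteq> PL \<longrightarrow> (\<Sum>q\<in>P. ln (max 1 (rabs q c))) \<le> T}"
  have C: "finite C" unfolding C_def by (rule finite_rat_bounded_height)
  define Ps where "Ps = Poly ` {l. set l \<subseteq> C \<and> length l \<le> Suc D} - {0}"
  have Ps: "finite Ps" unfolding Ps_def using finite_lists_length_le[OF C] by simp
  have "{a. algebraic a \<and> qdeg a \<le> D \<and> weil_height a \<le> H} \<subseteq> (\<Union>p\<in>Ps. {z. rpoly p z = 0})"
  proof
    fix a assume "a \<in> {a. algebraic a \<and> qdeg a \<le> D \<and> weil_height a \<le> H}"
    hence a: "algebraic a" "qdeg a \<le> D" "weil_height a \<le> H" by auto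
    have "coeff (minpol a) i \<in> C" for i unfolding C_def mem_Collect_eq
    proof (intro allI impI)
      fix P assume P: "finite P \<and> P \<subseteq> PL"
      have "(\<Sum>q\<in>P. ln (max 1 (rabs q (coeff (minpol a) i)))) \<le> real (qdeg a) * (ln 2 + weil_height a)"
        using minpol_coeff_height[OF a(1)] P by blast
      also have "\<dots> \<le> T" unfolding T_def using a weil_height_nonneg[OF a(1)] by (intro mult_mono) auto
      finally show "(\<Sum>q\<in>P. ln (max 1 (rabs q (coeff (minpol a) i)))) \<le> T" .
    qed
    hence "set (coeffs (minpol a)) \<subseteq> C" unfolding coeffs_def by auto
    moreover have "length (coeffs (minpol a)) \<le> Suc D" using a(2) minpol_nz[OF a(1)] unfolding qdeg_def by (simp add: length_coeffs_degree)
    ultimately have "minpol a \<in> Ps" unfolding Ps_def using minpol_nz[OF a(1)]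
      by (intro DiffI image_eqI[of _ _ "coeffs (minpol a)"]) auto
    thus "a \<in> (\<Union>p\<in>Ps. {z. rpoly p z = 0})" using minpol_props(1)[OF a(1)] by blast
  qed
  moreover have "finite (\<Union>p\<in>Ps. {z. rpoly p z = 0})"
    using Ps by (intro finite_UN_I) (auto intro!: poly_roots_finite simp: Ps_def)
  ultimately show ?thesis by (rule finite_subset)
qed

section \<open>Heights of products and radicals\<close>

lemma weil_height_mult:
  assumes "algebraic x" "algebraic y"
  shows "weil_height (x * y) \<le> weil_height x + weil_height y"
proof -
  obtain t where t: "x \<in> Qgen (x + of_rat t * y)" "y \<in> Qgen (x + of_rat t * y)" using primitive_element[OF assms] by blast
  define th where "th = x + of_rat t * y"
  have th: "algebraic th" unfolding th_def using assms by (intro algebraic_add_mult) (auto simp: rat_imp_algebraic)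
  note xy = t[folded th_def]
  have m: "x * y \<in> Qgen th" using xy by (rule Qgen_closed(2))
  obtain P1 where P1: "finite P1" "P1 \<subseteq> PL" "\<And>P. finite P \<and> P \<subseteq> PL \<and> P1 \<subseteq> P \<Longrightarrow>
    (\<Sum>q\<in>P. \<Sum>z\<in>conjs th. lmax q (emb th z x)) = real (qdeg th) * weil_height x"
    using weil_height_over[OF th xy(1)] by blast
  obtain P2 where P2: "finite P2" "P2 \<subseteq> PL" "\<And>P. finite P \<and> P \<subseteq> PL \<and> P2 \<subseteq> P \<Longrightarrow>
    (\<Sum>q\<in>P. \<Sum>z\<in>conjs th. lmax q (emb th z y)) = real (qdeg th) * weil_height y"
    using weil_height_over[OF th xy(2)] by blast
  obtain P3 where P3: "finite P3" "P3 \<subseteq> PL" "\<And>P. finite P \<and> P \<subseteq> PL \<and> P3 \<subseteq> P \<Longrightarrow>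
    (\<Sum>q\<in>P. \<Sum>z\<in>conjs th. lmax q (emb th z (x * y))) = real (qdeg th) * weil_height (x * y)"
    using weil_height_over[OF th m] by blast
  define P where "P = P1 \<union> P2 \<union> P3"
  have P: "finite P" "P \<subseteq> PL" "P1 \<subseteq> P" "P2 \<subseteq> P" "P3 \<subseteq> P" unfolding P_def using P1 P2 P3 by auto
  have "(\<Sum>q\<in>P. \<Sum>z\<in>conjs th. lmax q (emb th z (x * y)))
    \<le> (\<Sum>q\<in>P. \<Sum>z\<in>conjs th. lmax q (emb th z x) + lmax q (emb th z y))"
  proof (intro sum_mono)
    fix q z assume q: "q \<in> P" and z: "z \<in> conjs th"
    have qP: "q \<in> PL" using q P by blast
    have Q: "emb th z x \<in> Qbar" "emb th z y \<in> Qbar" using emb_Qbar[OF th z] xy by auto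
    define u v where "u = vabs q (emb th z x)" and "v = vabs q (emb th z y)"
    have uv: "u \<ge> 0" "v \<ge> 0" unfolding u_def v_def using Q qP by simp_all
    have pos: "max 1 u > 0" "max 1 v > 0" "max 1 u \<ge> 1" "max 1 v \<ge> 1" by linarith+
    have "u * v \<le> max 1 u * max 1 v" using uv by (intro mult_mono) auto
    moreover have "1 * 1 \<le> max 1 u * max 1 v" using pos by (intro mult_mono) auto
    ultimately have "max 1 (u * v) \<le> max 1 u * max 1 v" by simp
    hence "ln (max 1 (u * v)) \<le> ln (max 1 u * max 1 v)" using pos by (subst ln_le_cancel_iff) (auto simp: max_def)
    also have "\<dots> = ln (max 1 u) + ln (max 1 v)" using pos by (simp only: ln_mult_pos)
    finally show "lmax q (emb th z (x * y)) \<le> lmax q (emb th z x) + lmax q (emb th z y)"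
      unfolding lmax_def emb_simps(7)[OF th z xy] vabs_mult[OF qP Q] u_def v_def .
  qed
  also have "\<dots> = (\<Sum>q\<in>P. \<Sum>z\<in>conjs th. lmax q (emb th z x)) + (\<Sum>q\<in>P. \<Sum>z\<in>conjs th. lmax q (emb th z y))"
    by (simp add: sum.distrib)
  finally have "real (qdeg th) * weil_height (x * y) \<le> real (qdeg th) * (weil_height x + weil_height y)"
    using P1(3)[of P] P2(3)[of P] P3(3)[of P] P by (simp add: distrib_left)
  thus ?thesis using qdeg_pos[OF th] by simp
qed

text \<open>
  At each place all conjugates have the same value, determined by \<open>p / q\<close>; it exceeds 1 only at \<open>q\<close>.
\<close>

lemma weil_height_radical:
  assumes p: "prime p" and q: "prime q" and pq: "p < q"
    and x: "x ^ E = of_rat (of_nat p / of_nat q)" and E: "E > 0"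
  shows "algebraic x" "weil_height x = ln (real q) / real E"
proof -
  define r :: rat where "r = of_nat p / of_nat q"
  have p1: "p > 1" "q > 1" using p q prime_gt_1_nat by blast+
  have r0: "r \<noteq> 0" unfolding r_def using p1 by simp
  have pne: "p \<noteq> q" using pq by simp
  note rr = rabs_ratio[OF p q pne, folded r_def]
  define f where "f = monom 1 E - [:r:]"
  have fx: "rpoly f z = z ^ E - of_rat r" for z unfolding f_def by (simp add: hom_distribs poly_monom)
  have "coeff f E = 1" unfolding f_def using E by (simp add: coeff_pCons split: nat.splits)
  hence "f \<noteq> 0" by auto
  thus xa: "algebraic x" unfolding algebraic_iff_rpoly using fx[of x] x r_def by auto
  have zE: "z ^ E = of_rat r" if "z \<in> conjs x" for z
    using conjs_rpoly_0[OF xa that, of f] fx x r_def by simp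
  have zQ: "z \<in> Qbar" if "z \<in> conjs x" for z using conjs_algebraic[OF xa that] by (simp add: Qbar_def)
  have v: "vabs l z = rabs l r powr (1 / real E)" if "l \<in> PL" "z \<in> conjs x" for l z
    by (rule vabs_radical[OF that(1) zQ[OF that(2)] zE[OF that(2)] E r0])
  have le: "vabs l z \<le> 1" if l: "l \<in> PL - {q}" and z: "z \<in> conjs x" for l z
  proof -
    have lP: "l \<in> PL" using l by simp
    have "rabs l r \<le> 1"
    proof (cases "l = 0 \<or> l = p")
      case True thus ?thesis using rr(1,4) p1 pq by auto
    next
      case False
      hence "prime l" using l by (auto simp: PL_def)
      thus ?thesis using rr(3) False l by simp
    qed
    thus ?thesis unfolding v[OF lP z] using rabs_props(1)[OF lP] by (intro powr_le1) auto
  qed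
  have qP: "q \<in> PL" using q by (simp add: PL_def)
  have "weil_height x * real (qdeg x) = (\<Sum>l\<in>{q}. \<Sum>z\<in>conjs x. lmax l z)"
    by (rule weil_height_formula[OF xa]) (use le qP in auto)
  also have "\<dots> = (\<Sum>z\<in>conjs x. ln (real q) / real E)"
  proof -
    have "lmax q z = ln (real q) / real E" if z: "z \<in> conjs x" for z
    proof -
      have "real q powr (1 / real E) \<ge> 1" using p1 by (intro ge_one_powr_ge_zero) auto
      thus ?thesis unfolding lmax_def v[OF qP z] rr(2) using p1 by (simp add: max_def ln_powr)
    qed
    thus ?thesis by simp
  qed
  also have "\<dots> = ln (real q) / real E * real (qdeg x)" by (simp add: card_conjs[OF xa])
  finally have "weil_height x * real (qdeg x) = ln (real q) / real E * real (qdeg x)" .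
  moreover have "real (qdeg x) \<noteq> 0" using qdeg_pos[OF xa] by simp
  ultimately show "weil_height x = ln (real q) / real E" by (metis mult_right_cancel)
qed

section \<open>Primes in multiplicatively short intervals\<close>

text \<open>
  Induction in Leibniz' harmonic triangle:
  \<open>1 / ((n + 1) (n choose (k + 1))) = 1 / (n ((n - 1) choose k)) - 1 / ((n + 1) (n choose k))\<close>.
\<close>

lemma leibniz_dvd_Lcm: "n < M \<Longrightarrow> k \<le> n \<Longrightarrow> Suc n * (n choose k) dvd Lcm {1..M::nat}"
proof (induction k arbitrary: n)
  case 0
  thus ?case by (simp add: dvd_Lcm)
next
  case (Suc k)
  obtain n' where n': "n = Suc n'" using Suc.prems by (cases n) auto
  have kn: "k \<le> n'" using Suc.prems n' by simp
  obtain y where y: "Lcm {1..M} = (n * (n' choose k)) * y" using Suc.IH[of n'] Suc.prems n' by (auto elim: dvdE)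
  obtain z where z: "Lcm {1..M} = (Suc n * (n choose k)) * z" using Suc.IH[of n] Suc.prems by (auto elim: dvdE)
  define L where "L = real (Lcm {1..M})"
  have pos: "real (n choose k) > 0" "real (n' choose k) > 0" "real (n choose Suc k) > 0"
    using Suc.prems kn by (simp_all add: zero_less_binomial)
  have e1: "real (n choose Suc k) * real (Suc k) = real (n choose k) * real (n - k)"
    by (metis binomial_absorb_comp binomial_absorption mult.commute of_nat_mult n' diff_Suc_Suc binomial_fact_lemma)
  have e2: "real n * real (n' choose k) = real (n - k) * real (n choose k)"
    unfolding of_nat_mult[symmetric] n' using binomial_absorb_comp[of "Suc n'" k] by simp
  have nk: "real (n - k) > 0" using Suc.prems by simp
  have "L / (real (Suc n) * real (n choose Suc k)) = L / (real n * real (n' choose k)) - L / (real (Suc n) * real (n choose k))"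
  proof -
    have "real (n choose Suc k) = real (n choose k) * real (n - k) / real (Suc k)" using e1 by (simp add: field_simps)
    hence a: "L / (real (Suc n) * real (n choose Suc k)) = L * real (Suc k) / (real (Suc n) * (real (n choose k) * real (n - k)))" by simp
    have gen: "u / (t * v) - u / (s * v) = u * (s - t) / (s * (v * t))" if "s > 0" "t > 0" "v > 0" for u s t v :: real
      using that by (simp add: field_simps)
    have "L / (real (n - k) * real (n choose k)) - L / (real (Suc n) * real (n choose k))
      = L * (real (Suc n) - real (n - k)) / (real (Suc n) * (real (n choose k) * real (n - k)))"
      by (rule gen) (use nk pos in auto)
    moreover have "real (Suc n) - real (n - k) = real (Suc k)" using Suc.prems by (simp add: of_nat_diff)
    ultimately show ?thesis unfolding a e2 by simp
  qed
  also have "L / (real n * real (n' choose k)) = real y" unfolding L_def y of_nat_mult using pos n' by (simp del: of_nat_Suc)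
  also have "L / (real (Suc n) * real (n choose k)) = real z" unfolding L_def z of_nat_mult using pos by (simp del: of_nat_Suc)
  finally have "L = real_of_int (int y - int z) * (real (Suc n) * real (n choose Suc k))"
    using pos by (subst (asm) nonzero_divide_eq_eq) (simp_all del: of_nat_Suc)
  hence "int (Lcm {1..M}) = (int y - int z) * int (Suc n * (n choose Suc k))"
    unfolding L_def by (metis of_int_eq_iff of_int_mult of_int_of_nat_eq of_nat_mult)
  hence "int (Suc n * (n choose Suc k)) dvd int (Lcm {1..M})" by (metis dvd_triv_right)
  thus ?case by (simp only: int_dvd_int_iff)
qed

lemma Lcm_atLeastAtMost_pos: "Lcm {1..m::nat} > 0"
proof -
  have "Lcm {1..m} \<noteq> 0" by (simp add: Lcm_0_iff)
  thus ?thesis by (simp only: neq0_conv)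
qed

lemma two_power_le_Lcm: "2 ^ n \<le> Lcm {1..Suc n}"
proof -
  have "Suc n * 2 ^ n = (\<Sum>k\<le>n. Suc n * (n choose k))" by (simp add: choose_row_sum sum_distrib_left[symmetric] del: mult_Suc)
  also have "\<dots> \<le> (\<Sum>k\<le>n. Lcm {1..Suc n})"
    by (intro sum_mono dvd_imp_le[OF leibniz_dvd_Lcm Lcm_atLeastAtMost_pos]) auto
  finally show ?thesis by (simp del: mult_Suc)
qed

lemma prime_power_dvd_Lcm:
  fixes A :: "nat set"
  assumes "finite A" "0 \<notin> A" "prime p" "p ^ k dvd Lcm A" "k > 0"
  shows "\<exists>a\<in>A. p ^ k dvd a"
  using assms
proof (induction A rule: finite_induct)
  case empty
  thus ?case using prime_gt_1_nat[of p] by (auto simp: nat_dvd_1_iff_1)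
next
  case (insert a A)
  have nz: "a \<noteq> 0" "Lcm A \<noteq> 0" using insert by (auto simp: Lcm_0_iff_nat)
  have "k \<le> multiplicity p (lcm a (Lcm A))"
    using insert nz by (intro multiplicity_geI) (auto simp: lcm_eq_0_iff prime_elem_not_unit)
  also have "\<dots> = max (multiplicity p a) (multiplicity p (Lcm A))" using nz insert by (intro multiplicity_lcm) auto
  finally have "p ^ k dvd a \<or> p ^ k dvd Lcm A" by (auto simp: le_max_iff_disj intro: multiplicity_dvd')
  thus ?case using insert by blast
qed

lemma Lcm_le_power: "m > 0 \<Longrightarrow> Lcm {1..m::nat} \<le> m ^ card {p. prime p \<and> p \<le> m}"
proof -
  assume m: "m > 0"
  define L where "L = Lcm {1..m}"
  have L: "L > 0" unfolding L_def by (rule Lcm_atLeastAtMost_pos)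
  have le: "p ^ multiplicity p L \<le> m \<and> p \<le> m" if p: "p \<in> prime_factors L" for p
  proof -
    have pp: "prime p" "p dvd L" using p by auto
    have k: "multiplicity p L > 0" using pp L by (simp add: prime_multiplicity_gt_zero_iff)
    obtain a where a: "a \<in> {1..m}" "p ^ multiplicity p L dvd a"
      using prime_power_dvd_Lcm[of "{1..m}" p "multiplicity p L"] pp(1) k multiplicity_dvd[of p L] unfolding L_def by auto
    have "p ^ multiplicity p L \<le> m" using dvd_imp_le[OF a(2)] a(1) by auto
    moreover have "p ^ 1 \<le> p ^ multiplicity p L" using k prime_gt_0_nat[OF pp(1)] by (intro power_increasing) auto
    ultimately show ?thesis by simp
  qed
  have "L = (\<Prod>p\<in>prime_factors L. p ^ multiplicity p L)" using prime_factorization_nat[OF L] .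
  also have "\<dots> \<le> (\<Prod>p\<in>prime_factors L. m)" by (rule prod_mono) (use le in auto)
  also have "\<dots> = m ^ card (prime_factors L)" by simp
  also have "\<dots> \<le> m ^ card {p. prime p \<and> p \<le> m}"
    by (intro power_increasing card_mono) (use le m in auto)
  finally show ?thesis unfolding L_def .
qed

text \<open>
  Let \<open>T\<close> be large and \<open>m\<close> the integral part of \<open>exp ((1 + \<eta>) * T)\<close>. If all primes up to \<open>m\<close> were at most \<open>exp T\<close>, then the least common multiple of
  \<open>{1..m}\<close>, a product of at most \<open>exp T\<close> prime powers not exceeding \<open>m\<close>, would be smaller than \<open>2 ^ (m - 1)\<close>.
\<close>

lemma prime_in_interval:
  assumes \<eta>: "\<eta> > (0::real)"
  shows "\<exists>T0. \<forall>T\<ge>T0. \<exists>p. prime p \<and> T < ln (real p) \<and> ln (real p) \<le> (1 + \<eta>) * T"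
proof -
  have "eventually (\<lambda>T. (exp ((1 + \<eta>) * T) - 2) * ln 2 > exp T * ((1 + \<eta>) * T)) at_top"
    using \<eta> by real_asymp
  then obtain T1 where T1: "\<And>T. T \<ge> T1 \<Longrightarrow> (exp ((1 + \<eta>) * T) - 2) * ln 2 > exp T * ((1 + \<eta>) * T)"
    unfolding eventually_at_top_linorder by blast
  have "\<exists>p. prime p \<and> T < ln (real p) \<and> ln (real p) \<le> (1 + \<eta>) * T" if T: "T \<ge> max T1 1" for T
  proof (rule ccontr)
    assume no: "\<nexists>p. prime p \<and> T < ln (real p) \<and> ln (real p) \<le> (1 + \<eta>) * T"
    define m where "m = nat \<lfloor>exp ((1 + \<eta>) * T)\<rfloor>"
    have pos: "(1 + \<eta>) * T > 0" using \<eta> T by simp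
    hence e1: "exp ((1 + \<eta>) * T) > 1" by simp
    have m: "real m \<le> exp ((1 + \<eta>) * T)" "real m > exp ((1 + \<eta>) * T) - 1" "m > 0" unfolding m_def using e1 by linarith+
    define S where "S = {p. prime p \<and> p \<le> m}"
    have "S \<subseteq> {1..nat \<lfloor>exp T\<rfloor>}"
    proof
      fix p assume "p \<in> S"
      hence p: "prime p" "p \<le> m" unfolding S_def by auto
      have p0: "p > 0" using prime_gt_0_nat[OF p(1)] .
      have "ln (real p) \<le> (1 + \<eta>) * T"
      proof -
        have "real p \<le> exp ((1 + \<eta>) * T)" using p(2) m(1) by linarith
        hence "ln (real p) \<le> ln (exp ((1 + \<eta>) * T))" using p0 by (subst ln_le_cancel_iff) auto
        thus ?thesis by simp
      qed
      hence "ln (real p) \<le> T" using no p(1) by (meson not_le)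
      hence "real p \<le> exp T" using p0 by (metis exp_le_cancel_iff exp_ln of_nat_0_less_iff)
      thus "p \<in> {1..nat \<lfloor>exp T\<rfloor>}" using p0 by (simp add: le_nat_floor)
    qed
    hence "card S \<le> nat \<lfloor>exp T\<rfloor>" using card_mono[of "{1..nat \<lfloor>exp T\<rfloor>}" S] by simp
    hence cS: "real (card S) \<le> exp T" by (meson exp_ge_zero of_nat_floor of_nat_mono order_trans)
    have "Suc (m - 1) = m" using m(3) by simp
    hence "2 ^ (m - 1) \<le> Lcm {1..m}" using two_power_le_Lcm[of "m - 1"] by (simp only:)
    hence "2 ^ (m - 1) \<le> m ^ card S" using Lcm_le_power[OF m(3)] unfolding S_def by (rule order_trans)
    hence "real (2 ^ (m - 1)) \<le> real (m ^ card S)" by (simp only: of_nat_le_iff)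
    hence "(2::real) ^ (m - 1) \<le> real m ^ card S" by (simp only: of_nat_power of_nat_numeral)
    hence "ln ((2::real) ^ (m - 1)) \<le> ln (real m ^ card S)" using m(3) by (subst ln_le_cancel_iff) simp_all
    hence "real (m - 1) * ln 2 \<le> real (card S) * ln (real m)" using m(3) by (simp add: ln_realpow)
    also have "\<dots> \<le> exp T * ((1 + \<eta>) * T)"
    proof (intro mult_mono cS)
      have "ln (real m) \<le> ln (exp ((1 + \<eta>) * T))" using m by (subst ln_le_cancel_iff) auto
      thus "ln (real m) \<le> (1 + \<eta>) * T" by simp
    qed (use m in auto)
    also have "\<dots> < (exp ((1 + \<eta>) * T) - 2) * ln 2" using T1 T by simp
    also have "\<dots> \<le> real (m - 1) * ln 2" using m(2,3) by (intro mult_right_mono) (auto simp: of_nat_diff)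
    finally show False by simp
  qed
  thus ?thesis by blast
qed

section \<open>Fields generated by real radicals\<close>

definition pord :: "nat \<Rightarrow> rat \<Rightarrow> int" where
  "pord l r = int (multiplicity (int l) (fst (quotient_of r))) - int (multiplicity (int l) (snd (quotient_of r)))"

lemma rabs_pord: "prime l \<Longrightarrow> r \<noteq> 0 \<Longrightarrow> rabs l r = real l powi (- pord l r)"
  unfolding rabs_def padic_abs_def pord_def by (auto simp: case_prod_beta)

lemma powi_inj: "real l powi i = real l powi j \<Longrightarrow> l > 1 \<Longrightarrow> i = j"
  by (metis linorder_neqE order_less_irrefl of_nat_1 of_nat_less_iff power_int_strict_increasing)

lemma pord_mult:
  assumes l: "prime l" and r: "r \<noteq> 0" "s \<noteq> 0"
  shows "pord l (r * s) = pord l r + pord l s"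
proof -
  have l1: "l > 1" using l prime_gt_1_nat by blast
  have "real l powi (- pord l (r * s)) = real l powi (- pord l r) * real l powi (- pord l s)"
    using rabs_pord[OF l, of "r * s"] rabs_pord[OF l r(1)] rabs_pord[OF l r(2)] rabs_props(3)[of l r s] l r
    by (simp add: PL_def)
  also have "\<dots> = real l powi (- pord l r + - pord l s)" using l1 by (subst power_int_add) auto
  finally show ?thesis using powi_inj[OF _ l1] by fastforce
qed

lemma pord_power:
  assumes l: "prime l" and r: "r \<noteq> 0"
  shows "pord l (r ^ n) = int n * pord l r"
proof (induction n)
  case 0
  show ?case unfolding pord_def by simp
next
  case (Suc n)
  thus ?case using pord_mult[OF l r, of "r ^ n"] r by (simp add: algebra_simps)
qed

lemma pord_ratio:
  assumes p: "prime p" and q: "prime q" and pq: "p \<noteq> q"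
  shows "pord p (of_nat p / of_nat q) = 1" "\<And>l. prime l \<Longrightarrow> l \<noteq> p \<Longrightarrow> l \<noteq> q \<Longrightarrow> pord l (of_nat p / of_nat q) = 0"
proof -
  have pos: "p > 1" "q > 1" using p q prime_gt_1_nat by blast+
  hence r0: "(of_nat p / of_nat q :: rat) \<noteq> 0" by simp
  have "real p powi (- pord p (of_nat p / of_nat q)) = real p powi (-1)"
    using rabs_pord[OF p r0] rabs_ratio(1)[OF p q pq] by (simp add: power_int_minus divide_inverse)
  from powi_inj[OF this pos(1)] show "pord p (of_nat p / of_nat q) = 1" by simp
  show "pord l (of_nat p / of_nat q) = 0" if l: "prime l" "l \<noteq> p" "l \<noteq> q" for l
  proof -
    have "real l powi (- pord l (of_nat p / of_nat q)) = real l powi 0"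
      using rabs_pord[OF l(1) r0] rabs_ratio(3)[OF p q pq l] by simp
    from powi_inj[OF this] show ?thesis using prime_gt_1_nat[OF l(1)] by simp
  qed
qed

text \<open>
  \<open>\<gamma>\<close> is the positive \<open>E\<close>-th root of \<open>r\<close>, and \<open>E\<close> has no common factor with the orders of \<open>r\<close> at all primes. The latter is put in
  the form in which the degree of \<open>\<gamma>\<close> uses it.
\<close>

definition radical_gen :: "complex \<Rightarrow> nat \<Rightarrow> rat \<Rightarrow> bool" where
  "radical_gen \<gamma> E r \<longleftrightarrow> E > 0 \<and> r > 0 \<and> (\<exists>x>0. \<gamma> = complex_of_real x) \<and> \<gamma> ^ E = of_rat r \<and>
    (\<forall>\<Delta>. (\<forall>l. prime l \<longrightarrow> int E dvd int \<Delta> * pord l r) \<longrightarrow> E dvd \<Delta>)"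

lemma radical_gen_1: "radical_gen 1 1 1"
  unfolding radical_gen_def by (auto intro: exI[of _ "1::real"])

text \<open>
  All conjugates of \<open>\<gamma>\<close> have the same modulus \<open>\<gamma>\<close>, so the constant coefficient of the minimal polynomial shows that \<open>\<gamma> ^ \<Delta>\<close> is
  rational, where \<open>\<Delta>\<close> is the degree. Comparing orders in \<open>(\<gamma> ^ \<Delta>) ^ E = r ^ \<Delta>\<close> shows that \<open>E\<close> divides \<open>\<Delta>\<close>.
\<close>

lemma radical_gen_degree:
  assumes "radical_gen \<gamma> E r"
  shows "algebraic \<gamma>" "qdeg \<gamma> = E"
proof -
  from assms obtain x where E: "E > 0" and r: "r > 0" and x: "x > 0" "\<gamma> = complex_of_real x" and \<gamma>E: "\<gamma> ^ E = of_rat r"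
    and div: "\<And>\<Delta>. (\<And>l. prime l \<Longrightarrow> int E dvd int \<Delta> * pord l r) \<Longrightarrow> E dvd \<Delta>"
    unfolding radical_gen_def by blast
  define f where "f = monom 1 E - [:r:]"
  have fx: "rpoly f z = z ^ E - of_rat r" for z unfolding f_def by (simp add: hom_distribs poly_monom)
  have "coeff f E = 1" unfolding f_def using E by (simp add: coeff_pCons split: nat.splits)
  hence f0: "f \<noteq> 0" by auto
  have df: "degree f \<le> E" unfolding f_def by (intro degree_diff_le) (auto simp: degree_monom_le)
  show a: "algebraic \<gamma>" unfolding algebraic_iff_rpoly using fx[of \<gamma>] \<gamma>E f0 by auto
  define \<Delta> where "\<Delta> = qdeg \<gamma>"
  have le: "\<Delta> \<le> E" unfolding \<Delta>_def qdeg_def using minpol_props(3)[OF a _ f0] fx[of \<gamma>] \<gamma>E df by simp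
  have rr: "complex_of_real (of_rat r) = of_rat r" by (cases r) (simp add: of_rat_rat)
  have xE: "x ^ E = of_rat r"
  proof -
    have "complex_of_real (x ^ E) = complex_of_real (of_rat r)" using \<gamma>E x(2) rr by simp
    thus ?thesis by (simp only: of_real_eq_iff)
  qed
  have cz: "cmod z = x" if "z \<in> conjs \<gamma>" for z
  proof -
    have "z ^ E = of_rat r" using conjs_rpoly_0[OF a that, of f] fx \<gamma>E by simp
    hence "cmod z ^ E = cmod (of_rat r)" by (metis norm_power)
    also have "\<dots> = of_rat r" using vabs_of_rat[of 0 r] r by (simp add: PL_def rabs_def)
    finally have "cmod z ^ E = x ^ E" using xE by simp
    thus ?thesis using E x(1) by (metis norm_ge_zero power_eq_imp_eq_base less_imp_le)
  qed
  define s where "s = \<bar>coeff (minpol \<gamma>) 0\<bar>"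
  have "of_rat (coeff (minpol \<gamma>) 0) = poly (cxp (minpol \<gamma>)) 0" by (simp add: poly_0_coeff_0 coeff_map_poly)
  also have "\<dots> = (\<Prod>z\<in>conjs \<gamma>. - z)" unfolding minpol_decomp[OF a] by (simp add: poly_prod)
  finally have "cmod (of_rat (coeff (minpol \<gamma>) 0)) = (\<Prod>z\<in>conjs \<gamma>. cmod z)" by (simp add: prod_norm[symmetric])
  also have "\<dots> = x ^ \<Delta>" using cz by (simp add: card_conjs[OF a] \<Delta>_def)
  finally have sx: "of_rat s = x ^ \<Delta>" using vabs_of_rat[of 0 "coeff (minpol \<gamma>) 0"] by (simp add: PL_def rabs_def s_def)
  hence s0: "s \<noteq> 0" using x(1) by auto
  have "of_rat (s ^ E) = (of_rat (r ^ \<Delta>) :: real)"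
    by (simp add: of_rat_power sx xE[symmetric] power_mult[symmetric] mult.commute)
  hence sr: "s ^ E = r ^ \<Delta>" by (simp only: of_rat_eq_iff)
  have "E dvd \<Delta>"
  proof (rule div)
    fix l :: nat assume l: "prime l"
    have "int E * pord l s = int \<Delta> * pord l r" using pord_power[OF l, of s E] pord_power[OF l, of r \<Delta>] sr s0 r by simp
    thus "int E dvd int \<Delta> * pord l r" by (metis dvd_triv_left)
  qed
  moreover have "\<Delta> > 0" unfolding \<Delta>_def by (rule qdeg_pos[OF a])
  ultimately show "qdeg \<gamma> = E" using le by (metis \<Delta>_def dvd_imp_le le_antisym)
qed

text \<open>
  The primes that occur in \<open>r\<close> force \<open>E\<close>, and the new prime \<open>p\<close>, of order \<open>E\<close> in the new radicand, forces \<open>F\<close> to divide the degree.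
\<close>

lemma radical_gen_step:
  assumes g: "radical_gen \<gamma> E r" and EF: "coprime E F" "F > 0" and y: "y > 0" "complex_of_real y ^ F = of_rat (of_nat p / of_nat q)"
    and p: "prime p" and q: "prime q" and pq: "p \<noteq> q" and new: "pord p r = 0" "pord q r = 0"
  shows "radical_gen (\<gamma> * complex_of_real y) (E * F) (r ^ F * (of_nat p / of_nat q) ^ E)"
proof -
  from g obtain x where E: "E > 0" and r: "r > 0" and x: "x > 0" "\<gamma> = complex_of_real x" and \<gamma>E: "\<gamma> ^ E = of_rat r"
    and div: "\<And>\<Delta>. (\<And>l. prime l \<Longrightarrow> int E dvd int \<Delta> * pord l r) \<Longrightarrow> E dvd \<Delta>"
    unfolding radical_gen_def by blast
  define s :: rat where "s = of_nat p / of_nat q"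
  have s: "s > 0" unfolding s_def using prime_gt_0_nat[OF p] prime_gt_0_nat[OF q] by simp
  note ps = pord_ratio[OF p q pq, folded s_def]
  have ordp: "pord l (r ^ F * s ^ E) = int F * pord l r + int E * pord l s" if l: "prime l" for l
    using pord_mult[OF l, of "r ^ F" "s ^ E"] pord_power[OF l, of r F] pord_power[OF l, of s E] r s by simp
  have "E * F dvd \<Delta>" if d: "\<And>l. prime l \<Longrightarrow> int (E * F) dvd int \<Delta> * pord l (r ^ F * s ^ E)" for \<Delta>
  proof -
    have "E dvd \<Delta>"
    proof (rule div)
      fix l :: nat assume l: "prime l"
      show "int E dvd int \<Delta> * pord l r"
      proof (cases "l = p \<or> l = q")
        case True thus ?thesis using new by auto
      next
        case False
        hence "pord l (r ^ F * s ^ E) = int F * pord l r" using ordp[OF l] ps(2)[OF l] by simp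
        hence "int F * int E dvd int F * (int \<Delta> * pord l r)" using d[OF l] by (simp add: mult_ac)
        thus ?thesis using EF(2) by (simp only: dvd_mult_cancel_left) simp
      qed
    qed
    moreover have "F dvd \<Delta>"
    proof -
      have "pord p (r ^ F * s ^ E) = int E" using ordp[OF p] ps(1) new(1) by simp
      hence "int E * int F dvd int E * int \<Delta>" using d[OF p] by (simp add: mult_ac)
      thus ?thesis using E by (simp only: dvd_mult_cancel_left) simp
    qed
    ultimately show ?thesis using EF(1) by (rule divides_mult)
  qed
  moreover have "(\<gamma> * complex_of_real y) ^ (E * F) = of_rat (r ^ F * s ^ E)"
  proof -
    have "(\<gamma> * complex_of_real y) ^ (E * F) = (\<gamma> ^ E) ^ F * (complex_of_real y ^ F) ^ E"
      by (simp add: power_mult_distrib power_mult[symmetric] mult.commute)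
    thus ?thesis unfolding \<gamma>E y(2) s_def[symmetric] by (simp add: of_rat_mult of_rat_power)
  qed
  moreover have "\<exists>z>0. \<gamma> * complex_of_real y = complex_of_real z" using x y(1) by (intro exI[of _ "x * y"]) simp
  ultimately show ?thesis unfolding radical_gen_def s_def[symmetric] using E EF(2) r s by simp
qed

text \<open>
  The power of \<open>\<gamma> * \<alpha>\<close> whose exponent is divisible by \<open>d\<close> and congruent to 1 modulo \<open>E\<close> is \<open>\<gamma>\<close> up to a rational factor.
\<close>

lemma radical_adjoin:
  assumes a: "algebraic \<gamma>" "algebraic (\<gamma> * \<alpha>)" and E: "coprime E d" "E > 0"
    and pow: "\<gamma> ^ E = of_rat r" "\<alpha> ^ d = of_rat s" "r \<noteq> 0" "s \<noteq> 0"
  shows "adjoin (Qgen \<gamma>) \<alpha> = Qgen (\<gamma> * \<alpha>)"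
proof
  have nz: "\<gamma> \<noteq> 0" using pow(1,3) E(2) by (auto simp: power_0_left)
  note sf = Qgen_subfield[OF a(2)]
  have g: "\<gamma> \<in> Qgen (\<gamma> * \<alpha>)"
  proof (cases "E = 1")
    case True thus ?thesis using pow(1) Qgen_of_rat[of r] by simp
  next
    case False
    obtain u where u: "[d * u = 1] (mod E)" using cong_solve_coprime_nat[of d E] E(1) by (auto simp: coprime_commute)
    have "(d * u) mod E = 1" using u False E(2) unfolding cong_def by simp
    then obtain v where v: "d * u = E * v + 1" by (metis mult_div_mod_eq)
    define t where "t = r ^ v * s ^ u"
    have t0: "complex_of_rat t \<noteq> 0" unfolding t_def using pow(3,4) by simp
    have "\<gamma> ^ (d * u) = \<gamma> * of_rat (r ^ v)" by (simp add: v power_mult pow(1) of_rat_power)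
    moreover have "\<alpha> ^ (d * u) = of_rat (s ^ u)" by (simp add: power_mult pow(2) of_rat_power)
    ultimately have "(\<gamma> * \<alpha>) ^ (d * u) = \<gamma> * of_rat t" unfolding power_mult_distrib t_def by (simp add: of_rat_mult)
    hence e: "(\<gamma> * \<alpha>) ^ (d * u) * of_rat (inverse t) = \<gamma>" using t0 by (simp add: of_rat_inverse)
    have "(\<gamma> * \<alpha>) ^ (d * u) * of_rat (inverse t) \<in> Qgen (\<gamma> * \<alpha>)" by (intro Qgen_closed(2) Qgen_power Qgen_self Qgen_of_rat)
    thus ?thesis unfolding e .
  qed
  have "\<gamma> * \<alpha> * inverse \<gamma> \<in> Qgen (\<gamma> * \<alpha>)" by (intro Qgen_closed(2) Qgen_self Qgen_inverse[OF a(2) g])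
  moreover have "\<gamma> * \<alpha> * inverse \<gamma> = \<alpha>" using nz by simp
  ultimately have al: "\<alpha> \<in> Qgen (\<gamma> * \<alpha>)" by simp
  have "Qgen \<gamma> \<subseteq> Qgen (\<gamma> * \<alpha>)" unfolding adjoin_Qgen[OF a(1), symmetric]
    by (rule adjoin_least[OF sf]) (use g in \<open>auto simp: Rats_def\<close>)
  thus "adjoin (Qgen \<gamma>) \<alpha> \<subseteq> Qgen (\<gamma> * \<alpha>)" by (rule adjoin_least[OF sf]) (rule al)
  have F: "subfield (adjoin (Qgen \<gamma>) \<alpha>) complex_ring" by (rule adjoin_subfield)
  have "\<gamma> \<in> adjoin (Qgen \<gamma>) \<alpha>" "\<alpha> \<in> adjoin (Qgen \<gamma>) \<alpha>" using adjoin_base Qgen_self by blast+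
  hence "\<gamma> * \<alpha> \<in> adjoin (Qgen \<gamma>) \<alpha>" using subfield_complexD[OF F] by blast
  thus "Qgen (\<gamma> * \<alpha>) \<subseteq> adjoin (Qgen \<gamma>) \<alpha>" unfolding adjoin_Qgen[OF a(2), symmetric]
    by (intro adjoin_least[OF F] subfield_Rats[OF F])
qed

lemma radical_ext_degree:
  assumes a: "algebraic \<gamma>" "algebraic \<alpha>" "algebraic (\<gamma> * \<alpha>)" and ad: "adjoin (Qgen \<gamma>) \<alpha> = Qgen (\<gamma> * \<alpha>)"
    and deg: "qdeg (\<gamma> * \<alpha>) = qdeg \<gamma> * d"
  shows "ext_degree (Qgen \<gamma>) (adjoin (Qgen \<gamma>) \<alpha>) = d"
proof -
  note K = Qgen_subfield[OF a(1)]
  have "cx.dimension (qdeg \<gamma> * ext_degree (Qgen \<gamma>) (adjoin (Qgen \<gamma>) \<alpha>)) \<rat> (adjoin (Qgen \<gamma>) \<alpha>)"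
    by (rule cx.telescopic_base[OF Rats_subfield K Qgen_dimension[OF a(1)] adjoin_dim(1)[OF K a(2)]])
  moreover have "cx.dimension (qdeg \<gamma> * d) \<rat> (adjoin (Qgen \<gamma>) \<alpha>)" unfolding ad deg[symmetric] by (rule Qgen_dimension[OF a(3)])
  ultimately have "qdeg \<gamma> * ext_degree (Qgen \<gamma>) (adjoin (Qgen \<gamma>) \<alpha>) = qdeg \<gamma> * d" by (rule cx.dimension_is_inj[OF Rats_subfield])
  thus ?thesis using qdeg_pos[OF a(1)] by simp
qed

lemma degree_over_bounds:
  assumes a: "algebraic \<gamma>" "algebraic a"
  shows "ext_degree (Qgen \<gamma>) (adjoin (Qgen \<gamma>) a) \<le> qdeg a" "qdeg a \<le> qdeg \<gamma> * ext_degree (Qgen \<gamma>) (adjoin (Qgen \<gamma>) a)"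
proof -
  note K = Qgen_subfield[OF a(1)]
  define m where "m = ext_degree (Qgen \<gamma>) (adjoin (Qgen \<gamma>) a)"
  show "m \<le> qdeg a" unfolding m_def qdeg_def
    using ext_degree_le[OF K a(2) cin_cxp[OF K], of "minpol a"] minpol_props(1)[OF a(2)] minpol_nz[OF a(2)] by simp
  define F where "F = adjoin (Qgen \<gamma>) a"
  have F: "subfield F complex_ring" unfolding F_def by (rule adjoin_subfield)
  have one: "adjoin F 1 = F"
    using adjoin_least[OF F subset_refl, of 1] adjoin_base(1)[of F 1] subfield_complexD(2)[OF F] subfield_Rats[OF F] by auto
  have "cx.dimension m (Qgen \<gamma>) F" unfolding m_def F_def by (rule adjoin_dim(1)[OF K a(2)])
  hence "cx.dimension m (Qgen \<gamma>) (adjoin F 1)" unfolding one .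
  from monomial_basis[OF a(1) _ a(2) m_def[symmetric] refl, of 1 m] this
  obtain th where th: "algebraic th" "qdeg th = qdeg \<gamma> * m" "a \<in> Qgen th"
    unfolding F_def by (auto simp: rat_imp_algebraic)
  obtain k where k: "qdeg th = k * qdeg a" using conj_fibres[OF th(1,3)] by blast
  have "k > 0" using k qdeg_pos[OF th(1)] by (cases k) auto
  thus "qdeg a \<le> qdeg \<gamma> * m" unfolding th(2)[symmetric] k by simp
qed

text \<open>
  The estimate of \<open>height_lower_bound\<close> for the basis of \<open>monomial_basis\<close>. By \<open>level_degrees\<close> the exponents of \<open>\<alpha>\<close> stay below \<open>N\<close>, so that
  in the limit of large \<open>d\<close> both primes contribute half of their logarithm.
\<close>

theorem stage_lower_bound:
  assumes \<gamma>: "algebraic \<gamma>" "qdeg \<gamma> = E" and al: "algebraic \<alpha>" "\<alpha> ^ d = of_rat (of_nat p / of_nat q)"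
    and d: "ext_degree (Qgen \<gamma>) (adjoin (Qgen \<gamma>) \<alpha>) = d" "prime d" "d > N" "2 * N \<le> d" "N > 0"
    and p: "prime p" and q: "prime q" and pq: "p < q" "E * d * N < p" and T: "0 \<le> T" "T \<le> ln (real p)"
    and a: "algebraic a" "ext_degree (Qgen \<gamma>) (adjoin (Qgen \<gamma>) a) > N"
      "ext_degree (adjoin (Qgen \<gamma>) \<alpha>) (adjoin (adjoin (Qgen \<gamma>) \<alpha>) a) \<le> N"
  shows "\<exists>k>0. k \<le> N \<and> k * d \<le> qdeg a \<and> qdeg a \<le> k * d * E \<and>
    T * (1 - real N / real d) - (real E * weil_height \<gamma> + ln (real (E * d * N))) \<le> real (k * d) * weil_height a"
proof -
  note K = Qgen_subfield[OF \<gamma>(1)]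
  define m where "m = ext_degree (Qgen \<gamma>) (adjoin (Qgen \<gamma>) a)"
  define e where "e = ext_degree (adjoin (Qgen \<gamma>) a) (adjoin (adjoin (Qgen \<gamma>) a) \<alpha>)"
  define n0 where "n0 = ext_degree (adjoin (Qgen \<gamma>) \<alpha>) (adjoin (adjoin (Qgen \<gamma>) \<alpha>) a)"
  note ld = level_degrees[OF K al(1) a(1) d(1-3) n0_def[symmetric] a(3)[folded n0_def] m_def[symmetric] a(2)[folded m_def] e_def[symmetric]]
  obtain k where k: "m = k * d" "k \<le> N" "k > 0" using ld(1) by blast
  obtain th x where th: "algebraic th" "qdeg th = E * (d * n0)" "a \<in> Qgen th" "\<gamma> \<in> Qgen th" "\<alpha> \<in> Qgen th"
    and x: "\<forall>t<qdeg th. \<exists>b<E. \<exists>j<m. \<exists>l<e. x t = \<gamma> ^ b * a ^ j * \<alpha> ^ l"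
    and ind': "\<forall>c :: nat \<Rightarrow> rat. (\<Sum>t<qdeg th. of_rat (c t) * x t) = 0 \<longrightarrow> (\<forall>t<qdeg th. c t = 0)"
    using monomial_basis[OF \<gamma>(1) al(1) a(1) m_def[symmetric] e_def[symmetric] ld(4)] unfolding \<gamma>(2)
    by (elim exE conjE) (rule that)
  have ind: "\<And>c :: nat \<Rightarrow> rat. (\<Sum>t<qdeg th. of_rat (c t) * x t) = 0 \<Longrightarrow> \<forall>t<qdeg th. c t = 0"
    by (rule mp[OF spec[OF ind']])
  have n0: "n0 \<le> N" using a(3) n0_def by simp
  have npos: "qdeg th > 0" by (rule qdeg_pos[OF th(1)])
  have nle: "qdeg th \<le> E * d * N" unfolding th(2) using n0 by (simp add: mult.assoc)
  have d0: "d > 0" using d by simp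
  have "(real (d - 1) * ln (real p) + real (d - 1 - 2 * (e - 1)) * ln (real q)) / (2 * real d)
    \<le> real (m - 1) * weil_height a + real (E - 1) * weil_height \<gamma> + ln (real (qdeg th))"
  proof (rule height_lower_bound[OF th(1) refl th(3-5) p q _ pq(1) al(2) _ _ ind])
    show "qdeg th < p" using nle pq(2) by simp
    show "2 * (e - 1) + 1 \<le> d" using ld(2,3) d(4) by simp
    fix t assume "t < qdeg th"
    then obtain b j l where "b < E" "j < m" "l < e" "x t = \<gamma> ^ b * a ^ j * \<alpha> ^ l" using x by blast
    thus "\<exists>b\<le>E - 1. \<exists>j\<le>m - 1. \<exists>l\<le>e - 1. x t = \<gamma> ^ b * a ^ j * \<alpha> ^ l"
      by (intro exI[of _ b] conjI exI[of _ j] exI[of _ l]) auto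
  qed
  also have "\<dots> \<le> real m * weil_height a + real E * weil_height \<gamma> + ln (real (E * d * N))"
  proof (intro add_mono mult_right_mono)
    show "ln (real (qdeg th)) \<le> ln (real (E * d * N))" using npos nle by (subst ln_le_cancel_iff) (simp_all only: of_nat_0_less_iff of_nat_le_iff less_le_trans)
  qed (use weil_height_nonneg \<gamma>(1) a(1) in auto)
  finally have up: "(real (d - 1) * ln (real p) + real (d - 1 - 2 * (e - 1)) * ln (real q)) / (2 * real d)
    \<le> real m * weil_height a + real E * weil_height \<gamma> + ln (real (E * d * N))" .
  have Tq: "T \<le> ln (real q)" 
  proof -
    have "p > 0" using p prime_gt_0_nat by blast
    hence "ln (real p) \<le> ln (real q)" using pq(1) by (subst ln_le_cancel_iff) auto
    thus ?thesis using T(2) by simp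
  qed
  have "T * (1 - real N / real d) = (real (d - 1) * T + (real d - 1 - 2 * (real N - 1)) * T) / (2 * real d)"
    using d0 by (simp add: field_simps of_nat_diff)
  also have "\<dots> \<le> (real (d - 1) * ln (real p) + real (d - 1 - 2 * (e - 1)) * ln (real q)) / (2 * real d)"
  proof (intro divide_right_mono add_mono mult_mono)
    have "real (d - 1 - 2 * (e - 1)) = real d - 1 - 2 * (real e - 1)" using ld(2,3) d(4) by (simp add: of_nat_diff)
    thus "real d - 1 - 2 * (real N - 1) \<le> real (d - 1 - 2 * (e - 1))" using ld(2) by simp
  qed (use T Tq in auto)
  finally have "T * (1 - real N / real d) - (real E * weil_height \<gamma> + ln (real (E * d * N))) \<le> real (k * d) * weil_height a"
    using up unfolding k(1) by simp
  moreover have "k * d \<le> qdeg a" "qdeg a \<le> k * d * E"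
    using degree_over_bounds[OF \<gamma>(1) a(1)] unfolding m_def[symmetric] \<gamma>(2) k(1) by (simp_all add: mult.commute)
  ultimately show ?thesis using k(2,3) by blast
qed

section \<open>Calibration by the weight\<close>

text \<open>
  \<open>W\<close> is the value of the weight to which the primes of a stage are calibrated: their logarithms are
  about \<open>c * N * d / W\<close>. The degrees that new elements of this stage can have lie between \<open>k * d\<close> and
  \<open>k * d * E\<close> with \<open>k \<le> N\<close>; there \<open>W / N\<close> must bound the weight divided by \<open>k\<close> from below. The
  second condition makes the error terms of the lower bound small against these logarithms. The third
  one says that the weight at the degree of a witness is hardly larger than \<open>W\<close>: the witness is a
  radical of degree \<open>N * d\<close>, or its product with the old generator, of degree \<open>E * N * d\<close>, and in the
  second case the height \<open>H\<close> of the old generator must not matter.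
\<close>

definition calibrated ::
  "(nat \<Rightarrow> real) \<Rightarrow> real \<Rightarrow> nat \<Rightarrow> nat \<Rightarrow> real \<Rightarrow> real \<Rightarrow> real \<Rightarrow> nat \<Rightarrow> real \<Rightarrow> bool" where
  "calibrated w c N E H K \<epsilon> d W \<longleftrightarrow> W > 0 \<and> (\<forall>k D. 0 < k \<longrightarrow> k \<le> N \<longrightarrow> k * d \<le> D \<longrightarrow> D \<le> k * d * E \<longrightarrow> W / real N \<le> w D / real k) \<and>
    W * (K + ln (real (E * d * N))) \<le> \<epsilon> * (c * real N * real d) \<and>
    (w (N * d) \<le> (1 + \<epsilon>) * W \<or> w (E * (N * d)) \<le> (1 + \<epsilon>) * W \<and> w (E * (N * d)) * H \<le> \<epsilon>)"

text \<open>
  If \<open>w\<close> does not decrease, then \<open>w D / k \<ge> w (k * d) / k \<ge> w (N * d) / N\<close> by the monotonicity of \<open>w d / d\<close>, and \<open>W\<close> is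
  \<open>w (N * d)\<close>. If \<open>w\<close> decreases to a positive limit, \<open>W\<close> is this limit. If it decreases to 0, \<open>W\<close> is the value
  \<open>w (E * (N * d))\<close> at the largest degree, and it beats the constant \<open>H\<close>.
\<close>

lemma weight_stage:
  fixes w :: "nat \<Rightarrow> real"
  assumes c: "c > 0" and N: "N > 0" and w: "weight w" and lim: "(\<lambda>d. w d * ln (real d) / real d) \<longlonglongrightarrow> 0"
    and dec: "antimono_on {d0..} (\<lambda>d. w d / real d)"
    and E: "E > 0" and H: "H \<ge> 0" and K: "K \<ge> 0" and \<epsilon>: "\<epsilon> > 0"
  shows "\<exists>d1. \<forall>d\<ge>d1. \<exists>W. calibrated w c N E H K \<epsilon> d W"
proof -
  have pos: "w d > 0" if "d > 0" for d using w that unfolding weight_def by blast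
  define \<delta> where "\<delta> = \<epsilon> * c / (2 * real E)"
  have \<delta>: "\<delta> > 0" unfolding \<delta>_def using \<epsilon> c E by simp
  obtain a1 where a1: "\<And>d. d \<ge> a1 \<Longrightarrow> w d * ln (real d) / real d < \<delta>"
    using order_tendstoD(2)[OF lim \<delta>] unfolding eventually_sequentially by blast
  \<comment> \<open>Beyond \<open>a2\<close>, \<open>ln d\<close> exceeds the constants, so that \<open>lim\<close> applies to the whole error term.\<close>
  define a2 where "a2 = nat \<lceil>exp (K + ln (real E))\<rceil> + 1"
  have small: "w (F * (N * d)) * (K + ln (real (E * d * N))) \<le> \<epsilon> * (c * real N * real d)"
    if d: "d \<ge> a1 + a2" and F: "F = 1 \<or> F = E" for d F
  proof -
    have F0: "F > 0" "F \<le> E" using F E by auto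
    have d0: "d > 0" using d unfolding a2_def by simp
    have dD: "d \<le> N * d" "N * d \<le> F * (N * d)" "0 < N * d" using N F0 d0 by simp_all
    define D where "D = F * (N * d)"
    have D: "D > 0" "d \<le> D" "N * d \<le> D" unfolding D_def using dD F0 by simp_all
    hence Da: "D \<ge> a1" using d by simp
    have "exp (K + ln (real E)) \<le> real d" using d unfolding a2_def by linarith
    hence "K + ln (real E) \<le> ln (real d)" using d0 by (metis exp_le_cancel_iff exp_ln of_nat_0_less_iff)
    also have "\<dots> \<le> ln (real D)" using D d0 by (subst ln_le_cancel_iff) auto
    finally have l1: "K + ln (real E) \<le> ln (real D)" .
    have l2: "ln (real (N * d)) \<le> ln (real D)" using D dD by (subst ln_le_cancel_iff) (simp_all only: of_nat_0_less_iff of_nat_le_iff)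
    have "ln (real (E * d * N)) = ln (real E) + ln (real (N * d))" using E d0 N by (simp add: ln_mult)
    hence "K + ln (real (E * d * N)) \<le> 2 * ln (real D)" using l1 l2 by linarith
    hence "w D * (K + ln (real (E * d * N))) \<le> w D * (2 * ln (real D))" using pos[OF D(1)] by (intro mult_left_mono) auto
    also have "\<dots> \<le> 2 * \<delta> * real D" using a1[OF Da] D(1) by (simp add: field_simps)
    also have "\<dots> \<le> 2 * \<delta> * (real E * (real N * real d))"
    proof -
      have "D \<le> E * (N * d)" unfolding D_def using F0 by simp
      hence "real D \<le> real (E * (N * d))" by (simp only: of_nat_le_iff)
      thus ?thesis using \<delta> by (intro mult_left_mono) auto
    qed
    also have "\<dots> = \<epsilon> * (c * real N * real d)" unfolding \<delta>_def using E by simp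
    finally show ?thesis unfolding D_def .
  qed
  from w consider (mono) e0 where "mono_on {e0..} w" | (anti) e0 where "antimono_on {e0..} w" unfolding weight_def by blast
  thus ?thesis
  proof cases
    case mono
    show ?thesis
    proof (intro exI[of _ "a1 + a2 + d0 + e0 + 1"] allI impI)
      fix d assume d: "d \<ge> a1 + a2 + d0 + e0 + 1"
      have "w (N * d) / real N \<le> w D / real k" if k: "0 < k" "k \<le> N" "k * d \<le> D" for k D
      proof -
        have kd: "d \<le> k * d" "k * d \<le> N * d" using k by simp_all
        have "w (N * d) / real (N * d) \<le> w (k * d) / real (k * d)"
          using monotone_onD[OF dec, of "k * d" "N * d"] kd d by simp
        hence "w (N * d) / real N \<le> w (k * d) / real k" using d k(1) N by (simp add: field_simps)
        also have "\<dots> \<le> w D / real k"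
          using monotone_onD[OF mono, of "k * d" D] kd d k by (intro divide_right_mono) auto
        finally show ?thesis .
      qed
      moreover have "w (N * d) > 0" using pos N d by simp
      moreover have "w (N * d) \<le> (1 + \<epsilon>) * w (N * d)" using \<epsilon> \<open>w (N * d) > 0\<close> by simp
      moreover have "w (N * d) * (K + ln (real (E * d * N))) \<le> \<epsilon> * (c * real N * real d)"
        using small[of d 1] d by simp
      ultimately show "\<exists>W. calibrated w c N E H K \<epsilon> d W" unfolding calibrated_def
        by (intro exI[of _ "w (N * d)"]) simp
    qed
  next
    case anti
    define l where "l = Inf (w ` {e0 + 1..})"
    have bdd: "bdd_below (w ` {e0 + 1..})" by (rule bdd_belowI2[of _ 0]) (use pos in \<open>auto intro: less_imp_le\<close>)
    have ne: "w ` {e0 + 1..} \<noteq> {}" by auto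
    have low: "l \<le> w D" if "D \<ge> e0 + 1" for D unfolding l_def using that by (intro cInf_lower[OF _ bdd]) auto
    have l0: "l \<ge> 0" unfolding l_def by (rule cInf_greatest[OF ne]) (use pos in \<open>auto intro: less_imp_le\<close>)
    have near: "\<exists>D1. \<forall>D\<ge>D1. w D \<le> t" if t: "l < t" for t
    proof -
      obtain D1 where D1: "D1 \<ge> e0 + 1" "w D1 < t" using cInf_lessD[OF ne t[unfolded l_def]] by auto
      have "w D \<le> t" if D: "D \<ge> D1" for D
      proof -
        have "w D \<le> w D1" using monotone_onD[OF anti, of D1 D] D D1(1) by simp
        thus ?thesis using D1(2) by simp
      qed
      thus ?thesis by blast
    qed
    show ?thesis
    proof (cases "l > 0")
      case True
      obtain D1 where D1: "\<And>D. D \<ge> D1 \<Longrightarrow> w D \<le> (1 + \<epsilon>) * l" using near[of "(1 + \<epsilon>) * l"] True \<epsilon> by auto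
      show ?thesis
      proof (intro exI[of _ "a1 + a2 + D1 + e0 + 1"] allI impI)
        fix d assume d: "d \<ge> a1 + a2 + D1 + e0 + 1"
        have dN: "d \<le> N * d" using N by simp
        have "l / real N \<le> w D / real k" if k: "0 < k" "k \<le> N" "k * d \<le> D" for k D
        proof -
          have "d \<le> k * d" using k by simp
          hence "e0 + 1 \<le> D" using k(3) d by linarith
          hence "l \<le> w D" by (rule low)
          thus ?thesis using k True by (intro frac_le) auto
        qed
        moreover have le: "l * (K + ln (real (E * d * N))) \<le> w (1 * (N * d)) * (K + ln (real (E * d * N)))"
        proof (rule mult_right_mono)
          show "l \<le> w (1 * (N * d))" using low[of "N * d"] dN d by simp
          have "E * d * N \<ge> 1" using E d N by simp
          hence "real (E * d * N) \<ge> 1" by linarith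
          hence "0 \<le> ln (real (E * d * N))" by (rule ln_ge_zero)
          thus "0 \<le> K + ln (real (E * d * N))" using K by linarith
        qed
        have "w (1 * (N * d)) * (K + ln (real (E * d * N))) \<le> \<epsilon> * (c * real N * real d)" by (rule small) (use d in auto)
        with le have "l * (K + ln (real (E * d * N))) \<le> \<epsilon> * (c * real N * real d)" by (rule order_trans)
        moreover have "w (N * d) \<le> (1 + \<epsilon>) * l" using D1[of "N * d"] dN d by simp
        ultimately show "\<exists>W. calibrated w c N E H K \<epsilon> d W" unfolding calibrated_def
          using True by (intro exI[of _ l]) simp
      qed
    next
      case False
      hence l0: "l = 0" using l0 by simp
      obtain D1 where D1: "\<And>D. D \<ge> D1 \<Longrightarrow> w D \<le> \<epsilon> / (H + 1)" using near[of "\<epsilon> / (H + 1)"] l0 \<epsilon> H by auto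
      show ?thesis
      proof (intro exI[of _ "a1 + a2 + D1 + e0 + 1"] allI impI)
        fix d assume d: "d \<ge> a1 + a2 + D1 + e0 + 1"
        have dN: "d \<le> N * d" "N * d \<le> E * (N * d)" using N E by simp_all
        have W0: "w (E * (N * d)) > 0" using pos N d E by simp
        have "w (E * (N * d)) / real N \<le> w D / real k" if k: "0 < k" "k \<le> N" "k * d \<le> D" "D \<le> k * d * E" for k D
        proof -
          have "d \<le> k * d" using k by simp
          moreover have "k * d * E \<le> E * (N * d)" using k by (simp add: mult.commute)
          ultimately have D: "e0 \<le> D" "D \<le> E * (N * d)" using k(3,4) d by linarith+
          hence "w (E * (N * d)) \<le> w D" using monotone_onD[OF anti, of D "E * (N * d)"] by simp
          thus ?thesis using k W0 by (intro frac_le) auto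
        qed
        moreover have "w (E * (N * d)) \<le> (1 + \<epsilon>) * w (E * (N * d))" using \<epsilon> W0 by simp
        moreover have "w (E * (N * d)) * (K + ln (real (E * d * N))) \<le> \<epsilon> * (c * real N * real d)" using small[of d E] d by simp
        moreover have "w (E * (N * d)) * H \<le> \<epsilon>"
        proof -
          have "D1 \<le> E * (N * d)" using dN d by linarith
          hence "w (E * (N * d)) * H \<le> \<epsilon> / (H + 1) * H" using H D1 by (intro mult_right_mono) auto
          also have "\<dots> \<le> \<epsilon>" using H \<epsilon> by (simp add: field_simps)
          finally show ?thesis .
        qed
        ultimately show "\<exists>W. calibrated w c N E H K \<epsilon> d W" unfolding calibrated_def
          using W0 by (intro exI[of _ "w (E * (N * d))"]) simp
      qed
    qed
  qed
qed

section \<open>One step of the construction\<close>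

lemma pord_bound: "\<exists>M. \<forall>l>M. prime l \<longrightarrow> pord l r = 0"
proof -
  obtain a b where ab: "quotient_of r = (a, b)" by force
  have b: "b > 0" using quotient_of_denom_pos[OF ab] .
  have z: "multiplicity (int l) x = 0" if "int l > \<bar>x\<bar>" for l and x :: int
  proof (cases "x = 0")
    case False
    hence "\<not> int l dvd x" using that dvd_imp_le_int[of x "int l"] by auto
    thus ?thesis by (rule not_dvd_imp_multiplicity_0)
  qed simp
  have "pord l r = 0" if "l > nat \<bar>a\<bar> + nat \<bar>b\<bar>" for l
  proof -
    have "int l > \<bar>a\<bar>" "int l > \<bar>b\<bar>" using that by linarith+
    thus ?thesis unfolding pord_def ab by (simp add: z)
  qed
  thus ?thesis by blast
qed

text \<open>
  One stage of the tower, with error \<open>\<epsilon>\<close>: \<open>\<gamma>'\<close> generates the next field, \<open>\<beta>\<close> is a witness of large degree whose weighted height is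
  hardly larger than \<open>c\<close>, and no element that first appears at this stage has weighted height much smaller than \<open>c\<close>. The condition that \<open>E\<close> is
  prime to \<open>N\<close> keeps the degree of \<open>\<gamma>\<close> times a radical of degree \<open>N * d\<close> maximal.
\<close>

lemma stage_exists:
  fixes w :: "nat \<Rightarrow> real"
  assumes c: "c > 0" and N: "N > 0" and w: "weight w" and lim: "(\<lambda>d. w d * ln (real d) / real d) \<longlonglongrightarrow> 0"
    and dec: "antimono_on {d0..} (\<lambda>d. w d / real d)"
    and g: "radical_gen \<gamma> E r" and cop: "coprime E N" and \<epsilon>: "\<epsilon> > 0" "\<epsilon> \<le> 1 / 2"
  shows "\<exists>\<gamma>' E' r' \<beta>. radical_gen \<gamma>' E' r' \<and> coprime E' N \<and> Qgen \<gamma> \<subseteq> Qgen \<gamma>' \<and>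
    \<beta> \<in> bounded_degree_over (Qgen \<gamma>') N \<and> D0 \<le> qdeg \<beta> \<and> w (qdeg \<beta>) * weil_height \<beta> \<le> (1 + \<epsilon>) ^ 3 * c + \<epsilon> \<and>
    (\<forall>a. algebraic a \<and> ext_degree (Qgen \<gamma>) (adjoin (Qgen \<gamma>) a) > N \<and> ext_degree (Qgen \<gamma>') (adjoin (Qgen \<gamma>') a) \<le> N
      \<longrightarrow> c * (1 - 2 * \<epsilon>) \<le> w (qdeg a) * weil_height a)"
proof -
  note ga = radical_gen_degree[OF g]
  have E: "E > 0" using qdeg_pos[OF ga(1)] ga(2) by simp
  have wpos: "w d > 0" if "d > 0" for d using w that unfolding weight_def by blast
  from g have rpos: "r > 0" and \<gamma>E: "\<gamma> ^ E = of_rat r" unfolding radical_gen_def by blast+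
  define H where "H = weil_height \<gamma>"
  have H: "H \<ge> 0" unfolding H_def by (rule weil_height_nonneg[OF ga(1)])
  obtain T1 where T1: "\<And>T. T \<ge> T1 \<Longrightarrow> \<exists>p. prime p \<and> T < ln (real p) \<and> ln (real p) \<le> (1 + \<epsilon>) * T"
    using prime_in_interval[OF \<epsilon>(1)] by blast
  obtain M where M: "\<And>l. l > M \<Longrightarrow> prime l \<Longrightarrow> pord l r = 0" using pord_bound[of r] by blast
  \<comment> \<open>Besides the error term of the lower bound, \<open>K\<close> makes \<open>T\<close> large enough for \<open>prime_in_interval\<close> and for primes that do not occur in \<open>r\<close>.\<close>
  define K where "K = real E * H + max 0 T1 + ln (real (M + 1))"
  have K: "K \<ge> 0" "K \<ge> T1" "K \<ge> ln (real (M + 1))" "K \<ge> real E * H"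
  proof -
    have "0 \<le> real E * H" "0 \<le> ln (real (M + 1))" using H by (simp, intro ln_ge_zero, simp)
    thus "K \<ge> 0" "K \<ge> T1" "K \<ge> ln (real (M + 1))" "K \<ge> real E * H" unfolding K_def by linarith+
  qed
  obtain d1 where d1: "\<forall>d\<ge>d1. \<exists>W. calibrated w c N E H K \<epsilon> d W"
    using weight_stage[OF c N w lim dec E H K(1) \<epsilon>(1)] by (elim exE) (rule that)
  obtain d where d: "prime d" "d > d1 + 2 * N + E + D0 + nat \<lceil>real N / \<epsilon>\<rceil>"
    using bigger_prime by blast
  have dge: "d \<ge> d1" "d > N" "2 * N \<le> d" "d > E" "d \<ge> D0" "real N / \<epsilon> \<le> real d" "d > 0"
    using d(2) by linarith+
  obtain W where cal: "calibrated w c N E H K \<epsilon> d W" using d1 dge(1) by blast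
  have W: "W > 0" "\<forall>k D. 0 < k \<longrightarrow> k \<le> N \<longrightarrow> k * d \<le> D \<longrightarrow> D \<le> k * d * E \<longrightarrow> W / real N \<le> w D / real k"
    "W * (K + ln (real (E * d * N))) \<le> \<epsilon> * (c * real N * real d)"
    and Wu: "w (N * d) \<le> (1 + \<epsilon>) * W \<or> w (E * (N * d)) \<le> (1 + \<epsilon>) * W \<and> w (E * (N * d)) * H \<le> \<epsilon>"
    using cal unfolding calibrated_def by blast+
  \<comment> \<open>For primes of this size, \<open>T \<le> k * d * h(a)\<close> and \<open>W / N \<le> w D / k\<close> give \<open>c \<le> w D * h(a)\<close>.\<close>
  define T where "T = c * real N * real d / W"
  have Tpos: "T > 0" unfolding T_def using c N W(1) dge by simp
  have lEdN: "0 \<le> ln (real (E * d * N))"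
  proof -
    have "E * d * N \<ge> 1" using E dge(7) N by simp
    thus ?thesis by (intro ln_ge_zero) linarith
  qed
  have KT: "K + ln (real (E * d * N)) \<le> \<epsilon> * T"
    using W(1,3) unfolding T_def by (simp add: field_simps)
  have \<epsilon>T: "\<epsilon> * T \<le> T" using \<epsilon> Tpos by simp
  have TT1: "T \<ge> T1" using KT \<epsilon>T lEdN K(2) by linarith
  obtain p where p: "prime p" "T < ln (real p)" "ln (real p) \<le> (1 + \<epsilon>) * T" using T1[OF TT1] by blast
  obtain q where q: "prime q" "ln (real p) < ln (real q)" "ln (real q) \<le> (1 + \<epsilon>) * ln (real p)"
    using T1[of "ln (real p)"] TT1 p(2) by force
  have pq0: "p > 0" "q > 0" using p(1) q(1) prime_gt_0_nat by blast+
  have pq: "p < q"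
  proof (rule ccontr)
    assume "\<not> p < q"
    hence "ln (real q) \<le> ln (real p)" using pq0 by (subst ln_le_cancel_iff) auto
    thus False using q(2) by simp
  qed
  hence pne: "p \<noteq> q" by simp
  have lt_p: "n < p" if "ln (real n) \<le> T" "n > 0" for n
  proof (rule ccontr)
    assume "\<not> n < p"
    hence "ln (real p) \<le> ln (real n)" using pq0 that(2) by (subst ln_le_cancel_iff) auto
    thus False using p(2) that by simp
  qed
  have pE: "E * d * N < p" by (rule lt_p) (use KT \<epsilon>T K(1) E dge N in \<open>linarith, simp\<close>)
  have pM: "M + 1 < p" by (rule lt_p) (use KT \<epsilon>T K(3) lEdN in \<open>linarith, simp\<close>)
  have new: "pord p r = 0" "pord q r = 0" using M[of p] M[of q] pM pq p(1) q(1) by simp_all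
  have lq: "ln (real q) \<le> (1 + \<epsilon>) ^ 2 * T"
  proof -
    have "(1 + \<epsilon>) * ln (real p) \<le> (1 + \<epsilon>) * ((1 + \<epsilon>) * T)" using p(3) \<epsilon> by (intro mult_left_mono) auto
    thus ?thesis using q(3) by (simp add: power2_eq_square mult.assoc)
  qed
  define s :: real where "s = real p / real q"
  have s: "s > 0" unfolding s_def using pq0 by simp
  have sc: "complex_of_real s = of_rat (of_nat p / of_nat q)" unfolding s_def by (simp add: of_rat_divide)
  define y where "y = root (N * d) s"
  have Nd: "N * d > 0" using N dge by simp
  have y: "y > 0" "y ^ (N * d) = s" unfolding y_def using s Nd by (simp_all add: real_root_pow_pos2)
  have yc: "complex_of_real y ^ (N * d) = of_rat (of_nat p / of_nat q)" unfolding sc[symmetric] y(2)[symmetric] by simp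
  define \<alpha> where "\<alpha> = complex_of_real (y ^ N)"
  have \<alpha>d: "\<alpha> ^ d = of_rat (of_nat p / of_nat q)" unfolding \<alpha>_def sc[symmetric] y(2)[symmetric] by (simp add: power_mult)
  have yN: "y ^ N > 0" using y(1) by simp
  have copd: "coprime E d"
  proof -
    have "\<not> d dvd E" using dge(4) E by (auto dest: dvd_imp_le)
    thus ?thesis using d(1) prime_imp_coprime coprime_commute by metis
  qed
  have copdN: "coprime d N"
  proof -
    have "\<not> d dvd N" using dge(2) N by (auto dest: dvd_imp_le)
    thus ?thesis using d(1) prime_imp_coprime by metis
  qed
  define \<gamma>' where "\<gamma>' = \<gamma> * \<alpha>"
  have g': "radical_gen \<gamma>' (E * d) (r ^ d * (of_nat p / of_nat q) ^ E)"
    unfolding \<gamma>'_def \<alpha>_def by (rule radical_gen_step[OF g copd dge(7) yN _ p(1) q(1) pne new]) (use \<alpha>d in \<open>simp add: \<alpha>_def\<close>)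
  note ga' = radical_gen_degree[OF g']
  have ala: "algebraic \<alpha>" by (rule weil_height_radical(1)[OF p(1) q(1) pq \<alpha>d dge(7)])
  have ad: "adjoin (Qgen \<gamma>) \<alpha> = Qgen \<gamma>'" unfolding \<gamma>'_def
    by (rule radical_adjoin[OF ga(1) ga'(1)[unfolded \<gamma>'_def] copd E \<gamma>E \<alpha>d]) (use rpos pq0 in auto)
  have ed: "ext_degree (Qgen \<gamma>) (adjoin (Qgen \<gamma>) \<alpha>) = d"
    by (rule radical_ext_degree[OF ga(1) ala ga'(1)[unfolded \<gamma>'_def] ad[unfolded \<gamma>'_def]]) (use ga ga' in \<open>simp add: \<gamma>'_def\<close>)
  have sub: "Qgen \<gamma> \<subseteq> Qgen \<gamma>'" unfolding ad[symmetric] by (rule adjoin_base)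
  have \<alpha>in: "\<alpha> \<in> Qgen \<gamma>'" unfolding ad[symmetric] by (rule adjoin_base)
  note K' = Qgen_subfield[OF ga'(1)]
  have lower: "c * (1 - 2 * \<epsilon>) \<le> w (qdeg a) * weil_height a"
    if a: "algebraic a" "ext_degree (Qgen \<gamma>) (adjoin (Qgen \<gamma>) a) > N" "ext_degree (Qgen \<gamma>') (adjoin (Qgen \<gamma>') a) \<le> N" for a
  proof -
    obtain k where k: "k > 0" "k \<le> N" "k * d \<le> qdeg a" "qdeg a \<le> k * d * E"
      "T * (1 - real N / real d) - (real E * weil_height \<gamma> + ln (real (E * d * N))) \<le> real (k * d) * weil_height a"
      using stage_lower_bound[OF ga ala \<alpha>d ed d(1) dge(2,3) N p(1) q(1) pq pE _ _ a(1,2), of T] a(3) Tpos p(2)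
      unfolding ad by auto
    have "real N / real d \<le> \<epsilon>" using dge(6,7) \<epsilon>(1) by (simp add: field_simps)
    hence "T * (1 - \<epsilon>) \<le> T * (1 - real N / real d)" using Tpos by (intro mult_left_mono) auto
    moreover have "real E * weil_height \<gamma> + ln (real (E * d * N)) \<le> \<epsilon> * T" using KT K(4) unfolding H_def by linarith
    ultimately have "T * (1 - \<epsilon>) - \<epsilon> * T \<le> real (k * d) * weil_height a" using k(5) by linarith
    hence "T * (1 - 2 * \<epsilon>) \<le> real (k * d) * weil_height a" by (simp add: algebra_simps)
    hence "W / (real N * real d) * (T * (1 - 2 * \<epsilon>)) \<le> W / (real N * real d) * (real (k * d) * weil_height a)"
      using W(1) by (intro mult_left_mono) auto
    also have "W / (real N * real d) * (T * (1 - 2 * \<epsilon>)) = c * (1 - 2 * \<epsilon>)" unfolding T_def using W(1) N dge by simp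
    also have "W / (real N * real d) * (real (k * d) * weil_height a) = W / real N * (real k * weil_height a)" using dge(7) by simp
    also have "\<dots> \<le> w (qdeg a) / real k * (real k * weil_height a)"
      using W(2)[rule_format, OF k(1-4)] weil_height_nonneg[OF a(1)] by (intro mult_right_mono) auto
    also have "\<dots> = w (qdeg a) * weil_height a" using k(1) by simp
    finally show ?thesis .
  qed
  define \<rho> where "\<rho> = complex_of_real y"
  have \<rho>h: "algebraic \<rho>" "weil_height \<rho> = ln (real q) / real (N * d)"
    using weil_height_radical[OF p(1) q(1) pq yc[folded \<rho>_def] Nd] by blast+
  have \<rho>N: "\<rho> ^ N = \<alpha>" unfolding \<rho>_def \<alpha>_def by simp
  have Wh: "(1 + \<epsilon>) * W * weil_height \<rho> \<le> (1 + \<epsilon>) ^ 3 * c"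
  proof -
    have "(1 + \<epsilon>) * W * weil_height \<rho> \<le> (1 + \<epsilon>) * W * ((1 + \<epsilon>) ^ 2 * T / real (N * d))"
      unfolding \<rho>h(2) using lq W(1) \<epsilon> by (intro mult_left_mono divide_right_mono) auto
    also have "\<dots> = (1 + \<epsilon>) ^ 3 * c" unfolding T_def using W(1) N dge by (simp add: power3_eq_cube power2_eq_square)
    finally show ?thesis .
  qed
  have member: "\<beta> \<in> bounded_degree_over (Qgen \<gamma>') N" if \<beta>: "algebraic \<beta>" "\<beta> ^ N \<in> Qgen \<gamma>'" for \<beta>
    unfolding bounded_degree_over_iff[OF K']
  proof (intro conjI exI[of _ "monom 1 N - [:\<beta> ^ N:]"])
    show "cin (Qgen \<gamma>') (monom 1 N - [:\<beta> ^ N:])"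
      using Qgen_of_rat[of 1 \<gamma>'] by (intro cin_diff[OF K'] cin_monom[OF K'] cin_const[OF K'] \<beta>(2)) simp
    have "coeff (monom 1 N - [:\<beta> ^ N:]) N = 1" using N by (simp add: coeff_pCons split: nat.splits)
    thus "monom 1 N - [:\<beta> ^ N:] \<noteq> 0" by (metis coeff_0 zero_neq_one)
    show "degree (monom 1 N - [:\<beta> ^ N:]) \<le> N" by (intro degree_diff_le) (auto simp: degree_monom_le)
  qed (use \<beta> in \<open>simp_all add: poly_monom\<close>)
  have "\<exists>\<beta>. \<beta> \<in> bounded_degree_over (Qgen \<gamma>') N \<and> D0 \<le> qdeg \<beta> \<and> w (qdeg \<beta>) * weil_height \<beta> \<le> (1 + \<epsilon>) ^ 3 * c + \<epsilon>"
    using Wu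
  proof
    assume u: "w (N * d) \<le> (1 + \<epsilon>) * W"
    have "radical_gen (1 * \<rho>) (1 * (N * d)) (1 ^ (N * d) * (of_nat p / of_nat q) ^ 1)"
      unfolding \<rho>_def by (rule radical_gen_step[OF radical_gen_1 _ Nd y(1) yc p(1) q(1) pne]) (simp_all add: pord_def)
    hence deg: "qdeg \<rho> = N * d" using radical_gen_degree(2) by fastforce
    have "w (qdeg \<rho>) * weil_height \<rho> \<le> (1 + \<epsilon>) * W * weil_height \<rho>"
      unfolding deg using u weil_height_nonneg[OF \<rho>h(1)] by (intro mult_right_mono)
    hence "w (qdeg \<rho>) * weil_height \<rho> \<le> (1 + \<epsilon>) ^ 3 * c + \<epsilon>" using Wh \<epsilon>(1) by linarith
    moreover have "D0 \<le> N * d" 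
    proof -
      have "d \<le> N * d" using N by simp
      thus ?thesis using dge(5) by linarith
    qed
    moreover have "\<rho> \<in> bounded_degree_over (Qgen \<gamma>') N" by (rule member[OF \<rho>h(1)]) (simp add: \<rho>N \<alpha>in)
    ultimately show ?thesis using deg by metis
  next
    assume u: "w (E * (N * d)) \<le> (1 + \<epsilon>) * W \<and> w (E * (N * d)) * H \<le> \<epsilon>"
    have "coprime E (N * d)" using cop copd by simp
    hence "radical_gen (\<gamma> * \<rho>) (E * (N * d)) (r ^ (N * d) * (of_nat p / of_nat q) ^ E)"
      unfolding \<rho>_def by (rule radical_gen_step[OF g _ Nd y(1) yc p(1) q(1) pne new])
    note rg = radical_gen_degree[OF this]
    have "w (qdeg (\<gamma> * \<rho>)) * weil_height (\<gamma> * \<rho>) \<le> w (E * (N * d)) * (H + weil_height \<rho>)"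
      unfolding rg(2) H_def using weil_height_mult[OF ga(1) \<rho>h(1)] wpos[of "E * (N * d)"] E Nd by (intro mult_left_mono) auto
    also have "\<dots> = w (E * (N * d)) * H + w (E * (N * d)) * weil_height \<rho>" by (simp add: distrib_left)
    also have "\<dots> \<le> \<epsilon> + (1 + \<epsilon>) * W * weil_height \<rho>"
      using u weil_height_nonneg[OF \<rho>h(1)] by (intro add_mono mult_right_mono) auto
    finally have "w (qdeg (\<gamma> * \<rho>)) * weil_height (\<gamma> * \<rho>) \<le> (1 + \<epsilon>) ^ 3 * c + \<epsilon>" using Wh by linarith
    moreover have "D0 \<le> qdeg (\<gamma> * \<rho>)" 
    proof -
      have "d \<le> E * (N * d)" using E N by simp
      thus ?thesis unfolding rg(2) using dge(5) by linarith
    qed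
    moreover have "\<gamma> * \<rho> \<in> bounded_degree_over (Qgen \<gamma>') N"
    proof (rule member[OF rg(1)])
      have "\<gamma> \<in> Qgen \<gamma>'" using sub Qgen_self by blast
      thus "(\<gamma> * \<rho>) ^ N \<in> Qgen \<gamma>'" unfolding power_mult_distrib \<rho>N using \<alpha>in by (intro Qgen_closed(2) Qgen_power)
    qed
    ultimately show ?thesis by blast
  qed
  moreover have "coprime (E * d) N" using cop copdN by simp
  ultimately show ?thesis using g' sub lower by blast
qed

section \<open>Union of the tower\<close>

lemma bounded_degree_over_mono:
  assumes K: "subfield K complex_ring" and L: "subfield L complex_ring" and sub: "K \<subseteq> L" and a: "a \<in> bounded_degree_over K N"
  shows "a \<in> bounded_degree_over L N"
  using a cin_mono[OF _ sub] unfolding bounded_degree_over_iff[OF K] bounded_degree_over_iff[OF L] by blast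

lemma finite_bounded_stage:
  fixes w :: "nat \<Rightarrow> real"
  assumes \<gamma>: "algebraic \<gamma>" and w: "\<And>d. d > 0 \<Longrightarrow> w d > 0"
  shows "finite {a \<in> bounded_degree_over (Qgen \<gamma>) N. w (qdeg a) * weil_height a < C}"
proof -
  define D where "D = qdeg \<gamma> * N"
  define m where "m = Min (insert 1 (w ` {1..D}))"
  have m: "m > 0" unfolding m_def using w by simp
  have "{a \<in> bounded_degree_over (Qgen \<gamma>) N. w (qdeg a) * weil_height a < C}
    \<subseteq> {a. algebraic a \<and> qdeg a \<le> D \<and> weil_height a \<le> max 0 C / m}"
  proof
    fix a assume "a \<in> {a \<in> bounded_degree_over (Qgen \<gamma>) N. w (qdeg a) * weil_height a < C}"
    hence a: "algebraic a" "ext_degree (Qgen \<gamma>) (adjoin (Qgen \<gamma>) a) \<le> N" "w (qdeg a) * weil_height a < C"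
      unfolding bounded_degree_over_def Qbar_def by auto
    have "qdeg a \<le> D" using degree_over_bounds(2)[OF \<gamma> a(1)] a(2) unfolding D_def by (meson le_trans mult_le_mono2)
    moreover have "m \<le> w (qdeg a)" unfolding m_def by (rule Min_le) (use \<open>qdeg a \<le> D\<close> qdeg_pos[OF a(1)] in auto)
    hence "m * weil_height a \<le> w (qdeg a) * weil_height a" using weil_height_nonneg[OF a(1)] by (rule mult_right_mono)
    hence "m * weil_height a \<le> max 0 C" using a(3) by linarith
    hence "weil_height a \<le> max 0 C / m" using m by (simp add: pos_le_divide_eq mult.commute)
    ultimately show "a \<in> {a. algebraic a \<and> qdeg a \<le> D \<and> weil_height a \<le> max 0 C / m}" using a(1) by simp
  qed
  thus ?thesis using northcott_finite by (rule finite_subset)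
qed

lemma northcott_numberI:
  assumes "c > 0" and up: "\<And>C. C > c \<Longrightarrow> infinite {s \<in> S. h s < C}" and low: "\<And>C. C < c \<Longrightarrow> finite {s \<in> S. h s < C}"
  shows "northcott_number S h = ereal c"
  unfolding northcott_number_def
proof (rule antisym)
  show "Inf {ereal C |C. C > 0 \<and> infinite {s \<in> S. h s < C}} \<le> ereal c"
  proof (rule ereal_le_epsilon2)
    fix e :: real assume e: "e > 0"
    have "Inf {ereal C |C. C > 0 \<and> infinite {s \<in> S. h s < C}} \<le> ereal (c + e)"
      by (rule Inf_lower) (use assms(1) up[of "c + e"] e in fastforce)
    thus "Inf {ereal C |C. C > 0 \<and> infinite {s \<in> S. h s < C}} \<le> ereal c + ereal e" by simp
  qed
  show "ereal c \<le> Inf {ereal C |C. C > 0 \<and> infinite {s \<in> S. h s < C}}"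
  proof (rule Inf_greatest)
    fix x assume "x \<in> {ereal C |C. C > 0 \<and> infinite {s \<in> S. h s < C}}"
    then obtain C where C: "x = ereal C" "infinite {s \<in> S. h s < C}" by blast
    hence "c \<le> C" using low[of C] by linarith
    thus "ereal c \<le> x" unfolding C(1) by simp
  qed
qed

lemma tower_union:
  assumes \<gamma>: "\<And>n :: nat. algebraic (\<gamma> n)" and sub: "\<And>n. Qgen (\<gamma> n) \<subseteq> Qgen (\<gamma> (Suc n))"
  shows "subfield (\<Union>n. Qgen (\<gamma> n)) complex_ring" "(\<Union>n. Qgen (\<gamma> n)) \<subseteq> Qbar"
    "a \<in> bounded_degree_over (\<Union>n. Qgen (\<gamma> n)) N \<longleftrightarrow> (\<exists>n. a \<in> bounded_degree_over (Qgen (\<gamma> n)) N)"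
proof -
  define L where "L = (\<Union>n. Qgen (\<gamma> n))"
  note K = Qgen_subfield[OF \<gamma>]
  have mono: "Qgen (\<gamma> i) \<subseteq> Qgen (\<gamma> j)" if "i \<le> j" for i j using lift_Suc_mono_le[of "\<lambda>n. Qgen (\<gamma> n)", OF sub that] .
  have two: "\<exists>n. x \<in> Qgen (\<gamma> n) \<and> y \<in> Qgen (\<gamma> n)" if xy: "x \<in> L" "y \<in> L" for x y
  proof -
    obtain i j where ij: "x \<in> Qgen (\<gamma> i)" "y \<in> Qgen (\<gamma> j)" using xy unfolding L_def by blast
    thus ?thesis using mono[of i "max i j"] mono[of j "max i j"] by (intro exI[of _ "max i j"]) auto
  qed
  have L: "subfield L complex_ring"
  proof (rule subfield_complexI)
    have r: "of_rat q \<in> L" for q unfolding L_def using Qgen_of_rat by blast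
    show "1 \<in> L" using r[of 1] by simp
    fix x y assume xy: "x \<in> L" "y \<in> L"
    then obtain n where n: "x \<in> Qgen (\<gamma> n)" "y \<in> Qgen (\<gamma> n)" using two by blast
    show "x + y \<in> L" "x * y \<in> L" unfolding L_def using Qgen_closed[OF n] by blast+
  next
    fix x assume "x \<in> L"
    then obtain n where n: "x \<in> Qgen (\<gamma> n)" unfolding L_def by blast
    show "- x \<in> L" "inverse x \<in> L" unfolding L_def using Qgen_uminus[OF n] Qgen_inverse[OF \<gamma> n] by blast+
  qed
  thus "subfield (\<Union>n. Qgen (\<gamma> n)) complex_ring" unfolding L_def .
  show "(\<Union>n. Qgen (\<gamma> n)) \<subseteq> Qbar" using Qgen_Qbar[OF \<gamma>] by blast
  show "a \<in> bounded_degree_over (\<Union>n. Qgen (\<gamma> n)) N \<longleftrightarrow> (\<exists>n. a \<in> bounded_degree_over (Qgen (\<gamma> n)) N)"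
    unfolding L_def[symmetric]
  proof
    assume "a \<in> bounded_degree_over L N"
    then obtain p where a: "algebraic a" and p: "cin L p" "p \<noteq> 0" "poly p a = 0" "degree p \<le> N"
      unfolding bounded_degree_over_iff[OF L] by blast
    have "\<forall>i. \<exists>n. coeff p i \<in> Qgen (\<gamma> n)" using p(1) unfolding cin_def L_def by blast
    then obtain h where h: "\<And>i. coeff p i \<in> Qgen (\<gamma> (h i))" by metis
    define n where "n = Max (h ` {..degree p})"
    have "coeff p i \<in> Qgen (\<gamma> n)" for i
    proof (cases "i \<le> degree p")
      case True
      hence "h i \<le> n" unfolding n_def by (intro Max_ge) auto
      thus ?thesis using h mono by blast
    next
      case False
      hence "coeff p i = 0" by (intro coeff_eq_0) simp
      thus ?thesis using Qgen_of_rat[of 0 "\<gamma> n"] by simp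
    qed
    hence "cin (Qgen (\<gamma> n)) p" unfolding cin_def by blast
    thus "\<exists>n. a \<in> bounded_degree_over (Qgen (\<gamma> n)) N" unfolding bounded_degree_over_iff[OF K] using a p by blast
  next
    assume "\<exists>n. a \<in> bounded_degree_over (Qgen (\<gamma> n)) N"
    then obtain n where n: "a \<in> bounded_degree_over (Qgen (\<gamma> n)) N" by blast
    have "Qgen (\<gamma> n) \<subseteq> L" unfolding L_def by blast
    from bounded_degree_over_mono[OF K L this n] show "a \<in> bounded_degree_over L N" .
  qed
qed

theorem theorem1p4:
  fixes c :: real and N :: nat and w :: "nat \<Rightarrow> real"
  assumes "c > 0" and "N > 0" and "weight w"
    and "(\<lambda>d. w d * ln (real d) / real d) \<longlonglongrightarrow> 0"
    and "\<exists>d0. antimono_on {d0..} (\<lambda>d. w d / real d)"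
  shows "\<exists>L. subfield L complex_ring \<and> L \<subseteq> Qbar \<and>
           northcott_number (bounded_degree_over L N) (weighted_height w) = ereal c"
proof -
  obtain d0 where dec: "antimono_on {d0..} (\<lambda>d. w d / real d)" using assms(5) by blast
  define \<epsilon> :: "nat \<Rightarrow> real" where "\<epsilon> = (\<lambda>n. 1 / (real n + 2))"
  have \<epsilon>: "\<epsilon> n > 0" "\<epsilon> n \<le> 1 / 2" for n unfolding \<epsilon>_def by (simp_all add: field_simps)
  define P :: "complex \<times> nat \<times> rat \<Rightarrow> bool" where "P = (\<lambda>(\<gamma>, E, r). radical_gen \<gamma> E r \<and> coprime E N)"
  define Q :: "nat \<Rightarrow> complex \<times> nat \<times> rat \<Rightarrow> complex \<times> nat \<times> rat \<Rightarrow> bool" where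
    "Q = (\<lambda>n s s'. Qgen (fst s) \<subseteq> Qgen (fst s') \<and>
      (\<exists>\<beta>. \<beta> \<in> bounded_degree_over (Qgen (fst s')) N \<and> n \<le> qdeg \<beta> \<and> w (qdeg \<beta>) * weil_height \<beta> \<le> (1 + \<epsilon> n) ^ 3 * c + \<epsilon> n) \<and>
      (\<forall>a. algebraic a \<and> ext_degree (Qgen (fst s)) (adjoin (Qgen (fst s)) a) > N \<and>
        ext_degree (Qgen (fst s')) (adjoin (Qgen (fst s')) a) \<le> N \<longrightarrow> c * (1 - 2 * \<epsilon> n) \<le> w (qdeg a) * weil_height a))"
  have "\<exists>f. \<forall>n. P (f n) \<and> Q n (f n) (f (Suc n))"
  proof (rule dependent_nat_choice)
    show "\<exists>s. P s" unfolding P_def using radical_gen_1 by (intro exI[of _ "(1, 1, 1)"]) simp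
    fix s n assume s: "P s"
    obtain \<gamma> E r where s': "s = (\<gamma>, E, r)" by (cases s)
    have g: "radical_gen \<gamma> E r" "coprime E N" using s unfolding P_def s' by simp_all
    obtain \<gamma>' E' r' \<beta> where st: "radical_gen \<gamma>' E' r'" "coprime E' N" "Qgen \<gamma> \<subseteq> Qgen \<gamma>'"
      "\<beta> \<in> bounded_degree_over (Qgen \<gamma>') N" "n \<le> qdeg \<beta>" "w (qdeg \<beta>) * weil_height \<beta> \<le> (1 + \<epsilon> n) ^ 3 * c + \<epsilon> n"
      "\<forall>a. algebraic a \<and> ext_degree (Qgen \<gamma>) (adjoin (Qgen \<gamma>) a) > N \<and> ext_degree (Qgen \<gamma>') (adjoin (Qgen \<gamma>') a) \<le> N
        \<longrightarrow> c * (1 - 2 * \<epsilon> n) \<le> w (qdeg a) * weil_height a"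
      using stage_exists[OF assms(1-4) dec g \<epsilon>, of n n] by (elim exE conjE) (rule that)
    show "\<exists>s'. P s' \<and> Q n s s'"
    proof (intro exI[of _ "(\<gamma>', E', r')"] conjI)
      show "P (\<gamma>', E', r')" unfolding P_def using st by simp
      show "Q n s (\<gamma>', E', r')" unfolding Q_def s' fst_conv using st(3-7) by blast
    qed
  qed
  then obtain f where f: "\<And>n. P (f n)" "\<And>n. Q n (f n) (f (Suc n))" by blast
  define \<gamma> where "\<gamma> = (\<lambda>n. fst (f n))"
  have \<gamma>: "algebraic (\<gamma> n)" for n using f(1)[of n] radical_gen_degree(1) unfolding P_def \<gamma>_def by (auto simp: case_prod_beta)
  have sub: "Qgen (\<gamma> n) \<subseteq> Qgen (\<gamma> (Suc n))" for n using f(2)[of n] unfolding Q_def \<gamma>_def by blast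
  have "\<exists>\<beta>. \<beta> \<in> bounded_degree_over (Qgen (\<gamma> (Suc n))) N \<and> n \<le> qdeg \<beta> \<and>
    w (qdeg \<beta>) * weil_height \<beta> \<le> (1 + \<epsilon> n) ^ 3 * c + \<epsilon> n" for n
    using f(2)[of n] unfolding Q_def \<gamma>_def by blast
  then obtain \<beta> where \<beta>: "\<And>n. \<beta> n \<in> bounded_degree_over (Qgen (\<gamma> (Suc n))) N" "\<And>n. n \<le> qdeg (\<beta> n)"
    "\<And>n. w (qdeg (\<beta> n)) * weil_height (\<beta> n) \<le> (1 + \<epsilon> n) ^ 3 * c + \<epsilon> n" by metis
  have lower: "c * (1 - 2 * \<epsilon> n) \<le> w (qdeg a) * weil_height a"
    if "algebraic a" "ext_degree (Qgen (\<gamma> n)) (adjoin (Qgen (\<gamma> n)) a) > N" "ext_degree (Qgen (\<gamma> (Suc n))) (adjoin (Qgen (\<gamma> (Suc n))) a) \<le> N" for n a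
    using f(2)[of n] that unfolding Q_def \<gamma>_def by blast
  define L where "L = (\<Union>n. Qgen (\<gamma> n))"
  note L = tower_union[of \<gamma>, OF \<gamma> sub, folded L_def]
  have alg: "algebraic a" if "a \<in> bounded_degree_over K N" for a K using that unfolding bounded_degree_over_def Qbar_def by simp
  have wh: "weighted_height w a = w (qdeg a) * weil_height a" if "a \<in> bounded_degree_over L N" for a
    unfolding weighted_height_def alg_degree_eq[OF alg[OF that]] ..
  have wpos: "w d > 0" if "d > 0" for d using assms(3) that unfolding weight_def by blast
  have "northcott_number (bounded_degree_over L N) (weighted_height w) = ereal c"
  proof (rule northcott_numberI[OF assms(1)])
    fix C assume C: "C > c"
    have "(\<lambda>n. (1 + \<epsilon> n) ^ 3 * c + \<epsilon> n) \<longlonglongrightarrow> (1 + 0) ^ 3 * c + 0"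
    proof (intro tendsto_intros)
      show "\<epsilon> \<longlonglongrightarrow> 0" "\<epsilon> \<longlonglongrightarrow> 0" unfolding \<epsilon>_def by real_asymp+
    qed
    hence "\<forall>\<^sub>F n in sequentially. (1 + \<epsilon> n) ^ 3 * c + \<epsilon> n < C" using C by (intro order_tendstoD(2)) auto
    then obtain n1 where n1: "\<And>n. n \<ge> n1 \<Longrightarrow> (1 + \<epsilon> n) ^ 3 * c + \<epsilon> n < C" unfolding eventually_sequentially by blast
    have in_S: "\<beta> n \<in> {s \<in> bounded_degree_over L N. weighted_height w s < C}" if "n \<ge> n1" for n
    proof -
      have "\<beta> n \<in> bounded_degree_over L N" using \<beta>(1) L(3) by blast
      thus ?thesis using wh \<beta>(3)[of n] n1[OF that] by simp
    qed
    show "infinite {s \<in> bounded_degree_over L N. weighted_height w s < C}"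
    proof
      assume fin: "finite {s \<in> bounded_degree_over L N. weighted_height w s < C}"
      define B where "B = Max (qdeg ` {s \<in> bounded_degree_over L N. weighted_height w s < C})"
      have "qdeg s \<le> B" if "s \<in> {s \<in> bounded_degree_over L N. weighted_height w s < C}" for s
        unfolding B_def using fin that by (intro Max_ge) auto
      from this[OF in_S[of "max n1 (Suc B)"]] have "qdeg (\<beta> (max n1 (Suc B))) \<le> B" by simp
      thus False using \<beta>(2)[of "max n1 (Suc B)"] by simp
    qed
  next
    fix C assume C: "C < c"
    have "(\<lambda>n. c * (1 - 2 * \<epsilon> n)) \<longlonglongrightarrow> c * (1 - 2 * 0)"
    proof (intro tendsto_intros)
      show "\<epsilon> \<longlonglongrightarrow> 0" unfolding \<epsilon>_def by real_asymp
    qed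
    hence "\<forall>\<^sub>F n in sequentially. C < c * (1 - 2 * \<epsilon> n)" using C by (intro order_tendstoD(1)) auto
    then obtain n0 where n0: "\<And>n. n \<ge> n0 \<Longrightarrow> C < c * (1 - 2 * \<epsilon> n)" unfolding eventually_sequentially by blast
    have mono: "Qgen (\<gamma> i) \<subseteq> Qgen (\<gamma> j)" if "i \<le> j" for i j using lift_Suc_mono_le[of "\<lambda>n. Qgen (\<gamma> n)", OF sub that] .
    have "{s \<in> bounded_degree_over L N. weighted_height w s < C}
      \<subseteq> {a \<in> bounded_degree_over (Qgen (\<gamma> n0)) N. w (qdeg a) * weil_height a < C}"
    proof
      fix a assume a0: "a \<in> {s \<in> bounded_degree_over L N. weighted_height w s < C}"
      hence a: "a \<in> bounded_degree_over L N" "w (qdeg a) * weil_height a < C" using wh by auto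
      define n where "n = (LEAST n. a \<in> bounded_degree_over (Qgen (\<gamma> n)) N)"
      have ex: "\<exists>n. a \<in> bounded_degree_over (Qgen (\<gamma> n)) N" using a(1) L(3) by blast
      have n: "a \<in> bounded_degree_over (Qgen (\<gamma> n)) N" unfolding n_def by (rule LeastI_ex[OF ex])
      \<comment> \<open>An element that is new at a stage after \<open>n0\<close> has weighted height above \<open>C\<close>.\<close>
      have "n \<le> n0"
      proof (rule ccontr)
        assume "\<not> n \<le> n0"
        then obtain j where j: "n = Suc j" "j \<ge> n0" by (cases n) auto
        have "a \<notin> bounded_degree_over (Qgen (\<gamma> j)) N"
          using not_less_Least[of j "\<lambda>n. a \<in> bounded_degree_over (Qgen (\<gamma> n)) N"] j(1) unfolding n_def by simp
        hence "ext_degree (Qgen (\<gamma> j)) (adjoin (Qgen (\<gamma> j)) a) > N"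
          using alg[OF a(1)] unfolding bounded_degree_over_def Qbar_def by simp
        moreover have "ext_degree (Qgen (\<gamma> (Suc j))) (adjoin (Qgen (\<gamma> (Suc j))) a) \<le> N"
          using n unfolding j(1) bounded_degree_over_def by simp
        ultimately have "c * (1 - 2 * \<epsilon> j) \<le> w (qdeg a) * weil_height a" by (rule lower[OF alg[OF a(1)]])
        thus False using n0[OF j(2)] a(2) by linarith
      qed
      hence "a \<in> bounded_degree_over (Qgen (\<gamma> n0)) N"
        by (rule bounded_degree_over_mono[OF Qgen_subfield[OF \<gamma>] Qgen_subfield[OF \<gamma>] mono n])
      thus "a \<in> {a \<in> bounded_degree_over (Qgen (\<gamma> n0)) N. w (qdeg a) * weil_height a < C}" using a(2) by simp
    qed
    thus "finite {s \<in> bounded_degree_over L N. weighted_height w s < C}"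
      by (rule finite_subset) (rule finite_bounded_stage[OF \<gamma> wpos])
  qed
  thus ?thesis using L(1,2) by blast
qed

end
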